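(* Consider the fixed step size case $\Delta t_n=\Delta t=T/N$, $t_n=n\Delta t$. Fix $\kappa>0$ and let $\Delta t$ and $h$ satisfy the CFL-type condition $$64\,c_{\rm inv}^2\|\boldsymbol u\|_{L^\infty(L^\infty)}^2\frac{\Delta t}{h^2}\le \frac{\kappa}{T},$$ and $$\Delta t\Bigl(4\frac{\kappa+1}{T}+M^j\Bigr)\le\frac12,\qquad j=2,\ldots,n+1,$$ where $$M^j=4\Bigl(\tfrac12\|\nabla\hat{\boldsymbol s}_h^{j-1}\|_\infty+\tfrac{9}{2\mu}\|\hat{\boldsymbol s}_h^{j-1}\|_\infty^2+3\|\nabla\hat{\boldsymbol s}_h^{j}\|_\infty+\tfrac32\|\nabla\hat{\boldsymbol s}_h^{j+1}\|_\infty\Bigr)$$ (with the convention that $\|\nabla\hat{\boldsymbol s}_h^{j+1}\|_\infty$ is replaced by $0$ for $j=n+1$). Then there exists a positive constant $h_0$ such that, for $h<h_0$, the error $\boldsymbol e_h^{n+1}=\boldsymbol s_h^{n+1}-\boldsymbol u_h^{n+1}$ of the IMEX method satisfies, for $1\le n\le N-1=T/\Delta t-1$, $$\|\boldsymbol e_h^{n+1}\|_0^2+\sum_{j=2}^{n+1}\nu\Delta t\|\nabla\boldsymbol e_h^j\|_0^2+\mu\sum_{j=2}^{n+1}\Delta t\|\nabla\cdot\boldsymbol e_h^j\|_0^2\le e^{8(\kappa+1)+2T\max_jM^j}\Bigl((C_0^2+TC_3^2)(\Delta t)^4+T(C_1^2h^{2k}+C_2^2h^{2l+2})\Bigr),$$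 where $$C_0^2=C\bigl(\|\boldsymbol u_{tt}\|_{L^\infty(L^2)}^2+\|\boldsymbol u\|_{L^\infty(W^{1,\infty})}^2\|\boldsymbol u_t\|_{L^\infty(L^2)}^2+\|\boldsymbol u\|_{L^\infty(L^\infty)}^2\|\boldsymbol u_t\|_{L^\infty(H^1)}^2\bigr),$$ $$C_1^2=C\bigl(\|\boldsymbol u_t\|_{L^2(H^k)}^2+(\mu+T|\Omega|^{2/d}\|\boldsymbol u\|_{L^\infty(W^{1,\infty})}^2)\|\boldsymbol u\|_{L^\infty(H^{k+1})}^2\bigr),\qquad C_2^2=\frac{C}{\mu}\|p\|_{L^\infty(H^{l+1})}^2,$$ $$C_3^2=C\bigl(\|\boldsymbol u_{ttt}\|_{L^2(L^2)}^2+\|\boldsymbol u\|_{L^\infty(W^{1,\infty})}^2\|\boldsymbol u_{tt}\|_{L^2(L^2)}^2+\|\boldsymbol u\|_{L^\infty(L^\infty)}^2\|\boldsymbol u_{tt}\|_{L^2(H^1)}^2\bigr),$$ with $C$ a generic constant independent of $\nu$, $h$ and $\Delta t$.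
   Context: Problem. $\Omega\subset\mathbb R^d$, $d\in\{2,3\}$, is a bounded domain with polyhedral Lipschitz boundary, $T>0$, $\nu>0$, and $(\boldsymbol u,p)$ is a solution, smooth enough for all norms used to be finite, of $\partial_t\boldsymbol u-\nu\Delta\boldsymbol u+(\boldsymbol u\cdot\nabla)\boldsymbol u+\nabla p=\boldsymbol f$, $\nabla\cdot\boldsymbol u=0$ in $(0,T)\times\Omega$, $\boldsymbol u=\boldsymbol 0$ on $\partial\Omega$, $\boldsymbol u(0)=\boldsymbol u_0$. Notation: $(\cdot,\cdot)$ and $\|\cdot\|_0$ are the $L^2(\Omega)$ inner product and norm, $\|\cdot\|_s$ the $H^s(\Omega)$ norm, $\|\cdot\|_\infty$ the $L^\infty(\Omega)$ norm; $\|\cdot\|_{L^q(X)}$ is the norm of $L^q(0,T;X)$ with $X$ a space of functions on $\Omega$; $V=H_0^1(\Omega)^d$, $Q=L_0^2(\Omega)$ (zero-mean $L^2$ functions); superscript $n$ on a function of time means evaluation at $t_n$. Finite elements. $V_h\subset V$, $Q_h\subset Q$ are spaces of piecewise polynomials of degrees at most $k\ge1$ and $l$ on a quasi-uniform family of partitions of $\Omega$ of mesh size $h$, satisfying $\inf_{q_h\in Q_h}\sup_{\boldsymbol v_h\in V_h}\frac{(\nabla\cdot\boldsymbol v_h,q_h)}{\|\nabla\boldsymbol v_h\|_0\|q_h\|_0}\ge\beta_0>0$ with $\beta_0$ independent of $h$. $c_{\rm inv}$ denotes the constant in the inverse inequalities $\|\boldsymbol v_h\|_{W^{m,p}(K)}\le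 c_{\rm inv}h_K^{n-m-d(1/q-1/p)}\|\boldsymbol v_h\|_{W^{n,q}(K)}$, $0\le n\le m\le1$, $1\le q\le p\le\infty$ (in particular $\|\nabla\boldsymbol v_h\|_0\le c_{\rm inv}h^{-1}\|\boldsymbol v_h\|_0$, $\|\boldsymbol v_h\|_\infty\le c_{\rm inv}h^{-d/2}\|\boldsymbol v_h\|_0$). The $L^2$ projection $\pi_h$ of $p$ onto $Q_h$ satisfies $\|p-\pi_h\|_m\le Ch^{l+1-m}\|p\|_{l+1}$, $0\le m\le1$. Projection. For each $t$, $(\boldsymbol s_h,l_h)\in V_h\times Q_h$ solves $\nu(\nabla\boldsymbol s_h,\nabla\boldsymbol v_h)-(\nabla\cdot\boldsymbol v_h,l_h)=(\boldsymbol g,\boldsymbol v_h)$, $(\nabla\cdot\boldsymbol s_h,q_h)=0$ for all $(\boldsymbol v_h,q_h)\in V_h\times Q_h$, where $\boldsymbol g=\boldsymbol f-\partial_t\boldsymbol u-(\boldsymbol u\cdot\nabla)\boldsymbol u-\nabla p$. The following bounds, recalled from the literature, are taken as available, with constants independent of $\nu$: $\|\boldsymbol u-\boldsymbol s_h\|_0+h\|\boldsymbol u-\boldsymbol s_h\|_1\le Ch^{k+1}\|\boldsymbol u\|_{k+1}$, estimates of the same form for time derivatives (in particular $\|\partial_t(\boldsymbol u-\boldsymbol s_h)\|_0\le Ch^k\|\partial_t\boldsymbol u\|_k$), $\|\boldsymbol u-\boldsymbol s_h\|_\infty\le C_\infty h(\log(|\Omega|^{1/d}/h))^{\bar r}\|\nabla\boldsymbol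 u\|_\infty$ ($\bar r=0$ for linear elements, $\bar r=1$ otherwise), $\|\nabla(\boldsymbol u-\boldsymbol s_h)\|_\infty\le C_\infty\|\nabla\boldsymbol u\|_\infty$. IMEX method. Let $\mu>0$ be the grad-div parameter, $b(\boldsymbol u,\boldsymbol v,\boldsymbol w)=((\boldsymbol u\cdot\nabla)\boldsymbol v+\frac12(\nabla\cdot\boldsymbol u)\boldsymbol v,\boldsymbol w)$. For a sequence $(\boldsymbol v^n)$ (fixed step size) put $\hat{\boldsymbol v}^n=2\boldsymbol v^n-\boldsymbol v^{n-1}$ for $n\ge1$, $\hat{\boldsymbol v}^0=\boldsymbol v^0$, $\mathcal D\boldsymbol v^{n+1}=\frac32\boldsymbol v^{n+1}-2\boldsymbol v^n+\frac12\boldsymbol v^{n-1}$ for $n\ge1$, $\mathcal D\boldsymbol v^1=\boldsymbol v^1-\boldsymbol v^0$. With $\boldsymbol u_h^0=\boldsymbol s_h^0$, for $n=0,1,\ldots,N-1$ (the case $n=0$ being one implicit-explicit Euler step), $(\boldsymbol u_h^{n+1},p_h^{n+1})\in V_h\times Q_h$ solves for all $(\boldsymbol v_h,q_h)\in V_h\times Q_h$ $$\Bigl(\tfrac1{\Delta t}\mathcal D\boldsymbol u_h^{n+1},\boldsymbol v_h\Bigr)+\nu(\nabla\boldsymbol u_h^{n+1},\nabla\boldsymbol v_h)+b(\hat{\boldsymbol u}_h^n,\hat{\boldsymbol u}_h^n,\boldsymbol v_h)-(p_h^{n+1},\nabla\cdot\boldsymbol v_h)+(\nabla\cdot\boldsymbol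 u_h^{n+1},q_h)+\mu(\nabla\cdot\boldsymbol u_h^{n+1},\nabla\cdot\boldsymbol v_h)=(\boldsymbol f^{n+1},\boldsymbol v_h).$$ *)

theory Defs
  imports "HOL-Probability.Probability"
begin

section \<open>Lebesgue and Sobolev spaces\<close>

text \<open>Elements of function spaces are represented by functions on the whole Euclidean space;
  only their values almost everywhere on the set \<open>S\<close> matter.\<close>

definition in_Lp :: "'a::euclidean_space set \<Rightarrow> ereal \<Rightarrow> ('a \<Rightarrow> 'b::euclidean_space) \<Rightarrow> bool" where
  "in_Lp S p f \<longleftrightarrow> f \<in> borel_measurable (lebesgue_on S) \<and>
     (if p = \<infinity> then esssup (lebesgue_on S) (\<lambda>x. ereal (norm (f x))) < \<infinity>
      else integrable (lebesgue_on S) (\<lambda>x. norm (f x) powr real_of_ereal p))"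

text \<open>The value of the next two norms is meaningful only for members of the respective space.\<close>

definition Lp_norm :: "'a::euclidean_space set \<Rightarrow> ereal \<Rightarrow> ('a \<Rightarrow> 'b::euclidean_space) \<Rightarrow> real" where
  "Lp_norm S p f =
     (if p = \<infinity> then real_of_ereal (esssup (lebesgue_on S) (\<lambda>x. ereal (norm (f x))))
      else (LINT x|lebesgue_on S. norm (f x) powr real_of_ereal p) powr (1 / real_of_ereal p))"

definition L2_inner :: "'a::euclidean_space set \<Rightarrow> ('a \<Rightarrow> 'b::euclidean_space) \<Rightarrow> ('a \<Rightarrow> 'b) \<Rightarrow> real" where
  "L2_inner S f g = (LINT x|lebesgue_on S. f x \<bullet> g x)"

definition L2_norm :: "'a::euclidean_space set \<Rightarrow> ('a \<Rightarrow> 'b::euclidean_space) \<Rightarrow> real" where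
  "L2_norm S f = sqrt (L2_inner S f f)"

definition in_L20 :: "'a::euclidean_space set \<Rightarrow> ('a \<Rightarrow> real) \<Rightarrow> bool" where
  "in_L20 S q \<longleftrightarrow> in_Lp S 2 q \<and> (LINT x|lebesgue_on S. q x) = 0"

primrec partials :: "'d list \<Rightarrow> (real^'d::finite \<Rightarrow> 'b::real_normed_vector) \<Rightarrow> real^'d \<Rightarrow> 'b" where
  "partials [] f = f"
| "partials (i # is) f = (\<lambda>x. frechet_derivative (partials is f) (at x) (axis i 1))"

definition test_function :: "(real^'d::finite) set \<Rightarrow> (real^'d \<Rightarrow> 'b::real_normed_vector) \<Rightarrow> bool" where
  "test_function \<Omega> \<phi> \<longleftrightarrow> (\<forall>is x. partials is \<phi> differentiable (at x)) \<and>
     compact (closure {x. \<phi> x \<noteq> 0}) \<and> closure {x. \<phi> x \<noteq> 0} \<subseteq> \<Omega>"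

definition locally_integrable :: "(real^'d::finite) set \<Rightarrow> (real^'d \<Rightarrow> 'b::euclidean_space) \<Rightarrow> bool" where
  "locally_integrable \<Omega> f \<longleftrightarrow> (\<forall>K. compact K \<and> K \<subseteq> \<Omega> \<longrightarrow> set_integrable lebesgue K f)"

definition has_weak_deriv ::
    "(real^'d::finite) set \<Rightarrow> 'd list \<Rightarrow> (real^'d \<Rightarrow> 'b::euclidean_space) \<Rightarrow> (real^'d \<Rightarrow> 'b) \<Rightarrow> bool" where
  "has_weak_deriv \<Omega> is f g \<longleftrightarrow> locally_integrable \<Omega> f \<and> locally_integrable \<Omega> g \<and>
     (\<forall>\<phi> :: real^'d \<Rightarrow> real. test_function \<Omega> \<phi> \<longrightarrow>
        (LINT x|lebesgue_on \<Omega>. partials is \<phi> x *\<^sub>R f x) =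
        (- 1) ^ length is *\<^sub>R (LINT x|lebesgue_on \<Omega>. \<phi> x *\<^sub>R g x))"

text \<open>Weak derivatives are unique almost everywhere, so the choice below is immaterial.\<close>

definition weak_deriv ::
    "(real^'d::finite) set \<Rightarrow> 'd list \<Rightarrow> (real^'d \<Rightarrow> 'b::euclidean_space) \<Rightarrow> real^'d \<Rightarrow> 'b" where
  "weak_deriv \<Omega> is f = (SOME g. has_weak_deriv \<Omega> is f g)"

definition in_W :: "(real^'d::finite) set \<Rightarrow> nat \<Rightarrow> ereal \<Rightarrow> (real^'d \<Rightarrow> 'b::euclidean_space) \<Rightarrow> bool" where
  "in_W \<Omega> m p f \<longleftrightarrow>
     (\<forall>is. length is \<le> m \<longrightarrow> (\<exists>g. has_weak_deriv \<Omega> is f g \<and> in_Lp \<Omega> p g))"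

text \<open>Derivatives are indexed by lists rather than multi-indices: each mixed derivative of order
  \<open>j\<close> is counted once per entry of the full \<open>j\<close>-th derivative tensor.\<close>

definition W_norm :: "(real^'d::finite) set \<Rightarrow> nat \<Rightarrow> ereal \<Rightarrow> (real^'d \<Rightarrow> 'b::euclidean_space) \<Rightarrow> real" where
  "W_norm \<Omega> m p f =
     (if p = \<infinity> then Max ((\<lambda>is. Lp_norm \<Omega> p (weak_deriv \<Omega> is f)) ` {is. length is \<le> m})
      else (\<Sum>is | length is \<le> m. Lp_norm \<Omega> p (weak_deriv \<Omega> is f) powr real_of_ereal p)
             powr (1 / real_of_ereal p))"

abbreviation in_H :: "(real^'d::finite) set \<Rightarrow> nat \<Rightarrow> (real^'d \<Rightarrow> 'b::euclidean_space) \<Rightarrow> bool" where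
  "in_H \<Omega> m \<equiv> in_W \<Omega> m 2"

abbreviation H_norm :: "(real^'d::finite) set \<Rightarrow> nat \<Rightarrow> (real^'d \<Rightarrow> 'b::euclidean_space) \<Rightarrow> real" where
  "H_norm \<Omega> m \<equiv> W_norm \<Omega> m 2"

definition in_H10 :: "(real^'d::finite) set \<Rightarrow> (real^'d \<Rightarrow> 'b::euclidean_space) \<Rightarrow> bool" where
  "in_H10 \<Omega> v \<longleftrightarrow> in_H \<Omega> 1 v \<and>
     (\<forall>\<epsilon>>0. \<exists>\<phi>. test_function \<Omega> \<phi> \<and> H_norm \<Omega> 1 (\<lambda>x. v x - \<phi> x) < \<epsilon>)"

definition grad :: "(real^'d::finite) set \<Rightarrow> (real^'d \<Rightarrow> real^'d) \<Rightarrow> real^'d \<Rightarrow> real^'d^'d" where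
  "grad \<Omega> v x = (\<chi> i j. weak_deriv \<Omega> [j] v x $ i)"

definition divergence :: "(real^'d::finite) set \<Rightarrow> (real^'d \<Rightarrow> real^'d) \<Rightarrow> real^'d \<Rightarrow> real" where
  "divergence \<Omega> v x = (\<Sum>i\<in>UNIV. weak_deriv \<Omega> [i] v x $ i)"

definition laplacian :: "(real^'d::finite) set \<Rightarrow> (real^'d \<Rightarrow> real^'d) \<Rightarrow> real^'d \<Rightarrow> real^'d" where
  "laplacian \<Omega> v x = (\<Sum>i\<in>UNIV. weak_deriv \<Omega> [i, i] v x)"

definition grad_scalar :: "(real^'d::finite) set \<Rightarrow> (real^'d \<Rightarrow> real) \<Rightarrow> real^'d \<Rightarrow> real^'d" where
  "grad_scalar \<Omega> q x = (\<chi> i. weak_deriv \<Omega> [i] q x)"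

definition convection ::
    "(real^'d::finite) set \<Rightarrow> (real^'d \<Rightarrow> real^'d) \<Rightarrow> (real^'d \<Rightarrow> real^'d) \<Rightarrow> real^'d \<Rightarrow> real^'d" where
  "convection \<Omega> u v x = grad \<Omega> v x *v u x"

definition trilinear ::
    "(real^'d::finite) set \<Rightarrow> (real^'d \<Rightarrow> real^'d) \<Rightarrow> (real^'d \<Rightarrow> real^'d) \<Rightarrow> (real^'d \<Rightarrow> real^'d) \<Rightarrow> real" where
  "trilinear \<Omega> u v w =
     L2_inner \<Omega> (\<lambda>x. convection \<Omega> u v x + (1/2 * divergence \<Omega> u x) *\<^sub>R v x) w"

section \<open>Functions of time with values in function spaces\<close>

text \<open>\<open>X\<close> is the norm of the space of functions on \<open>\<Omega>\<close>, \<open>inX\<close> membership in it.\<close>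

definition bochner_norm ::
    "real \<Rightarrow> ereal \<Rightarrow> (('a \<Rightarrow> 'b) \<Rightarrow> real) \<Rightarrow> (real \<Rightarrow> 'a \<Rightarrow> 'b) \<Rightarrow> real" where
  "bochner_norm T q X w = Lp_norm {0<..<T} q (\<lambda>t. X (w t))"

definition in_bochner ::
    "real \<Rightarrow> ereal \<Rightarrow> (('a \<Rightarrow> 'b) \<Rightarrow> bool) \<Rightarrow> (('a \<Rightarrow> 'b) \<Rightarrow> real) \<Rightarrow> (real \<Rightarrow> 'a \<Rightarrow> 'b) \<Rightarrow> bool" where
  "in_bochner T q inX X w \<longleftrightarrow>
     (AE t in lebesgue_on {0<..<T}. inX (w t)) \<and> in_Lp {0<..<T} q (\<lambda>t. X (w t))"

text \<open>\<open>w'\<close> is the time derivative of \<open>w\<close> as a function with values in \<open>L\<^sup>2(\<Omega>)\<close>: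
  \<open>w(t) - w(s)\<close> is the integral of \<open>w'\<close> from \<open>s\<close> to \<open>t\<close>, tested against \<open>L\<^sup>2\<close> functions. By
  separability of \<open>L\<^sup>2(\<Omega>)\<close> this is the Bochner integral whenever the norm of \<open>w'\<close> is integrable.\<close>

definition has_time_deriv ::
    "(real^'d::finite) set \<Rightarrow> real \<Rightarrow> (real \<Rightarrow> real^'d \<Rightarrow> 'b::euclidean_space)
      \<Rightarrow> (real \<Rightarrow> real^'d \<Rightarrow> 'b) \<Rightarrow> bool" where
  "has_time_deriv \<Omega> T w w' \<longleftrightarrow>
     (\<forall>t\<in>{0..T}. in_Lp \<Omega> 2 (w t)) \<and> (AE t in lebesgue_on {0<..<T}. in_Lp \<Omega> 2 (w' t)) \<and>
     (\<forall>v. in_Lp \<Omega> 2 v \<longrightarrow> (\<forall>s t. 0 \<le> s \<and> s \<le> t \<and> t \<le> T \<longrightarrow>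
        set_integrable lebesgue {s..t} (\<lambda>\<tau>. L2_inner \<Omega> (w' \<tau>) v) \<and>
        (LINT \<tau>:{s..t}|lebesgue. L2_inner \<Omega> (w' \<tau>) v) = L2_inner \<Omega> (w t) v - L2_inner \<Omega> (w s) v))"

section \<open>Domain and Navier--Stokes solution\<close>

text \<open>Locally, after a rotation, a Lipschitz domain lies on one side of the graph of a Lipschitz
  function; here \<open>e\<close> is the vertical direction and \<open>\<phi>\<close> a function of the remaining coordinates.\<close>

definition lipschitz_boundary :: "(real^'d::finite) set \<Rightarrow> bool" where
  "lipschitz_boundary \<Omega> \<longleftrightarrow> (\<forall>x\<in>frontier \<Omega>. \<exists>e r L \<phi>. norm e = 1 \<and> r > 0 \<and>
     L-lipschitz_on UNIV \<phi> \<and> (\<forall>y s. \<phi> (y + s *\<^sub>R e) = \<phi> y) \<and>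
     \<Omega> \<inter> ball x r = {y \<in> ball x r. \<phi> y < y \<bullet> e})"

definition polyhedral_lipschitz_domain :: "(real^'d::finite) set \<Rightarrow> bool" where
  "polyhedral_lipschitz_domain \<Omega> \<longleftrightarrow> open \<Omega> \<and> connected \<Omega> \<and> bounded \<Omega> \<and> \<Omega> \<noteq> {} \<and>
     lipschitz_boundary \<Omega> \<and> (\<exists>F. finite F \<and> (\<forall>P\<in>F. polytope P) \<and> closure \<Omega> = \<Union>F)"

text \<open>\<open>ut\<close>, \<open>utt\<close>, \<open>uttt\<close> are the first three time derivatives of \<open>u\<close>. Since the method and the
  projection evaluate the data at all grid points, including \<open>0\<close> and \<open>T\<close>, the equation is required
  for each \<open>t\<close> in the closed interval, and \<open>p\<close> is continuous in time (as \<open>u\<close> and \<open>ut\<close> are, being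
  integrals of their derivatives).\<close>

definition navier_stokes_solution ::
    "(real^'d::finite) set \<Rightarrow> real \<Rightarrow> real \<Rightarrow> nat \<Rightarrow> nat \<Rightarrow> (real \<Rightarrow> real^'d \<Rightarrow> real^'d) \<Rightarrow>
     (real^'d \<Rightarrow> real^'d) \<Rightarrow> (real \<Rightarrow> real^'d \<Rightarrow> real^'d) \<Rightarrow> (real \<Rightarrow> real^'d \<Rightarrow> real^'d) \<Rightarrow>
     (real \<Rightarrow> real^'d \<Rightarrow> real^'d) \<Rightarrow> (real \<Rightarrow> real^'d \<Rightarrow> real^'d) \<Rightarrow> (real \<Rightarrow> real^'d \<Rightarrow> real) \<Rightarrow> bool" where
  "navier_stokes_solution \<Omega> T \<nu> k l f u0 u ut utt uttt p \<longleftrightarrow>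
     (\<comment> \<open>the equations\<close>
      \<forall>t\<in>{0..T}. in_H10 \<Omega> (u t) \<and> in_H \<Omega> (k + 1) (u t) \<and> in_W \<Omega> 1 \<infinity> (u t) \<and>
        in_L20 \<Omega> (p t) \<and> in_H \<Omega> (l + 1) (p t) \<and> in_Lp \<Omega> 2 (f t) \<and>
        (AE x in lebesgue_on \<Omega>. divergence \<Omega> (u t) x = 0) \<and>
        (AE x in lebesgue_on \<Omega>. ut t x - \<nu> *\<^sub>R laplacian \<Omega> (u t) x + convection \<Omega> (u t) (u t) x
           + grad_scalar \<Omega> (p t) x = f t x)) \<and>
     (AE x in lebesgue_on \<Omega>. u 0 x = u0 x) \<and>
     \<comment> \<open>regularity in time\<close>
     has_time_deriv \<Omega> T u ut \<and> has_time_deriv \<Omega> T ut utt \<and> has_time_deriv \<Omega> T utt uttt \<and>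
     (\<forall>t\<in>{0..T}. ((\<lambda>\<tau>. L2_norm \<Omega> (\<lambda>x. p \<tau> x - p t x)) \<longlongrightarrow> 0) (at t within {0..T})) \<and>
     in_bochner T \<infinity> (in_H \<Omega> (k + 1)) (H_norm \<Omega> (k + 1)) u \<and>
     in_bochner T \<infinity> (in_Lp \<Omega> \<infinity>) (Lp_norm \<Omega> \<infinity>) u \<and>
     in_bochner T \<infinity> (in_W \<Omega> 1 \<infinity>) (W_norm \<Omega> 1 \<infinity>) u \<and>
     in_bochner T \<infinity> (in_Lp \<Omega> 2) (L2_norm \<Omega>) ut \<and>
     in_bochner T \<infinity> (in_H \<Omega> 1) (H_norm \<Omega> 1) ut \<and>
     in_bochner T 2 (in_H \<Omega> k) (H_norm \<Omega> k) ut \<and>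
     in_bochner T \<infinity> (in_Lp \<Omega> 2) (L2_norm \<Omega>) utt \<and>
     in_bochner T 2 (in_H \<Omega> 1) (H_norm \<Omega> 1) utt \<and>
     in_bochner T 2 (in_Lp \<Omega> 2) (L2_norm \<Omega>) uttt \<and>
     in_bochner T \<infinity> (in_H \<Omega> (l + 1)) (H_norm \<Omega> (l + 1)) p"

section \<open>Finite element spaces\<close>

definition poly_deg_le :: "nat \<Rightarrow> (real^'d::finite \<Rightarrow> real) \<Rightarrow> bool" where
  "poly_deg_le k q \<longleftrightarrow> (\<exists>c. \<forall>x. q x =
     (\<Sum>\<alpha> | (\<Sum>i\<in>UNIV. \<alpha> i) \<le> k. c \<alpha> * (\<Prod>i\<in>UNIV. (x $ i) ^ \<alpha> i)))"

definition piecewise_poly :: "(real^'d::finite) set set \<Rightarrow> nat \<Rightarrow> (real^'d \<Rightarrow> real) \<Rightarrow> bool" where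
  "piecewise_poly \<T> k v \<longleftrightarrow> (\<forall>K\<in>\<T>. \<exists>q. poly_deg_le k q \<and> (\<forall>x\<in>interior K. v x = q x))"

definition mesh_size :: "(real^'d::finite) set set \<Rightarrow> real" where
  "mesh_size \<T> = Max (diameter ` \<T>)"

definition mesh_partition :: "(real^'d::finite) set \<Rightarrow> (real^'d) set set \<Rightarrow> bool" where
  "mesh_partition \<Omega> \<T> \<longleftrightarrow> finite \<T> \<and> \<Union>\<T> = closure \<Omega> \<and>
     (\<forall>K\<in>\<T>. polytope K \<and> interior K \<noteq> {}) \<and>
     (\<forall>K\<in>\<T>. \<forall>K'\<in>\<T>. K \<noteq> K' \<longrightarrow> interior K \<inter> interior K' = {})"

definition quasi_uniform :: "('i \<Rightarrow> (real^'d::finite) set set) \<Rightarrow> bool" where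
  "quasi_uniform \<T> \<longleftrightarrow>
     (\<exists>\<gamma>>0. \<forall>i. \<forall>K\<in>\<T> i. \<exists>x. ball x (\<gamma> * mesh_size (\<T> i)) \<subseteq> K)"

definition function_subspace :: "('a \<Rightarrow> 'b::real_vector) set \<Rightarrow> bool" where
  "function_subspace S \<longleftrightarrow> (\<lambda>x. 0) \<in> S \<and> (\<forall>v\<in>S. \<forall>w\<in>S. (\<lambda>x. v x + w x) \<in> S) \<and>
     (\<forall>c. \<forall>v\<in>S. (\<lambda>x. c *\<^sub>R v x) \<in> S)"

definition inf_sup_stable ::
    "(real^'d::finite) set \<Rightarrow> real \<Rightarrow> (real^'d \<Rightarrow> real^'d) set \<Rightarrow> (real^'d \<Rightarrow> real) set \<Rightarrow> bool" where
  "inf_sup_stable \<Omega> \<beta>\<^sub>0 Vh Qh \<longleftrightarrow>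
     ereal \<beta>\<^sub>0 \<le> (INF q\<in>{q\<in>Qh. L2_norm \<Omega> q \<noteq> 0}. SUP v\<in>{v\<in>Vh. L2_norm \<Omega> (grad \<Omega> v) \<noteq> 0}.
       ereal (L2_inner \<Omega> (divergence \<Omega> v) q / (L2_norm \<Omega> (grad \<Omega> v) * L2_norm \<Omega> q)))"

text \<open>The last two inequalities are the global consequences of the elementwise ones; they are
  required with the same constant, which absorbs the ratio of \<open>h\<close> to the element diameters.\<close>

definition inverse_inequalities ::
    "(real^'d::finite) set \<Rightarrow> (real^'d) set set \<Rightarrow> (real^'d \<Rightarrow> real^'d) set \<Rightarrow> real \<Rightarrow> bool" where
  "inverse_inequalities \<Omega> \<T> Vh c \<longleftrightarrow>
     (\<forall>v\<in>Vh. (\<forall>K\<in>\<T>. \<forall>m n. \<forall>p q :: ereal. n \<le> m \<and> m \<le> 1 \<and> 1 \<le> q \<and> q \<le> p \<longrightarrow>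
          W_norm (interior K) m p v \<le>
            c * diameter K powr (real n - real m - real CARD('d) * real_of_ereal (1 / q - 1 / p))
              * W_norm (interior K) n q v) \<and>
        L2_norm \<Omega> (grad \<Omega> v) \<le> c * mesh_size \<T> powr (- 1) * L2_norm \<Omega> v \<and>
        Lp_norm \<Omega> \<infinity> v \<le> c * mesh_size \<T> powr (- real CARD('d) / 2) * L2_norm \<Omega> v)"

definition finite_element_family ::
    "(real^'d::finite) set \<Rightarrow> nat \<Rightarrow> nat \<Rightarrow> ('i \<Rightarrow> (real^'d) set set) \<Rightarrow>
     ('i \<Rightarrow> (real^'d \<Rightarrow> real^'d) set) \<Rightarrow> ('i \<Rightarrow> (real^'d \<Rightarrow> real) set) \<Rightarrow> real \<Rightarrow> real \<Rightarrow> bool" where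
  "finite_element_family \<Omega> k l \<T> Vh Qh \<beta>\<^sub>0 c_inv \<longleftrightarrow> quasi_uniform \<T> \<and>
     (\<forall>i. mesh_partition \<Omega> (\<T> i) \<and>
        function_subspace (Vh i) \<and>
        (\<forall>v\<in>Vh i. in_H10 \<Omega> v \<and> (\<forall>j. piecewise_poly (\<T> i) k (\<lambda>x. v x $ j))) \<and>
        function_subspace (Qh i) \<and>
        (\<forall>q\<in>Qh i. in_L20 \<Omega> q \<and> piecewise_poly (\<T> i) l q) \<and>
        inf_sup_stable \<Omega> \<beta>\<^sub>0 (Vh i) (Qh i) \<and>
        inverse_inequalities \<Omega> (\<T> i) (Vh i) c_inv)"

section \<open>Projections\<close>

definition is_L2_projection ::
    "(real^'d::finite) set \<Rightarrow> (real^'d \<Rightarrow> real) set \<Rightarrow> (real^'d \<Rightarrow> real) \<Rightarrow> (real^'d \<Rightarrow> real) \<Rightarrow> bool" where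
  "is_L2_projection \<Omega> Qh q \<pi> \<longleftrightarrow> \<pi> \<in> Qh \<and> (\<forall>r\<in>Qh. L2_inner \<Omega> (\<lambda>x. q x - \<pi> x) r = 0)"

text \<open>Functions in \<open>Qh\<close> may be discontinuous across element boundaries, so the \<open>H\<^sup>m\<close> norm is
  taken elementwise.\<close>

definition broken_H_norm :: "(real^'d::finite) set set \<Rightarrow> nat \<Rightarrow> (real^'d \<Rightarrow> real) \<Rightarrow> real" where
  "broken_H_norm \<T> m q = sqrt (\<Sum>K\<in>\<T>. (H_norm (interior K) m q)\<^sup>2)"

definition pressure_projection_bound ::
    "(real^'d::finite) set \<Rightarrow> nat \<Rightarrow> ('i \<Rightarrow> (real^'d) set set) \<Rightarrow> ('i \<Rightarrow> (real^'d \<Rightarrow> real) set) \<Rightarrow>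
     real \<Rightarrow> real \<Rightarrow> (real \<Rightarrow> real^'d \<Rightarrow> real) \<Rightarrow> bool" where
  "pressure_projection_bound \<Omega> l \<T> Qh C_pi T p \<longleftrightarrow>
     (\<forall>i. \<forall>t\<in>{0..T}. \<forall>\<pi>. is_L2_projection \<Omega> (Qh i) (p t) \<pi> \<longrightarrow>
        (\<forall>m\<le>1. broken_H_norm (\<T> i) m (\<lambda>x. p t x - \<pi> x) \<le>
           C_pi * mesh_size (\<T> i) ^ (l + 1 - m) * H_norm \<Omega> (l + 1) (p t)))"

definition is_stokes_projection ::
    "(real^'d::finite) set \<Rightarrow> real \<Rightarrow> (real^'d \<Rightarrow> real^'d) set \<Rightarrow> (real^'d \<Rightarrow> real) set \<Rightarrow>
     (real^'d \<Rightarrow> real^'d) \<Rightarrow> (real^'d \<Rightarrow> real^'d) \<Rightarrow> (real^'d \<Rightarrow> real) \<Rightarrow> bool" where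
  "is_stokes_projection \<Omega> \<nu> Vh Qh g s lam \<longleftrightarrow> s \<in> Vh \<and> lam \<in> Qh \<and>
     (\<forall>v\<in>Vh. \<nu> * L2_inner \<Omega> (grad \<Omega> s) (grad \<Omega> v) - L2_inner \<Omega> (divergence \<Omega> v) lam
        = L2_inner \<Omega> g v) \<and>
     (\<forall>q\<in>Qh. L2_inner \<Omega> (divergence \<Omega> s) q = 0)"

definition projection_of_solution ::
    "(real^'d::finite) set \<Rightarrow> real \<Rightarrow> real \<Rightarrow> ('i \<Rightarrow> (real^'d \<Rightarrow> real^'d) set) \<Rightarrow>
     ('i \<Rightarrow> (real^'d \<Rightarrow> real) set) \<Rightarrow> (real \<Rightarrow> real^'d \<Rightarrow> real^'d) \<Rightarrow> (real \<Rightarrow> real^'d \<Rightarrow> real^'d) \<Rightarrow>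
     (real \<Rightarrow> real^'d \<Rightarrow> real^'d) \<Rightarrow> (real \<Rightarrow> real^'d \<Rightarrow> real) \<Rightarrow>
     ('i \<Rightarrow> real \<Rightarrow> real^'d \<Rightarrow> real^'d) \<Rightarrow> ('i \<Rightarrow> real \<Rightarrow> real^'d \<Rightarrow> real) \<Rightarrow> bool" where
  "projection_of_solution \<Omega> T \<nu> Vh Qh f u ut p s lam \<longleftrightarrow>
     (\<forall>i. \<forall>t\<in>{0..T}. is_stokes_projection \<Omega> \<nu> (Vh i) (Qh i)
        (\<lambda>x. f t x - ut t x - convection \<Omega> (u t) (u t) x - grad_scalar \<Omega> (p t) x)
        (s i t) (lam i t))"

text \<open>The third bound is the one for the time derivative. The fourth is only meaningful for \<open>h\<close>
  far below \<open>|\<Omega>|\<^bsup>1/d\<^esup>\<close>, where the logarithm is positive, hence the restriction to fine meshes;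
  its exponent is \<open>0\<close> for linear elements and \<open>1\<close> otherwise.\<close>

definition stokes_projection_bounds ::
    "(real^'d::finite) set \<Rightarrow> nat \<Rightarrow> ('i \<Rightarrow> (real^'d) set set) \<Rightarrow> real \<Rightarrow> real \<Rightarrow> real \<Rightarrow>
     (real \<Rightarrow> real^'d \<Rightarrow> real^'d) \<Rightarrow> (real \<Rightarrow> real^'d \<Rightarrow> real^'d) \<Rightarrow>
     ('i \<Rightarrow> real \<Rightarrow> real^'d \<Rightarrow> real^'d) \<Rightarrow> bool" where
  "stokes_projection_bounds \<Omega> k \<T> C\<^sub>s C_inf T u ut s \<longleftrightarrow>
     (\<forall>i. \<forall>t\<in>{0..T}.
        L2_norm \<Omega> (\<lambda>x. u t x - s i t x) + mesh_size (\<T> i) * H_norm \<Omega> 1 (\<lambda>x. u t x - s i t x)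
          \<le> C\<^sub>s * mesh_size (\<T> i) ^ (k + 1) * H_norm \<Omega> (k + 1) (u t)) \<and>
     (\<forall>i. \<forall>t\<in>{0..T}.
        Lp_norm \<Omega> \<infinity> (grad \<Omega> (\<lambda>x. u t x - s i t x)) \<le> C_inf * Lp_norm \<Omega> \<infinity> (grad \<Omega> (u t))) \<and>
     (\<forall>i. \<exists>e'. has_time_deriv \<Omega> T (\<lambda>t x. u t x - s i t x) e' \<and>
        (AE t in lebesgue_on {0<..<T}.
           L2_norm \<Omega> (e' t) \<le> C\<^sub>s * mesh_size (\<T> i) ^ k * H_norm \<Omega> k (ut t))) \<and>
     (\<exists>h\<^sub>1>0. \<forall>i. mesh_size (\<T> i) < h\<^sub>1 \<longrightarrow> (\<forall>t\<in>{0..T}.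
        Lp_norm \<Omega> \<infinity> (\<lambda>x. u t x - s i t x) \<le>
          C_inf * mesh_size (\<T> i)
            * ln (measure lebesgue \<Omega> powr (1 / real CARD('d)) / mesh_size (\<T> i)) ^ (if k = 1 then 0 else 1)
            * Lp_norm \<Omega> \<infinity> (grad \<Omega> (u t))))"

section \<open>The IMEX method\<close>

definition extrapolate :: "(nat \<Rightarrow> 'a \<Rightarrow> 'b::real_vector) \<Rightarrow> nat \<Rightarrow> 'a \<Rightarrow> 'b" where
  "extrapolate v n = (if n = 0 then v 0 else (\<lambda>x. 2 *\<^sub>R v n x - v (n - 1) x))"

text \<open>\<open>bdf v n\<close> is the difference operator at time level \<open>n + 1\<close>.\<close>

definition bdf :: "(nat \<Rightarrow> 'a \<Rightarrow> 'b::real_vector) \<Rightarrow> nat \<Rightarrow> 'a \<Rightarrow> 'b" where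
  "bdf v n = (if n = 0 then (\<lambda>x. v 1 x - v 0 x)
     else (\<lambda>x. (3/2) *\<^sub>R v (n + 1) x - 2 *\<^sub>R v n x + (1/2) *\<^sub>R v (n - 1) x))"

definition imex_solution ::
    "(real^'d::finite) set \<Rightarrow> (real^'d \<Rightarrow> real^'d) set \<Rightarrow> (real^'d \<Rightarrow> real) set \<Rightarrow> real \<Rightarrow> real \<Rightarrow>
     real \<Rightarrow> nat \<Rightarrow> (real \<Rightarrow> real^'d \<Rightarrow> real^'d) \<Rightarrow> (real^'d \<Rightarrow> real^'d) \<Rightarrow>
     (nat \<Rightarrow> real^'d \<Rightarrow> real^'d) \<Rightarrow> (nat \<Rightarrow> real^'d \<Rightarrow> real) \<Rightarrow> bool" where
  "imex_solution \<Omega> Vh Qh \<nu> \<mu> \<Delta>t N f s0 uh ph \<longleftrightarrow>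
     uh 0 \<in> Vh \<and> (AE x in lebesgue_on \<Omega>. uh 0 x = s0 x) \<and>
     (\<forall>n<N. uh (n + 1) \<in> Vh \<and> ph (n + 1) \<in> Qh \<and>
        (\<forall>v\<in>Vh. \<forall>q\<in>Qh.
           L2_inner \<Omega> (\<lambda>x. (1 / \<Delta>t) *\<^sub>R bdf uh n x) v
           + \<nu> * L2_inner \<Omega> (grad \<Omega> (uh (n + 1))) (grad \<Omega> v)
           + trilinear \<Omega> (extrapolate uh n) (extrapolate uh n) v
           - L2_inner \<Omega> (ph (n + 1)) (divergence \<Omega> v)
           + L2_inner \<Omega> (divergence \<Omega> (uh (n + 1))) q
           + \<mu> * L2_inner \<Omega> (divergence \<Omega> (uh (n + 1))) (divergence \<Omega> v)
           = L2_inner \<Omega> (f (real (n + 1) * \<Delta>t)) v))"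

section \<open>Constants of the error bound\<close>

definition stab_const ::
    "(real^'d::finite) set \<Rightarrow> real \<Rightarrow> (nat \<Rightarrow> real^'d \<Rightarrow> real^'d) \<Rightarrow> nat \<Rightarrow> nat \<Rightarrow> real" where
  "stab_const \<Omega> \<mu> s n j = 4 *
     (1/2 * Lp_norm \<Omega> \<infinity> (grad \<Omega> (extrapolate s (j - 1)))
      + 9 / (2 * \<mu>) * (Lp_norm \<Omega> \<infinity> (extrapolate s (j - 1)))\<^sup>2
      + 3 * Lp_norm \<Omega> \<infinity> (grad \<Omega> (extrapolate s j))
      + 3/2 * (if j = n + 1 then 0 else Lp_norm \<Omega> \<infinity> (grad \<Omega> (extrapolate s (j + 1)))))"

definition C0_sq ::
    "real \<Rightarrow> (real^'d::finite) set \<Rightarrow> real \<Rightarrow> (real \<Rightarrow> real^'d \<Rightarrow> real^'d) \<Rightarrow>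
     (real \<Rightarrow> real^'d \<Rightarrow> real^'d) \<Rightarrow> (real \<Rightarrow> real^'d \<Rightarrow> real^'d) \<Rightarrow> real" where
  "C0_sq C \<Omega> T u ut utt = C *
     ((bochner_norm T \<infinity> (L2_norm \<Omega>) utt)\<^sup>2
      + (bochner_norm T \<infinity> (W_norm \<Omega> 1 \<infinity>) u)\<^sup>2 * (bochner_norm T \<infinity> (L2_norm \<Omega>) ut)\<^sup>2
      + (bochner_norm T \<infinity> (Lp_norm \<Omega> \<infinity>) u)\<^sup>2 * (bochner_norm T \<infinity> (H_norm \<Omega> 1) ut)\<^sup>2)"

definition C1_sq ::
    "real \<Rightarrow> (real^'d::finite) set \<Rightarrow> real \<Rightarrow> real \<Rightarrow> nat \<Rightarrow> (real \<Rightarrow> real^'d \<Rightarrow> real^'d) \<Rightarrow>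
     (real \<Rightarrow> real^'d \<Rightarrow> real^'d) \<Rightarrow> real" where
  "C1_sq C \<Omega> T \<mu> k u ut = C *
     ((bochner_norm T 2 (H_norm \<Omega> k) ut)\<^sup>2
      + (\<mu> + T * measure lebesgue \<Omega> powr (2 / real CARD('d)) * (bochner_norm T \<infinity> (W_norm \<Omega> 1 \<infinity>) u)\<^sup>2)
        * (bochner_norm T \<infinity> (H_norm \<Omega> (k + 1)) u)\<^sup>2)"

definition C2_sq ::
    "real \<Rightarrow> (real^'d::finite) set \<Rightarrow> real \<Rightarrow> real \<Rightarrow> nat \<Rightarrow> (real \<Rightarrow> real^'d \<Rightarrow> real) \<Rightarrow> real" where
  "C2_sq C \<Omega> T \<mu> l p = C / \<mu> * (bochner_norm T \<infinity> (H_norm \<Omega> (l + 1)) p)\<^sup>2"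

definition C3_sq ::
    "real \<Rightarrow> (real^'d::finite) set \<Rightarrow> real \<Rightarrow> (real \<Rightarrow> real^'d \<Rightarrow> real^'d) \<Rightarrow>
     (real \<Rightarrow> real^'d \<Rightarrow> real^'d) \<Rightarrow> (real \<Rightarrow> real^'d \<Rightarrow> real^'d) \<Rightarrow> real" where
  "C3_sq C \<Omega> T u utt uttt = C *
     ((bochner_norm T 2 (L2_norm \<Omega>) uttt)\<^sup>2
      + (bochner_norm T \<infinity> (W_norm \<Omega> 1 \<infinity>) u)\<^sup>2 * (bochner_norm T 2 (L2_norm \<Omega>) utt)\<^sup>2
      + (bochner_norm T \<infinity> (Lp_norm \<Omega> \<infinity>) u)\<^sup>2 * (bochner_norm T 2 (H_norm \<Omega> 1) utt)\<^sup>2)"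

end

theory Submission
  imports Defs
begin

text \<open>
  The error \<open>e\<close> between the projected and the discrete solution satisfies the scheme with a consistency
  residual; testing with \<open>e\<close> itself and using the BDF2 identity produces the dissipation
  \<open>|e_j - 2 e_{j-1} + e_{j-2}|^2\<close>. Skew symmetry moves the transport term \<open>b(s, extrapolated e, e)\<close> onto this
  second difference, where the inverse inequality and the CFL condition absorb it. The cubic term is
  controlled by a bootstrap: as long as \<open>|e| <= K h\<close>, the refined discrete Sobolev bound
  \<open>h |v|_inf <= eps (|grad v| + |v|)\<close>, valid for every \<open>eps\<close> on fine meshes when \<open>d <= 3\<close>, lets viscosity
  absorb it, and Gronwall's lemma returns \<open>|e| <= K h\<close> at the next step. Fineness may depend on the
  viscosity here, but the constant in the bound does not. If \<open>u = 0\<close> there is no CFL restriction, but then all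
  consistency terms in the time step vanish.
\<close>

text \<open>Two exponents decide whether the bootstrap closes. If \<open>u\<close> does not vanish,
  the CFL condition makes \<open>dt\<close> of order \<open>h^2\<close>, hence \<open>dt^4\<close>
  of order \<open>h^8\<close>, and \<open>k \<ge> 1\<close> makes every spatial term of order at
  least \<open>h^2\<close>. So the right-hand side is at most a constant times \<open>h^2\<close>:
  the smallness level is \<open>K h\<close>, with \<open>K\<close> fixed from the data before
  \<open>h\<close>. The plain inverse inequality, on the other hand, gives only
  \<open>c h^(1-d/2) |v|_0\<close> for \<open>h |v|_inf\<close>, without a small factor. That factor
  comes from comparing the mass of \<open>v\<close> on one element with its mass on many disjoint
  translates of the element. A second obstacle is time: regularity is given for almost every time
  and time derivatives are defined by pairings, whereas the scheme samples single times. Time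
  estimates are therefore made for scalar functions, the pairings with a fixed function, and become
  norm estimates by duality; bounds for almost every time reach all times by lower semicontinuity,
  at the price of dimensional constants that enter \<open>C\<close>.\<close>

abbreviation "nrm \<equiv> L2_norm"
abbreviation "ip \<equiv> L2_inner"
abbreviation "sn S \<equiv> Lp_norm S \<infinity>"
abbreviation "lon \<equiv> lebesgue_on"
abbreviation "bm \<equiv> borel_measurable"
abbreviation "dv \<equiv> divergence"
abbreviation "tf \<equiv> test_function"
abbreviation "wd \<equiv> weak_deriv"
abbreviation "hwd \<equiv> has_weak_deriv"
abbreviation "pd \<equiv> partials"
abbreviation "ind \<equiv> indicator"
notation scaleR (infixr "*." 75)

text \<open>Keeps the exponent 2 in \<open>in_Lp S 2\<close> and \<open>in_H\<close> a numeral; the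
  simplifier would otherwise rewrite it to \<open>ereal 2\<close> and the facts below would no
  longer match.\<close>

declare numeral_eq_ereal [simp del]

section \<open>Square integrable functions: inner product, norm, Cauchy-Schwarz\<close>

lemma in_L2_iff:
 "in_Lp S 2 f \<longleftrightarrow> f \<in> bm (lon S) &
  integrable (lon S) (%x. (norm (f x))\<^sup>2)" by (simp add: in_Lp_def numeral_eq_ereal)

lemma in_L2_measurable: "in_Lp S p f ==> f \<in> bm (lon S)" by (simp add: in_Lp_def)

lemma L2_norm_sq: "(nrm S f)\<^sup>2 = (LINT x|lon S. (norm (f x))\<^sup>2)" by (simp add: L2_norm_def L2_inner_def power2_norm_eq_inner Bochner_Integration.integral_nonneg)

lemma L2_norm_nonneg [simp]: "0 <= nrm S f" by (simp add: L2_norm_def L2_inner_def Bochner_Integration.integral_nonneg)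

lemma L2_norm_sq_inner: "(nrm S f)\<^sup>2 = ip S f f" by (simp add: L2_norm_def L2_inner_def Bochner_Integration.integral_nonneg)

lemma integrable_inner_L2:
 assumes "in_Lp S 2 f" "in_Lp S 2 g"
 shows "integrable (lon S) (%x. f x \<bullet> g x)"
proof (rule Bochner_Integration.integrable_bound)
 show "integrable (lon S) (%x. (norm (f x))\<^sup>2+(norm (g x))\<^sup>2)" using assms by (simp add: in_L2_iff)
 show "(%x. f x \<bullet> g x) \<in> bm (lon S)" using assms by (auto simp: in_L2_iff)
 show "AE x in lon S. norm (f x \<bullet> g x) <= norm ((norm (f x))\<^sup>2+(norm (g x))\<^sup>2)"
 proof (rule AE_I2)
  fix x
  have "\<bar>f x \<bullet> g x\<bar> <= norm (f x) * norm (g x)" by (rule Cauchy_Schwarz_ineq2)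
  also have "... <= (norm (f x))\<^sup>2+(norm (g x))\<^sup>2" using sum_squares_bound[of "norm (f x)" "norm (g x)"]
  mult_nonneg_nonneg[OF norm_ge_zero norm_ge_zero, of "f x" "g x"] by linarith
  finally show "norm (f x \<bullet> g x) <= norm ((norm (f x))\<^sup>2+(norm (g x))\<^sup>2)" by simp
 qed
qed

lemma in_L2_dominated:
 assumes f: "f \<in> bm (lon S)" and g: "in_Lp S 2 g"
  and le: "AE x in lon S. norm (f x) <= c * norm (g x)"
 shows "in_Lp S 2 f"
proof -
 have "integrable (lon S) (%x. (norm (f x))\<^sup>2)"
 proof (rule Bochner_Integration.integrable_bound)
  show "integrable (lon S) (%x. c\<^sup>2*(norm (g x))\<^sup>2)" using g by (simp add: in_L2_iff)
  show "(%x. (norm (f x))\<^sup>2) \<in> bm (lon S)" using f by simp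
  show "AE x in lon S. norm ((norm (f x))\<^sup>2) <= norm (c\<^sup>2*(norm (g x))\<^sup>2)" using le
  proof eventually_elim
  case (elim x)
  then have "(norm (f x))\<^sup>2 <= (c * norm (g x))\<^sup>2" by (intro power_mono) auto
  then show ?case by (simp add: power_mult_distrib)
  qed
 qed
 with f show ?thesis by (simp add: in_L2_iff)
qed

lemma L2_norm_dominated:
 assumes f: "f \<in> bm (lon S)" and g: "in_Lp S 2 g" and c: "0 <= c"
  and le: "AE x in lon S. norm (f x) <= c * norm (g x)"
 shows "nrm S f <= c * nrm S g"
proof (rule power2_le_imp_le)
 have f2: "in_Lp S 2 f" by (rule in_L2_dominated[OF f g le])
 have "(LINT x|lon S. (norm (f x))\<^sup>2) <= (LINT x|lon S. c\<^sup>2*(norm (g x))\<^sup>2)"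
 proof (rule integral_mono_AE)
  show "AE x in lon S. (norm (f x))\<^sup>2 <= c\<^sup>2*(norm (g x))\<^sup>2" using le
  proof eventually_elim
  case (elim x)
  then have "(norm (f x))\<^sup>2 <= (c * norm (g x))\<^sup>2" by (intro power_mono) auto
  then show ?case by (simp add: power_mult_distrib)
  qed
 qed (use f2 g in \<open>auto simp: in_L2_iff\<close>)
 then show "(nrm S f)\<^sup>2 <= (c * nrm S g)\<^sup>2" by (simp add: L2_norm_sq power_mult_distrib)
qed (use c in simp)

lemma in_L2_cong_AE:
 assumes "f \<in> bm (lon S)" "in_Lp S 2 g" "AE x in lon S. f x = g x"
 shows "in_Lp S 2 f" by (rule in_L2_dominated[where c=1, OF assms(1,2)]) (use assms(3) in eventually_elim, simp)

lemma in_L2_zero [simp]: "in_Lp S 2 (%x. 0)" by (simp add: in_L2_iff)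

lemma in_L2_add:
 assumes "in_Lp S 2 f" "in_Lp S 2 g"
 shows "in_Lp S 2 (%x. f x+g x)"
proof -
 have "integrable (lon S) (%x. (norm (f x))\<^sup>2+(norm (g x))\<^sup>2+2*(f x \<bullet> g x))" using integrable_inner_L2[OF assms] assms by (simp add: in_L2_iff)
 moreover have "(norm (f x+g x))\<^sup>2 = (norm (f x))\<^sup>2+(norm (g x))\<^sup>2+2*(f x \<bullet> g x)" for x by (simp add: power2_norm_eq_inner inner_add inner_commute)
 ultimately show ?thesis using assms by (auto simp: in_L2_iff)
qed

lemma in_L2_scaleR:
 assumes "in_Lp S 2 f"
 shows "in_Lp S 2 (%x. c *. f x)" using assms by (auto simp: in_L2_iff power_mult_distrib)

lemma in_L2_diff:
 assumes "in_Lp S 2 f" "in_Lp S 2 g"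
 shows "in_Lp S 2 (%x. f x-g x)" using in_L2_add[OF assms(1) in_L2_scaleR[OF assms(2), of "-1"]] by simp

lemma in_L2_uminus:
 assumes "in_Lp S 2 f"
 shows "in_Lp S 2 (%x. - f x)" using in_L2_scaleR[OF assms, of "-1"] by simp

lemma in_L2_sum:
 assumes "!!i. i \<in> I ==> in_Lp S 2 (f i)"
 shows "in_Lp S 2 (%x. \<Sum>i\<in>I. f i x)" using assms by (induction I rule: infinite_finite_induct) (auto intro: in_L2_add)

lemma in_L2_mult_left:
 fixes f :: "'a::euclidean_space => real"
 shows "in_Lp S 2 f ==> in_Lp S 2 (%x. c * f x)" using in_L2_scaleR[of S f c] by simp

lemma L2_inner_commute: "ip S f g = ip S g f" by (simp add: L2_inner_def inner_commute)

lemma L2_inner_add_left: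
 assumes "in_Lp S 2 f" "in_Lp S 2 g" "in_Lp S 2 h"
 shows "ip S (%x. f x+g x) h = ip S f h+ip S g h" using assms by (simp add: L2_inner_def inner_add integrable_inner_L2)

lemma L2_inner_diff_left:
 assumes "in_Lp S 2 f" "in_Lp S 2 g" "in_Lp S 2 h"
 shows "ip S (%x. f x-g x) h = ip S f h-ip S g h" using assms by (simp add: L2_inner_def inner_diff integrable_inner_L2)

lemma L2_inner_scaleR_left: "ip S (%x. c *. f x) h = c * ip S f h" by (simp add: L2_inner_def)

lemma L2_inner_mult_left:
 "ip S (%x. c * f x) (h :: 'a::euclidean_space => real) = c * ip S f h" using L2_inner_scaleR_left[of S c f h] by simp

lemma L2_inner_add_right:
 assumes "in_Lp S 2 f" "in_Lp S 2 g" "in_Lp S 2 h"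
 shows "ip S h (%x. f x+g x) = ip S h f+ip S h g" using L2_inner_add_left[OF assms] by (simp add: L2_inner_commute)

lemma L2_inner_diff_right:
 assumes "in_Lp S 2 f" "in_Lp S 2 g" "in_Lp S 2 h"
 shows "ip S h (%x. f x-g x) = ip S h f-ip S h g" using L2_inner_diff_left[OF assms] by (simp add: L2_inner_commute)

lemma L2_inner_scaleR_right: "ip S h (%x. c *. f x) = c * ip S h f" by (simp add: L2_inner_def)

lemma L2_inner_mult_right:
 "ip S (h :: 'a::euclidean_space => real) (%x. c * f x) = c * ip S h f" using L2_inner_scaleR_right[of S h c f] by simp

lemma L2_inner_zero_left [simp]: "ip S (%x. 0) h = 0" by (simp add: L2_inner_def)

lemma L2_inner_zero_right [simp]: "ip S h (%x. 0) = 0" by (simp add: L2_inner_def)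

lemma L2_norm_zero [simp]: "nrm S (%x. 0) = 0" by (simp add: L2_norm_def)

lemma L2_norm_scaleR: "nrm S (%x. c *. f x) = \<bar>c\<bar> * nrm S f" by (rule power2_eq_imp_eq)
  (simp_all add: L2_norm_sq power_mult_distrib)

lemma L2_norm_uminus: "nrm S (%x. - f x) = nrm S f" using L2_norm_scaleR[of S "-1" f] by simp

lemma L2_norm_minus_commute: "nrm S (%x. f x-g x) = nrm S (%x. g x-f x)" using L2_norm_uminus[of S "%x. f x-g x"] by simp

lemma L2_inner_cong_AE:
 assumes "AE x in lon S. f x = f' x" "AE x in lon S. g x = g' x"
  and "f \<in> bm (lon S)" "f' \<in> bm (lon S)"
  and "g \<in> bm (lon S)" "g' \<in> bm (lon S)"
 shows "ip S f g = ip S f' g'" unfolding L2_inner_def by (rule integral_cong_AE) (use assms in auto)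

lemma L2_norm_cong_AE:
 assumes "AE x in lon S. f x = f' x"
  and "f \<in> bm (lon S)" "f' \<in> bm (lon S)"
 shows "nrm S f = nrm S f'" unfolding L2_norm_def using L2_inner_cong_AE[OF assms(1,1,2,3,2,3)] by simp

lemma L2_inner_norm_add_sq:
 assumes "in_Lp S 2 f" "in_Lp S 2 g"
 shows "(nrm S (%x. f x+g x))\<^sup>2 = (nrm S f)\<^sup>2+2 * ip S f g+(nrm S g)\<^sup>2" using assms by (simp add: L2_norm_sq_inner L2_inner_add_left L2_inner_add_right in_L2_add L2_inner_commute[of S g f])

lemma L2_Cauchy_Schwarz:
 assumes f: "in_Lp S 2 f" and g: "in_Lp S 2 g"
 shows "\<bar>ip S f g\<bar> <= nrm S f * nrm S g"
proof -
 define a b c where "a = (nrm S f)\<^sup>2" and "b = ip S f g" and "c = (nrm S g)\<^sup>2"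
 have *: "0 <= a+2 * t * b+t\<^sup>2 * c" for t
 proof -
  have "0 <= (nrm S (%x. f x+t *. g x))\<^sup>2" by simp
  also have "... = a+2 * t * b+t\<^sup>2 * c" by (simp only: L2_inner_norm_add_sq[OF f in_L2_scaleR[OF g]])
  (simp add: a_def b_def c_def L2_inner_scaleR_right L2_norm_scaleR power_mult_distrib)
  finally show ?thesis .
 qed
 have "b\<^sup>2 <= a * c"
 proof (cases "c = 0")
  case True
  have "b = 0"
  proof (rule ccontr)
  assume "b ~= 0"
  \<comment> \<open>For \<open>c = 0\<close> the quadratic is affine in \<open>t\<close>, and this
    \<open>t\<close> gives it the value -1.\<close>
  with *[of "- (a+1)/(2 * b)"] True show False by (simp add: field_simps)
  qed
  then show ?thesis using True by simp
 next
  case False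
  then have "c > 0" by (simp add: c_def)
  have "0 <= c * (a+2*(- b/c) * b+(- b/c)\<^sup>2 * c)" using *[of "- b/c"] \<open>c > 0\<close> by (intro mult_nonneg_nonneg) auto
  also have "... = a * c-b\<^sup>2" using False by (simp add: field_simps power2_eq_square)
  finally show ?thesis by simp
 qed
 then have "\<bar>b\<bar>\<^sup>2 <= (nrm S f * nrm S g)\<^sup>2" by (simp add: a_def c_def power_mult_distrib)
 then show ?thesis unfolding b_def by (rule power2_le_imp_le) simp
qed

lemma L2_norm_triangle:
 assumes f: "in_Lp S 2 f" and g: "in_Lp S 2 g"
 shows "nrm S (%x. f x+g x) <= nrm S f+nrm S g"
proof (rule power2_le_imp_le)
 show "(nrm S (%x. f x+g x))\<^sup>2 <= (nrm S f+nrm S g)\<^sup>2" unfolding L2_inner_norm_add_sq[OF assms] power2_sum using L2_Cauchy_Schwarz[OF assms] by simp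
qed simp

lemma L2_norm_triangle_diff:
 assumes f: "in_Lp S 2 f" and g: "in_Lp S 2 g"
 shows "nrm S (%x. f x-g x) <= nrm S f+nrm S g" using L2_norm_triangle[OF f in_L2_uminus[OF g]] by (simp add: L2_norm_uminus)

lemma L2_norm_sum:
 assumes "!!i. i \<in> I ==> in_Lp S 2 (f i)"
 shows "nrm S (%x. \<Sum>i\<in>I. f i x) <= (\<Sum>i\<in>I. nrm S (f i))" using assms
proof (induction I rule: infinite_finite_induct)
 case (insert i I)
 have "nrm S (%x. f i x+(\<Sum>i\<in>I. f i x)) <= nrm S (f i)+nrm S (%x. \<Sum>i\<in>I. f i x)" using insert by (intro L2_norm_triangle in_L2_sum) auto
 with insert show ?case by fastforce
qed auto

lemma L2_norm_eq_0_iff: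
 assumes "in_Lp S 2 f"
 shows "nrm S f = 0 \<longleftrightarrow> (AE x in lon S. f x = 0)"
proof -
 have "nrm S f = 0 \<longleftrightarrow> (LINT x|lon S. (norm (f x))\<^sup>2) = 0" by (metis L2_norm_sq power2_eq_iff_nonneg L2_norm_nonneg order_refl zero_power2)
 also have "... \<longleftrightarrow> (AE x in lon S. (norm (f x))\<^sup>2 = 0)" by (rule integral_nonneg_eq_0_iff_AE) (use assms in \<open>auto simp: in_L2_iff\<close>)
 finally show ?thesis by simp
qed

text \<open>Test with \<open>f\<close> itself and divide by its norm. This turns estimates of
  pairings, the form in which time derivatives are given, into norm estimates.\<close>

lemma L2_norm_le_of_inner:
 assumes f: "in_Lp S 2 f" and B: "0 <= B" and le: "!!v. in_Lp S 2 v ==> \<bar>ip S f v\<bar> <= B * nrm S v"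
 shows "nrm S f <= B"
proof (cases "nrm S f = 0")
 case False
 have "nrm S f * nrm S f <= B * nrm S f" using le[OF f] L2_norm_sq_inner[of S f] by (simp add: power2_eq_square)
 with False show ?thesis by (metis L2_norm_nonneg less_eq_real_def mult_right_le_imp_le)
qed (use B in simp)

lemma Lp_norm_2: "Lp_norm S 2 f = nrm S f"
proof -
 have "(LINT x|lon S. norm (f x) powr 2) = (nrm S f)\<^sup>2" by (simp add: L2_norm_sq)
 then show ?thesis by (simp add: Lp_norm_def numeral_eq_ereal powr_half_sqrt)
qed

section \<open>Essentially bounded functions\<close>

lemma in_Linf_iff:
 "in_Lp S \<infinity> f \<longleftrightarrow> f \<in> bm (lon S) &
  (\<exists>c. AE x in lon S. norm (f x) <= c)"
proof (safe)
 assume *: "in_Lp S \<infinity> f"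
 then show "f \<in> bm (lon S)" by (simp add: in_Lp_def)
 have "esssup (lon S) (%x. ereal (norm (f x))) < \<infinity>" using * by (simp add: in_Lp_def)
 then obtain c where "esssup (lon S) (%x. ereal (norm (f x))) < ereal c" using less_PInf_Ex_of_nat by auto
 then have lt: "esssup (lon S) (%x. ereal (norm (f x))) <= ereal c" by simp
 from esssup_AE[of "%x. ereal (norm (f x))" "lon S"]
 have "AE x in lon S. norm (f x) <= c"
 proof eventually_elim
  case (elim x)
  then have "ereal (norm (f x)) <= ereal c" using lt by (rule order_trans)
  then show ?case by simp
 qed
 then show "\<exists>c. AE x in lon S. norm (f x) <= c" by blast
next
 fix c assume f: "f \<in> bm (lon S)" and c: "AE x in lon S. norm (f x) <= c"
 have "esssup (lon S) (%x. ereal (norm (f x))) <= ereal c" using f c by (intro esssup_I) auto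
 then show "in_Lp S \<infinity> f" using f by (auto simp: in_Lp_def)
qed

text \<open>An essential supremum \<open>-\<infinity>\<close> (null space) or
  \<open>\<infinity>\<close> (non-measurable function) becomes 0 under \<open>real_of_ereal\<close>;
  otherwise it is compared with that of the zero function.\<close>

lemma Linf_norm_nonneg [simp]: "0 <= sn S f"
proof -
 have "0 <= esssup (lon S) (%x. ereal (norm (f x)))"
  if "esssup (lon S) (%x. ereal (norm (f x))) ~= -\<infinity>"
 proof (cases "f \<in> bm (lon S)")
  case True
  then have "emeasure (lon S) (space (lon S)) ~= 0" using that esssup_zero_space[of "lon S" "%x. ereal (norm (f x))"] by auto
  then have "0 = esssup (lon S) (%x. 0 :: ereal)" by (simp add: esssup_const)
  also have "... <= esssup (lon S) (%x. ereal (norm (f x)))" by (intro esssup_mono) auto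
  finally show ?thesis .
 next
  case False
  show ?thesis
  proof (cases "(%x. ereal (norm (f x))) \<in> bm (lon S)")
  case True
  then have "emeasure (lon S) (space (lon S)) ~= 0" using that esssup_zero_space[of "lon S" "%x. ereal (norm (f x))"] by auto
  then have "0 = esssup (lon S) (%x. 0 :: ereal)" by (simp add: esssup_const)
  also have "... <= esssup (lon S) (%x. ereal (norm (f x)))" by (intro esssup_mono) auto
  finally show ?thesis .
  qed (simp add: esssup_non_measurable)
 qed
 then show ?thesis unfolding Lp_norm_def by (cases "esssup (lon S) (%x. ereal (norm (f x)))") auto
qed

lemma Linf_norm_AE:
 assumes "in_Lp S \<infinity> f"
 shows "AE x in lon S. norm (f x) <= sn S f"
proof -
 let ?e = "esssup (lon S) (%x. ereal (norm (f x)))"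
 have e: "?e < \<infinity>" using assms by (simp add: in_Lp_def)
 show ?thesis using esssup_AE[of "%x. ereal (norm (f x))" "lon S"]
 proof eventually_elim
  case (elim x)
  then have "?e ~= -\<infinity>" by auto
  with elim e show ?case by (cases ?e) (auto simp: Lp_norm_def)
 qed
qed

lemma Linf_norm_le:
 assumes f: "f \<in> bm (lon S)" and c: "0 <= c"
  and le: "AE x in lon S. norm (f x) <= c"
 shows "sn S f <= c"
proof -
 have "esssup (lon S) (%x. ereal (norm (f x))) <= ereal c" using f le by (intro esssup_I) auto
 then show ?thesis using c by (cases "esssup (lon S) (%x. ereal (norm (f x)))") (auto simp: Lp_norm_def)
qed

lemma Linf_norm_cong_AE:
 assumes "AE x in lon S. f x = f' x"
  and "f \<in> bm (lon S)" "f' \<in> bm (lon S)"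
 shows "Lp_norm S p f = Lp_norm S p f'"
proof -
 have "esssup (lon S) (%x. ereal (norm (f x))) = esssup (lon S) (%x. ereal (norm (f' x)))" by (rule esssup_AE_cong) (use assms in auto)
 moreover have "(LINT x|lon S. norm (f x) powr real_of_ereal p)
  = (LINT x|lon S. norm (f' x) powr real_of_ereal p)" by (rule integral_cong_AE) (use assms in auto)
 ultimately show ?thesis by (simp add: Lp_norm_def)
qed

lemma in_Linf_add:
 assumes "in_Lp S \<infinity> f" "in_Lp S \<infinity> g"
 shows "in_Lp S \<infinity> (%x. f x+g x)"
  and "sn S (%x. f x+g x) <= sn S f+sn S g"
proof -
 have m: "(%x. f x+g x) \<in> bm (lon S)" using assms by (auto simp: in_Linf_iff)
 have *: "AE x in lon S. norm (f x+g x) <= sn S f+sn S g" using Linf_norm_AE[OF assms(1)] Linf_norm_AE[OF assms(2)] by eventually_elim (meson add_mono norm_triangle_le)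
 show "in_Lp S \<infinity> (%x. f x+g x)" using m * by (auto simp: in_Linf_iff)
 show "sn S (%x. f x+g x) <= sn S f+sn S g" by (rule Linf_norm_le[OF m _ *]) simp
qed

lemma in_Linf_scaleR:
 assumes "in_Lp S \<infinity> f"
 shows "in_Lp S \<infinity> (%x. c *. f x)"
  and "sn S (%x. c *. f x) <= \<bar>c\<bar> * sn S f"
proof -
 have m: "(%x. c *. f x) \<in> bm (lon S)" using assms by (auto simp: in_Linf_iff)
 have *: "AE x in lon S. norm (c *. f x) <= \<bar>c\<bar> * sn S f" using Linf_norm_AE[OF assms(1)] by eventually_elim (simp add: mult_left_mono)
 show "in_Lp S \<infinity> (%x. c *. f x)" using m * by (auto simp: in_Linf_iff)
 show "sn S (%x. c *. f x) <= \<bar>c\<bar> * sn S f" by (rule Linf_norm_le[OF m _ *]) simp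
qed

lemma in_Linf_diff:
 assumes "in_Lp S \<infinity> f" "in_Lp S \<infinity> g"
 shows "in_Lp S \<infinity> (%x. f x-g x)"
  and "sn S (%x. f x-g x) <= sn S f+sn S g" using in_Linf_add[OF assms(1) in_Linf_scaleR(1)[OF assms(2), of "-1"]]
  in_Linf_scaleR(2)[OF assms(2), of "-1"] by auto

lemma in_Linf_imp_L2:
 assumes f: "in_Lp S \<infinity> f" and S: "S \<in> lmeasurable"
 shows "in_Lp S 2 f"
proof -
 have fin: "finite_measure (lon S)" using S by (metis finite_measure_lebesgue_on)
 obtain c where c: "AE x in lon S. norm (f x) <= c" using f by (auto simp: in_Linf_iff)
 have "integrable (lon S) (%x. (norm (f x))\<^sup>2)"
 proof (rule finite_measure.integrable_const_bound[OF fin])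
  show "AE x in lon S. norm ((norm (f x))\<^sup>2) <= c\<^sup>2" using c by eventually_elim (simp add: power_mono)
 qed (use f in \<open>auto simp: in_Linf_iff\<close>)
 then show ?thesis using f by (auto simp: in_L2_iff in_Linf_iff)
qed

text \<open>The pointwise product \<open>bop\<close> of a bounded and a square integrable function, for any of the
 products used below.\<close>

lemma in_L2_Linf_mult:
 assumes f: "in_Lp S \<infinity> f" and g: "in_Lp S 2 g"
  and m: "(%x. bop (f x) (g x)) \<in> bm (lon S)"
  and le: "!!a b. norm (bop a b) <= norm a * norm b"
 shows "in_Lp S 2 (%x. bop (f x) (g x))"
  and "nrm S (%x. bop (f x) (g x)) <= sn S f * nrm S g"
proof -
 have *: "AE x in lon S. norm (bop (f x) (g x)) <= sn S f * norm (g x)" using Linf_norm_AE[OF f] by eventually_elim (meson le mult_right_mono norm_ge_zero order_trans)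
 show "in_Lp S 2 (%x. bop (f x) (g x))" by (rule in_L2_dominated[OF m g *])
 show "nrm S (%x. bop (f x) (g x)) <= sn S f * nrm S g" by (rule L2_norm_dominated[OF m g _ *]) simp
qed

lemma norm_matrix_vector_mult_le:
 fixes A :: "real^'n^'m"
 shows "norm (A *v x) <= norm A * norm x"
proof (rule power2_le_imp_le)
 have "(norm (A *v x))\<^sup>2 = (\<Sum>i\<in>UNIV. ((A $ i) \<bullet> x)\<^sup>2)" by (simp add: norm_vec_def L2_set_def sum_nonneg matrix_vector_mul_component)
 also have "... <= (\<Sum>i\<in>UNIV. (norm (A $ i))\<^sup>2*(norm x)\<^sup>2)" by (intro sum_mono) (metis Cauchy_Schwarz_ineq power2_norm_eq_inner)
 also have "... = (norm A * norm x)\<^sup>2" by (simp add: norm_vec_def[of A] L2_set_def sum_nonneg power_mult_distrib sum_distrib_right)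
 finally show "(norm (A *v x))\<^sup>2 <= (norm A * norm x)\<^sup>2" .
qed simp

lemma borel_measurable_matrix_vector_mult:
 fixes f :: "_ => real^'n^'m"
 assumes "f \<in> bm M" "g \<in> bm M"
 shows "(%x. f x *v g x) \<in> bm M"
proof -
 have "continuous_on UNIV (%p :: (real^'n^'m) \<times> (real^'n). fst p *v snd p)" unfolding matrix_vector_mult_def by (intro continuous_intros)
 then show ?thesis by (intro borel_measurable_continuous_Pair[OF assms, where H="%A v. A *v v"])
qed

lemma in_Lp_nth:
 fixes f :: "'a::euclidean_space => ('b::euclidean_space)^'n"
 assumes "in_Lp S 2 f"
 shows "in_Lp S 2 (%x. f x $ i)" and "nrm S (%x. f x $ i) <= nrm S f"
proof -
 have m: "(%x. f x $ i) \<in> bm (lon S)"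
 proof -
  have "(%v :: 'b^'n. v $ i) \<in> bm borel" by (intro borel_measurable_continuous_onI continuous_intros)
  with in_L2_measurable[OF assms] show ?thesis by (rule measurable_compose)
 qed
 have le: "AE x in lon S. norm (f x $ i) <= 1 * norm (f x)" by (simp add: Finite_Cartesian_Product.norm_nth_le)
 show "in_Lp S 2 (%x. f x $ i)" by (rule in_L2_dominated[OF m assms le])
 show "nrm S (%x. f x $ i) <= nrm S f" using L2_norm_dominated[OF m assms _ le] by simp
qed

section \<open>Smooth functions and test functions\<close>

text \<open>The regularity half of \<open>test_function\<close>, kept apart so that closure under
  products, sums and linear maps can be settled before supports are discussed.\<close>

definition smooth :: "(real^'d::finite => 'b::real_normed_vector) => bool" where
 "smooth f \<longleftrightarrow> (\<forall>is x. pd is f differentiable (at x))"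

lemma partials_append: "pd (is @ js) f = pd is (pd js f)" by (induction "is") simp_all

lemma partials_eqI:
 assumes "(f has_derivative f') (at x)"
 shows "pd [i] f x = f' (axis i 1)" using frechet_derivative_at[OF assms] by simp

lemma smooth_partials: "smooth f ==> smooth (pd js f)" by (simp add: smooth_def partials_append[symmetric])

lemma smooth_differentiable: "smooth f ==> f differentiable (at x)" unfolding smooth_def by (metis partials.simps(1))

lemma smooth_has_derivative:
 "smooth f ==> (f has_derivative frechet_derivative f (at x)) (at x)" using smooth_differentiable frechet_derivative_works by blast

lemma smooth_continuous: "smooth f ==> continuous_on S f" by (meson continuous_at_imp_continuous_on differentiable_imp_continuous_within smooth_differentiable)

text \<open>A coinduction principle: iterated partials stay in any set that is closed under a single
  partial. The closure properties of smooth functions then amount to guessing such a set.\<close>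

lemma smoothI_closed:
 assumes "f \<in> S" and diff: "!!g x. g \<in> S ==> g differentiable (at x)"
  and closed: "!!g i. g \<in> S ==> pd [i] g \<in> S"
 shows "smooth f"
proof -
 have "pd is f \<in> S" for "is"
 proof (induction "is")
  case (Cons i "is")
  then show ?case using closed[of "pd is f" i] by simp
 qed (use assms in simp)
 then show ?thesis using diff by (simp add: smooth_def)
qed

lemma partials_const: "pd [i] (%x. c) = (%x. 0)" by (rule ext) (use partials_eqI[OF has_derivative_const] in simp)

lemma smooth_const [simp]: "smooth (%x. c)" by (rule smoothI_closed[where S="range (%c x. c)"]) (use partials_const in auto)

lemma partials_scaleR:
 assumes "smooth f" "smooth g"
 shows "pd [i] (%x. f x *. g x) = (%x. f x *. pd [i] g x+pd [i] f x *. g x)" by (rule ext, subst partials_eqI[OF has_derivative_scaleR[OF smooth_has_derivative[OF assms(1)] smooth_has_derivative[OF assms(2)]]]) simp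

lemma partials_mult:
 fixes f :: "real^'d::finite => real"
 assumes "smooth f" "smooth g"
 shows "pd [i] (%x. f x * g x) = (%x. f x * pd [i] g x+pd [i] f x * g x)" using partials_scaleR[OF assms] by simp

lemma partials_bounded_linear:
 assumes "bounded_linear L" "smooth f"
 shows "pd [i] (%x. L (f x)) = (%x. L (pd [i] f x))" by (rule ext, subst partials_eqI[OF bounded_linear.has_derivative[OF assms(1) smooth_has_derivative[OF assms(2)]]]) simp

text \<open>By Leibniz' rule a partial of a product is a sum of two products. Products alone are
  therefore not closed under partials, but their finite sums are.\<close>

inductive_set smooth_alg :: "(real^'d::finite => 'b::real_normed_vector) set" where
 prod: "smooth f ==> smooth g ==> (%x. f x *. g x) \<in> smooth_alg"
| add: "f \<in> smooth_alg ==> g \<in> smooth_alg ==> (%x. f x+g x) \<in> smooth_alg"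

lemma smooth_alg_differentiable: "f \<in> smooth_alg ==> f differentiable (at x)"
proof (induction rule: smooth_alg.induct)
 case (prod f g)
 from has_derivative_scaleR[OF smooth_has_derivative[OF prod(1)] smooth_has_derivative[OF prod(2)]]
 show ?case unfolding differentiable_def by blast
qed (rule differentiable_add)

lemma smooth_alg_partials: "f \<in> smooth_alg ==> pd [i] f \<in> smooth_alg"
proof (induction rule: smooth_alg.induct)
 case (prod f g)
 then show ?case unfolding partials_scaleR[OF prod] by (intro smooth_alg.intros smooth_partials)
next
 case (add f g)
 have "pd [i] (%x. f x+g x) = (%x. pd [i] f x+pd [i] g x)"
 proof
  fix x
  have "(f has_derivative frechet_derivative f (at x)) (at x)" "(g has_derivative frechet_derivative g (at x)) (at x)" using smooth_alg_differentiable add frechet_derivative_works by blast+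
  from partials_eqI[OF has_derivative_add[OF this]]
  show "pd [i] (%x. f x+g x) x = pd [i] f x+pd [i] g x" by simp
 qed
 then show ?case using add by (simp only:) (rule smooth_alg.add)
qed

lemma smooth_alg_smooth: "f \<in> smooth_alg ==> smooth f" by (rule smoothI_closed[where S=smooth_alg]) (auto intro: smooth_alg_differentiable smooth_alg_partials simp del: partials.simps)

lemma smooth_scaleR: "smooth f ==> smooth g ==> smooth (%x. f x *. g x)" by (rule smooth_alg_smooth, rule smooth_alg.prod)

lemma smooth_mult: "smooth f ==> smooth g ==> smooth (%x. f x * g x :: real)" using smooth_scaleR[of f g] by simp

lemma smooth_add: "smooth f ==> smooth g ==> smooth (%x. f x+g x)"
proof -
 assume "smooth f" "smooth g"
 \<comment> \<open>Multiplication by the constant 1 turns \<open>f\<close> and \<open>g\<close> into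
   products, the base case of \<open>smooth_alg\<close>.\<close>
 then have "(%x. (1::real) *. f x) \<in> smooth_alg" "(%x. (1::real) *. g x) \<in> smooth_alg" using smooth_alg.prod[OF smooth_const, of f "1::real"] smooth_alg.prod[OF smooth_const, of g "1::real"] by blast+
 then have "f \<in> smooth_alg" "g \<in> smooth_alg" by simp_all
 then show "smooth (%x. f x+g x)" by (intro smooth_alg_smooth smooth_alg.add)
qed

lemma smooth_sum: "(!!i. i \<in> I ==> smooth (f i)) ==> smooth (%x. \<Sum>i\<in>I. f i x)" by (induction I rule: infinite_finite_induct) (auto intro: smooth_add)

lemma smooth_prod: "(!!i. i \<in> I ==> smooth (f i)) ==> smooth (%x. \<Prod>i\<in>I. f i x :: real)" by (induction I rule: infinite_finite_induct) (auto intro: smooth_mult)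

lemma smooth_power: "smooth f ==> smooth (%x. f x^n :: real)" by (induction n) (auto intro: smooth_mult)

lemma smooth_bounded_linear:
 assumes "bounded_linear L" "smooth f"
 shows "smooth (%x. L (f x))"
proof (rule smoothI_closed[where S="{%x. L (g x) |g. smooth g}"])
 show "g differentiable (at x)" if "g \<in> {%x. L (g x) |g. smooth g}" for g x
 proof -
  from that obtain k where "g = (%x. L (k x))" "smooth k" by blast
  then show ?thesis using bounded_linear.has_derivative[OF assms(1) smooth_has_derivative[of k x]] by (auto simp: differentiable_def)
 qed
 show "pd [i] g \<in> {%x. L (g x) |g. smooth g}" if "g \<in> {%x. L (g x) |g. smooth g}" for g i
 proof -
  from that obtain k where k: "g = (%x. L (k x))" "smooth k" by blast
  have "pd [i] g = (%x. L (pd [i] k x))" unfolding k(1) by (rule partials_bounded_linear[OF assms(1) k(2)])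
  then show ?thesis using smooth_partials[OF k(2), of "[i]"] by blast
 qed
qed (use assms in auto)

lemma smooth_linear:
 assumes "bounded_linear L"
 shows "smooth L"
proof (rule smoothI_closed[where S="insert L (range (%c x. c))"])
 show "g differentiable (at x)" if "g \<in> insert L (range (%c x. c))" for g x using that bounded_linear_imp_has_derivative[OF assms] smooth_differentiable[OF smooth_const] unfolding differentiable_def by blast
 show "pd [i] g \<in> insert L (range (%c x. c))" if "g \<in> insert L (range (%c x. c))" for g i
 proof -
  have "pd [i] L = (%x. L (axis i 1))" by (rule ext) (use partials_eqI[OF bounded_linear_imp_has_derivative[OF assms]] in simp)
  with that partials_const show ?thesis by blast
 qed
qed simp

lemma smooth_coord: "smooth (%x. x $ i)" by (rule smooth_linear[OF bounded_linear_vec_nth])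

text \<open>The closed set consists of the functions \<open>k * h (c x_i + a)\<close> with
  \<open>h\<close> in \<open>F\<close>: the chain rule changes the factor \<open>k\<close> and
  replaces \<open>h\<close> by its derivative, again in \<open>F\<close>. A negative
  \<open>c\<close> yields descending cutoffs.\<close>

lemma smooth_compose_coord:
 assumes "g \<in> F" and F: "!!g. g \<in> F ==> \<exists>g'\<in>F. \<forall>t. (g has_real_derivative g' t) (at t)"
 shows "smooth (%x :: real^'d::finite. g (c * x $ i+a))"
proof (rule smoothI_closed[where S="{%x. k * h (c * x $ i+a) |k h. h \<in> F}"])
 have der: "((%x. k * h (c * x $ i+a)) has_derivative (%y. k * (h' (c * x $ i+a)*(c * y $ i)))) (at x)"
  if "!!t. (h has_real_derivative h' t) (at t)" for k :: real and h h' and x :: "real^'d"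
 proof -
  have "((%x. c * x $ i+a) has_derivative (%y. c * y $ i+0)) (at x)" by (intro has_derivative_add has_derivative_const has_derivative_mult_right
  bounded_linear_imp_has_derivative bounded_linear_vec_nth)
  then have "((%x. c * x $ i+a) has_derivative (%y. c * y $ i)) (at x)" by simp
  from has_derivative_compose[OF this, of h "%y. h' (c * x $ i+a) * y"] that
  have "((%x. h (c * x $ i+a)) has_derivative (%y. h' (c * x $ i+a)*(c * y $ i))) (at x)" by (simp add: has_field_derivative_def)
  then show ?thesis by (rule has_derivative_mult_right)
 qed
 show "f differentiable (at x)" if "f \<in> {%x :: real^'d. k * h (c * x $ i+a) |k h. h \<in> F}" for f x using that F der unfolding differentiable_def by blast
 show "pd [j] f \<in> {%x. k * h (c * x $ i+a) |k h. h \<in> F}"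
  if "f \<in> {%x :: real^'d. k * h (c * x $ i+a) |k h. h \<in> F}" for f j
 proof -
  obtain k h where f: "f = (%x. k * h (c * x $ i+a))" "h \<in> F" using \<open>f \<in> _\<close> by blast
  then obtain h' where h': "h' \<in> F" "!!t. (h has_real_derivative h' t) (at t)" using F by blast
  have "pd [j] f = (%x. (k * c * (axis j 1 :: real^'d) $ i) * h' (c * x $ i+a))" unfolding f(1) by (rule ext, subst partials_eqI[OF der[OF h'(2)]]) (simp add: mult_ac)
  then show ?thesis using h'(1) by blast
 qed
 show "(%x. g (c * x $ i+a)) \<in> {%x. k * h (c * x $ i+a) |k h. h \<in> F}" using assms(1) by (auto intro!: exI[of _ 1] exI[of _ g])
qed

text \<open>The span of \<open>t \<mapsto> t\<^sup>-\<^sup>n exp(-1/t)\<close>, extended by zero: closed under derivatives.\<close>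

inductive_set flat :: "(real => real) set" where
 base: "(%t. if t <= 0 then 0 else inverse t^n * exp (- inverse t)) \<in> flat"
| add: "f \<in> flat ==> g \<in> flat ==> (%t. f t+g t) \<in> flat"
| scale: "f \<in> flat ==> (%t. c * f t) \<in> flat"

text \<open>Away from 0 this is calculus. At 0 the right difference quotient is
  \<open>s^(n+1) exp (- s)\<close> with \<open>s = 1/t\<close> tending to infinity, so it tends to
  0.\<close>

lemma flat_base_deriv:
 fixes n :: nat
 defines "g \<equiv> %n t :: real. if t <= 0 then 0 else inverse t^n * exp (- inverse t)"
 shows "(g n has_real_derivative (- real n * g (n+1) t+g (n+2) t)) (at t)"
proof -
 consider "t < 0" | "t = 0" | "t > 0" by linarith
 then show ?thesis
 proof cases
  case 1
  have "(g n has_real_derivative 0) (at t)"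
  proof (rule has_field_derivative_transform_within_open[where S="{..<0}"])
  show "((%t. 0) has_real_derivative 0) (at t)" by simp
  qed (use 1 in \<open>auto simp: g_def\<close>)
  then show ?thesis using 1 by (simp add: g_def)
 next
  case 3
  have "((%t. inverse t^n * exp (- inverse t)) has_real_derivative (- real n * g (n+1) t+g (n+2) t)) (at t)"
  proof -
  have "((%t. inverse t^n * exp (- inverse t)) has_real_derivative
  (inverse t^n * (exp (- inverse t)*(inverse t * inverse t))
  + real n * (- (inverse t * inverse t) * inverse t^(n-1)) * exp (- inverse t))) (at t)" using 3 by (auto intro!: derivative_eq_intros simp: power2_eq_square)
  also have "inverse t^n * (exp (- inverse t)*(inverse t * inverse t))
  + real n * (- (inverse t * inverse t) * inverse t^(n-1)) * exp (- inverse t)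
  = - real n * g (n+1) t+g (n+2) t" using 3 by (cases n) (simp_all add: g_def algebra_simps)
  finally show ?thesis .
  qed
  then show ?thesis by (rule has_field_derivative_transform_within_open[where S="{0<..}"]) (use 3 in \<open>auto simp: g_def\<close>)
 next
  case 2
  have "((%h. g n h/h) \<longlongrightarrow> 0) (at_left 0)" by (rule tendsto_eventually) (auto simp: eventually_at_filter g_def)
  moreover have "((%h. g n h/h) \<longlongrightarrow> 0) (at_right 0)"
  proof -
  have "((%h. inverse h^(n+1)/exp (inverse h)) \<longlongrightarrow> 0) (at_right (0::real))" by (rule filterlim_compose[OF tendsto_power_div_exp_0 filterlim_inverse_at_top_right])
  then show ?thesis by (rule Lim_transform_eventually)
  (auto simp: eventually_at_filter g_def exp_minus divide_simps)
  qed
  ultimately have "((%h. g n h/h) \<longlongrightarrow> 0) (at 0)" by (simp add: filterlim_at_split)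
  then have "((%h. (g n (0+h)-g n 0)/h) \<longlongrightarrow> 0) (at 0)" by (simp add: g_def)
  then show ?thesis using 2 by (simp only: DERIV_def) (simp add: g_def)
 qed
qed

lemma flat_deriv: "g \<in> flat ==> \<exists>g'\<in>flat. \<forall>t. (g has_real_derivative g' t) (at t)"
proof (induction rule: flat.induct)
 case (base n)
 let ?g = "%n t :: real. if t <= 0 then 0 else inverse t^n * exp (- inverse t)"
 have "(%t. - real n * ?g (n+1) t + ?g (n+2) t) \<in> flat" by (intro flat.intros)
 then show ?case using flat_base_deriv[of n] by (intro bexI[of _ "%t. - real n * ?g (n+1) t + ?g (n+2) t"]) auto
next
 case (add f g)
 then obtain f' g' where "f' \<in> flat" "g' \<in> flat" "!!t. (f has_real_derivative f' t) (at t)" "!!t. (g has_real_derivative g' t) (at t)" by blast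
 then show ?case by (intro bexI[of _ "%t. f' t+g' t"]) (auto intro: flat.intros DERIV_add)
next
 case (scale f c)
 then obtain f' where "f' \<in> flat" "!!t. (f has_real_derivative f' t) (at t)" by blast
 then show ?case by (intro bexI[of _ "%t. c * f' t"]) (auto intro: flat.intros DERIV_cmult)
qed

definition cutoff :: "real => real" where
 "cutoff t = (if t <= 0 then 0 else exp (- inverse t))"

lemma cutoff_flat: "cutoff \<in> flat" using flat.base[of 0] unfolding cutoff_def[abs_def] power_0 mult_1_left .

lemma cutoff_bounds: "0 <= cutoff t" "cutoff t <= 1" by (auto simp: cutoff_def)

text \<open>A smooth substitute for the indicator of an open box: every face contributes a cutoff of
  the scaled distance to it. For positive \<open>m\<close> the product is positive exactly inside
  the box, and it increases to 1 there as \<open>m\<close> grows.\<close>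

definition box_bump :: "real^'d::finite => real^'d => real => real^'d => real" where
 "box_bump a b m x = (\<Prod>i\<in>UNIV. cutoff (m * (x $ i-a $ i)) * cutoff (m * (b $ i-x $ i)))"

lemma smooth_box_bump: "smooth (box_bump a b m)"
proof -
 have "smooth (%x. cutoff (m * x $ i+(- m * a $ i)) * cutoff ((- m) * x $ i+m * b $ i))" for i by (intro smooth_mult smooth_compose_coord[OF cutoff_flat flat_deriv])
 then have "smooth (%x. \<Prod>i\<in>UNIV. cutoff (m * x $ i+(- m * a $ i)) * cutoff ((- m) * x $ i+m * b $ i))" by (intro smooth_prod)
 then show ?thesis by (simp add: box_bump_def[abs_def] algebra_simps)
qed

lemma box_bump_bounds: "0 <= box_bump a b m x" "box_bump a b m x <= 1" unfolding box_bump_def by (auto intro!: prod_nonneg prod_le_1 mult_nonneg_nonneg mult_le_one cutoff_bounds)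

lemma box_bump_zero: "m > 0 ==> x \<notin> box a b ==> box_bump a b m x = 0" unfolding box_bump_def cutoff_def mem_box_cart by (auto simp: not_less mult_le_0_iff)

lemma box_bump_tendsto:
 "(%n. box_bump a b (real (Suc n)) x) \<longlonglongrightarrow> ind (box a b) x"
proof (cases "x \<in> box a b")
 case True
 have *: "(%n. cutoff (real (Suc n) * t)) \<longlonglongrightarrow> 1" if "t > 0" for t
 proof -
  have "(%n. exp (- (inverse (real (Suc n)) * inverse t))) \<longlonglongrightarrow> exp (- (0 * inverse t))" by (intro tendsto_intros LIMSEQ_inverse_real_of_nat)
  moreover have "cutoff (real (Suc n) * t) = exp (- (inverse (real (Suc n)) * inverse t))" for n using that by (simp add: cutoff_def mult_le_0_iff del: of_nat_Suc)
  ultimately show ?thesis by simp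
 qed
 have "(%n. box_bump a b (real (Suc n)) x) \<longlonglongrightarrow> (\<Prod>i\<in>(UNIV :: 'a set). 1*1)" unfolding box_bump_def by (intro tendsto_prod tendsto_mult *) (use True in \<open>auto simp: mem_box_cart\<close>)
 then show ?thesis using True by simp
qed (simp add: box_bump_zero)

subsection \<open>Test functions\<close>

lemma test_smooth: "tf Om fi ==> smooth fi" by (simp add: test_function_def smooth_def)

lemma test_compact: "tf Om fi ==> compact (closure {x. fi x ~= 0})"
 and test_support: "tf Om fi ==> closure {x. fi x ~= 0} <= Om" by (simp_all add: test_function_def)

lemma test_functionI:
 assumes "smooth fi" "compact K" "K <= Om" "!!x. x \<notin> K ==> fi x = 0"
 shows "tf Om fi"
proof -
 have "{x. fi x ~= 0} <= K" using assms(4) by blast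
 then have sub: "closure {x. fi x ~= 0} <= K" using assms(2) by (simp add: closure_minimal compact_imp_closed)
 then have "compact (closure {x. fi x ~= 0})" using assms(2) by (metis closed_closure compact_Int_closed inf.absorb_iff2)
 with sub assms show ?thesis unfolding test_function_def smooth_def by blast
qed

lemma test_eq_0: "tf Om fi ==> x \<notin> Om ==> fi x = 0" using test_support[of Om fi] closure_subset[of "{x. fi x ~= 0}"] by blast

lemma test_mono: "tf A fi ==> A <= B ==> tf B fi" unfolding test_function_def by blast

lemma test_zero: "tf Om (%x. 0)" by (rule test_functionI[where K="{}"]) auto

lemma test_add:
 assumes "tf Om f" "tf Om g"
 shows "tf Om (%x. f x+g x)"
proof (rule test_functionI)
 let ?K = "closure {x. f x ~= 0} \<union> closure {x. g x ~= 0}"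
 show "compact ?K" "?K <= Om" using assms by (auto simp: test_function_def)
 show "f x+g x = 0" if "x \<notin> ?K" for x
 proof -
  have "f x = 0" "g x = 0" using that closure_subset[of "{x. f x ~= 0}"] closure_subset[of "{x. g x ~= 0}"] by blast+
  then show ?thesis by simp
 qed
qed (intro smooth_add test_smooth[OF assms(1)] test_smooth[OF assms(2)])

lemma test_of_zero:
 assumes "tf Om fi" "smooth g" "!!x. fi x = 0 ==> g x = 0"
 shows "tf Om g"
proof (rule test_functionI[OF assms(2) test_compact[OF assms(1)] test_support[OF assms(1)]])
 fix x assume "x \<notin> closure {x. fi x ~= 0}"
 then have "x \<notin> {x. fi x ~= 0}" by (meson closure_subset in_mono)
 then show "g x = 0" using assms(3) by simp
qed

lemma test_scaleR: "tf Om f ==> smooth g ==> tf Om (%x. f x *. g x)" by (rule test_of_zero[of Om f]) (auto intro: smooth_scaleR test_smooth)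

lemma test_scaleR2: "smooth f ==> tf Om g ==> tf Om (%x. f x *. g x)" by (rule test_of_zero[of Om g]) (auto intro: smooth_scaleR test_smooth)

lemma test_mult: "tf Om f ==> smooth g ==> tf Om (%x. f x * g x :: real)" using test_scaleR[of Om f g] by simp

lemma test_sum: "(!!i. i \<in> I ==> tf Om (f i)) ==> tf Om (%x. \<Sum>i\<in>I. f i x)" by (induction I rule: infinite_finite_induct) (auto intro: test_add test_zero)

lemma test_bounded_linear:
 "bounded_linear L ==> tf Om f ==> tf Om (%x. L (f x))" by (rule test_of_zero[of Om f]) (auto intro: smooth_bounded_linear test_smooth simp: bounded_linear.linear linear_0)

lemma partials_zero_nbhd:
 assumes "open U" "x \<in> U" "!!y. y \<in> U ==> fi y = 0"
 shows "pd [i] fi x = 0"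
proof -
 have "(fi has_derivative (%h. 0)) (at x)" by (rule has_derivative_transform_within_open[of "%x. 0" _ x UNIV U]) (use assms in auto)
 from partials_eqI[OF this] show ?thesis .
qed

lemma test_partials: "tf Om fi ==> tf Om (pd [i] fi)"
proof (rule test_functionI[OF smooth_partials[OF test_smooth] test_compact test_support])
 fix x assume "x \<notin> closure {x. fi x ~= 0}"
 then show "pd [i] fi x = 0" by (intro partials_zero_nbhd[of "- closure {x. fi x ~= 0}"]) (auto intro: ccontr subsetD[OF closure_subset])
qed

lemma test_box_bump:
 assumes "cbox a b <= Om" "m > 0"
 shows "tf Om (box_bump a b m)" by (rule test_functionI[OF smooth_box_bump compact_cbox assms(1)])
  (metis assms(2) box_bump_zero box_subset_cbox in_mono)

lemma test_bounded:
 assumes "tf Om fi"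
 obtains B where "B > 0" "!!x. norm (fi x) <= B"
proof -
 have "compact (fi ` closure {x. fi x ~= 0})" by (intro compact_continuous_image smooth_continuous test_smooth[OF assms] test_compact[OF assms])
 then obtain B where B: "B > 0" "!!y. y \<in> fi ` closure {x. fi x ~= 0} ==> norm y <= B" using bounded_pos compact_imp_bounded by metis
 have "norm (fi x) <= B" for x
 proof (cases "fi x = 0")
  case False
  then show ?thesis using B(2) closure_subset[of "{x. fi x ~= 0}"] by blast
 qed (use B in simp)
 with B(1) show thesis using that by blast
qed

section \<open>Measurability and integrability of test functions\<close>

lemma borel_measurable_lebesgue_on_continuous:
 fixes f :: "'a::euclidean_space => 'b::euclidean_space"
 assumes "continuous_on UNIV f"
 shows "f \<in> bm (lon S)"
proof -
 have "f \<in> bm lebesgue" using borel_measurable_continuous_onI[OF assms] by (simp add: measurable_completion)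
 then show ?thesis by (simp add: measurable_restrict_space1)
qed

lemma smooth_measurable:
 fixes f :: "real^'d::finite => 'b::euclidean_space"
 shows "smooth f ==> f \<in> bm (lon S)" by (intro borel_measurable_lebesgue_on_continuous smooth_continuous)

lemma test_has_compact_box:
 assumes "tf Om fi"
 obtains a b where "!!x. x \<notin> cbox a b ==> fi x = 0"
proof -
 obtain a where "closure {x. fi x ~= 0} <= cbox (-a) a" using bounded_subset_cbox_symmetric[OF compact_imp_bounded[OF test_compact[OF assms]]] by blast
 then show thesis using that[of "-a" a] closure_subset[of "{x. fi x ~= 0}"] by blast
qed

lemma bounded_support_integrable:
 fixes f :: "'a::euclidean_space => 'b::euclidean_space"
 assumes f: "f \<in> bm (lon S)" and S: "S \<in> sets lebesgue"
  and le: "!!x. norm (f x) <= B" and z: "!!x. x \<notin> cbox a b ==> f x = 0"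
 shows "integrable (lon S) f"
proof -
 have "integrable (lon S) (%x. B * ind (cbox a b) x)"
 proof (subst integrable_restrict_space)
  show "integrable lebesgue (%x. ind S x *. (B * ind (cbox a b) x))"
  proof (rule Bochner_Integration.integrable_bound)
  show "integrable lebesgue (%x. B * ind (cbox a b) x :: real)" by (intro integrable_mult_right integrable_real_indicator) (auto simp: less_top[symmetric] emeasure_lborel_cbox_eq)
  show "(%x. ind S x *. (B * ind (cbox a b) x) :: real) \<in> bm lebesgue" by (intro borel_measurable_scaleR borel_measurable_times borel_measurable_const borel_measurable_indicator S) simp
  qed (auto simp: indicator_def)
 qed (use S in simp)
 then show ?thesis
 proof (rule Bochner_Integration.integrable_bound)
  show "AE x in lon S. norm (f x) <= norm (B * ind (cbox a b) x)"
  proof (rule AE_I2)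
  fix x
  show "norm (f x) <= norm (B * ind (cbox a b) x)" using le[of x] z[of x] by (cases "x \<in> cbox a b") auto
  qed
 qed (rule f)
qed

lemma test_integrable:
 fixes fi :: "real^'d::finite => 'b::euclidean_space"
 assumes "tf Om fi" "S \<in> sets lebesgue"
 shows "integrable (lon S) fi"
proof -
 obtain B where "!!x. norm (fi x) <= B" using test_bounded[OF assms(1)] by blast
 moreover obtain a b where "!!x. x \<notin> cbox a b ==> fi x = 0" using test_has_compact_box[OF assms(1)] by blast
 ultimately show ?thesis by (intro bounded_support_integrable smooth_measurable test_smooth[OF assms(1)] assms(2))
qed

lemma test_in_L2:
 fixes fi :: "real^'d::finite => 'b::euclidean_space"
 assumes "tf Om fi" "S \<in> sets lebesgue"
 shows "in_Lp S 2 fi"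
proof -
 obtain B where B: "!!x. norm (fi x) <= B" using test_bounded[OF assms(1)] by blast
 moreover obtain a b where "!!x. x \<notin> cbox a b ==> fi x = 0" using test_has_compact_box[OF assms(1)] by blast
 moreover have "(%x. (norm (fi x))\<^sup>2) \<in> bm (lon S)" using smooth_measurable[OF test_smooth[OF assms(1)], where S=S] by simp
 ultimately have "integrable (lon S) (%x. (norm (fi x))\<^sup>2)" by (intro bounded_support_integrable[where B="B\<^sup>2" and a=a and b=b] assms(2)) (auto simp: power_mono)
 then show ?thesis using smooth_measurable[OF test_smooth[OF assms(1)]] by (simp add: in_L2_iff)
qed

lemma test_in_Linf:
 fixes fi :: "real^'d::finite => 'b::euclidean_space"
 assumes "tf Om fi"
 shows "in_Lp S \<infinity> fi" using test_bounded[OF assms] smooth_measurable[OF test_smooth[OF assms]] by (metis AE_I2 in_Linf_iff)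

section \<open>Integration by parts for test functions\<close>

lemma integral_lebesgue_on_support:
 fixes f :: "'a::euclidean_space => 'b::euclidean_space"
 assumes "S \<in> sets lebesgue" "!!x. x \<notin> S ==> f x = 0"
 shows "(LINT x|lon S. f x) = (LINT x|lebesgue. f x)"
proof -
 have "(LINT x|lon S. f x) = (LINT x|lebesgue. ind S x *. f x)" by (rule integral_restrict_space) (use assms in simp)
 also have "(%x. ind S x *. f x) = f" using assms(2) by (auto simp: indicator_def)
 finally show ?thesis .
qed

lemma lebesgue_integral_translate:
 fixes f :: "'a::euclidean_space => 'b::euclidean_space"
 assumes "f \<in> bm borel"
 shows "(LINT x|lebesgue. f (y+x)) = (LINT x|lebesgue. f x)"
proof -
 have m: "(%x. f (y+x)) \<in> bm borel" using assms by measurable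
 have "(LINT x|lebesgue. f x) = (LINT x|lborel. f x)" by (rule integral_completion) (use assms in simp)
 also have "... = (LINT x|distr lborel borel ((+) y). f x)" by (simp add: lborel_distr_plus)
 also have "... = (LINT x|lborel. f (y+x))" by (rule integral_distr) (use assms in simp_all)
 also have "... = (LINT x|lebesgue. f (y+x))" by (rule integral_completion[symmetric]) (use m in simp)
 finally show ?thesis by simp
qed

text \<open>Prepares dominated convergence: for steps up to 1 the quotients share a Lipschitz bound
  and a bounding box, and they converge pointwise to the directional derivative along
  \<open>y\<close>.\<close>

lemma test_difference_quotient:
 fixes fi :: "real^'d::finite => real" and y :: "real^'d"
 assumes "tf Om fi"
 obtains L a b where "!!x t. 0 < t ==> t <= 1 ==> \<bar>(fi (t *. y+x)-fi x)/t\<bar> <= L"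
  and "!!x t. 0 < t ==> t <= 1 ==> x \<notin> cbox a b ==> (fi (t *. y+x)-fi x)/t = 0"
  and "!!x. (%n. (fi (inverse (real (Suc n)) *. y+x)-fi x)/inverse (real (Suc n)))
  \<longlonglongrightarrow> (\<Sum>i\<in>UNIV. y $ i * pd [i] fi x)"
proof -
 note sm = test_smooth[OF assms]
 define D where "D x = (\<Sum>i\<in>UNIV. y $ i * pd [i] fi x)" for x
 have D: "frechet_derivative fi (at x) y = D x" for x
 proof -
  interpret bounded_linear "frechet_derivative fi (at x)" by (rule has_derivative_bounded_linear[OF smooth_has_derivative[OF sm]])
  have "y = (\<Sum>i\<in>UNIV. y $ i *. axis i 1)" using basis_expansion[of y] by (simp add: scalar_mult_eq_scaleR)
  then have "frechet_derivative fi (at x) y = frechet_derivative fi (at x) (\<Sum>i\<in>UNIV. y $ i *. axis i 1)" by simp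
  also have "... = D x" by (simp add: sum scaleR D_def)
  finally show ?thesis .
 qed
 have line: "((%t. fi (t *. y+x)) has_real_derivative D (t *. y+x)) (at t)" for x t
 proof -
  have "((%t. t *. y+x) has_derivative (%s. s *. y)) (at t)" by (auto intro!: derivative_eq_intros)
  from has_derivative_compose[OF this smooth_has_derivative[OF sm]]
  have "((%t. fi (t *. y+x)) has_derivative (%s. s * D (t *. y+x))) (at t)" using linear_scale[OF has_derivative_linear[OF smooth_has_derivative[OF sm]]] D by simp
  moreover have "(%s. s * D (t *. y+x)) = (*) (D (t *. y+x))" by (rule ext) (rule mult.commute)
  ultimately show ?thesis unfolding has_field_derivative_def by simp
 qed
 have "tf Om (%x. \<Sum>i\<in>UNIV. y $ i * pd [i] fi x)" using test_scaleR2[OF smooth_const test_partials[OF assms]] by (intro test_sum) (simp del: partials.simps)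
 then have "tf Om D" by (simp add: D_def[abs_def] del: partials.simps)
 then obtain L where L: "!!x. \<bar>D x\<bar> <= L" using test_bounded by (metis real_norm_def)
 obtain R where R: "R > 0" "closure {x. fi x ~= 0} <= ball 0 R" using bounded_subset_ballD[OF compact_imp_bounded[OF test_compact[OF assms]]] by metis
 have zero: "fi x = 0" if "norm x \<ge> R" for x
 proof (rule ccontr)
  assume "fi x ~= 0"
  then have "x \<in> ball 0 R" using R(2) closure_subset[of "{x. fi x ~= 0}"] by blast
  with that show False by simp
 qed
 \<comment> \<open>The margin \<open>norm y\<close> covers the points from which a step
   \<open>t *. y\<close> with \<open>t \<le> 1\<close> still reaches the support.\<close>
 obtain a where a: "cball (0::real^'d) (R+norm y) <= cbox (-a) a" using bounded_subset_cbox_symmetric[OF bounded_cball] by blast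
 show thesis
 proof
  fix x :: "real^'d" and t :: real assume t: "0 < t" "t <= 1"
  obtain z where "0 < z" "z < t" "fi (t *. y+x)-fi (0 *. y+x) = (t-0) * D (z *. y+x)" using MVT2[of 0 t "%t. fi (t *. y+x)" "%t. D (t *. y+x)"] line t by auto
  then show "\<bar>(fi (t *. y+x)-fi x)/t\<bar> <= L" using L t by simp
  assume "x \<notin> cbox (-a) a"
  then have "norm x > R+norm y" using a by (auto simp: subset_eq)
  moreover have "norm x <= norm (t *. y+x)+norm (t *. y)" by (metis add_diff_cancel_left' norm_triangle_ineq4 add.commute)
  moreover have "norm (t *. y) <= norm y" using t by (simp add: mult_left_le_one_le)
  ultimately have "fi x = 0" "fi (t *. y+x) = 0" using norm_ge_zero[of y] by (intro zero, linarith)+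
  then show "(fi (t *. y+x)-fi x)/t = 0" by simp
 next
  fix x
  have "((%h. (fi ((0+h) *. y+x)-fi (0 *. y+x))/h) \<longlongrightarrow> D (0 *. y+x)) (at 0)" using line[of x 0] unfolding DERIV_def .
  then have lim: "((%h. (fi (h *. y+x)-fi x)/h) \<longlongrightarrow> D x) (at 0)" by simp
  have "filterlim (%n. inverse (real (Suc n))) (at 0) sequentially" unfolding filterlim_at by (auto intro: LIMSEQ_inverse_real_of_nat simp del: of_nat_Suc)
  from filterlim_compose[OF lim this]
  show "(%n. (fi (inverse (real (Suc n)) *. y+x)-fi x)/inverse (real (Suc n)))
  \<longlonglongrightarrow> (\<Sum>i\<in>UNIV. y $ i * pd [i] fi x)" unfolding D_def .
 qed
qed

lemma test_borel: 
 fixes fi :: "real^'d::finite => 'b::euclidean_space"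
 shows "tf Om fi ==> fi \<in> bm borel" by (intro borel_measurable_continuous_onI smooth_continuous test_smooth)

text \<open>Difference quotients have integral 0 by translation invariance, and they converge to the
  partial under a common majorant.\<close>

lemma test_integral_partial:
 fixes fi :: "real^'d::finite => real"
 assumes "tf Om fi"
 shows "(LINT x|lebesgue. pd [i] fi x) = 0"
proof -
 define Q where "Q n x = (fi (inverse (real (Suc n)) *. axis i 1+x)-fi x)/inverse (real (Suc n))" for n x
 obtain L a b where L: "!!x t. 0 < t ==> t <= 1 ==> \<bar>(fi (t *. axis i 1+x)-fi x)/t\<bar> <= L"
  and z: "!!x t. 0 < t ==> t <= 1 ==> x \<notin> cbox a b ==> (fi (t *. axis i 1+x)-fi x)/t = 0"
  and lim: "!!x. (%n. Q n x) \<longlonglongrightarrow> (\<Sum>j\<in>UNIV. axis i 1 $ j * pd [j] fi x)" unfolding Q_def using test_difference_quotient[OF assms, of "axis i 1"] by blast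
 have lim: "(%n. Q n x) \<longlonglongrightarrow> pd [i] fi x" for x using lim[of x] by (simp add: axis_def if_distrib[of "%c. c * _"] cong: if_cong del: partials.simps)
 have [measurable]: "fi \<in> bm borel" by (rule test_borel[OF assms])
 have inv: "inverse (real (Suc n)) <= 1" for n by (simp add: inverse_eq_divide)
 have Q0: "(LINT x|lebesgue. Q n x) = 0" for n
 proof -
  have i1: "integrable lebesgue fi" using test_integrable[OF assms, where S=UNIV] by (simp add: lebesgue_on_UNIV_eq)
  have i2: "integrable lebesgue (%x. fi (inverse (real (Suc n)) *. axis i 1+x))"
  proof -
  have "integrable lborel fi" using i1 by (simp add: integrable_completion)
  then have "integrable (distr lborel borel ((+) (inverse (real (Suc n)) *. axis i 1))) fi" by (simp add: lborel_distr_plus)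
  then have "integrable lborel (%x. fi (inverse (real (Suc n)) *. axis i 1+x))" by (subst (asm) integrable_distr_eq) auto
  then show ?thesis by (subst integrable_completion) (simp_all del: of_nat_Suc)
  qed
  show ?thesis unfolding Q_def using lebesgue_integral_translate[of fi "inverse (real (Suc n)) *. axis i 1"] i1 i2 by (simp del: of_nat_Suc)
 qed
 have "(%n. LINT x|lebesgue. Q n x) \<longlonglongrightarrow> (LINT x|lebesgue. pd [i] fi x)"
 proof (rule integral_dominated_convergence[where w="%x. L * ind (cbox a b) x"])
  show "pd [i] fi \<in> bm lebesgue" using smooth_measurable[OF test_smooth[OF test_partials[OF assms]], where S=UNIV] by (simp add: lebesgue_on_UNIV_eq)
  show "Q n \<in> bm lebesgue" for n unfolding Q_def by (rule measurable_completion) measurable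
  show "integrable lebesgue (%x. L * ind (cbox a b) x)" by (intro integrable_mult_right integrable_real_indicator) (auto simp: less_top[symmetric] emeasure_lborel_cbox_eq)
  show "AE x in lebesgue. (%n. Q n x) \<longlonglongrightarrow> pd [i] fi x" using lim by simp
  show "AE x in lebesgue. norm (Q n x) <= L * ind (cbox a b) x" for n
  proof (rule AE_I2)
  fix x show "norm (Q n x) <= L * ind (cbox a b) x" using L[OF _ inv, of n x] z[OF _ inv, of n x] unfolding Q_def by (cases "x \<in> cbox a b") auto
  qed
 qed
 then show ?thesis by (simp add: Q0 LIMSEQ_const_iff)
qed

lemma test_integration_by_parts:
 fixes fi \<psi> :: "real^'d::finite => real"
 assumes fi: "tf Om fi" and \<psi>: "smooth \<psi>" and Om: "open Om"
 shows "(LINT x|lon Om. pd [i] fi x * \<psi> x) = - (LINT x|lon Om. fi x * pd [i] \<psi> x)"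
proof -
 have S: "Om \<in> sets lebesgue" using Om by simp
 note t = test_mult[OF fi \<psi>] and t1 = test_mult[OF test_partials[OF fi] \<psi>, of i]
  and t2 = test_mult[OF fi smooth_partials[OF \<psi>], of "[i]"]
 have "0 = (LINT x|lebesgue. pd [i] (%x. fi x * \<psi> x) x)" using test_integral_partial[OF t] by simp
 also have "... = (LINT x|lon Om. pd [i] (%x. fi x * \<psi> x) x)" by (rule integral_lebesgue_on_support[symmetric, OF S]) (rule test_eq_0[OF test_partials[OF t]])
 also have "... = (LINT x|lon Om. fi x * pd [i] \<psi> x+pd [i] fi x * \<psi> x)" unfolding partials_mult[OF test_smooth[OF fi] \<psi>] ..
 also have "... = (LINT x|lon Om. fi x * pd [i] \<psi> x)+(LINT x|lon Om. pd [i] fi x * \<psi> x)" by (rule Bochner_Integration.integral_add[OF test_integrable[OF t2 S] test_integrable[OF t1 S]])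
 finally show ?thesis by simp
qed

section \<open>Density of test functions\<close>

lemma real_polynomial_function_smooth:
 "real_polynomial_function p ==> smooth p" by (induction rule: real_polynomial_function.induct)
  (auto intro: smooth_linear smooth_add smooth_mult)

lemma AE_lebesgue_on_iff:
 "S \<in> sets lebesgue ==> (AE x in lon S. P x) \<longleftrightarrow> (AE x in lebesgue. x \<in> S --> P x)" by (simp add: AE_restrict_space_iff)

text \<open>The work of mollifiers is done as follows. A measurable function is an almost everywhere
  limit of continuous ones; these are clipped to \<open>[-M, M]\<close>, replaced on the box by
  polynomials (Stone-Weierstrass) and multiplied by a bump. The bound \<open>M + 1\<close> allows
  for the polynomial error, which is below 1.\<close>

lemma bounded_approx_test:
 fixes f :: "real^'d::finite => real"
 assumes f: "f \<in> bm lebesgue" and M: "!!x. \<bar>f x\<bar> <= M" and ab: "cbox a b <= Om"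
 obtains fi :: "nat => real^'d => real" where "!!n. tf Om (fi n)" "!!n x. \<bar>fi n x\<bar> <= M+1"
  "!!n x. x \<notin> cbox a b ==> fi n x = 0"
  "AE x in lebesgue. (%n. fi n x) \<longlonglongrightarrow> ind (box a b) x * f x"
proof -
 have "f measurable_on UNIV" using f by (subst measurable_on_iff_borel_measurable) (simp_all add: lebesgue_on_UNIV_eq)
 then obtain N g where N: "negligible N" and g: "!!n. continuous_on UNIV (g n)"
  and lim: "!!x. x \<notin> N ==> (%n. g n x) \<longlonglongrightarrow> f x" unfolding measurable_on_def by auto
 define c where "c n x = max (-M) (min M (g n x))" for n x
 have M0: "0 <= M" using M[of undefined] by linarith
 have c: "continuous_on UNIV (c n)" for n unfolding c_def by (intro continuous_intros g)
 have "\<exists>p. real_polynomial_function p & (\<forall>x\<in>cbox a b. \<bar>c n x-p x\<bar> < inverse (real (Suc n)))" for n by (rule Stone_Weierstrass_real_polynomial_function[OF compact_cbox continuous_on_subset[OF c], where e="inverse (real (Suc n))"])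
  auto
 then obtain p where p: "!!n. real_polynomial_function (p n)"
  and pc: "!!n x. x \<in> cbox a b ==> \<bar>c n x-p n x\<bar> < inverse (real (Suc n))" by metis
 define fi where "fi n x = box_bump a b (real (Suc n)) x * p n x" for n x
 show thesis
 proof
  show "tf Om (fi n)" for n unfolding fi_def by (intro test_mult test_box_bump ab real_polynomial_function_smooth p) simp
  show z: "fi n x = 0" if "x \<notin> cbox a b" for n x using that box_bump_zero[of "real (Suc n)" x a b] box_subset_cbox[of a b] by (auto simp: fi_def simp del: of_nat_Suc)
  show "\<bar>fi n x\<bar> <= M+1" for n x
  proof (cases "x \<in> cbox a b")
  case True
  have "\<bar>c n x\<bar> <= M" using M0 by (auto simp: c_def)
  moreover have "inverse (real (Suc n)) <= 1" by (simp add: inverse_eq_divide)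
  ultimately have "\<bar>p n x\<bar> <= M+1" using pc[OF True, of n] by linarith
  moreover have "\<bar>box_bump a b (real (Suc n)) x\<bar> <= 1" using box_bump_bounds[of a b "real (Suc n)" x] by simp
  ultimately have "\<bar>box_bump a b (real (Suc n)) x\<bar>*\<bar>p n x\<bar> <= 1*(M+1)" by (intro mult_mono) auto
  then show ?thesis by (simp add: fi_def abs_mult del: of_nat_Suc)
  qed (use z M0 in simp)
  have "(%n. fi n x) \<longlonglongrightarrow> ind (box a b) x * f x" if "x \<notin> N" for x
  proof (cases "x \<in> box a b")
  case True
  then have xc: "x \<in> cbox a b" using box_subset_cbox by blast
  have "(%n. max (-M) (min M (g n x))) \<longlonglongrightarrow> max (-M) (min M (f x))" by (intro tendsto_intros lim that)
  then have "(%n. c n x) \<longlonglongrightarrow> f x" using M[of x] by (simp add: c_def)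
  moreover have "(%n. c n x-p n x) \<longlonglongrightarrow> 0" by (rule Lim_null_comparison[OF _ LIMSEQ_inverse_real_of_nat])
  (use pc[OF xc] in \<open>auto intro!: always_eventually less_imp_le simp del: of_nat_Suc\<close>)
  ultimately have "(%n. c n x-(c n x-p n x)) \<longlonglongrightarrow> f x-0" by (rule tendsto_diff)
  then have "(%n. p n x) \<longlonglongrightarrow> f x" by simp
  then show ?thesis unfolding fi_def by (intro tendsto_mult box_bump_tendsto)
  next
  case False
  then show ?thesis using box_bump_zero[of "real (Suc _)" x a b] by (simp add: fi_def del: of_nat_Suc)
  qed
  moreover have "AE x in lebesgue. x \<notin> N" using N by (simp add: AE_not_in negligible_iff_null_sets)
  ultimately show "AE x in lebesgue. (%n. fi n x) \<longlonglongrightarrow> ind (box a b) x * f x" by (metis (mono_tags, lifting) AE_mp AE_I2)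
 qed
qed

lemma open_countable_boxes:
 fixes Om :: "'a::euclidean_space set"
 assumes "open Om"
 obtains a b :: "nat => 'a" where "!!n. cbox (a n) (b n) <= Om" "Om = (\<Union>n. box (a n) (b n))"
proof -
 let ?F = "{box a b |a b :: 'a. cbox a b <= Om}"
 obtain F' where F': "F' <= ?F" "countable F'" "\<Union>F' = \<Union>?F" by (rule Lindelof[of ?F]) auto
 have U: "\<Union>?F = Om"
 proof
  show "\<Union>?F <= Om" using box_subset_cbox by blast
  show "Om <= \<Union>?F"
  proof
  fix x assume "x \<in> Om"
  with assms obtain a b where "cbox a b <= Om" "x \<in> box a b" using open_contains_cbox by metis
  then show "x \<in> \<Union>?F" by blast
  qed
 qed
 \<comment> \<open>The empty box joins the family so that it is nonempty and
   \<open>from_nat_into\<close> enumerates it; \<open>box 0 (- i)\<close> is such a box.\<close>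
 obtain i :: 'a where i: "i \<in> Basis" using nonempty_Basis by blast
 have "box (0::'a) (- i) = {}" "cbox (0::'a) (- i) = {}" unfolding box_eq_empty using i by (auto intro!: bexI[of _ i])
 then have em: "{} \<in> ?F" by (metis (mono_tags, lifting) CollectI empty_subsetI)
 define G where "G = from_nat_into (insert {} F')"
 have G: "range G = insert {} F'" unfolding G_def by (rule range_from_nat_into) (use F'(2) in auto)
 have "\<exists>a b. G n = box a b & cbox a b <= Om" for n
 proof -
  have "G n \<in> insert {} F'" using G by blast
  then have "G n \<in> ?F" using em F'(1) by blast
  then show ?thesis by blast
 qed
 then obtain a b where ab: "!!n. G n = box (a n) (b n)" "!!n. cbox (a n) (b n) <= Om" by metis
 have "Om = \<Union>(range G)" using G F'(3) U by simp
 with ab show thesis by (intro that[of a b]) auto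
qed

text \<open>On each box test with approximations of the sign of \<open>g\<close>; in the limit the
  integral of \<open>\<bar>g\<bar>\<close> over the box is 0. Countably many boxes exhaust the open
  set.\<close>

lemma fundamental_lemma_real:
 fixes g :: "real^'d::finite => real"
 assumes Om: "open Om" and g: "locally_integrable Om g"
  and z: "!!fi. tf Om fi ==> (LINT x|lon Om. fi x * g x) = 0"
 shows "AE x in lon Om. g x = 0"
proof -
 have S: "Om \<in> sets lebesgue" using Om by simp
 have box: "AE x in lebesgue. x \<in> box a b --> g x = 0" if ab: "cbox a b <= Om" for a b
 proof -
  have gi: "integrable lebesgue (%x. ind (cbox a b) x *. g x)" using g ab by (auto simp: locally_integrable_def set_integrable_def)
  then have gm: "(%x. ind (cbox a b) x *. g x) \<in> bm lebesgue" by simp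
  then have fm: "(%x. sgn (ind (cbox a b) x *. g x)) \<in> bm lebesgue" by measurable
  obtain fi where fi: "!!n. tf Om (fi n)" "!!n x. \<bar>fi n x\<bar> <= 1+1"
  "!!n x. x \<notin> cbox a b ==> fi n x = 0"
  "AE x in lebesgue. (%n. fi n x) \<longlonglongrightarrow> ind (box a b) x * sgn (ind (cbox a b) x *. g x)" by (rule bounded_approx_test[OF fm _ ab, where M=1]) (auto simp: abs_sgn_eq)
  have eq: "fi n x * g x = fi n x * (ind (cbox a b) x *. g x)" for n x using fi(3)[of x n] by (cases "x \<in> cbox a b") auto
  have eq2: "ind (box a b) x * sgn (ind (cbox a b) x *. g x)*(ind (cbox a b) x *. g x)
  = ind (box a b) x * \<bar>ind (cbox a b) x *. g x\<bar>" for x by (simp add: sgn_mult_self_eq abs_sgn[symmetric] mult.assoc) (metis abs_sgn mult.commute)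
  have int: "integrable lebesgue (%x. ind (box a b) x * \<bar>ind (cbox a b) x *. g x\<bar>)"
  proof (rule Bochner_Integration.integrable_bound[OF gi])
  show "(%x. ind (box a b) x * \<bar>ind (cbox a b) x *. g x\<bar>) \<in> bm lebesgue" by (intro borel_measurable_times borel_measurable_indicator borel_measurable_abs gm) simp
  qed (auto simp: indicator_def)
  have "(%n. LINT x|lebesgue. fi n x * g x) \<longlonglongrightarrow> (LINT x|lebesgue. ind (box a b) x * \<bar>ind (cbox a b) x *. g x\<bar>)" unfolding eq
  proof (rule integral_dominated_convergence[where w="%x. 2*\<bar>ind (cbox a b) x *. g x\<bar>"])
  show "(%x. ind (box a b) x * \<bar>ind (cbox a b) x *. g x\<bar>) \<in> bm lebesgue" using int by simp
  show "(%x. fi n x * (ind (cbox a b) x *. g x)) \<in> bm lebesgue" for n using smooth_measurable[OF test_smooth[OF fi(1)], where S=UNIV] gm by (intro borel_measurable_times) (simp_all add: lebesgue_on_UNIV_eq)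
  show "integrable lebesgue (%x. 2*\<bar>ind (cbox a b) x *. g x\<bar>)" using gi by simp
  show "AE x in lebesgue. (%n. fi n x * (ind (cbox a b) x *. g x)) \<longlonglongrightarrow> ind (box a b) x * \<bar>ind (cbox a b) x *. g x\<bar>" using fi(4)
  proof eventually_elim
  case (elim x)
  from tendsto_mult_right[OF elim, of "ind (cbox a b) x *. g x"] show ?case unfolding eq2 .
  qed
  show "AE x in lebesgue. norm (fi n x * (ind (cbox a b) x *. g x)) <= 2*\<bar>ind (cbox a b) x *. g x\<bar>" for n using fi(2)[of n] by (intro AE_I2) (simp add: abs_mult mult_right_mono)
  qed
  moreover have "(LINT x|lebesgue. fi n x * g x) = 0" for n using z[OF fi(1)[of n]] integral_lebesgue_on_support[OF S, of "%x. fi n x * g x"] test_eq_0[OF fi(1)[of n]] by simp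
  ultimately have "(LINT x|lebesgue. ind (box a b) x * \<bar>ind (cbox a b) x *. g x\<bar>) = 0" by (simp add: LIMSEQ_const_iff)
  then have "AE x in lebesgue. ind (box a b) x * \<bar>ind (cbox a b) x *. g x\<bar> = 0" by (subst (asm) integral_nonneg_eq_0_iff_AE[OF int]) auto
  then show ?thesis by eventually_elim (use box_subset_cbox[of a b] in \<open>auto simp: indicator_def split: if_splits\<close>)
 qed
 obtain a b :: "nat => real^'d" where ab: "!!n. cbox (a n) (b n) <= Om" "Om = (\<Union>n. box (a n) (b n))" by (rule open_countable_boxes[OF Om]) blast
 have "AE x in lebesgue. \<forall>n. x \<in> box (a n) (b n) --> g x = 0" unfolding AE_all_countable using box[OF ab(1)] by blast
 then have "AE x in lebesgue. x \<in> Om --> g x = 0" by eventually_elim (use ab(2) in blast)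
 then show ?thesis by (simp add: AE_lebesgue_on_iff[OF S])
qed

lemma locally_integrable_mult_bounded:
 fixes g :: "real^'d::finite => 'b::euclidean_space"
 assumes Om: "open Om" and g: "locally_integrable Om g" and fi: "tf Om fi"
 shows "integrable (lon Om) (%x. fi x *. g x)"
proof -
 have S: "Om \<in> sets lebesgue" using Om by simp
 let ?K = "closure {x. fi x ~= 0}"
 obtain B where B: "!!x. norm (fi x) <= B" using test_bounded[OF fi] by blast
 have i: "integrable lebesgue (%x. ind ?K x *. g x)" using g test_compact[OF fi] test_support[OF fi] by (auto simp: locally_integrable_def set_integrable_def)
 have z: "fi x = 0" if "x \<notin> ?K" for x using that closure_subset[of "{x. fi x ~= 0}"] by blast
 have eq: "ind Om x *. fi x *. g x = fi x *. (ind ?K x *. g x)" for x using test_eq_0[OF fi, of x] z[of x] by (cases "x \<in> Om"; cases "x \<in> ?K") auto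
 have "integrable lebesgue (%x. fi x *. (ind ?K x *. g x))"
 proof (rule Bochner_Integration.integrable_bound)
  show "integrable lebesgue (%x. B *. (ind ?K x *. g x))" by (intro integrable_scaleR_right i)
  show "(%x. fi x *. ind ?K x *. g x) \<in> bm lebesgue" using smooth_measurable[OF test_smooth[OF fi], where S=UNIV, unfolded lebesgue_on_UNIV_eq]
  borel_measurable_integrable[OF i] by (rule borel_measurable_scaleR)
  show "AE x in lebesgue. norm (fi x *. ind ?K x *. g x) <= norm (B *. ind ?K x *. g x)"
  proof (rule AE_I2)
  fix x
  have "\<bar>fi x\<bar> <= \<bar>B\<bar>" using B[of x] by simp
  then show "norm (fi x *. ind ?K x *. g x) <= norm (B *. ind ?K x *. g x)" unfolding norm_scaleR by (intro mult_right_mono) auto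
  qed
 qed
 then have "integrable lebesgue (%x. ind Om x *. fi x *. g x)" unfolding eq .
 moreover have "Om \<inter> space lebesgue \<in> sets lebesgue" using S by simp
 ultimately show ?thesis by (simp only: integrable_restrict_space)
qed

lemma locally_integrable_inner:
 assumes "locally_integrable Om g"
 shows "locally_integrable Om (%x. g x \<bullet> b)" unfolding locally_integrable_def set_integrable_def
proof (intro allI impI)
 fix K assume "compact K & K <= Om"
 then have "integrable lebesgue (%x. (ind K x *. g x) \<bullet> b)" using assms by (intro integrable_inner_left) (auto simp: locally_integrable_def set_integrable_def)
 then show "integrable lebesgue (%x. ind K x *. (g x \<bullet> b))" by simp
qed

lemma locally_integrable_add:
 assumes "locally_integrable Om f" "locally_integrable Om g"
 shows "locally_integrable Om (%x. f x+g x)" using assms unfolding locally_integrable_def by (auto intro: set_integral_add)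

lemma locally_integrable_scaleR:
 assumes "locally_integrable Om f"
 shows "locally_integrable Om (%x. c *. f x)" using assms unfolding locally_integrable_def by (auto intro: set_integrable_scaleR_right)

lemma fundamental_lemma:
 fixes g :: "real^'d::finite => 'b::euclidean_space"
 assumes Om: "open Om" and g: "locally_integrable Om g"
  and z: "!!fi :: real^'d => real. tf Om fi ==> (LINT x|lon Om. fi x *. g x) = 0"
 shows "AE x in lon Om. g x = 0"
proof -
 have "AE x in lon Om. g x \<bullet> b = 0" for b
 proof (rule fundamental_lemma_real[OF Om locally_integrable_inner[OF g]])
  fix fi :: "real^'d => real" assume fi: "tf Om fi"
  have "(LINT x|lon Om. (fi x *. g x) \<bullet> b) = (LINT x|lon Om. fi x *. g x) \<bullet> b" by (rule integral_inner_left) (use locally_integrable_mult_bounded[OF Om g fi] in simp)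
  then show "(LINT x|lon Om. fi x * (g x \<bullet> b)) = 0" using z[OF fi] by simp
 qed
 then have "AE x in lon Om. \<forall>b\<in>Basis. g x \<bullet> b = 0" by (intro AE_finite_allI) auto
 then show ?thesis by eventually_elim (auto intro: euclidean_eqI)
qed

lemma L2_norm_tendsto_0:
 fixes f :: "nat => 'a::euclidean_space => 'b::euclidean_space"
 assumes w: "in_Lp S 2 w" and m: "!!n. f n \<in> bm (lon S)"
  and le: "!!n. AE x in lon S. norm (f n x) <= norm (w x)"
  and lim: "AE x in lon S. (%n. f n x) \<longlonglongrightarrow> 0"
 shows "(%n. nrm S (f n)) \<longlonglongrightarrow> 0"
proof -
 have "(%n. LINT x|lon S. (norm (f n x))\<^sup>2) \<longlonglongrightarrow> (LINT x|lon S. 0)"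
 proof (rule integral_dominated_convergence[where w="%x. (norm (w x))\<^sup>2"])
  show "AE x in lon S. (%n. (norm (f n x))\<^sup>2) \<longlonglongrightarrow> 0" using lim by eventually_elim (metis power_zero_numeral tendsto_norm_zero tendsto_power)
  show "AE x in lon S. norm ((norm (f n x))\<^sup>2) <= (norm (w x))\<^sup>2" for n using le[of n] by eventually_elim (simp add: power_mono)
 qed (use w m in \<open>auto simp: in_L2_iff\<close>)
 then have "(%n. (nrm S (f n))\<^sup>2) \<longlonglongrightarrow> 0" by (simp add: L2_norm_sq)
 then have "(%n. sqrt ((nrm S (f n))\<^sup>2)) \<longlonglongrightarrow> sqrt 0" by (rule tendsto_real_sqrt)
 then show ?thesis by simp
qed

definition test_approximable :: "(real^'d::finite) set => (real^'d => real) => bool" where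
 "test_approximable Om f \<longleftrightarrow> in_Lp Om 2 f &
  (\<forall>ep>0. \<exists>fi. tf Om fi & nrm Om (%x. f x-fi x) < ep)"

lemma test_approximable_add:
 assumes Om: "open Om" and f: "test_approximable Om f" and g: "test_approximable Om g"
 shows "test_approximable Om (%x. f x+g x)" unfolding test_approximable_def
proof (intro conjI allI impI)
 show "in_Lp Om 2 (%x. f x+g x)" using f g by (auto simp: test_approximable_def intro: in_L2_add)
 fix ep :: real assume "ep > 0"
 then have e: "ep/2 > 0" by simp
 obtain fi \<psi> where p: "tf Om fi" "nrm Om (%x. f x-fi x) < ep/2"
  "tf Om \<psi>" "nrm Om (%x. g x-\<psi> x) < ep/2" using f g e unfolding test_approximable_def by meson
 have S: "Om \<in> sets lebesgue" using Om by simp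
 have "nrm Om (%x. (f x-fi x)+(g x-\<psi> x)) <= nrm Om (%x. f x-fi x)+nrm Om (%x. g x-\<psi> x)" using f g p(1,3) by (intro L2_norm_triangle in_L2_diff) (auto simp: test_approximable_def intro: test_in_L2[OF _ S])
 also have "... < ep" using p by linarith
 also have "(%x. (f x-fi x)+(g x-\<psi> x)) = (%x. f x+g x-(fi x+\<psi> x))" by auto
 finally show "\<exists>fi. tf Om fi & nrm Om (%x. f x+g x-fi x) < ep" using test_add[OF p(1,3)] by blast
qed

lemma test_approximable_limit:
 assumes Om: "open Om" and f: "in_Lp Om 2 f" and g: "!!n. test_approximable Om (g n)"
  and lim: "(%n. nrm Om (%x. f x-g n x)) \<longlonglongrightarrow> 0"
 shows "test_approximable Om f" unfolding test_approximable_def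
proof (intro conjI allI impI f)
 fix ep :: real assume "ep > 0"
 then have e: "ep/2 > 0" by simp
 obtain n where n: "nrm Om (%x. f x-g n x) < ep/2" using order_tendstoD(2)[OF lim e] by (auto simp: eventually_sequentially)
 obtain fi where p: "tf Om fi" "nrm Om (%x. g n x-fi x) < ep/2" using g e unfolding test_approximable_def by meson
 have S: "Om \<in> sets lebesgue" using Om by simp
 have "nrm Om (%x. (f x-g n x)+(g n x-fi x)) <= nrm Om (%x. f x-g n x)+nrm Om (%x. g n x-fi x)" using f g p(1) by (intro L2_norm_triangle in_L2_diff) (auto simp: test_approximable_def intro: test_in_L2[OF _ S])
 also have "... < ep" using p n by linarith
 finally show "\<exists>fi. tf Om fi & nrm Om (%x. f x-fi x) < ep" using p by auto
qed

lemma lebesgue_measurable_extend: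
 fixes f :: "'a::euclidean_space => 'b::euclidean_space"
 assumes "f \<in> bm (lon S)" "S \<in> sets lebesgue"
 shows "(%x. ind S x *. f x) \<in> bm lebesgue" using assms by (subst (asm) borel_measurable_restrict_space_iff) auto

lemma test_approximable_box:
 fixes f :: "real^'d::finite => real"
 assumes Om: "open Om" and f: "f \<in> bm (lon Om)" and M: "!!x. \<bar>f x\<bar> <= M"
  and ab: "cbox a b <= Om"
 shows "test_approximable Om (%x. ind (box a b) x * f x)"
proof -
 have S: "Om \<in> sets lebesgue" using Om by simp
 have M0: "0 <= M" using M[of undefined] by linarith
 have fm: "(%x. ind Om x * f x) \<in> bm lebesgue" using lebesgue_measurable_extend[OF f S] by simp
 obtain fi where fi: "!!n. tf Om (fi n)" "!!n x. \<bar>fi n x\<bar> <= M+1"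
  "!!n x. x \<notin> cbox a b ==> fi n x = 0"
  "AE x in lebesgue. (%n. fi n x) \<longlonglongrightarrow> ind (box a b) x * (ind Om x * f x)" by (rule bounded_approx_test[OF fm _ ab, where M=M]) (use M M0 in \<open>auto simp: indicator_def\<close>)
 have wz: "in_Lp Om 2 (%x. (2 * M+1) * ind (cbox a b) x :: real)" unfolding in_L2_iff
 proof
  show m: "(%x. (2 * M+1) * ind (cbox a b) x :: real) \<in> bm (lon Om)" by (intro measurable_restrict_space1 borel_measurable_times borel_measurable_indicator borel_measurable_const) auto
  show "integrable (lon Om) (%x. (norm ((2 * M+1) * ind (cbox a b) x :: real))\<^sup>2)" by (rule bounded_support_integrable[where B="(2 * M+1)\<^sup>2" and a=a and b=b,
  OF borel_measurable_power[OF measurable_compose[OF m borel_measurable_norm]] S])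
  (use M0 in \<open>auto simp: indicator_def power_mult_distrib abs_mult\<close>)
 qed
 have fb: "(%x. ind (box a b) x * f x) \<in> bm (lon Om)" by (intro borel_measurable_times f measurable_restrict_space1 borel_measurable_indicator) auto
 have f2: "in_Lp Om 2 (%x. ind (box a b) x * f x)" by (rule in_L2_dominated[OF fb wz, where c=1])
  (use M M0 box_subset_cbox[of a b] in \<open>auto intro!: AE_I2 simp: indicator_def intro: order_trans[OF M]\<close>)
 show ?thesis
 proof (rule test_approximable_limit[OF Om f2])
  show "test_approximable Om (fi n)" for n unfolding test_approximable_def using fi(1)[of n] test_in_L2[OF fi(1) S] by (auto intro!: exI[of _ "fi n"])
  show "(%n. nrm Om (%x. ind (box a b) x * f x-fi n x)) \<longlonglongrightarrow> 0"
  proof (rule L2_norm_tendsto_0[OF wz])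
  show "(%x. ind (box a b) x * f x-fi n x) \<in> bm (lon Om)" for n by (intro borel_measurable_diff fb smooth_measurable[OF test_smooth[OF fi(1)]])
  show "AE x in lon Om. norm (ind (box a b) x * f x-fi n x) <= norm ((2 * M+1) * ind (cbox a b) x :: real)" for n
  proof (rule AE_I2)
  fix x
  show "norm (ind (box a b) x * f x-fi n x) <= norm ((2 * M+1) * ind (cbox a b) x :: real)"
  proof (cases "x \<in> cbox a b")
  case True
  have "\<bar>ind (box a b) x * f x\<bar> <= M" using M[of x] M0 by (auto simp: indicator_def)
  then show ?thesis using fi(2)[of n x] True M0 by simp
  next
  case False
  then show ?thesis using fi(3)[OF False] box_subset_cbox[of a b] by (auto simp: indicator_def)
  qed
  qed
  show "AE x in lon Om. (%n. ind (box a b) x * f x-fi n x) \<longlonglongrightarrow> 0" unfolding AE_lebesgue_on_iff[OF S] using fi(4)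
  proof eventually_elim
  case (elim x)
  show ?case
  proof
  assume "x \<in> Om"
  then have "(%n. ind (box a b) x * f x-fi n x) \<longlonglongrightarrow> ind (box a b) x * f x-ind (box a b) x * f x" using elim by (intro tendsto_diff tendsto_const) simp
  then show "(%n. ind (box a b) x * f x-fi n x) \<longlonglongrightarrow> 0" by simp
  qed
  qed
  qed
 qed
qed

text \<open>\<open>f\<close> is cut off in size and to finitely many boxes, both growing with
  \<open>n\<close>. A finite union of boxes is reached by induction: the new box carries the
  function multiplied by the indicator of the complement of the earlier boxes, which is again
  bounded and measurable.\<close>

theorem test_functions_dense:
 fixes f :: "real^'d::finite => real"
 assumes Om: "open Om" and f: "in_Lp Om 2 f"
 shows "test_approximable Om f"
proof -
 have S: "Om \<in> sets lebesgue" using Om by simp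
 have fm: "f \<in> bm (lon Om)" using f by (simp add: in_L2_iff)
 obtain a b :: "nat => real^'d" where ab: "!!n. cbox (a n) (b n) <= Om" "Om = (\<Union>n. box (a n) (b n))" by (rule open_countable_boxes[OF Om]) blast
 define U where "U j = (\<Union>i<j. box (a i) (b i))" for j :: nat
 have Um: "U j \<in> sets lebesgue" for j unfolding U_def by auto
 define c where "c m x = (if \<bar>f x\<bar> <= real m then f x else 0)" for m x
 have cm: "c m \<in> bm (lon Om)" for m unfolding c_def using fm by measurable
 have step: "test_approximable Om (%x. ind (U j) x * c m x)" for j m
 proof (induction j)
  case 0
  then show ?case by (auto simp: U_def test_approximable_def intro!: exI[of _ "%x. 0"] test_zero)
 next
  case (Suc j)
  have g: "(%x. ind (- U j) x * c m x) \<in> bm (lon Om)" by (intro borel_measurable_times cm measurable_restrict_space1 borel_measurable_indicator)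
  (use sets.compl_sets[OF Um[of j]] in \<open>simp add: Compl_eq_Diff_UNIV\<close>)
  have "test_approximable Om (%x. ind (box (a j) (b j)) x * (ind (- U j) x * c m x))" by (rule test_approximable_box[OF Om g _ ab(1), where M="real m"]) (auto simp: c_def indicator_def)
  from test_approximable_add[OF Om Suc this]
  have "test_approximable Om (%x. ind (U j) x * c m x+ind (box (a j) (b j)) x * (ind (- U j) x * c m x))" .
  also have "(%x. ind (U j) x * c m x+ind (box (a j) (b j)) x * (ind (- U j) x * c m x))
  = (%x. ind (U (Suc j)) x * c m x)" by (rule ext) (auto simp: U_def indicator_def lessThan_Suc)
  finally show ?case .
 qed
 show ?thesis
 proof (rule test_approximable_limit[OF Om f, where g="%n x. ind (U n) x * c n x"])
  show "test_approximable Om (%x. ind (U n) x * c n x)" for n by (rule step)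
  show "(%n. nrm Om (%x. f x-ind (U n) x * c n x)) \<longlonglongrightarrow> 0"
  proof (rule L2_norm_tendsto_0[OF f])
  show "(%x. f x-ind (U n) x * c n x) \<in> bm (lon Om)" for n by (intro borel_measurable_diff borel_measurable_times cm fm measurable_restrict_space1 borel_measurable_indicator) (use Um in auto)
  show "AE x in lon Om. norm (f x-ind (U n) x * c n x) <= norm (f x)" for n by (rule AE_I2) (auto simp: c_def indicator_def)
  show "AE x in lon Om. (%n. f x-ind (U n) x * c n x) \<longlonglongrightarrow> 0"
  proof (rule AE_I2)
  fix x assume "x \<in> space (lon Om)"
  then have "x \<in> Om" by (simp add: space_restrict_space)
  then obtain i where i: "x \<in> box (a i) (b i)" using ab(2) by blast
  obtain m where m: "\<bar>f x\<bar> <= real m" using real_arch_simple by blast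
  have "f x-ind (U n) x * c n x = 0" if "n \<ge> Suc (max i m)" for n
  proof -
  have "x \<in> U n" using i that by (auto simp: U_def intro!: bexI[of _ i])
  moreover have "\<bar>f x\<bar> <= real n" using m that by linarith
  ultimately show ?thesis by (simp add: c_def)
  qed
  then have "eventually (%n. f x-ind (U n) x * c n x = 0) sequentially" unfolding eventually_sequentially by blast
  then show "(%n. f x-ind (U n) x * c n x) \<longlonglongrightarrow> 0" by (rule tendsto_eventually)
  qed
  qed
 qed
qed

section \<open>Norm bounds by duality with test functions\<close>

lemma test_functions_dense_seq:
 fixes f :: "real^'d::finite => real"
 assumes Om: "open Om" and f: "in_Lp Om 2 f"
 obtains fi :: "nat => real^'d => real" where "!!n. tf Om (fi n)" "(%n. nrm Om (%x. f x-fi n x)) \<longlonglongrightarrow> 0"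
proof -
 have "\<exists>fi. tf Om fi & nrm Om (%x. f x-fi x) < inverse (real (Suc n))" for n using test_functions_dense[OF assms] unfolding test_approximable_def by (simp del: of_nat_Suc)
 then obtain fi where fi: "!!n. tf Om (fi n)" "!!n. nrm Om (%x. f x-fi n x) < inverse (real (Suc n))" by metis
 have "(%n. nrm Om (%x. f x-fi n x)) \<longlonglongrightarrow> 0" by (rule Lim_null_comparison[OF _ LIMSEQ_inverse_real_of_nat])
  (use fi(2) in \<open>auto intro!: always_eventually less_imp_le simp del: of_nat_Suc\<close>)
 with fi(1) show thesis using that by blast
qed

text \<open>Testing with approximations of \<open>g\<close> bounds the square of its norm by
  \<open>B\<close> times the norm. Division leaves the case of norm 0 apart, since the sign of
  \<open>B\<close> is open.\<close>

lemma L2_norm_dual_test: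
 fixes g :: "real^'d::finite => real"
 assumes Om: "open Om" and g: "in_Lp Om 2 g"
  and le: "!!fi. tf Om fi ==> \<bar>ip Om g fi\<bar> <= B * nrm Om fi"
 shows "nrm Om g <= B \<or> nrm Om g = 0"
proof -
 have S: "Om \<in> sets lebesgue" using Om by simp
 obtain fi :: "nat => real^'d => real" where fi: "!!n. tf Om (fi n)" "(%n. nrm Om (%x. g x-fi n x)) \<longlonglongrightarrow> 0" by (rule test_functions_dense_seq[OF Om g]) blast
 note pL = test_in_L2[OF fi(1) S]
 have bnd: "(nrm Om g)\<^sup>2 <= nrm Om (%x. g x-fi n x) * nrm Om g+(B * nrm Om g+\<bar>B\<bar> * nrm Om (%x. g x-fi n x))" for n
 proof -
  have "(nrm Om g)\<^sup>2 = ip Om g (%x. (g x-fi n x)+fi n x)" by (simp add: L2_norm_sq_inner)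
  also have "... = ip Om g (%x. g x-fi n x)+ip Om g (fi n)" by (rule L2_inner_add_right[OF in_L2_diff[OF g pL] pL g])
  also have "ip Om g (%x. g x-fi n x) <= nrm Om (%x. g x-fi n x) * nrm Om g" using L2_Cauchy_Schwarz[OF g in_L2_diff[OF g pL], of n] by (simp add: mult.commute)
  also have "ip Om g (fi n) <= B * nrm Om (fi n)" using le[OF fi(1)[of n]] by simp
  also have "... <= B * nrm Om g+\<bar>B\<bar> * nrm Om (%x. g x-fi n x)"
  proof -
  have "nrm Om (fi n) <= nrm Om g+nrm Om (%x. g x-fi n x)" using L2_norm_triangle_diff[OF g in_L2_diff[OF g pL], of n] by simp
  moreover have "nrm Om g <= nrm Om (fi n)+nrm Om (%x. g x-fi n x)" using L2_norm_triangle[OF pL in_L2_diff[OF g pL], of n n] by simp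
  ultimately have "\<bar>nrm Om (fi n)-nrm Om g\<bar> <= nrm Om (%x. g x-fi n x)" by linarith
  then have "\<bar>B\<bar>*\<bar>nrm Om (fi n)-nrm Om g\<bar> <= \<bar>B\<bar> * nrm Om (%x. g x-fi n x)" by (intro mult_left_mono) auto
  moreover have "B * (nrm Om (fi n)-nrm Om g) <= \<bar>B\<bar>*\<bar>nrm Om (fi n)-nrm Om g\<bar>" by (metis abs_ge_self abs_mult)
  ultimately show ?thesis by (simp add: algebra_simps)
  qed
  finally show ?thesis by simp
 qed
 have "(%n. nrm Om (%x. g x-fi n x) * nrm Om g+(B * nrm Om g+\<bar>B\<bar> * nrm Om (%x. g x-fi n x)))
  \<longlonglongrightarrow> 0 * nrm Om g+(B * nrm Om g+\<bar>B\<bar>*0)" by (intro tendsto_intros fi(2))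
 then have "(nrm Om g)\<^sup>2 <= 0 * nrm Om g+(B * nrm Om g+\<bar>B\<bar>*0)" by (rule LIMSEQ_le_const) (use bnd in blast)
 then have "nrm Om g * nrm Om g <= B * nrm Om g" by (simp add: power2_eq_square)
 then show ?thesis using L2_norm_nonneg[of Om g] by (metis less_eq_real_def mult_right_le_imp_le)
qed

lemma L1_le_L2:
 fixes g :: "'a::euclidean_space => real"
 assumes S: "S \<in> lmeasurable" and g: "in_Lp S 2 g"
 shows "integrable (lon S) g" "(LINT x|lon S. \<bar>g x\<bar>) <= sqrt (measure lebesgue S) * nrm S g"
proof -
 have fin: "finite_measure (lon S)" using S by (rule finite_measure_lebesgue_on)
 have c1: "in_Lp S \<infinity> (%x. 1 :: real)" by (auto simp: in_Linf_iff)
 then have c2: "in_Lp S 2 (%x. 1 :: real)" using in_Linf_imp_L2 S by blast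
 have ga: "in_Lp S 2 (%x. \<bar>g x\<bar>)" using g by (auto simp: in_L2_iff)
 show "integrable (lon S) g" using integrable_inner_L2[OF g c2] by simp
 have "(LINT x|lon S. \<bar>g x\<bar>) = ip S (%x. 1) (%x. \<bar>g x\<bar>)" by (simp add: L2_inner_def)
 also have "... <= nrm S (%x. 1 :: real) * nrm S (%x. \<bar>g x\<bar>)" using L2_Cauchy_Schwarz[OF c2 ga] by simp
 also have "nrm S (%x. \<bar>g x\<bar>) = nrm S g" by (simp add: L2_norm_def L2_inner_def)
 also have "nrm S (%x. 1 :: real) = sqrt (measure lebesgue S)" using S by (simp add: L2_norm_def L2_inner_def measure_restrict_space space_restrict_space fmeasurableD)
 finally show "(LINT x|lon S. \<bar>g x\<bar>) <= sqrt (measure lebesgue S) * nrm S g" .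
qed

text \<open>The test functions approximate the sign \<open>s\<close> of \<open>g\<close> on the set
  where \<open>\<bar>g\<bar>\<close> exceeds \<open>B\<close>. In the limit the nonnegative function
  \<open>g s - B \<bar>s\<bar>\<close> has integral at most 0, so that set is null.\<close>

lemma Linf_dual_test:
 fixes g :: "real^'d::finite => real"
 assumes Om: "open Om" "Om \<in> lmeasurable" and g: "in_Lp Om 2 g" and B: "0 <= B"
  and le: "!!fi. tf Om fi ==> \<bar>ip Om g fi\<bar> <= B * (LINT x|lon Om. \<bar>fi x\<bar>)"
 shows "AE x in lon Om. \<bar>g x\<bar> <= B"
proof -
 have S: "Om \<in> sets lebesgue" using Om by simp
 have gm [measurable]: "g \<in> bm (lon Om)" using g by (simp add: in_L2_iff)
 define s where "s x = (if \<bar>g x\<bar> > B then sgn (g x) else 0)" for x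
 have sm: "s \<in> bm (lon Om)" unfolding s_def by measurable
 have "in_Lp Om \<infinity> s" using sm by (auto simp: in_Linf_iff s_def abs_sgn_eq intro!: exI[of _ 1])
 then have s2: "in_Lp Om 2 s" using in_Linf_imp_L2 Om by blast
 obtain fi :: "nat => real^'d => real" where fi: "!!n. tf Om (fi n)" "(%n. nrm Om (%x. s x-fi n x)) \<longlonglongrightarrow> 0" by (rule test_functions_dense_seq[OF Om(1) s2]) blast
 note pL = test_in_L2[OF fi(1) S]
 have sa: "in_Lp Om 2 (%x. \<bar>s x\<bar>)" using s2 by (auto simp: in_L2_iff)
 let ?m = "sqrt (measure lebesgue Om)"
 have bnd: "ip Om g s <= B * (LINT x|lon Om. \<bar>s x\<bar>)+(B * ?m+nrm Om g) * nrm Om (%x. s x-fi n x)" for n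
 proof -
  have "(LINT x|lon Om. \<bar>fi n x\<bar>) <= (LINT x|lon Om. \<bar>s x\<bar>+\<bar>s x-fi n x\<bar>)" using L1_le_L2(1)[OF Om(2) s2] L1_le_L2(1)[OF Om(2) pL[of n]] by (intro integral_mono) (auto intro!: integrable_abs Bochner_Integration.integrable_add Bochner_Integration.integrable_diff)
  also have "... = (LINT x|lon Om. \<bar>s x\<bar>)+(LINT x|lon Om. \<bar>s x-fi n x\<bar>)" using L1_le_L2(1)[OF Om(2) s2] L1_le_L2(1)[OF Om(2) pL[of n]] by (intro Bochner_Integration.integral_add) (auto intro!: integrable_abs Bochner_Integration.integrable_diff)
  also have "(LINT x|lon Om. \<bar>s x-fi n x\<bar>) <= ?m * nrm Om (%x. s x-fi n x)" by (rule L1_le_L2(2)[OF Om(2) in_L2_diff[OF s2 pL]])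
  finally have le1: "(LINT x|lon Om. \<bar>fi n x\<bar>) <= (LINT x|lon Om. \<bar>s x\<bar>) + ?m * nrm Om (%x. s x-fi n x)" by simp
  have "ip Om g s = ip Om g (%x. (s x-fi n x)+fi n x)" by simp
  also have "... = ip Om g (%x. s x-fi n x)+ip Om g (fi n)" by (rule L2_inner_add_right[OF in_L2_diff[OF s2 pL] pL g])
  also have "ip Om g (%x. s x-fi n x) <= nrm Om g * nrm Om (%x. s x-fi n x)" using L2_Cauchy_Schwarz[OF g in_L2_diff[OF s2 pL], of n] by simp
  also have "ip Om g (fi n) <= B * (LINT x|lon Om. \<bar>fi n x\<bar>)" using le[OF fi(1)[of n]] by simp
  finally show ?thesis using mult_left_mono[OF le1 B] by (simp add: algebra_simps)
 qed
 have "(%n. B * (LINT x|lon Om. \<bar>s x\<bar>)+(B * ?m+nrm Om g) * nrm Om (%x. s x-fi n x))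
  \<longlonglongrightarrow> B * (LINT x|lon Om. \<bar>s x\<bar>)+(B * ?m+nrm Om g)*0" by (intro tendsto_intros fi(2))
 then have "ip Om g s <= B * (LINT x|lon Om. \<bar>s x\<bar>)+(B * ?m+nrm Om g)*0" by (rule LIMSEQ_le_const) (use bnd in blast)
 then have le0: "(LINT x|lon Om. g x * s x)-(LINT x|lon Om. B * \<bar>s x\<bar>) <= 0" by (simp add: L2_inner_def)
 have i1: "integrable (lon Om) (%x. g x * s x)" using integrable_inner_L2[OF g s2] by simp
 have i2: "integrable (lon Om) (%x. B * \<bar>s x\<bar>)" using L1_le_L2(1)[OF Om(2) s2] by simp
 have pos: "0 <= g x * s x-B * \<bar>s x\<bar>" for x by (auto simp: s_def abs_sgn_eq sgn_if)
 have "0 <= (LINT x|lon Om. g x * s x-B * \<bar>s x\<bar>)" by (rule Bochner_Integration.integral_nonneg) (rule pos)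
 then have "(LINT x|lon Om. g x * s x-B * \<bar>s x\<bar>) = 0" using le0 Bochner_Integration.integral_diff[OF i1 i2] by simp
 then have "AE x in lon Om. g x * s x-B * \<bar>s x\<bar> = 0" by (subst (asm) integral_nonneg_eq_0_iff_AE) (use i1 i2 pos in auto)
 then show ?thesis by eventually_elim (use B in \<open>auto simp: s_def sgn_if split: if_splits\<close>)
qed

section \<open>Weak derivatives\<close>

lemma test_partials_list: "tf Om fi ==> tf Om (pd is fi)"
proof (induction "is")
 case (Cons i "is")
 from test_partials[OF Cons(1)[OF Cons(2)], of i] show ?case by simp
qed simp

text \<open>\<open>f\<close> is the pointwise limit of its restrictions to finite unions of compact
  boxes, on which it is integrable.\<close>

lemma locally_integrable_measurable:
 fixes f :: "real^'d::finite => 'b::euclidean_space"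
 assumes Om: "open Om" and f: "locally_integrable Om f"
 shows "f \<in> bm (lon Om)"
proof -
 obtain a b :: "nat => real^'d" where ab: "!!n. cbox (a n) (b n) <= Om" "Om = (\<Union>n. box (a n) (b n))" by (rule open_countable_boxes[OF Om]) blast
 have "(%x. ind Om x *. f x) \<in> bm lebesgue"
 proof (rule borel_measurable_LIMSEQ_metric)
  fix n
  let ?K = "\<Union>i<n. cbox (a i) (b i)"
  have "compact ?K" "?K <= Om" using ab(1) by (auto intro!: compact_UN)
  then have "set_integrable lebesgue ?K f" using f unfolding locally_integrable_def by blast
  then show "(%x. ind ?K x *. f x) \<in> bm lebesgue" unfolding set_integrable_def by (rule borel_measurable_integrable)
 next
  fix x
  show "(%n. ind (\<Union>i<n. cbox (a i) (b i)) x *. f x) \<longlonglongrightarrow> ind Om x *. f x"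
  proof (cases "x \<in> Om")
  case True
  then obtain i where "x \<in> cbox (a i) (b i)" using ab(2) box_subset_cbox by blast
  then have "ind (\<Union>i<n. cbox (a i) (b i)) x *. f x = ind Om x *. f x" if "n \<ge> Suc i" for n using that True by (auto simp: indicator_def intro!: bexI[of _ i])
  then show ?thesis by (intro tendsto_eventually) (auto simp: eventually_sequentially)
  next
  case False
  then have "x \<notin> (\<Union>i<n. cbox (a i) (b i))" for n using ab(1) by blast
  with False show ?thesis by simp
  qed
 qed
 then show ?thesis using Om by (subst borel_measurable_restrict_space_iff) auto
qed

lemma in_L2_locally_integrable:
 fixes f :: "real^'d::finite => 'b::euclidean_space"
 assumes Om: "open Om" and f: "in_Lp Om 2 f"
 shows "locally_integrable Om f" unfolding locally_integrable_def set_integrable_def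
proof (intro allI impI)
 fix K assume K: "compact K & K <= Om"
 have S: "Om \<inter> space lebesgue \<in> sets lebesgue" using Om by simp
 have Km: "K \<in> sets lebesgue" using K by (simp add: compact_imp_closed)
 have Kf: "K \<in> lmeasurable" using K lmeasurable_compact by blast
 have "integrable lebesgue (%x. ind Om x *. (norm (f x))\<^sup>2)" using f S by (simp only: in_L2_iff integrable_restrict_space)
 moreover have "integrable lebesgue (%x. ind K x :: real)" using Kf by (intro integrable_real_indicator) (auto simp: fmeasurable_def)
 ultimately have i: "integrable lebesgue (%x. ind Om x *. (norm (f x))\<^sup>2+ind K x)" by (rule Bochner_Integration.integrable_add)
 show "integrable lebesgue (%x. ind K x *. f x)"
 proof (rule Bochner_Integration.integrable_bound[OF i])
  have "(%x. ind Om x *. f x) \<in> bm lebesgue" by (rule lebesgue_measurable_extend) (use f Om in \<open>simp_all add: in_L2_iff\<close>)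
  then have "(%x. ind K x *. (ind Om x *. f x)) \<in> bm lebesgue" by (rule borel_measurable_scaleR[OF borel_measurable_indicator[OF Km]])
  also have "(%x. ind K x *. (ind Om x *. f x)) = (%x. ind K x *. f x)" using K by (intro ext) (auto simp: indicator_def)
  finally show "(%x. ind K x *. f x) \<in> bm lebesgue" .
  show "AE x in lebesgue. norm (ind K x *. f x) <= norm (ind Om x *. (norm (f x))\<^sup>2+ind K x)"
  proof (rule AE_I2)
  fix x
  have "2 * norm (f x) <= (norm (f x))\<^sup>2+1" using sum_squares_bound[of "norm (f x)" 1] by simp
  then have "norm (f x) <= (norm (f x))\<^sup>2+1" using norm_ge_zero[of "f x"] by linarith
  then show "norm (ind K x *. f x) <= norm (ind Om x *. (norm (f x))\<^sup>2+ind K x)" using K by (auto simp: indicator_def)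
  qed
 qed
qed

text \<open>Stated for two functions that agree almost everywhere, so that it gives uniqueness and
  independence of the representative at once. The fundamental lemma is applied to the difference of
  the derivatives.\<close>

lemma has_weak_deriv_unique:
 fixes f :: "real^'d::finite => 'b::euclidean_space"
 assumes Om: "open Om" and fg: "hwd Om is f g" and fg': "hwd Om is f' g'"
  and eq: "AE x in lon Om. f x = f' x"
 shows "AE x in lon Om. g x = g' x"
proof -
 have l: "locally_integrable Om f" "locally_integrable Om f'" "locally_integrable Om g" "locally_integrable Om g'" using fg fg' by (auto simp: has_weak_deriv_def)
 have "AE x in lon Om. g x+(-1) *. g' x = 0"
 proof (rule fundamental_lemma[OF Om])
  show "locally_integrable Om (%x. g x+(-1) *. g' x)" by (intro locally_integrable_add locally_integrable_scaleR l)
  fix fi :: "real^'d => real" assume fi: "tf Om fi"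
  note t = test_partials_list[OF fi, of "is"]
  have i: "integrable (lon Om) (%x. fi x *. g x)" "integrable (lon Om) (%x. fi x *. g' x)" using locally_integrable_mult_bounded[OF Om _ fi] l by blast+
  have "(LINT x|lon Om. pd is fi x *. f x) = (LINT x|lon Om. pd is fi x *. f' x)"
  proof (rule integral_cong_AE)
  show "AE x in lon Om. pd is fi x *. f x = pd is fi x *. f' x" using eq by eventually_elim simp
  qed (intro borel_measurable_integrable locally_integrable_mult_bounded[OF Om _ t] l)+
  moreover have "(LINT x|lon Om. pd is fi x *. f x) = (- 1)^length is *. (LINT x|lon Om. fi x *. g x)"
  "(LINT x|lon Om. pd is fi x *. f' x) = (- 1)^length is *. (LINT x|lon Om. fi x *. g' x)" using fg fg' fi unfolding has_weak_deriv_def by blast+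
  ultimately have "(LINT x|lon Om. fi x *. g x) = (LINT x|lon Om. fi x *. g' x)" by simp
  then show "(LINT x|lon Om. fi x *. (g x+(-1) *. g' x)) = 0" using i by (simp add: scaleR_diff_right)
 qed
 then show ?thesis by eventually_elim simp
qed

lemma has_weak_deriv_weak_deriv:
 "hwd Om is f g ==> hwd Om is f (wd Om is f)" unfolding weak_deriv_def by (rule someI[of "hwd Om is f"])

lemma weak_deriv_AE:
 assumes "open Om" "hwd Om is f g"
 shows "AE x in lon Om. wd Om is f x = g x" by (rule has_weak_deriv_unique[OF assms(1) has_weak_deriv_weak_deriv[OF assms(2)] assms(2)]) simp

lemma has_weak_deriv_add:
 fixes f :: "real^'d::finite => 'b::euclidean_space"
 assumes Om: "open Om" and f: "hwd Om is f f'" and g: "hwd Om is g g'"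
 shows "hwd Om is (%x. f x+g x) (%x. f' x+g' x)" unfolding has_weak_deriv_def
proof (intro conjI allI impI)
 have l: "locally_integrable Om f" "locally_integrable Om f'" "locally_integrable Om g" "locally_integrable Om g'" using f g by (auto simp: has_weak_deriv_def)
 then show "locally_integrable Om (%x. f x+g x)" "locally_integrable Om (%x. f' x+g' x)" by (auto intro: locally_integrable_add)
 fix fi :: "real^'d => real" assume fi: "tf Om fi"
 note t = test_partials_list[OF fi, of "is"]
 have "(LINT x|lon Om. pd is fi x *. f x) = (- 1)^length is *. (LINT x|lon Om. fi x *. f' x)"
  "(LINT x|lon Om. pd is fi x *. g x) = (- 1)^length is *. (LINT x|lon Om. fi x *. g' x)" using f g fi unfolding has_weak_deriv_def by blast+
 then show "(LINT x|lon Om. pd is fi x *. (f x+g x)) = (- 1)^length is *. (LINT x|lon Om. fi x *. (f' x+g' x))" using locally_integrable_mult_bounded[OF Om l(1) t] locally_integrable_mult_bounded[OF Om l(3) t]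
  locally_integrable_mult_bounded[OF Om l(2) fi] locally_integrable_mult_bounded[OF Om l(4) fi] by (simp add: scaleR_add_right)
qed

lemma has_weak_deriv_bounded_linear:
 fixes f :: "real^'d::finite => 'b::euclidean_space" and L :: "'b => 'c::euclidean_space"
 assumes Om: "open Om" and L: "bounded_linear L" and f: "hwd Om is f f'"
 shows "hwd Om is (%x. L (f x)) (%x. L (f' x))" unfolding has_weak_deriv_def
proof (intro conjI allI impI)
 interpret bounded_linear L by (rule L)
 have l: "locally_integrable Om f" "locally_integrable Om f'" using f by (auto simp: has_weak_deriv_def)
 have li: "locally_integrable Om (%x. L (h x))" if h: "locally_integrable Om h" for h unfolding locally_integrable_def set_integrable_def
 proof (intro allI impI)
  fix K assume "compact K & K <= Om"
  then have "integrable lebesgue (%x. ind K x *. h x)" using h by (auto simp: locally_integrable_def set_integrable_def)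
  from integrable_bounded_linear[OF L this]
  show "integrable lebesgue (%x. ind K x *. L (h x))" by (simp add: scaleR)
 qed
 show "locally_integrable Om (%x. L (f x))" "locally_integrable Om (%x. L (f' x))" using li l by blast+
 fix fi :: "real^'d => real" assume fi: "tf Om fi"
 note t = test_partials_list[OF fi, of "is"]
 have "(LINT x|lon Om. pd is fi x *. L (f x)) = L (LINT x|lon Om. pd is fi x *. f x)" using integral_bounded_linear[OF L locally_integrable_mult_bounded[OF Om l(1) t]] by (simp add: scaleR)
 also have "(LINT x|lon Om. pd is fi x *. f x) = (- 1)^length is *. (LINT x|lon Om. fi x *. f' x)" using f fi unfolding has_weak_deriv_def by blast
 also have "L ... = (- 1)^length is *. (LINT x|lon Om. fi x *. L (f' x))" using integral_bounded_linear[OF L locally_integrable_mult_bounded[OF Om l(2) fi]] by (simp add: scaleR)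
 finally show "(LINT x|lon Om. pd is fi x *. L (f x)) = (- 1)^length is *. (LINT x|lon Om. fi x *. L (f' x))" .
qed

lemma has_weak_deriv_scaleR:
 fixes f :: "real^'d::finite => 'b::euclidean_space"
 assumes "open Om" "hwd Om is f f'"
 shows "hwd Om is (%x. c *. f x) (%x. c *. f' x)" by (rule has_weak_deriv_bounded_linear[OF assms(1) bounded_linear_scaleR_right assms(2)])

lemma has_weak_deriv_zero: "hwd Om is (%x. 0) (%x. 0)" by (simp add: has_weak_deriv_def locally_integrable_def set_integrable_def)

lemma has_weak_deriv_Nil: "locally_integrable Om f ==> hwd Om [] f f" by (simp add: has_weak_deriv_def)

lemma smooth_locally_integrable:
 fixes f :: "real^'d::finite => 'b::euclidean_space"
 assumes "smooth f"
 shows "locally_integrable Om f" unfolding locally_integrable_def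
proof (intro allI impI)
 fix K assume "compact K & K <= Om"
 then have "integrable lborel (%x. ind K x *. f x)" by (intro borel_integrable_compact smooth_continuous assms) auto
 then show "set_integrable lebesgue K f" unfolding set_integrable_def by (simp add: integrable_completion borel_measurable_integrable)
qed

lemma has_weak_deriv_smooth:
 fixes f :: "real^'d::finite => 'b::euclidean_space"
 assumes Om: "open Om" and f: "smooth f"
 shows "hwd Om [i] f (pd [i] f)" unfolding has_weak_deriv_def
proof (intro conjI allI impI)
 note l = smooth_locally_integrable[OF f, of Om] smooth_locally_integrable[OF smooth_partials[OF f], of Om "[i]"]
 show "locally_integrable Om f" "locally_integrable Om (pd [i] f)" by (fact l)+
 fix fi :: "real^'d => real" assume fi: "tf Om fi"
 note t = test_partials[OF fi, of i]
 note i1 = locally_integrable_mult_bounded[OF Om l(1) t] and i2 = locally_integrable_mult_bounded[OF Om l(2) fi]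
 show "(LINT x|lon Om. pd [i] fi x *. f x) = (- 1)^length [i] *. (LINT x|lon Om. fi x *. pd [i] f x)"
 proof (rule euclidean_eqI)
  fix b :: 'b
  have sb: "smooth (%x. f x \<bullet> b)" by (rule smooth_bounded_linear[OF bounded_linear_inner_left f])
  have pb: "pd [i] (%x. f x \<bullet> b) = (%x. pd [i] f x \<bullet> b)" by (rule partials_bounded_linear[OF bounded_linear_inner_left f])
  have "(LINT x|lon Om. pd [i] fi x *. f x) \<bullet> b = (LINT x|lon Om. pd [i] fi x * (f x \<bullet> b))" using integral_inner_left[of b "lon Om" "%x. pd [i] fi x *. f x"] i1 by (simp del: partials.simps)
  also have "... = - (LINT x|lon Om. fi x * pd [i] (%x. f x \<bullet> b) x)" by (rule test_integration_by_parts[OF fi sb Om])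
  also have "... = - ((LINT x|lon Om. fi x *. pd [i] f x) \<bullet> b)" unfolding pb using integral_inner_left[of b "lon Om" "%x. fi x *. pd [i] f x"] i2 by (simp del: partials.simps)
  finally show "(LINT x|lon Om. pd [i] fi x *. f x) \<bullet> b
  = ((- 1)^length [i] *. (LINT x|lon Om. fi x *. pd [i] f x)) \<bullet> b" by (simp del: partials.simps)
 qed
qed

text \<open>A test function on \<open>U\<close> is one on \<open>Om\<close>, and the integrals over
  the two sets agree. This is how weak derivatives are restricted to single mesh elements.\<close>

lemma has_weak_deriv_mono:
 fixes f :: "real^'d::finite => 'b::euclidean_space"
 assumes "open Om" "open U" "U <= Om" and f: "hwd Om is f g"
 shows "hwd U is f g" unfolding has_weak_deriv_def
proof (intro conjI allI impI)
 show "locally_integrable U f" "locally_integrable U g" using f \<open>U <= Om\<close> unfolding has_weak_deriv_def locally_integrable_def by (meson order_trans)+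
 fix fi :: "real^'d => real" assume fi: "tf U fi"
 have fi': "tf Om fi" using test_mono[OF fi \<open>U <= Om\<close>] .
 have eq: "(LINT x|lon U. \<psi> x *. h x) = (LINT x|lon Om. \<psi> x *. h x)"
  if "tf U \<psi>" for \<psi> :: "real^'d => real" and h :: "real^'d => 'b" using integral_lebesgue_on_support[of U "%x. \<psi> x *. h x"] integral_lebesgue_on_support[of Om "%x. \<psi> x *. h x"]
  test_eq_0[OF that] test_eq_0[OF test_mono[OF that \<open>U <= Om\<close>]] assms(1-3) by simp
 show "(LINT x|lon U. pd is fi x *. f x) = (- 1)^length is *. (LINT x|lon U. fi x *. g x)" unfolding eq[OF fi] eq[OF test_partials_list[OF fi]] using f fi' by (simp add: has_weak_deriv_def)
qed

text \<open>Membership in the space provides some good weak derivative, while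
  \<open>weak_deriv\<close> is an arbitrary choice. The two agree almost everywhere, so
  integrability carries over.\<close>

lemma in_W_weak_deriv:
 fixes f :: "real^'d::finite => 'b::euclidean_space"
 assumes Om: "open Om" and f: "in_W Om m p f" and len: "length is <= m"
 shows "hwd Om is f (wd Om is f)"
  and "wd Om is f \<in> bm (lon Om)"
  and "p = 2 \<or> p = \<infinity> ==> in_Lp Om p (wd Om is f)"
proof -
 obtain g where g: "hwd Om is f g" "in_Lp Om p g" using f len unfolding in_W_def by blast
 show h: "hwd Om is f (wd Om is f)" by (rule has_weak_deriv_weak_deriv[OF g(1)])
 then show m: "wd Om is f \<in> bm (lon Om)" unfolding has_weak_deriv_def by (intro locally_integrable_measurable[OF Om]) blast
 assume p: "p = 2 \<or> p = \<infinity>"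
 note ae = weak_deriv_AE[OF Om g(1)]
 show "in_Lp Om p (wd Om is f)"
 proof (cases "p = 2")
  case True
  then show ?thesis using in_L2_cong_AE[OF m _ ae] g(2) by simp
 next
  case False
  then have "p = \<infinity>" using p by simp
  moreover obtain c where "AE x in lon Om. norm (g x) <= c" using g(2) \<open>p = \<infinity>\<close> by (auto simp: in_Linf_iff)
  then have "AE x in lon Om. norm (wd Om is f x) <= c" using ae by eventually_elim simp
  ultimately show ?thesis using m by (auto simp: in_Linf_iff)
 qed
qed

lemma in_W_self:
 fixes f :: "real^'d::finite => 'b::euclidean_space"
 assumes Om: "open Om" and f: "in_W Om m p f" and p: "p = 2 \<or> p = \<infinity>"
 shows "in_Lp Om p f" "AE x in lon Om. wd Om [] f x = f x"
proof -
 obtain g where g: "hwd Om [] f g" "in_Lp Om p g" using f unfolding in_W_def by (metis le0 list.size(3))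
 then have l: "locally_integrable Om f" by (simp add: has_weak_deriv_def)
 note m = locally_integrable_measurable[OF Om l]
 have ae: "AE x in lon Om. f x = g x" by (rule has_weak_deriv_unique[OF Om has_weak_deriv_Nil[OF l] g(1)]) simp
 show "in_Lp Om p f"
 proof (cases "p = 2")
  case True
  then show ?thesis using in_L2_cong_AE[OF m _ ae] g(2) by simp
 next
  case False
  then have "p = \<infinity>" using p by simp
  moreover obtain c where "AE x in lon Om. norm (g x) <= c" using g(2) \<open>p = \<infinity>\<close> by (auto simp: in_Linf_iff)
  then have "AE x in lon Om. norm (f x) <= c" using ae by eventually_elim simp
  ultimately show ?thesis using m by (auto simp: in_Linf_iff)
 qed
 show "AE x in lon Om. wd Om [] f x = f x" by (rule weak_deriv_AE[OF Om has_weak_deriv_Nil[OF l]])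
qed

lemma in_W_mono: "in_W Om m p f ==> m' <= m ==> in_W Om m' p f" unfolding in_W_def by (meson order_trans)

section \<open>Linear combinations and norms in Sobolev spaces\<close>

lemma in_H_add:
 fixes f :: "real^'d::finite => 'b::euclidean_space"
 assumes Om: "open Om" and f: "in_H Om m f" and g: "in_H Om m g"
 shows "in_H Om m (%x. f x+g x)" unfolding in_W_def
proof (intro allI impI)
 fix "is" :: "'d list" assume l: "length is <= m"
 show "\<exists>h. hwd Om is (%x. f x+g x) h & in_Lp Om 2 h" using has_weak_deriv_add[OF Om in_W_weak_deriv(1)[OF Om f l] in_W_weak_deriv(1)[OF Om g l]]
  in_L2_add[OF in_W_weak_deriv(3)[OF Om f l] in_W_weak_deriv(3)[OF Om g l]] by blast
qed

lemma in_H_scaleR: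
 fixes f :: "real^'d::finite => 'b::euclidean_space"
 assumes Om: "open Om" and f: "in_H Om m f"
 shows "in_H Om m (%x. c *. f x)" unfolding in_W_def
proof (intro allI impI)
 fix "is" :: "'d list" assume l: "length is <= m"
 show "\<exists>h. hwd Om is (%x. c *. f x) h & in_Lp Om 2 h" using has_weak_deriv_scaleR[OF Om in_W_weak_deriv(1)[OF Om f l]]
  in_L2_scaleR[OF in_W_weak_deriv(3)[OF Om f l]] by blast
qed

lemma in_H_diff:
 fixes f :: "real^'d::finite => 'b::euclidean_space"
 assumes Om: "open Om" and f: "in_H Om m f" and g: "in_H Om m g"
 shows "in_H Om m (%x. f x-g x)" using in_H_add[OF Om f in_H_scaleR[OF Om g, of "-1"]] by simp

lemma in_H1_test:
 fixes fi :: "real^'d::finite => 'b::euclidean_space"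
 assumes Om: "open Om" and fi: "tf Om fi"
 shows "in_H Om 1 fi" unfolding in_W_def
proof (intro allI impI)
 fix "is" :: "'d list" assume l: "length is <= 1"
 have S: "Om \<in> sets lebesgue" using Om by simp
 consider "is = []" | i where "is = [i]" using l by (cases "is") auto
 then show "\<exists>h. hwd Om is fi h & in_Lp Om 2 h"
 proof cases
  case 1
  then show ?thesis using has_weak_deriv_Nil[OF smooth_locally_integrable[OF test_smooth[OF fi]]] test_in_L2[OF fi S] by blast
 next
  case 2
  then show ?thesis using has_weak_deriv_smooth[OF Om test_smooth[OF fi]] test_in_L2[OF test_partials[OF fi] S] by blast
 qed
qed

lemma weak_deriv_lincomb:
 fixes f :: "real^'d::finite => 'b::euclidean_space"
 assumes Om: "open Om" and f: "in_H Om m f" and g: "in_H Om m g" and l: "length is <= m"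
 shows "AE x in lon Om. wd Om is (%x. a *. f x+b *. g x) x = a *. wd Om is f x+b *. wd Om is g x" by (rule weak_deriv_AE[OF Om]) (intro has_weak_deriv_add has_weak_deriv_scaleR Om in_W_weak_deriv(1)[OF Om f l] in_W_weak_deriv(1)[OF Om g l])

lemma weak_deriv_diff:
 fixes f :: "real^'d::finite => 'b::euclidean_space"
 assumes Om: "open Om" and f: "in_H Om m f" and g: "in_H Om m g" and l: "length is <= m"
 shows "AE x in lon Om. wd Om is (%x. f x-g x) x = wd Om is f x-wd Om is g x" using weak_deriv_lincomb[OF assms, of 1 "-1"] by simp

lemma finite_lists_le: "finite {is :: 'd::finite list. length is <= m}" using finite_lists_length_le[of "UNIV :: 'd set" m] by simp

lemma H_norm_sq: "(H_norm Om m f)\<^sup>2 = (\<Sum>is | length is <= m. (nrm Om (wd Om is f))\<^sup>2)"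
proof -
 have "(\<Sum>is | length is <= m. Lp_norm Om 2 (wd Om is f) powr 2) = (\<Sum>is | length is <= m. (nrm Om (wd Om is f))\<^sup>2)" by (simp add: Lp_norm_2)
 then show ?thesis by (simp add: W_norm_def numeral_eq_ereal powr_half_sqrt sum_nonneg Lp_norm_2[unfolded numeral_eq_ereal])
qed

lemma H_norm_nonneg [simp]: "0 <= H_norm Om m f" by (simp add: W_norm_def numeral_eq_ereal)

lemma L2_weak_deriv_le_H_norm:
 assumes "length is <= m"
 shows "nrm Om (wd Om is f) <= H_norm Om m f"
proof (rule power2_le_imp_le)
 show "(nrm Om (wd Om is f))\<^sup>2 <= (H_norm Om m f)\<^sup>2" unfolding H_norm_sq by (rule member_le_sum) (use assms finite_lists_le in auto)
qed simp

lemma L2_le_H_norm: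
 fixes f :: "real^'d::finite => 'b::euclidean_space"
 assumes Om: "open Om" and f: "in_H Om m f"
 shows "nrm Om f <= H_norm Om m f"
proof -
 have "nrm Om f = nrm Om (wd Om [] f)" by (rule L2_norm_cong_AE[symmetric])
  (use in_W_self[OF Om f] in_W_weak_deriv(2)[OF Om f] in \<open>auto simp: in_L2_iff\<close>)
 then show ?thesis using L2_weak_deriv_le_H_norm[of "[]" m Om f] by simp
qed

lemma W_norm_inf_ge:
 assumes "length is <= m"
 shows "sn Om (wd Om is f) <= W_norm Om m \<infinity> f" unfolding W_norm_def using assms finite_lists_le[of m] by (auto intro!: Max_ge)

lemma W_norm_inf_nonneg [simp]: "0 <= W_norm Om m \<infinity> f" using W_norm_inf_ge[of "[]" m Om f] order_trans[OF Linf_norm_nonneg] by fastforce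

section \<open>Gradient and dv\<close>

lemma grad_nth: "grad Om v x $ i $ j = wd Om [j] v x $ i" by (simp add: grad_def)

lemma grad_in_L2:
 assumes Om: "open Om" and v: "in_H Om 1 v"
 shows "in_Lp Om 2 (grad Om v)"
  and "(nrm Om (grad Om v))\<^sup>2 = (\<Sum>j\<in>UNIV. (nrm Om (wd Om [j] v))\<^sup>2)"
proof -
 have w: "in_Lp Om 2 (wd Om [j] v)" for j using in_W_weak_deriv(3)[OF Om v, of "[j]"] by simp
 have comp: "in_Lp Om 2 (%x. wd Om [j] v x $ i)" for i j by (rule in_Lp_nth(1)[OF w])
 \<comment> \<open>The gradient is assembled from its scalar entries times matrix units, because
   square integrability is available for finite sums.\<close>
 have "in_Lp Om 2 (%x. \<Sum>i\<in>UNIV. \<Sum>j\<in>UNIV. (wd Om [j] v x $ i) *. axis i (axis j (1::real)))"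
 proof (intro in_L2_sum)
  fix i j
  show "in_Lp Om 2 (%x. (wd Om [j] v x $ i) *. axis i (axis j (1::real)))" by (rule in_L2_dominated[OF _ comp[of j i], where c="norm (axis i (axis j 1 :: real^'a) :: real^'a^'a)"])
  (use comp[of j i] in \<open>auto simp only: in_L2_iff norm_scaleR real_norm_def mult.commute order_refl
  intro!: AE_I2 borel_measurable_scaleR borel_measurable_const\<close>)
 qed
 also have "(%x. \<Sum>i\<in>UNIV. \<Sum>j\<in>UNIV. (wd Om [j] v x $ i) *. axis i (axis j (1::real))) = grad Om v"
 proof (rule ext)
  fix x
  have *: "(\<Sum>b\<in>UNIV. if P then g b else 0) = (if P then (\<Sum>b\<in>UNIV. g b) else 0)" for P and g :: "'a => real" by simp
  show "(\<Sum>i\<in>UNIV. \<Sum>j\<in>UNIV. (wd Om [j] v x $ i) *. axis i (axis j (1::real))) = grad Om v x" by (simp add: vec_eq_iff grad_nth axis_def * if_distrib[of "%c. c $ _"] if_distrib[of "%c. _ * c"] cong: if_cong)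
 qed
 finally show g: "in_Lp Om 2 (grad Om v)" .
 have "(norm (grad Om v x))\<^sup>2 = (\<Sum>j\<in>UNIV. (norm (wd Om [j] v x))\<^sup>2)" for x
 proof -
  have "(norm (grad Om v x))\<^sup>2 = (\<Sum>i\<in>UNIV. \<Sum>j\<in>UNIV. (wd Om [j] v x $ i)\<^sup>2)" by (simp add: norm_vec_def L2_set_def sum_nonneg grad_nth)
  also have "... = (\<Sum>j\<in>UNIV. \<Sum>i\<in>UNIV. (wd Om [j] v x $ i)\<^sup>2)" by (rule sum.swap)
  also have "... = (\<Sum>j\<in>UNIV. (norm (wd Om [j] v x))\<^sup>2)" by (simp add: norm_vec_def L2_set_def sum_nonneg)
  finally show ?thesis .
 qed
 then show "(nrm Om (grad Om v))\<^sup>2 = (\<Sum>j\<in>UNIV. (nrm Om (wd Om [j] v))\<^sup>2)" unfolding L2_norm_sq using w by (simp add: in_L2_iff)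
qed

lemma L2_weak_deriv_le_grad:
 assumes Om: "open Om" and v: "in_H Om 1 v"
 shows "nrm Om (wd Om [j] v) <= nrm Om (grad Om v)"
proof (rule power2_le_imp_le)
 show "(nrm Om (wd Om [j] v))\<^sup>2 <= (nrm Om (grad Om v))\<^sup>2" unfolding grad_in_L2(2)[OF assms] by (rule member_le_sum) auto
qed simp

lemma L2_grad_le_H_norm:
 assumes Om: "open Om" and v: "in_H Om 1 v"
 shows "nrm Om (grad Om v) <= H_norm Om 1 v"
proof (rule power2_le_imp_le)
 have "(nrm Om (grad Om v))\<^sup>2 = (\<Sum>is\<in>(%j. [j]) ` UNIV. (nrm Om (wd Om is v))\<^sup>2)" unfolding grad_in_L2(2)[OF assms] by (subst sum.reindex) (auto simp: inj_on_def)
 also have "... <= (H_norm Om 1 v)\<^sup>2" unfolding H_norm_sq by (rule sum_mono2) (use finite_lists_le in auto)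
 finally show "(nrm Om (grad Om v))\<^sup>2 <= (H_norm Om 1 v)\<^sup>2" .
qed simp

lemma grad_lincomb:
 fixes u v :: "real^'d::finite => real^'d"
 assumes Om: "open Om" and u: "in_H Om 1 u" and v: "in_H Om 1 v"
 shows "AE x in lon Om. grad Om (%x. a *. u x+b *. v x) x = a *. grad Om u x+b *. grad Om v x"
proof -
 have "AE x in lon Om. \<forall>j\<in>UNIV. wd Om [j] (%x. a *. u x+b *. v x) x
  = a *. wd Om [j] u x+b *. wd Om [j] v x" by (intro AE_finite_allI weak_deriv_lincomb[OF Om u v]) auto
 then show ?thesis by eventually_elim (simp add: vec_eq_iff grad_nth)
qed

lemma divergence_grad: "dv Om v x = (\<Sum>i\<in>UNIV. grad Om v x $ i $ i)" by (simp add: divergence_def grad_nth)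

lemma abs_divergence_le: "\<bar>dv Om v x\<bar> <= real CARD('d) * norm (grad Om v x)"
 for v :: "real^'d::finite => real^'d"
proof -
 have "\<bar>grad Om v x $ i $ i\<bar> <= norm (grad Om v x)" for i using Finite_Cartesian_Product.norm_nth_le[of "grad Om v x" i]
  Finite_Cartesian_Product.norm_nth_le[of "grad Om v x $ i" i] by simp
 then have "(\<Sum>i\<in>UNIV. \<bar>grad Om v x $ i $ i\<bar>) <= (\<Sum>i\<in>(UNIV :: 'd set). norm (grad Om v x))" by (intro sum_mono)
 then show ?thesis unfolding divergence_grad using order_trans[OF sum_abs[of "%i. grad Om v x $ i $ i" UNIV]] by simp
qed

lemma divergence_measurable:
 fixes v :: "real^'d::finite => real^'d"
 assumes "grad Om v \<in> bm (lon Om)"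
 shows "dv Om v \<in> bm (lon Om)"
proof -
 have "(%A :: real^'d^'d. \<Sum>i\<in>UNIV. A $ i $ i) \<in> bm borel" by (intro borel_measurable_continuous_onI continuous_intros)
 from measurable_compose[OF assms this] show ?thesis by (simp add: divergence_grad[abs_def])
qed

lemma divergence_in_L2:
 fixes v :: "real^'d::finite => real^'d"
 assumes Om: "open Om" and v: "in_H Om 1 v"
 shows "in_Lp Om 2 (dv Om v)" "nrm Om (dv Om v) <= real CARD('d) * nrm Om (grad Om v)"
proof -
 note g = grad_in_L2(1)[OF assms]
 have m: "dv Om v \<in> bm (lon Om)" using g by (intro divergence_measurable) (simp add: in_L2_iff)
 have le: "AE x in lon Om. norm (dv Om v x) <= real CARD('d) * norm (grad Om v x)" by (rule AE_I2) (use abs_divergence_le[of Om v] in simp)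
 show "in_Lp Om 2 (dv Om v)" by (rule in_L2_dominated[OF m g le])
 show "nrm Om (dv Om v) <= real CARD('d) * nrm Om (grad Om v)" by (rule L2_norm_dominated[OF m g _ le]) simp
qed

lemma divergence_lincomb:
 fixes u v :: "real^'d::finite => real^'d"
 assumes Om: "open Om" and u: "in_H Om 1 u" and v: "in_H Om 1 v"
 shows "AE x in lon Om. dv Om (%x. a *. u x+b *. v x) x = a * dv Om u x+b * dv Om v x" using grad_lincomb[OF assms, of a b] by eventually_elim (simp add: divergence_grad sum.distrib sum_distrib_left)

section \<open>Functions with vanishing boundary values\<close>

lemma in_H10_in_H1: "in_H10 Om v ==> in_H Om 1 v" by (simp add: in_H10_def)

lemma in_H10_approx:
 fixes v :: "real^'d::finite => 'b::euclidean_space"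
 assumes Om: "open Om" and v: "in_H10 Om v"
 obtains fi :: "nat => real^'d => 'b" where "!!n. tf Om (fi n)"
  "(%n. nrm Om (%x. v x-fi n x)) \<longlonglongrightarrow> 0"
  "!!i. (%n. nrm Om (%x. wd Om [i] v x-pd [i] (fi n) x)) \<longlonglongrightarrow> 0"
proof -
 note h = in_H10_in_H1[OF v]
 have "\<exists>fi. tf Om fi & H_norm Om 1 (%x. v x-fi x) < inverse (real (Suc n))" for n using v unfolding in_H10_def by (simp del: of_nat_Suc)
 then obtain fi where fi: "!!n. tf Om (fi n)" "!!n. H_norm Om 1 (%x. v x-fi n x) < inverse (real (Suc n))" by metis
 have d: "in_H Om 1 (%x. v x-fi n x)" for n by (rule in_H_diff[OF Om h in_H1_test[OF Om fi(1)]])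
 have S: "Om \<in> sets lebesgue" using Om by simp
 have "nrm Om (%x. v x-fi n x) <= inverse (real (Suc n))" for n using L2_le_H_norm[OF Om d[of n]] fi(2)[of n] by linarith
 moreover have "nrm Om (%x. wd Om [i] v x-pd [i] (fi n) x) <= inverse (real (Suc n))" for n i
 proof -
  have w: "in_Lp Om 2 (wd Om [i] v)" using in_W_weak_deriv(3)[OF Om h, of "[i]"] by simp
  have p: "in_Lp Om 2 (pd [i] (fi n))" by (rule test_in_L2[OF test_partials[OF fi(1)] S])
  have "AE x in lon Om. wd Om [i] (%x. v x-fi n x) x = wd Om [i] v x-wd Om [i] (fi n) x" by (rule weak_deriv_diff[OF Om h in_H1_test[OF Om fi(1)]]) simp
  moreover have "AE x in lon Om. wd Om [i] (fi n) x = pd [i] (fi n) x" by (rule weak_deriv_AE[OF Om has_weak_deriv_smooth[OF Om test_smooth[OF fi(1)]]])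
  ultimately have "AE x in lon Om. wd Om [i] v x-pd [i] (fi n) x = wd Om [i] (%x. v x-fi n x) x" by eventually_elim simp
  then have "nrm Om (%x. wd Om [i] v x-pd [i] (fi n) x) = nrm Om (wd Om [i] (%x. v x-fi n x))" by (rule L2_norm_cong_AE)
  (use in_L2_diff[OF w p] in_W_weak_deriv(2)[OF Om d[of n], of "[i]"] in \<open>auto simp: in_L2_iff\<close>)
  also have "... <= H_norm Om 1 (%x. v x-fi n x)" by (rule L2_weak_deriv_le_H_norm) simp
  finally show ?thesis using fi(2)[of n] by linarith
 qed
 ultimately show thesis by (intro that[of fi] fi(1) Lim_null_comparison[OF _ LIMSEQ_inverse_real_of_nat] always_eventually)
  (auto simp del: of_nat_Suc partials.simps)
qed

lemma L2_inner_tendsto: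
 assumes f: "in_Lp S 2 f" and g: "in_Lp S 2 g" and fn: "!!n. in_Lp S 2 (fn n)"
  and lim: "(%n. nrm S (%x. f x-fn n x)) \<longlonglongrightarrow> 0"
 shows "(%n. ip S (fn n) g) \<longlonglongrightarrow> ip S f g"
proof -
 have "(%n. ip S (fn n) g-ip S f g) \<longlonglongrightarrow> 0"
 proof (rule Lim_null_comparison)
  have "norm (ip S (fn n) g-ip S f g) <= nrm S (%x. f x-fn n x) * nrm S g" for n using L2_Cauchy_Schwarz[OF in_L2_diff[OF f fn] g, of n] L2_inner_diff_left[OF f fn g, of n] by simp
  then show "eventually (%n. norm (ip S (fn n) g-ip S f g) <= nrm S (%x. f x-fn n x) * nrm S g) sequentially" by simp
  show "(%n. nrm S (%x. f x-fn n x) * nrm S g) \<longlonglongrightarrow> 0" using tendsto_mult[OF lim tendsto_const[of "nrm S g"]] by simp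
 qed
 then show ?thesis by (simp add: LIM_zero_iff)
qed

section \<open>Integration by parts in Sobolev spaces\<close>

lemma L2_Linf_mult_real:
 fixes f g :: "'a::euclidean_space => real"
 assumes "in_Lp S \<infinity> f" "in_Lp S 2 g"
 shows "in_Lp S 2 (%x. f x * g x)" "in_Lp S 2 (%x. g x * f x)"
  "nrm S (%x. f x * g x) <= sn S f * nrm S g"
proof -
 have m: "(%x. f x * g x) \<in> bm (lon S)" using assms by (auto simp: in_L2_iff in_Linf_iff)
 show 1: "in_Lp S 2 (%x. f x * g x)" by (rule in_L2_Linf_mult(1)[OF assms m]) (simp add: abs_mult)
 then show "in_Lp S 2 (%x. g x * f x)" by (simp add: mult.commute)
 show "nrm S (%x. f x * g x) <= sn S f * nrm S g" by (rule in_L2_Linf_mult(2)[OF assms m]) (simp add: abs_mult)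
qed

text \<open>A pair \<open>(f, f')\<close> in the closure of the pairs \<open>(fi, \<partial>\<^sub>i fi)\<close>, for test functions \<open>fi\<close>.\<close>

definition zero_trace :: "(real^'d::finite) set => 'd => (real^'d => real) => (real^'d => real) => bool" where
 "zero_trace Om i f f' \<longleftrightarrow> in_Lp Om 2 f & in_Lp Om 2 f' &
  (\<exists>fi :: nat => real^'d => real. (\<forall>n. tf Om (fi n)) &
  (%n. nrm Om (%x. f x-fi n x)) \<longlonglongrightarrow> 0 &
  (%n. nrm Om (%x. f' x-pd [i] (fi n) x)) \<longlonglongrightarrow> 0)"

lemma in_H10_zero_trace:
 fixes v :: "real^'d::finite => real^'d"
 assumes Om: "open Om" and v: "in_H10 Om v"
 shows "zero_trace Om i (%x. v x $ k) (%x. wd Om [i] v x $ k)"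
proof -
 have S: "Om \<in> sets lebesgue" using Om by simp
 note h = in_H10_in_H1[OF v]
 have v2: "in_Lp Om 2 v" by (rule in_W_self(1)[OF Om h]) simp
 have w2: "in_Lp Om 2 (wd Om [i] v)" by (rule in_W_weak_deriv(3)[OF Om h]) auto
 obtain fi :: "nat => real^'d => real^'d" where fi: "!!n. tf Om (fi n)"
  "(%n. nrm Om (%x. v x-fi n x)) \<longlonglongrightarrow> 0"
  "!!i. (%n. nrm Om (%x. wd Om [i] v x-pd [i] (fi n) x)) \<longlonglongrightarrow> 0" by (rule in_H10_approx[OF Om v]) blast
 have t: "tf Om (%x. fi n x $ k)" for n by (rule test_bounded_linear[OF bounded_linear_vec_nth fi(1)])
 have pt: "pd [i] (%x. fi n x $ k) = (%x. pd [i] (fi n) x $ k)" for n by (rule partials_bounded_linear[OF bounded_linear_vec_nth test_smooth[OF fi(1)]])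
 have "(%n. nrm Om (%x. v x $ k-fi n x $ k)) \<longlonglongrightarrow> 0" by (rule Lim_null_comparison[OF _ fi(2)])
  (use in_Lp_nth(2)[OF in_L2_diff[OF v2 test_in_L2[OF fi(1) S]]] in \<open>auto intro!: always_eventually\<close>)
 moreover have "(%n. nrm Om (%x. wd Om [i] v x $ k-pd [i] (fi n) x $ k)) \<longlonglongrightarrow> 0" by (rule Lim_null_comparison[OF _ fi(3)[of i]])
  (use in_Lp_nth(2)[OF in_L2_diff[OF w2 test_in_L2[OF test_partials[OF fi(1)] S]]] in \<open>auto intro!: always_eventually simp del: partials.simps\<close>)
 ultimately show ?thesis unfolding zero_trace_def using in_Lp_nth(1)[OF v2] in_Lp_nth(1)[OF w2] t pt by (auto intro!: exI[of _ "%n x. fi n x $ k"] simp del: partials.simps)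
qed

text \<open>The identity is linear in \<open>(f, f')\<close> and continuous in the \<open>L2\<close>
  norms of both, so it extends from test functions to the closure.\<close>

lemma zero_trace_pairing:
 assumes Om: "open Om" and f: "zero_trace Om i f f'" and g: "in_Lp Om 2 g" "in_Lp Om 2 g'"
  and test: "!!fi. tf Om fi ==> ip Om (pd [i] fi) g+ip Om fi g' = 0"
 shows "ip Om f' g+ip Om f g' = 0"
proof -
 have S: "Om \<in> sets lebesgue" using Om by simp
 obtain fi where fi: "!!n :: nat. tf Om (fi n)"
  "(%n. nrm Om (%x. f x-fi n x)) \<longlonglongrightarrow> 0"
  "(%n. nrm Om (%x. f' x-pd [i] (fi n) x)) \<longlonglongrightarrow> 0"
  and f2: "in_Lp Om 2 f" "in_Lp Om 2 f'" using f unfolding zero_trace_def by blast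
 have "(%n. ip Om (pd [i] (fi n)) g+ip Om (fi n) g') \<longlonglongrightarrow> ip Om f' g+ip Om f g'" by (intro tendsto_add L2_inner_tendsto f2 g fi(2,3) test_in_L2[OF fi(1) S] test_in_L2[OF test_partials[OF fi(1)] S])
 then show ?thesis by (simp add: test[OF fi(1)] LIMSEQ_const_iff del: partials.simps)
qed

lemma zero_trace_by_parts:
 assumes Om: "open Om" and f: "zero_trace Om i f f'" and w: "hwd Om [i] w w'"
  and w2: "in_Lp Om 2 w" "in_Lp Om 2 w'"
 shows "ip Om f' w+ip Om f w' = 0" by (rule zero_trace_pairing[OF Om f w2]) (use w in \<open>auto simp: has_weak_deriv_def L2_inner_def simp del: partials.simps\<close>)

text \<open>If \<open>a\<close> is a test function, the rule is the definition of the weak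
  derivative of \<open>b\<close>, tested with the product of \<open>fi\<close> and \<open>a\<close>.
  Both sides depend continuously on \<open>(a, a')\<close>, so \<open>zero_trace_pairing\<close>
  extends it. Boundedness of \<open>a\<close> and \<open>b\<close> keeps the products square
  integrable.\<close>

lemma has_weak_deriv_product:
 assumes Om: "open Om" and a: "zero_trace Om i a a'" "in_Lp Om \<infinity> a"
  and b: "hwd Om [i] b b'" "in_Lp Om 2 b" "in_Lp Om \<infinity> b" "in_Lp Om 2 b'"
 shows "hwd Om [i] (%x. a x * b x) (%x. a' x * b x+a x * b' x)"
  and "in_Lp Om 2 (%x. a x * b x)" and "in_Lp Om 2 (%x. a' x * b x+a x * b' x)"
proof -
 have a2: "in_Lp Om 2 a" "in_Lp Om 2 a'" using a by (auto simp: zero_trace_def)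
 show ab: "in_Lp Om 2 (%x. a x * b x)" by (rule L2_Linf_mult_real(1)[OF a(2) b(2)])
 have s1: "in_Lp Om 2 (%x. a' x * b x)" by (rule L2_Linf_mult_real(2)[OF b(3) a2(2)])
 have s2: "in_Lp Om 2 (%x. a x * b' x)" by (rule L2_Linf_mult_real(1)[OF a(2) b(4)])
 show ab': "in_Lp Om 2 (%x. a' x * b x+a x * b' x)" by (rule in_L2_add[OF s1 s2])
 show "hwd Om [i] (%x. a x * b x) (%x. a' x * b x+a x * b' x)" unfolding has_weak_deriv_def
 proof (intro conjI allI impI in_L2_locally_integrable[OF Om] ab ab')
  fix fi :: "real^'a => real" assume fi: "tf Om fi"
  have S: "Om \<in> sets lebesgue" using Om by simp
  note p = test_in_Linf[OF fi, where S=Om] test_in_Linf[OF test_partials[OF fi, of i], where S=Om]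
  have g1: "in_Lp Om 2 (%x. fi x * b x)" by (rule L2_Linf_mult_real(1)[OF p(1) b(2)])
  have g2: "in_Lp Om 2 (%x. pd [i] fi x * b x)" by (rule L2_Linf_mult_real(1)[OF p(2) b(2)])
  have g3: "in_Lp Om 2 (%x. fi x * b' x)" by (rule L2_Linf_mult_real(1)[OF p(1) b(4)])
  have "ip Om a' (%x. fi x * b x)+ip Om a (%x. pd [i] fi x * b x+fi x * b' x) = 0"
  proof (rule zero_trace_pairing[OF Om a(1) g1 in_L2_add[OF g2 g3]])
  fix al :: "real^'a => real" assume al: "tf Om al"
  note al2 = test_in_L2[OF al S] test_in_L2[OF test_partials[OF al, of i] S]
  have "(LINT x|lon Om. pd [i] (%x. fi x * al x) x * b x) = - (LINT x|lon Om. (fi x * al x) * b' x)" using b(1) test_mult[OF fi test_smooth[OF al]] by (simp add: has_weak_deriv_def del: partials.simps)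
  also have "(LINT x|lon Om. (fi x * al x) * b' x) = ip Om al (%x. fi x * b' x)" by (simp add: L2_inner_def mult_ac)
  also have "(LINT x|lon Om. pd [i] (%x. fi x * al x) x * b x)
  = ip Om (pd [i] al) (%x. fi x * b x)+ip Om al (%x. pd [i] fi x * b x)" unfolding partials_mult[OF test_smooth[OF fi] test_smooth[OF al]] L2_inner_def using integrable_inner_L2[OF al2(2) g1] integrable_inner_L2[OF al2(1) g2] by (subst Bochner_Integration.integral_add[symmetric]) (simp_all add: algebra_simps del: partials.simps)
  finally show "ip Om (pd [i] al) (%x. fi x * b x)+ip Om al (%x. pd [i] fi x * b x+fi x * b' x) = 0" unfolding L2_inner_add_right[OF g2 g3 al2(1)] by simp
  qed
  then have "ip Om a (%x. pd [i] fi x * b x) = - (ip Om a' (%x. fi x * b x)+ip Om a (%x. fi x * b' x))" unfolding L2_inner_add_right[OF g2 g3 a2(1)] by simp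
  moreover have "ip Om a' (%x. fi x * b x)+ip Om a (%x. fi x * b' x) = (LINT x|lon Om. fi x * (a' x * b x+a x * b' x))" unfolding L2_inner_def using integrable_inner_L2[OF a2(2) g1] integrable_inner_L2[OF a2(1) g3] by (subst Bochner_Integration.integral_add[symmetric]) (simp_all add: algebra_simps)
  ultimately show "(LINT x|lon Om. pd [i] fi x *. (a x * b x)) = (- 1)^length [i] *. (LINT x|lon Om. fi x *. (a' x * b x+a x * b' x))" by (simp add: L2_inner_def mult_ac del: partials.simps)
 qed
qed

lemma has_weak_deriv_nth:
 fixes v :: "real^'d::finite => real^'d"
 assumes "open Om" "in_H Om 1 v"
 shows "hwd Om [i] (%x. v x $ k) (%x. wd Om [i] v x $ k)" by (rule has_weak_deriv_bounded_linear[OF assms(1) bounded_linear_vec_nth in_W_weak_deriv(1)[OF assms]]) simp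

lemma in_Linf_nth:
 fixes v :: "'a::euclidean_space => ('b::euclidean_space)^'n"
 assumes "in_Lp S \<infinity> v"
 shows "in_Lp S \<infinity> (%x. v x $ k)"
proof -
 have "(%v :: 'b^'n. v $ k) \<in> bm borel" by (intro borel_measurable_continuous_onI continuous_intros)
 moreover have "v \<in> bm (lon S)" using assms by (simp add: in_Linf_iff)
 ultimately have "(%x. v x $ k) \<in> bm (lon S)" by (rule measurable_compose[rotated])
 moreover obtain c where "AE x in lon S. norm (v x) <= c" using assms by (auto simp: in_Linf_iff)
 then have "AE x in lon S. norm (v x $ k) <= c" by eventually_elim (rule order_trans[OF Finite_Cartesian_Product.norm_nth_le])
 ultimately show ?thesis by (auto simp: in_Linf_iff)
qed

section \<open>Convection terms and skew symmetry of the trilinear form\<close>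

lemma convection_bounds:
 fixes u v :: "real^'d::finite => real^'d"
 assumes Om: "open Om" and v: "in_H Om 1 v" and u: "in_Lp Om \<infinity> u"
 shows "in_Lp Om 2 (convection Om u v)" "nrm Om (convection Om u v) <= sn Om u * nrm Om (grad Om v)"
proof -
 note g = grad_in_L2(1)[OF Om v]
 have m: "(%x. grad Om v x *v u x) \<in> bm (lon Om)" using g u by (intro borel_measurable_matrix_vector_mult) (auto simp: in_L2_iff in_Linf_iff)
 have le: "norm (A *v b) <= norm b * norm A" for A :: "real^'d^'d" and b using norm_matrix_vector_mult_le[of A b] by (simp add: mult.commute)
 show "in_Lp Om 2 (convection Om u v)" "nrm Om (convection Om u v) <= sn Om u * nrm Om (grad Om v)" unfolding convection_def[abs_def] using in_L2_Linf_mult[OF u g, where bop="%b A. A *v b", OF m le] by auto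
qed

lemma convection_bounds2:
 fixes u v :: "real^'d::finite => real^'d"
 assumes v: "in_Lp Om \<infinity> (grad Om v)" and u: "in_Lp Om 2 u"
 shows "in_Lp Om 2 (convection Om u v)" "nrm Om (convection Om u v) <= sn Om (grad Om v) * nrm Om u"
proof -
 have m: "(%x. grad Om v x *v u x) \<in> bm (lon Om)" using v u by (intro borel_measurable_matrix_vector_mult) (auto simp: in_L2_iff in_Linf_iff)
 show "in_Lp Om 2 (convection Om u v)" "nrm Om (convection Om u v) <= sn Om (grad Om v) * nrm Om u" unfolding convection_def[abs_def] using in_L2_Linf_mult[OF v u, where bop="(*v)", OF m norm_matrix_vector_mult_le] by auto
qed

lemma divergence_mult_bounds:
 fixes u v :: "real^'d::finite => real^'d"
 assumes Om: "open Om" and u: "in_H Om 1 u" and v: "in_Lp Om \<infinity> v"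
 shows "in_Lp Om 2 (%x. (1/2 * dv Om u x) *. v x)"
  "nrm Om (%x. (1/2 * dv Om u x) *. v x) <= 1/2*(sn Om v * nrm Om (dv Om u))"
proof -
 note d = divergence_in_L2(1)[OF Om u]
 have m: "(%x. dv Om u x *. v x) \<in> bm (lon Om)" using d v by (auto simp: in_L2_iff in_Linf_iff)
 have *: "in_Lp Om 2 (%x. dv Om u x *. v x)"
  "nrm Om (%x. dv Om u x *. v x) <= sn Om v * nrm Om (dv Om u)" using in_L2_Linf_mult[OF v d, where bop="%b a. a *. b", OF m] by auto
 show "in_Lp Om 2 (%x. (1/2 * dv Om u x) *. v x)" using in_L2_scaleR[OF *(1), of "1/2"] by simp
 show "nrm Om (%x. (1/2 * dv Om u x) *. v x) <= 1/2*(sn Om v * nrm Om (dv Om u))" using L2_norm_scaleR[of Om "1/2" "%x. dv Om u x *. v x"] *(2) by simp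
qed

lemma trilinear_split:
 fixes u v w :: "real^'d::finite => real^'d"
 assumes "in_Lp Om 2 (convection Om u v)" "in_Lp Om 2 (%x. (1/2 * dv Om u x) *. v x)" "in_Lp Om 2 w"
 shows "trilinear Om u v w = ip Om (convection Om u v) w+ip Om (%x. (1/2 * dv Om u x) *. v x) w" unfolding trilinear_def by (rule L2_inner_add_left[OF assms])

lemma L2_inner_eq_sum:
 fixes f g :: "real^'d::finite => real^'d"
 assumes "in_Lp Om 2 f" "in_Lp Om 2 g"
 shows "ip Om f g = (\<Sum>k\<in>UNIV. ip Om (%x. f x $ k) (%x. g x $ k))" unfolding L2_inner_def inner_vec_def by (rule Bochner_Integration.integral_sum) (rule integrable_inner_L2[OF in_Lp_nth(1)[OF assms(1)] in_Lp_nth(1)[OF assms(2)]])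

text \<open>For all indices \<open>i\<close>, \<open>k\<close> the integral of the i-th partial of
  \<open>u_i v_k w_k\<close> vanishes, because \<open>u_i\<close> has zero trace and
  \<open>v_k w_k\<close> has a weak derivative. The half divergence splits the term with the
  derivative of \<open>u_i\<close> evenly, so the sum over the indices is the sum of the two
  forms.\<close>

theorem trilinear_skew:
 fixes u v w :: "real^'d::finite => real^'d"
 assumes Om: "open Om" and u: "in_H10 Om u" "in_Lp Om \<infinity> u" and v: "in_H10 Om v" "in_Lp Om \<infinity> v"
  and w: "in_H Om 1 w" "in_Lp Om \<infinity> w"
 shows "trilinear Om u v w = - trilinear Om u w v"
proof -
 note hu = in_H10_in_H1[OF u(1)] and hv = in_H10_in_H1[OF v(1)]
 have L2: "in_Lp Om 2 u" "in_Lp Om 2 v" "in_Lp Om 2 w" using in_W_self(1)[OF Om] hu hv w(1) by blast+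
 have D2: "in_Lp Om 2 (%x. wd Om [i] z x $ k)" if "in_H Om 1 z" for z :: "real^'d => real^'d" and i k by (rule in_Lp_nth(1)[OF in_W_weak_deriv(3)[OF Om that]]) auto
 have core: "(LINT x|lon Om. (wd Om [i] u x $ i)*(v x $ k * w x $ k))
  + (LINT x|lon Om. u x $ i * wd Om [i] v x $ k * w x $ k)
  + (LINT x|lon Om. u x $ i * wd Om [i] w x $ k * v x $ k) = 0"
  (is "?A + ?B + ?C = 0")
  and int1: "integrable (lon Om) (%x. (wd Om [i] u x $ i)*(v x $ k * w x $ k))"
  and int2: "integrable (lon Om) (%x. u x $ i * wd Om [i] v x $ k * w x $ k)"
  and int3: "integrable (lon Om) (%x. u x $ i * wd Om [i] w x $ k * v x $ k)"
  for i k
 proof -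
  note P = has_weak_deriv_product[OF Om in_H10_zero_trace[OF Om v(1), of i k] in_Linf_nth[OF v(2)]
  has_weak_deriv_nth[OF Om w(1), of i k] in_Lp_nth(1)[OF L2(3)] in_Linf_nth[OF w(2)] D2[OF w(1)]]
  have s1: "in_Lp Om 2 (%x. wd Om [i] v x $ k * w x $ k)" by (rule L2_Linf_mult_real(2)[OF in_Linf_nth[OF w(2)] D2[OF hv]])
  have s2: "in_Lp Om 2 (%x. v x $ k * wd Om [i] w x $ k)" by (rule L2_Linf_mult_real(1)[OF in_Linf_nth[OF v(2)] D2[OF w(1)]])
  note ui = in_Lp_nth(1)[OF L2(1), of i]
  show i1: "integrable (lon Om) (%x. (wd Om [i] u x $ i)*(v x $ k * w x $ k))" using integrable_inner_L2[OF D2[OF hu] P(2)] by simp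
  show i2: "integrable (lon Om) (%x. u x $ i * wd Om [i] v x $ k * w x $ k)" using integrable_inner_L2[OF ui s1] by (simp add: mult.assoc)
  show i3: "integrable (lon Om) (%x. u x $ i * wd Om [i] w x $ k * v x $ k)" using integrable_inner_L2[OF ui s2] by (simp add: mult_ac)
  have "ip Om (%x. wd Om [i] u x $ i) (%x. v x $ k * w x $ k)
  + ip Om (%x. u x $ i) (%x. wd Om [i] v x $ k * w x $ k+v x $ k * wd Om [i] w x $ k) = 0" by (rule zero_trace_by_parts[OF Om in_H10_zero_trace[OF Om u(1)] P])
  then show "?A + ?B + ?C = 0" unfolding L2_inner_add_right[OF s1 s2 ui] by (simp add: L2_inner_def mult_ac)
 qed
 have tri: "trilinear Om u a b = (\<Sum>k\<in>UNIV. \<Sum>i\<in>UNIV. (LINT x|lon Om. u x $ i * wd Om [i] a x $ k * b x $ k)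
  + 1/2*(LINT x|lon Om. (wd Om [i] u x $ i)*(a x $ k * b x $ k)))"
  if ha: "in_H Om 1 a" and ab: "in_Lp Om \<infinity> a" "in_Lp Om 2 b"
  and i1: "!!i k. integrable (lon Om) (%x. (wd Om [i] u x $ i)*(a x $ k * b x $ k))"
  and i2: "!!i k. integrable (lon Om) (%x. u x $ i * wd Om [i] a x $ k * b x $ k)"
  for a b :: "real^'d => real^'d"
 proof -
  have "trilinear Om u a b = (LINT x|lon Om. (\<Sum>k\<in>UNIV. \<Sum>i\<in>UNIV. u x $ i * wd Om [i] a x $ k * b x $ k
  + 1/2*((wd Om [i] u x $ i)*(a x $ k * b x $ k))))" unfolding trilinear_def L2_inner_def convection_def divergence_def
  proof (rule Bochner_Integration.integral_cong[OF refl])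
  fix x
  show "(grad Om a x *v u x+(1/2*(\<Sum>i\<in>UNIV. wd Om [i] u x $ i)) *. a x) \<bullet> b x
  = (\<Sum>k\<in>UNIV. \<Sum>i\<in>UNIV. u x $ i * wd Om [i] a x $ k * b x $ k+1/2*((wd Om [i] u x $ i)*(a x $ k * b x $ k)))" by (simp add: inner_vec_def matrix_vector_mult_def grad_nth sum_distrib_left sum_distrib_right sum.distrib algebra_simps)
  qed
  also have "... = (\<Sum>k\<in>UNIV. \<Sum>i\<in>UNIV. (LINT x|lon Om. u x $ i * wd Om [i] a x $ k * b x $ k)
  + 1/2*(LINT x|lon Om. (wd Om [i] u x $ i)*(a x $ k * b x $ k)))" using i1 i2 by (simp add: Bochner_Integration.integral_sum)
  finally show ?thesis .
 qed
 have int1': "integrable (lon Om) (%x. (wd Om [i] u x $ i)*(w x $ k * v x $ k))" for i k using int1[of i k] by (simp add: mult.commute[of "w _ $ k"])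
 have "trilinear Om u v w+trilinear Om u w v = (\<Sum>k\<in>UNIV. \<Sum>i\<in>UNIV.
  (LINT x|lon Om. (wd Om [i] u x $ i)*(v x $ k * w x $ k))
  + (LINT x|lon Om. u x $ i * wd Om [i] v x $ k * w x $ k)
  + (LINT x|lon Om. u x $ i * wd Om [i] w x $ k * v x $ k))" unfolding tri[OF hv v(2) L2(3) int1 int2] tri[OF w L2(2) int1' int3] by (simp add: sum.distrib[symmetric] mult.commute[of "w _ $ _" "v _ $ _"] algebra_simps)
 also have "... = 0" by (simp add: core)
 finally show ?thesis by simp
qed

lemma pressure_by_parts:
 fixes v :: "real^'d::finite => real^'d"
 assumes Om: "open Om" and v: "in_H10 Om v" and p: "in_H Om 1 p"
 shows "in_Lp Om 2 (grad_scalar Om p)" "ip Om (grad_scalar Om p) v = - ip Om (dv Om v) p"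
proof -
 note hv = in_H10_in_H1[OF v]
 have v2: "in_Lp Om 2 v" by (rule in_W_self(1)[OF Om hv]) simp
 have p2: "in_Lp Om 2 p" by (rule in_W_self(1)[OF Om p]) simp
 have w: "in_Lp Om 2 (wd Om [i] p)" for i by (rule in_W_weak_deriv(3)[OF Om p]) auto
 have D2: "in_Lp Om 2 (%x. wd Om [i] v x $ k)" for i k by (rule in_Lp_nth(1)[OF in_W_weak_deriv(3)[OF Om hv]]) auto
 have "in_Lp Om 2 (%x. \<Sum>i\<in>UNIV. wd Om [i] p x *. axis i (1::real))"
 proof (intro in_L2_sum)
  fix i
  have "(%x. wd Om [i] p x *. axis i (1::real)) \<in> bm (lon Om)" using w[of i] by (auto simp: in_L2_iff)
  then show "in_Lp Om 2 (%x. wd Om [i] p x *. axis i (1::real))" by (rule in_L2_dominated[OF _ w[of i], where c=1]) simp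
 qed
 also have "(%x. \<Sum>i\<in>UNIV. wd Om [i] p x *. axis i (1::real)) = grad_scalar Om p" by (rule ext) (simp add: vec_eq_iff grad_scalar_def axis_def if_distrib[of "%c. _ * c"] cong: if_cong)
 finally show g: "in_Lp Om 2 (grad_scalar Om p)" .
 have "ip Om (grad_scalar Om p) v = (\<Sum>i\<in>UNIV. ip Om (%x. v x $ i) (wd Om [i] p))" unfolding L2_inner_eq_sum[OF g v2] by (simp add: grad_scalar_def L2_inner_commute)
 also have "... = (\<Sum>i\<in>UNIV. - ip Om (%x. wd Om [i] v x $ i) p)"
 proof (intro sum.cong refl)
  fix i
  have "hwd Om [i] p (wd Om [i] p)" by (rule in_W_weak_deriv(1)[OF Om p]) simp
  from zero_trace_by_parts[OF Om in_H10_zero_trace[OF Om v] this p2 w, of i]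
  show "ip Om (%x. v x $ i) (wd Om [i] p) = - ip Om (%x. wd Om [i] v x $ i) p" by simp
 qed
 also have "... = - ip Om (dv Om v) p"
 proof -
  have "ip Om (dv Om v) p = (\<Sum>i\<in>UNIV. ip Om (%x. wd Om [i] v x $ i) p)" unfolding L2_inner_def divergence_def using integrable_inner_L2[OF D2 p2] by (simp add: sum_distrib_right Bochner_Integration.integral_sum)
  then show ?thesis by (simp add: sum_negf)
 qed
 finally show "ip Om (grad_scalar Om p) v = - ip Om (dv Om v) p" .
qed

section \<open>A discrete Sobolev inequality\<close>

lemma L2_norm_translate:
 fixes g :: "'a::euclidean_space => 'b::euclidean_space"
 assumes "g \<in> bm borel"
 shows "nrm UNIV (%x. g (y+x)) = nrm UNIV g"
proof -
 have "(%x. g x \<bullet> g x) \<in> bm borel" using assms by measurable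
 from lebesgue_integral_translate[OF this, of y] show ?thesis by (simp add: L2_norm_def L2_inner_def lebesgue_on_UNIV_eq)
qed

lemma test_translate_in_L2:
 fixes fi :: "real^'d::finite => real"
 assumes "tf Om fi"
 shows "in_Lp UNIV 2 (%x. fi (y+x))"
proof -
 have b [measurable]: "fi \<in> bm borel" by (rule test_borel[OF assms])
 have "integrable lebesgue (%x. (norm (fi x))\<^sup>2)" using test_in_L2[OF assms, of UNIV] by (simp add: in_L2_iff lebesgue_on_UNIV_eq)
 then have "integrable lborel (%x. (norm (fi x))\<^sup>2)" by (subst (asm) integrable_completion) auto
 then have "integrable (distr lborel borel ((+) y)) (%x. (norm (fi x))\<^sup>2)" by (simp add: lborel_distr_plus)
 then have "integrable lborel (%x. (norm (fi (y+x)))\<^sup>2)" by (subst (asm) integrable_distr_eq) auto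
 then have "integrable lebesgue (%x. (norm (fi (y+x)))\<^sup>2)" by (subst integrable_completion) auto
 moreover have "(%x. fi (y+x)) \<in> bm lebesgue" by (rule measurable_completion) measurable
 ultimately show ?thesis by (simp add: in_L2_iff lebesgue_on_UNIV_eq)
qed

text \<open>Cut the translation into \<open>N\<close> steps of length \<open>1/N\<close>. All
  increments are translates of the first, so the norm is at most that of the difference quotient of
  step \<open>1/N\<close>, and these quotients converge in \<open>L2\<close> to the directional
  derivative.\<close>

lemma test_translation_estimate:
 fixes fi :: "real^'d::finite => real"
 assumes fi: "tf Om fi"
 shows "nrm UNIV (%x. fi (y+x)-fi x) <= (\<Sum>i\<in>UNIV. \<bar>y $ i\<bar> * nrm UNIV (pd [i] fi))"
proof -
 define t where "t n = inverse (real (Suc n))" for n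
 have t: "0 < t n" "t n <= 1" for n by (simp_all add: t_def inverse_eq_divide)
 define Q where "Q n x = (fi (t n *. y+x)-fi x)/t n" for n x
 define D where "D x = (\<Sum>i\<in>UNIV. y $ i * pd [i] fi x)" for x
 obtain L a b where L: "!!x t. 0 < t ==> t <= 1 ==> \<bar>(fi (t *. y+x)-fi x)/t\<bar> <= L"
  and z: "!!x t. 0 < t ==> t <= 1 ==> x \<notin> cbox a b ==> (fi (t *. y+x)-fi x)/t = 0"
  and lim: "!!x. (%n. Q n x) \<longlonglongrightarrow> D x" unfolding Q_def D_def t_def using test_difference_quotient[OF fi, of y] by blast
 note p2 = test_in_L2[OF test_partials[OF fi], of UNIV]
 have Di: "in_Lp UNIV 2 (%x. y $ i * pd [i] fi x)" for i using p2 by (intro in_L2_mult_left) (simp del: partials.simps)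
 have D2: "in_Lp UNIV 2 D" unfolding D_def[abs_def] by (intro in_L2_sum Di)
 have Q2: "in_Lp UNIV 2 (Q n)" for n using in_L2_mult_left[OF in_L2_diff[OF test_translate_in_L2[OF fi, of "t n *. y"] test_translate_in_L2[OF fi, of 0]], of "inverse (t n)"] by (simp add: Q_def[abs_def] field_simps)
 have bound: "nrm UNIV (%x. fi (y+x)-fi x) <= nrm UNIV (Q n)" for n
 proof -
  define N where "N = Suc n"
  have N: "real N * t n = 1" by (simp add: N_def t_def)
  define g where "g x = fi (t n *. y+x)-fi x" for x
  have gb: "g \<in> bm borel" unfolding g_def using test_borel[OF fi] by measurable
  have g2: "in_Lp UNIV 2 (%x. g (z+x))" for z using in_L2_diff[OF test_translate_in_L2[OF fi, of "t n *. y+z"] test_translate_in_L2[OF fi, of z]] by (simp add: g_def add.assoc)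
  have "fi (y+x)-fi x = (\<Sum>k<N. g ((real k * t n) *. y+x))" for x
  proof -
  have "(\<Sum>k<N. g ((real k * t n) *. y+x)) = (\<Sum>k<N. fi ((real (Suc k) * t n) *. y+x)-fi ((real k * t n) *. y+x))" by (intro sum.cong refl) (simp add: g_def algebra_simps)
  also have "... = fi ((real N * t n) *. y+x)-fi ((real 0 * t n) *. y+x)" by (rule sum_lessThan_telescope)
  finally show ?thesis using N by simp
  qed
  then have "nrm UNIV (%x. fi (y+x)-fi x) <= (\<Sum>k<N. nrm UNIV (%x. g ((real k * t n) *. y+x)))" using L2_norm_sum[of "{..<N}" UNIV "%k x. g ((real k * t n) *. y+x)"] g2 by simp
  also have "... = real N * nrm UNIV g" by (simp add: L2_norm_translate[OF gb])
  also have "... = nrm UNIV (%x. real N *. g x)" by (simp only: L2_norm_scaleR)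
  also have "(%x. real N *. g x) = Q n"
  proof
  fix x
  have "real N = 1/t n" using N t(1)[of n] by (simp add: field_simps)
  then show "real N *. g x = Q n x" by (simp add: Q_def g_def)
  qed
  finally show ?thesis .
 qed
 have "(%n. nrm UNIV (%x. Q n x-D x)) \<longlonglongrightarrow> 0"
 proof (rule L2_norm_tendsto_0)
  obtain B where B: "!!x. \<bar>D x\<bar> <= B"
  proof -
  have "tf Om D" unfolding D_def[abs_def] using test_scaleR2[OF smooth_const test_partials[OF fi]] by (intro test_sum) (simp del: partials.simps)
  then show thesis using test_bounded that by (metis real_norm_def)
  qed
  have Lnn: "0 <= L" using L[OF t, of 0 0] by linarith
  let ?w = "%x. L * ind (cbox a b) x+\<bar>D x\<bar>"
  have "in_Lp UNIV 2 (%x. L * ind (cbox a b) x :: real)" unfolding in_L2_iff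
  proof
  show m: "(%x. L * ind (cbox a b) x :: real) \<in> bm (lon UNIV)" by (intro measurable_restrict_space1 borel_measurable_times borel_measurable_indicator borel_measurable_const) auto
  show "integrable (lon UNIV) (%x. (norm (L * ind (cbox a b) x :: real))\<^sup>2)" by (rule bounded_support_integrable[where B="L\<^sup>2" and a=a and b=b,
  OF borel_measurable_power[OF measurable_compose[OF m borel_measurable_norm]]])
  (auto simp: indicator_def)
  qed
  moreover have "in_Lp UNIV 2 (%x. \<bar>D x\<bar>)" using D2 by (auto simp: in_L2_iff)
  ultimately show "in_Lp UNIV 2 ?w" by (rule in_L2_add)
  show "(%x. Q n x-D x) \<in> bm (lon UNIV)" for n using in_L2_diff[OF Q2[of n] D2] by (simp add: in_L2_iff)
  show "AE x in lon UNIV. norm (Q n x-D x) <= norm (?w x)" for n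
  proof (rule AE_I2)
  fix x
  have "\<bar>Q n x\<bar> <= L * ind (cbox a b) x" using L[OF t, of n x] z[OF t, of x n] unfolding Q_def by (cases "x \<in> cbox a b") auto
  moreover have "0 <= L * ind (cbox a b) x" using Lnn by simp
  ultimately show "norm (Q n x-D x) <= norm (?w x)" unfolding real_norm_def by linarith
  qed
  show "AE x in lon UNIV. (%n. Q n x-D x) \<longlonglongrightarrow> 0"
  proof (rule AE_I2)
  fix x
  show "(%n. Q n x-D x) \<longlonglongrightarrow> 0" using tendsto_diff[OF lim tendsto_const[of "D x"], of x] by simp
  qed
 qed
 then have "(%n. nrm UNIV D+nrm UNIV (%x. Q n x-D x)) \<longlonglongrightarrow> nrm UNIV D+0" by (intro tendsto_intros)
 moreover have "nrm UNIV (%x. fi (y+x)-fi x) <= nrm UNIV D+nrm UNIV (%x. Q n x-D x)" for n using bound[of n] L2_norm_triangle[OF D2 in_L2_diff[OF Q2[of n] D2]] by simp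
 ultimately have "nrm UNIV (%x. fi (y+x)-fi x) <= nrm UNIV D+0" by (intro LIMSEQ_le_const) blast+
 also have "... <= (\<Sum>i\<in>UNIV. nrm UNIV (%x. y $ i * pd [i] fi x))" unfolding D_def[abs_def] using L2_norm_sum[of UNIV UNIV "%i x. y $ i * pd [i] fi x"] Di by simp
 also have "... = (\<Sum>i\<in>UNIV. \<bar>y $ i\<bar> * nrm UNIV (pd [i] fi))" using L2_norm_scaleR[of UNIV "y $ _" "pd [_] fi"] by (simp del: partials.simps)
 finally show ?thesis .
qed

section \<open>The mass of a function on a small set\<close>

lemma L2_norm_sq_support:
 fixes f :: "'a::euclidean_space => 'b::euclidean_space"
 assumes "S \<in> sets lebesgue"
 shows "(nrm S f)\<^sup>2 = (LINT x|lebesgue. ind S x * (norm (f x))\<^sup>2)" unfolding L2_norm_sq using assms by (subst integral_restrict_space) auto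

text \<open>The local norm is compared with its average over a grid of disjoint translates of the set \<open>A\<close>.\<close>

lemma test_local_estimate:
 fixes fi :: "real^'d::finite => real"
 assumes fi: "tf Om fi" and Ab: "A \<in> sets borel" and h: "h > 0" and m: "m \<ge> (1::nat)"
  and diam: "!!x y. x \<in> A ==> y \<in> A ==> norm (x-y) <= h"
 shows "(nrm A fi)\<^sup>2 <= 2*(2 * h * real m * (\<Sum>i\<in>UNIV. nrm UNIV (pd [i] fi)))\<^sup>2
  + 2/real m ^ CARD('d)*(nrm UNIV fi)\<^sup>2"
proof -
 have A: "A \<in> sets lebesgue" using Ab by simp
 \<comment> \<open>The grid has \<open>m\<close> points per direction with spacing
   \<open>2 h\<close>, twice the diameter bound for \<open>A\<close>; this is what separates the
   translates.\<close>
 define Y where "Y = (%al. \<chi> i. 2 * h * real (al i)) ` (PiE UNIV (%_ :: 'd. {..<m}))"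
 have inj: "inj_on (%al. \<chi> i. 2 * h * real (al i)) (PiE UNIV (%_ :: 'd. {..<m}))" using h by (auto simp: inj_on_def vec_eq_iff)
 have card: "card Y = m ^ CARD('d)" unfolding Y_def card_image[OF inj] by (simp add: card_PiE)
 have fin: "finite Y" unfolding Y_def by (intro finite_imageI finite_PiE) auto
 have Yb: "\<bar>y $ i\<bar> <= 2 * h * real m" if "y \<in> Y" for y i using that h by (auto simp: Y_def abs_mult PiE_iff intro!: mult_left_mono less_imp_le)
 have sep: "x+y ~= x'+y'" if "y \<in> Y" "y' \<in> Y" "y ~= y'" "x \<in> A" "x' \<in> A" for x x' y y'
 proof
  assume eq: "x+y = x'+y'"
  obtain al \<beta> where ab: "y = (\<chi> i. 2 * h * real (al i))" "y' = (\<chi> i. 2 * h * real (\<beta> i))" using \<open>y \<in> Y\<close> \<open>y' \<in> Y\<close> unfolding Y_def by blast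
  with \<open>y ~= y'\<close> obtain i where i: "al i ~= \<beta> i" by (metis ext)
  then have "1 <= \<bar>real (al i)-real (\<beta> i)\<bar>" by linarith
  then have "2 * h * 1 <= 2 * h * \<bar>real (al i)-real (\<beta> i)\<bar>" using h by (intro mult_left_mono) auto
  also have "... = \<bar>y $ i-y' $ i\<bar>" using h by (simp add: ab abs_mult right_diff_distrib[symmetric])
  also have "y $ i-y' $ i = (x'-x) $ i" using arg_cong[OF eq, of "%v. v $ i"] by simp
  also have "\<bar>(x'-x) $ i\<bar> <= norm (x'-x)" using Finite_Cartesian_Product.norm_nth_le[of "x'-x" i] by simp
  also have "... <= h" using diam that by blast
  finally show False using h by simp
 qed
 let ?G = "\<Sum>i\<in>UNIV. nrm UNIV (pd [i] fi)"
 have G0: "0 <= ?G" by (intro sum_nonneg) simp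
 have bm [measurable]: "fi \<in> bm borel" by (rule test_borel[OF fi])
 have p2: "in_Lp UNIV 2 fi" by (rule test_in_L2[OF fi]) simp
 have isq: "integrable lebesgue (%x. ind B x * (f x)\<^sup>2)" if "in_Lp UNIV 2 f" "B \<in> sets lebesgue" for f :: "real^'d => real" and B
 proof -
  have i: "integrable lebesgue (%x. (f x)\<^sup>2)" using that(1) by (simp add: in_L2_iff lebesgue_on_UNIV_eq)
  show ?thesis by (rule Bochner_Integration.integrable_bound[OF i])
  (use that(2) borel_measurable_integrable[OF i] in \<open>auto simp: indicator_def intro!: borel_measurable_times borel_measurable_indicator\<close>)
 qed
 define I where "I B = (LINT x|lebesgue. ind B x * (fi x)\<^sup>2)" for B
 have one: "(nrm A fi)\<^sup>2 <= 2*(2 * h * real m * ?G)\<^sup>2+2*(LINT x|lebesgue. ind A x * (fi (y+x))\<^sup>2)"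
  if y: "y \<in> Y" for y
 proof -
  note t2 = test_translate_in_L2[OF fi, of y]
  note d2 = in_L2_diff[OF t2 p2]
  have "(nrm A fi)\<^sup>2 = (LINT x|lebesgue. ind A x * (fi x)\<^sup>2)" by (simp add: L2_norm_sq_support[OF A])
  also have "... <= (LINT x|lebesgue. 2*(ind UNIV x * (fi (y+x)-fi x)\<^sup>2)+2*(ind A x * (fi (y+x))\<^sup>2))"
  proof (rule integral_mono)
  show "integrable lebesgue (%x. ind A x * (fi x)\<^sup>2)" by (rule isq[OF p2 A])
  show "integrable lebesgue (%x. 2*(ind UNIV x * (fi (y+x)-fi x)\<^sup>2)+2*(ind A x * (fi (y+x))\<^sup>2))" by (intro Bochner_Integration.integrable_add integrable_mult_right isq[OF d2] isq[OF t2] A) auto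
  fix x
  have "(a :: real)\<^sup>2 <= 2*(b-a)\<^sup>2+2 * b\<^sup>2" for a b using zero_le_power2[of "a-2 * b"] by (simp add: power2_eq_square algebra_simps)
  then show "ind A x * (fi x)\<^sup>2 <= 2*(ind UNIV x * (fi (y+x)-fi x)\<^sup>2)+2*(ind A x * (fi (y+x))\<^sup>2)" by (auto simp: indicator_def)
  qed
  also have "... = 2*(nrm UNIV (%x. fi (y+x)-fi x))\<^sup>2+2*(LINT x|lebesgue. ind A x * (fi (y+x))\<^sup>2)" using isq[OF d2, of UNIV] isq[OF t2 A] by (simp add: L2_norm_sq_support)
  also have "(nrm UNIV (%x. fi (y+x)-fi x))\<^sup>2 <= (2 * h * real m * ?G)\<^sup>2"
  proof (rule power_mono)
  have "nrm UNIV (%x. fi (y+x)-fi x) <= (\<Sum>i\<in>UNIV. \<bar>y $ i\<bar> * nrm UNIV (pd [i] fi))" by (rule test_translation_estimate[OF fi])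
  also have "... <= (\<Sum>i\<in>UNIV. (2 * h * real m) * nrm UNIV (pd [i] fi))" by (intro sum_mono mult_right_mono Yb[OF y]) simp
  finally show "nrm UNIV (%x. fi (y+x)-fi x) <= 2 * h * real m * ?G" by (simp add: sum_distrib_left)
  qed simp
  finally show ?thesis by simp
 qed
 have shift: "(\<Sum>y\<in>Y. LINT x|lebesgue. ind A x * (fi (y+x))\<^sup>2) <= (nrm UNIV fi)\<^sup>2"
 proof -
  have eq: "(LINT x|lebesgue. ind A x * (fi (y+x))\<^sup>2) = (LINT x|lebesgue. ind ((+) y ` A) x * (fi x)\<^sup>2)" for y
  proof -
  note [measurable] = Ab
  have ind: "ind ((+) y ` A) x = (ind A (x-y) :: real)" for x by (auto simp: indicator_def image_iff) (metis add_diff_cancel_left' diff_add_cancel add.commute)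
  have "(%x. ind A (x-y)*(fi x)\<^sup>2) \<in> bm borel" by measurable
  from lebesgue_integral_translate[OF this, of y] show ?thesis unfolding ind by simp
  qed
  have Am: "(+) y ` A \<in> sets lebesgue" for y by (rule lebesgue_sets_translation[OF A])
  have "(\<Sum>y\<in>Y. LINT x|lebesgue. ind A x * (fi (y+x))\<^sup>2) = (LINT x|lebesgue. (\<Sum>y\<in>Y. ind ((+) y ` A) x * (fi x)\<^sup>2))" unfolding eq using isq[OF p2 Am] by (subst Bochner_Integration.integral_sum) auto
  also have "... <= (LINT x|lebesgue. ind UNIV x * (fi x)\<^sup>2)"
  proof (rule integral_mono)
  show "integrable lebesgue (%x. \<Sum>y\<in>Y. ind ((+) y ` A) x * (fi x)\<^sup>2)" using isq[OF p2 Am] by auto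
  show "integrable lebesgue (%x. ind UNIV x * (fi x)\<^sup>2)" by (rule isq[OF p2]) simp
  fix x
  have "(\<Sum>y\<in>Y. ind ((+) y ` A) x) <= (1 :: real)"
  proof (cases "\<exists>y\<in>Y. x \<in> (+) y ` A")
  case True
  then obtain y where y: "y \<in> Y" "x \<in> (+) y ` A" by blast
  have z: "ind ((+) y' ` A) x = (0 :: real)" if "y' \<in> Y - {y}" for y'
  proof -
  have "x \<notin> (+) y' ` A" using sep[of y y'] that y by (auto simp: add.commute)
  then show ?thesis by simp
  qed
  have "(\<Sum>y\<in>Y. ind ((+) y ` A) x) = ind ((+) y ` A) x+(\<Sum>y\<in>Y - {y}. ind ((+) y ` A) x :: real)" by (rule sum.remove[OF fin y(1)])
  also have "(\<Sum>y\<in>Y - {y}. ind ((+) y ` A) x :: real) = 0" using z by (intro sum.neutral) blast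
  finally show ?thesis by (simp add: indicator_def)
  next
  case False
  then have "(\<Sum>y\<in>Y. ind ((+) y ` A) x) = (0 :: real)" by (intro sum.neutral) auto
  then show ?thesis by simp
  qed
  then have "(\<Sum>y\<in>Y. ind ((+) y ` A) x)*(fi x)\<^sup>2 <= 1*(fi x)\<^sup>2" by (intro mult_right_mono) auto
  then show "(\<Sum>y\<in>Y. ind ((+) y ` A) x * (fi x)\<^sup>2) <= ind UNIV x * (fi x)\<^sup>2" by (simp add: sum_distrib_right)
  qed
  also have "... = (nrm UNIV fi)\<^sup>2" by (simp add: L2_norm_sq_support)
  finally show ?thesis .
 qed
 have M0: "real m ^ CARD('d) > 0" using m by simp
 have "real m ^ CARD('d)*(nrm A fi)\<^sup>2 = (\<Sum>y\<in>Y. (nrm A fi)\<^sup>2)" by (simp add: card)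
 also have "... <= (\<Sum>y\<in>Y. 2*(2 * h * real m * ?G)\<^sup>2+2*(LINT x|lebesgue. ind A x * (fi (y+x))\<^sup>2))" by (intro sum_mono one)
 also have "... = real m ^ CARD('d)*(2*(2 * h * real m * ?G)\<^sup>2)+2*(\<Sum>y\<in>Y. LINT x|lebesgue. ind A x * (fi (y+x))\<^sup>2)" by (simp add: sum.distrib card sum_distrib_left)
 also have "... <= real m ^ CARD('d)*(2*(2 * h * real m * ?G)\<^sup>2)+2*(nrm UNIV fi)\<^sup>2" using shift by simp
 also have "... = real m ^ CARD('d)*(2*(2 * h * real m * ?G)\<^sup>2+2/real m ^ CARD('d)*(nrm UNIV fi)\<^sup>2)" using M0 by (simp add: distrib_left)
 finally show ?thesis using M0 by (simp only: mult_le_cancel_left_pos)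
qed

lemma L2_norm_subset:
 fixes f :: "'a::euclidean_space => 'b::euclidean_space"
 assumes A: "A \<in> sets lebesgue" "Om \<in> sets lebesgue" "A <= Om" and f: "in_Lp Om 2 f"
 shows "in_Lp A 2 f" "nrm A f <= nrm Om f"
proof -
 have i: "integrable lebesgue (%x. ind Om x * (norm (f x))\<^sup>2)" using f A by (simp add: in_L2_iff integrable_restrict_space)
 have m: "f \<in> bm (lon A)" using f A(3) by (auto simp: in_L2_iff intro: measurable_restrict_mono)
 have i2: "integrable lebesgue (%x. ind A x * (norm (f x))\<^sup>2)"
 proof (rule Bochner_Integration.integrable_bound[OF i])
  have "(%x. (norm (f x))\<^sup>2) \<in> bm (lon A)" using m by simp
  from lebesgue_measurable_extend[OF this A(1)]
  show "(%x. ind A x * (norm (f x))\<^sup>2) \<in> bm lebesgue" by simp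
 qed (use A(3) in \<open>auto simp: indicator_def\<close>)
 then show "in_Lp A 2 f" using m A(1) by (simp add: in_L2_iff integrable_restrict_space)
 have "(nrm A f)\<^sup>2 <= (nrm Om f)\<^sup>2" unfolding L2_norm_sq_support[OF A(1)] L2_norm_sq_support[OF A(2)] by (rule integral_mono[OF i2 i]) (use A(3) in \<open>auto simp: indicator_def\<close>)
 then show "nrm A f <= nrm Om f" by (rule power2_le_imp_le) simp
qed

lemma L2_norm_sq_components:
 fixes f :: "real^'d::finite => real^'d"
 assumes "in_Lp Om 2 f"
 shows "(nrm Om f)\<^sup>2 = (\<Sum>k\<in>UNIV. (nrm Om (%x. f x $ k))\<^sup>2)" using L2_inner_eq_sum[OF assms assms] by (simp add: L2_norm_sq_inner)

lemma L2_norm_tendsto: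
 assumes f: "in_Lp S 2 f" and fn: "!!n. in_Lp S 2 (fn n)"
  and lim: "(%n. nrm S (%x. f x-fn n x)) \<longlonglongrightarrow> 0"
 shows "(%n. nrm S (fn n)) \<longlonglongrightarrow> nrm S f"
proof -
 have "(%n. nrm S (fn n)-nrm S f) \<longlonglongrightarrow> 0"
 proof (rule Lim_null_comparison[OF always_eventually lim], rule allI)
  fix n
  show "norm (nrm S (fn n)-nrm S f) <= nrm S (%x. f x-fn n x)" using L2_norm_triangle[OF in_L2_diff[OF f fn] fn, of n n] L2_norm_triangle_diff[OF f in_L2_diff[OF f fn], of n] by simp
 qed
 then show ?thesis by (simp add: LIM_zero_iff)
qed

lemma L2_norm_UNIV_support:
 fixes f :: "'a::euclidean_space => 'b::euclidean_space"
 assumes "S \<in> sets lebesgue" "!!x. x \<notin> S ==> f x = 0"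
 shows "nrm UNIV f = nrm S f" unfolding L2_norm_def L2_inner_def using assms by (subst integral_lebesgue_on_support) (auto simp: lebesgue_on_UNIV_eq)

text \<open>The scalar estimate is applied to the components of approximating test functions. One
  factor \<open>d\<close> counts the components, and \<open>d^2\<close> comes from bounding each
  partial by the whole gradient inside the squared sum.\<close>

lemma in_H10_local_estimate:
 fixes v :: "real^'d::finite => real^'d"
 assumes Om: "open Om" and v: "in_H10 Om v" and Ab: "A \<in> sets borel" and A2: "A <= Om" and h: "h > 0" and m: "m \<ge> (1::nat)"
  and diam: "!!x y. x \<in> A ==> y \<in> A ==> norm (x-y) <= h"
 shows "(nrm A v)\<^sup>2 <= 8 * real CARD('d)^3*(h * real m)\<^sup>2*(nrm Om (grad Om v))\<^sup>2
  + 2/real m ^ CARD('d)*(nrm Om v)\<^sup>2"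
proof -
 have A: "A \<in> sets lebesgue" "A <= Om" using Ab A2 by auto
 have S: "Om \<in> sets lebesgue" using Om by simp
 note hv = in_H10_in_H1[OF v]
 have v2: "in_Lp Om 2 v" by (rule in_W_self(1)[OF Om hv]) simp
 have w2: "in_Lp Om 2 (wd Om [i] v)" for i by (rule in_W_weak_deriv(3)[OF Om hv]) auto
 obtain fi :: "nat => real^'d => real^'d" where fi: "!!n. tf Om (fi n)"
  "(%n. nrm Om (%x. v x-fi n x)) \<longlonglongrightarrow> 0"
  "!!i. (%n. nrm Om (%x. wd Om [i] v x-pd [i] (fi n) x)) \<longlonglongrightarrow> 0" by (rule in_H10_approx[OF Om v]) blast
 note p2 = test_in_L2[OF fi(1) S] and pp2 = test_in_L2[OF test_partials[OF fi(1)] S]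
 let ?c = "2/real m ^ CARD('d)"
 have est: "(nrm A (fi n))\<^sup>2 <= real CARD('d)*(2*(2 * h * real m * (\<Sum>i\<in>UNIV. nrm Om (pd [i] (fi n))))\<^sup>2) + ?c * (nrm Om (fi n))\<^sup>2" for n
 proof -
  let ?G = "\<Sum>i\<in>UNIV. nrm Om (pd [i] (fi n))"
  have t: "tf Om (%x. fi n x $ k)" for k by (rule test_bounded_linear[OF bounded_linear_vec_nth fi(1)])
  have pt: "pd [i] (%x. fi n x $ k) = (%x. pd [i] (fi n) x $ k)" for i k by (rule partials_bounded_linear[OF bounded_linear_vec_nth test_smooth[OF fi(1)]])
  have c: "(nrm A (%x. fi n x $ k))\<^sup>2 <= 2*(2 * h * real m * ?G)\<^sup>2 + ?c * (nrm Om (%x. fi n x $ k))\<^sup>2" for k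
  proof -
  have "(nrm A (%x. fi n x $ k))\<^sup>2 <= 2*(2 * h * real m * (\<Sum>i\<in>UNIV. nrm UNIV (pd [i] (%x. fi n x $ k))))\<^sup>2
  + ?c * (nrm UNIV (%x. fi n x $ k))\<^sup>2" by (rule test_local_estimate[OF t Ab h m diam])
  also have "(2 * h * real m * (\<Sum>i\<in>UNIV. nrm UNIV (pd [i] (%x. fi n x $ k))))\<^sup>2 <= (2 * h * real m * ?G)\<^sup>2"
  proof (intro power_mono mult_left_mono sum_mono)
  fix i
  have "nrm UNIV (pd [i] (%x. fi n x $ k)) = nrm Om (pd [i] (%x. fi n x $ k))" by (rule L2_norm_UNIV_support[OF S test_eq_0[OF test_partials[OF t]]])
  also have "... <= nrm Om (pd [i] (fi n))" unfolding pt by (rule in_Lp_nth(2)[OF pp2])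
  finally show "nrm UNIV (pd [i] (%x. fi n x $ k)) <= nrm Om (pd [i] (fi n))" .
  qed (use h in \<open>auto intro!: mult_nonneg_nonneg sum_nonneg simp del: partials.simps\<close>)
  also have "nrm UNIV (%x. fi n x $ k) = nrm Om (%x. fi n x $ k)" by (rule L2_norm_UNIV_support[OF S test_eq_0[OF t]])
  finally show ?thesis by simp
  qed
  have "(nrm A (fi n))\<^sup>2 = (\<Sum>k\<in>UNIV. (nrm A (%x. fi n x $ k))\<^sup>2)" by (rule L2_norm_sq_components[OF test_in_L2[OF fi(1) A(1)]])
  also have "... <= (\<Sum>k\<in>(UNIV :: 'd set). 2*(2 * h * real m * ?G)\<^sup>2 + ?c * (nrm Om (%x. fi n x $ k))\<^sup>2)" by (intro sum_mono c)
  also have "... = real CARD('d)*(2*(2 * h * real m * ?G)\<^sup>2) + ?c * (nrm Om (fi n))\<^sup>2" unfolding L2_norm_sq_components[OF p2] by (simp add: sum.distrib sum_distrib_left)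
  finally show ?thesis .
 qed
 have lA: "(%n. nrm A (%x. v x-fi n x)) \<longlonglongrightarrow> 0" by (rule Lim_null_comparison[OF always_eventually fi(2)])
  (use L2_norm_subset(2)[OF A(1) S A(2) in_L2_diff[OF v2 p2]] in auto)
 have "(nrm A v)\<^sup>2 <= real CARD('d)*(2*(2 * h * real m * (\<Sum>i\<in>UNIV. nrm Om (wd Om [i] v)))\<^sup>2) + ?c * (nrm Om v)\<^sup>2"
 proof (rule LIMSEQ_le)
  show "(%n. (nrm A (fi n))\<^sup>2) \<longlonglongrightarrow> (nrm A v)\<^sup>2" by (intro tendsto_power L2_norm_tendsto lA L2_norm_subset(1)[OF A(1) S A(2)] v2 p2)
  show "(%n. real CARD('d)*(2*(2 * h * real m * (\<Sum>i\<in>UNIV. nrm Om (pd [i] (fi n))))\<^sup>2) + ?c * (nrm Om (fi n))\<^sup>2)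
  \<longlonglongrightarrow> real CARD('d)*(2*(2 * h * real m * (\<Sum>i\<in>UNIV. nrm Om (wd Om [i] v)))\<^sup>2) + ?c * (nrm Om v)\<^sup>2" by (intro tendsto_intros L2_norm_tendsto fi(2,3) v2 p2 w2 pp2)
 qed (use est in blast)
 also have "real CARD('d)*(2*(2 * h * real m * (\<Sum>i\<in>UNIV. nrm Om (wd Om [i] v)))\<^sup>2)
  <= real CARD('d)*(2*(2 * h * real m * (\<Sum>i\<in>(UNIV :: 'd set). nrm Om (grad Om v)))\<^sup>2)" by (intro sum_mono mult_left_mono power_mono L2_weak_deriv_le_grad[OF Om hv]) (use h in \<open>auto intro!: mult_nonneg_nonneg sum_nonneg\<close>)
 also have "real CARD('d)*(2*(2 * h * real m * (\<Sum>i\<in>(UNIV :: 'd set). nrm Om (grad Om v)))\<^sup>2)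
  = 8 * real CARD('d)^3*(h * real m)\<^sup>2*(nrm Om (grad Om v))\<^sup>2" by (simp add: power_mult_distrib power2_eq_square power3_eq_cube mult_ac)
 finally show ?thesis by simp
qed

section \<open>Finite element functions\<close>

text \<open>A Lipschitz boundary has no slits: just below a boundary point, in the graph direction
  \<open>e\<close>, lies an open set that misses \<open>Om\<close>, so the point is not interior to
  the closure. Consequently open mesh elements lie in \<open>Om\<close>, although the mesh is only
  known to cover the closure.\<close>

lemma interior_closure_lipschitz:
 fixes Om :: "(real^'d::finite) set"
 assumes Om: "open Om" and L: "lipschitz_boundary Om"
 shows "interior (closure Om) <= Om"
proof
 fix x assume x: "x \<in> interior (closure Om)"
 show "x \<in> Om"
 proof (rule ccontr)
  assume nx: "x \<notin> Om"
  then have fx: "x \<in> frontier Om" using x interior_subset[of "closure Om"] Om by (auto simp: frontier_def interior_open)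
  obtain e r L fi where conj: "norm e = 1 & r > 0 & L-lipschitz_on UNIV fi & (\<forall>y s. fi (y+s *. e) = fi y) &
  Om \<inter> ball x r = {y \<in> ball x r. fi y < y \<bullet> e}" using bspec[OF L[unfolded lipschitz_boundary_def] fx] by (elim exE) (rule that)
  note e = conj[THEN conjunct1] conj[THEN conjunct2, THEN conjunct1] conj[THEN conjunct2, THEN conjunct2, THEN conjunct1]
  conj[THEN conjunct2, THEN conjunct2, THEN conjunct2, THEN conjunct1]
  and eq = conj[THEN conjunct2, THEN conjunct2, THEN conjunct2, THEN conjunct2]
  have ge: "fi x \<ge> x \<bullet> e"
  proof (rule ccontr)
  assume "\<not> fi x \<ge> x \<bullet> e"
  then have "x \<in> {y \<in> ball x r. fi y < y \<bullet> e}" using e(2) by simp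
  with nx show False unfolding eq[symmetric] by simp
  qed
  obtain dt where dt: "dt > 0" "ball x dt <= closure Om" using x by (metis mem_interior)
  define s where "s = min dt r/2"
  have s: "s > 0" "s < dt" "s < r" using dt e(2) by (auto simp: s_def)
  define y where "y = x+(- s) *. e"
  have dy: "dist x y = s" using s e(1) by (simp add: y_def dist_norm)
  have yin: "y \<in> closure Om" using dt(2) dy s by (auto simp: subset_eq)
  have cont: "continuous_on UNIV fi" by (rule lipschitz_on_continuous_on[OF e(3)])
  have op: "open ({z. z \<bullet> e < fi z} \<inter> ball x r)" by (intro open_Int open_Collect_less continuous_intros cont) auto
  have "y \<bullet> e = x \<bullet> e-s" using e(1) by (simp add: y_def inner_add_left inner_diff_left dot_square_norm)
  moreover have "fi y = fi x" unfolding y_def using e(4) by blast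
  ultimately have "y \<in> {z. z \<bullet> e < fi z} \<inter> ball x r" using ge s dy by simp
  moreover have "({z. z \<bullet> e < fi z} \<inter> ball x r) \<inter> Om = {}"
  proof -
  have False if "z \<in> Om" "z \<in> ball x r" "z \<bullet> e < fi z" for z
  proof -
  have "z \<in> {y \<in> ball x r. fi y < y \<bullet> e}" unfolding eq[symmetric] using that by simp
  with that show False by simp
  qed
  then show ?thesis by blast
  qed
  ultimately have "y \<notin> closure Om" using op open_Int_closure_eq_empty by blast
  with yin show False by simp
 qed
qed

lemma poly_deg_le_smooth: "poly_deg_le k q ==> smooth q"
proof -
 assume "poly_deg_le k q"
 then obtain c where q: "!!x. q x = (\<Sum>al | (\<Sum>i\<in>UNIV. al i) <= k. c al * (\<Prod>i\<in>UNIV. (x $ i)^al i))" unfolding poly_deg_le_def by blast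
 show ?thesis unfolding q[abs_def] by (intro smooth_sum smooth_mult smooth_const smooth_prod smooth_power smooth_coord)
qed

lemma mesh_AE_interior:
 fixes \<T> :: "(real^'d::finite) set set"
 assumes Om: "open Om" and m: "mesh_partition Om \<T>"
 shows "AE x in lon Om. \<exists>K\<in>\<T>. x \<in> interior K"
proof -
 have fin: "finite \<T>" and U: "\<Union>\<T> = closure Om" and P: "!!K. K \<in> \<T> ==> polytope K" using m by (auto simp: mesh_partition_def)
 have "negligible (\<Union>K\<in>\<T>. frontier K)" by (intro negligible_Union) (use fin P in \<open>auto intro!: negligible_convex_frontier polytope_imp_convex\<close>)
 then have "AE x in lebesgue. x \<notin> (\<Union>K\<in>\<T>. frontier K)" by (intro AE_not_in) (simp only: negligible_iff_null_sets)
 then have "AE x in lebesgue. x \<in> Om --> (\<exists>K\<in>\<T>. x \<in> interior K)"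
 proof eventually_elim
  case (elim x)
  show ?case
  proof
  assume "x \<in> Om"
  then obtain K where "K \<in> \<T>" "x \<in> K" using U closure_subset[of Om] by blast
  moreover have "x \<notin> frontier K" using elim \<open>K \<in> \<T>\<close> by blast
  ultimately show "\<exists>K\<in>\<T>. x \<in> interior K" using closure_subset[of K] unfolding frontier_def by blast
  qed
 qed
 then show ?thesis using Om by (simp add: AE_lebesgue_on_iff)
qed

lemma mesh_interior_subset:
 assumes "open Om" "lipschitz_boundary Om" "mesh_partition Om \<T>" "K \<in> \<T>"
 shows "interior K <= Om"
proof -
 have "K <= closure Om" using assms(3,4) by (auto simp: mesh_partition_def)
 then show ?thesis using interior_mono interior_closure_lipschitz[OF assms(1,2)] by blast
qed

lemma in_Linf_piecewise:
 fixes f :: "real^'d::finite => 'b::euclidean_space"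
 assumes Om: "open Om" and m: "mesh_partition Om \<T>" and f: "f \<in> bm (lon Om)"
  and B: "!!K. K \<in> \<T> ==> \<exists>B. AE x in lon Om. x \<in> interior K --> norm (f x) <= B"
 shows "in_Lp Om \<infinity> f"
proof -
 have fin: "finite \<T>" using m by (simp add: mesh_partition_def)
 obtain b where b: "!!K. K \<in> \<T> ==> AE x in lon Om. x \<in> interior K --> norm (f x) <= b K" using B by metis
 have "AE x in lon Om. \<forall>K\<in>\<T>. x \<in> interior K --> norm (f x) <= b K" by (intro AE_finite_allI fin b)
 moreover note mesh_AE_interior[OF Om m]
 ultimately have "AE x in lon Om. norm (f x) <= (\<Sum>K\<in>\<T>. \<bar>b K\<bar>)"
 proof eventually_elim
  case (elim x)
  then obtain K where K: "K \<in> \<T>" "norm (f x) <= b K" by blast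
  have "\<bar>b K\<bar> <= (\<Sum>K\<in>\<T>. \<bar>b K\<bar>)" by (rule member_le_sum[OF K(1) _ fin]) simp
  with K show ?case by linarith
 qed
 with f show ?thesis by (auto simp: in_Linf_iff)
qed

lemma smooth_bounded_on:
 fixes q :: "real^'d::finite => real"
 assumes "smooth q" "bounded K"
 obtains B where "!!x. x \<in> K ==> \<bar>q x\<bar> <= B"
proof -
 have "compact (q ` closure K)" by (intro compact_continuous_image smooth_continuous assms(1)) (use assms(2) in \<open>simp add: compact_closure\<close>)
 then obtain B where B: "!!y. y \<in> q ` closure K ==> norm y <= B" using bounded_iff compact_imp_bounded by metis
 show thesis
 proof
  fix x assume "x \<in> K"
  then have "q x \<in> q ` closure K" using closure_subset by blast
  from B[OF this] show "\<bar>q x\<bar> <= B" by simp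
 qed
qed

text \<open>On each of the finitely many bounded elements the components are polynomials, and so are
  the gradient entries, by uniqueness of weak derivatives on the open element. The bounds depend on
  the mesh; only their finiteness is recorded.\<close>

lemma FE_in_Linf:
 fixes v :: "real^'d::finite => real^'d"
 assumes Om: "open Om" "lipschitz_boundary Om" and m: "mesh_partition Om \<T>"
  and v: "in_H Om 1 v" and p: "!!j. piecewise_poly \<T> k (%x. v x $ j)"
 shows "in_Lp Om \<infinity> v" "in_Lp Om \<infinity> (grad Om v)"
proof -
 have Kb: "bounded (interior K)" if "K \<in> \<T>" for K using m that by (auto simp: mesh_partition_def intro: bounded_subset[OF polytope_imp_bounded interior_subset])
 have q: "\<exists>q. smooth q & (\<forall>x\<in>interior K. v x $ j = q x)" if "K \<in> \<T>" for K j using p[of j] that poly_deg_le_smooth unfolding piecewise_poly_def by metis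
 have vm: "v \<in> bm (lon Om)" using in_W_self(1)[OF Om(1) v] by (simp add: in_L2_iff)
 show "in_Lp Om \<infinity> v"
 proof (rule in_Linf_piecewise[OF Om(1) m vm])
  fix K assume K: "K \<in> \<T>"
  have "\<exists>B. \<forall>x\<in>interior K. \<bar>v x $ j\<bar> <= B" for j using q[OF K, of j] smooth_bounded_on[OF _ Kb[OF K]] by metis
  then obtain B where B: "!!j x. x \<in> interior K ==> \<bar>v x $ j\<bar> <= B j" by metis
  have "norm (v x) <= (\<Sum>j\<in>UNIV. B j)" if "x \<in> interior K" for x using norm_le_l1_cart[of "v x"] B[OF that] by (meson order_trans sum_mono)
  then show "\<exists>B. AE x in lon Om. x \<in> interior K --> norm (v x) <= B" by (intro exI AE_I2 impI) blast
 qed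
 have gm: "grad Om v \<in> bm (lon Om)" using grad_in_L2(1)[OF Om(1) v] by (simp add: in_L2_iff)
 show "in_Lp Om \<infinity> (grad Om v)"
 proof (rule in_Linf_piecewise[OF Om(1) m gm])
  fix K assume K: "K \<in> \<T>"
  let ?U = "interior K"
  have U: "open ?U" "?U <= Om" using mesh_interior_subset[OF Om m K] by auto
  have ex: "\<exists>B. AE x in lon Om. x \<in> ?U --> \<bar>grad Om v x $ j $ i\<bar> <= B" for i j
  proof -
  obtain q where q: "smooth q" "!!x. x \<in> ?U ==> v x $ j = q x" using q[OF K, of j] by blast
  have "AE x in lon ?U. wd Om [i] v x $ j = pd [i] q x" by (rule has_weak_deriv_unique[OF U(1) has_weak_deriv_mono[OF Om(1) U has_weak_deriv_nth[OF Om(1) v]]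
  has_weak_deriv_smooth[OF U(1) q(1)]]) (auto intro!: AE_I2 q(2) simp: space_restrict_space)
  then have "AE x in lebesgue. x \<in> ?U --> wd Om [i] v x $ j = pd [i] q x" by (subst (asm) AE_lebesgue_on_iff) auto
  moreover obtain B where B: "!!x. x \<in> ?U ==> \<bar>pd [i] q x\<bar> <= B" using smooth_bounded_on[OF smooth_partials[OF q(1)] Kb[OF K]] by metis
  ultimately have "AE x in lebesgue. x \<in> Om --> x \<in> ?U --> \<bar>grad Om v x $ j $ i\<bar> <= B" by (elim AE_mp) (auto intro!: AE_I2 simp: grad_nth simp del: partials.simps)
  then show ?thesis using Om(1) by (intro exI[of _ B]) (simp add: AE_lebesgue_on_iff)
  qed
  define B where "B i j = (SOME B. AE x in lon Om. x \<in> ?U --> \<bar>grad Om v x $ j $ i\<bar> <= B)" for i j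
  have B: "AE x in lon Om. x \<in> ?U --> \<bar>grad Om v x $ j $ i\<bar> <= B i j" for i j unfolding B_def by (rule someI_ex[OF ex])
  have "AE x in lon Om. \<forall>i\<in>UNIV. \<forall>j\<in>UNIV. x \<in> ?U --> \<bar>grad Om v x $ j $ i\<bar> <= B i j" by (intro AE_finite_allI B) auto
  then have "AE x in lon Om. x \<in> ?U --> norm (grad Om v x) <= (\<Sum>j\<in>UNIV. \<Sum>i\<in>UNIV. B i j)"
  proof eventually_elim
  case (elim x)
  show ?case
  proof
  assume x: "x \<in> ?U"
  have "norm (grad Om v x) <= (\<Sum>j\<in>UNIV. norm (grad Om v x $ j))" unfolding norm_vec_def by (rule L2_set_le_sum) simp
  also have "... <= (\<Sum>j\<in>UNIV. \<Sum>i\<in>UNIV. \<bar>grad Om v x $ j $ i\<bar>)" by (intro sum_mono norm_le_l1_cart)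
  also have "... <= (\<Sum>j\<in>UNIV. \<Sum>i\<in>UNIV. B i j)" using elim x by (intro sum_mono) auto
  finally show "norm (grad Om v x) <= (\<Sum>j\<in>UNIV. \<Sum>i\<in>UNIV. B i j)" .
  qed
  qed
  then show "\<exists>B. AE x in lon Om. x \<in> ?U --> norm (grad Om v x) <= B" by blast
 qed
qed

lemma mesh_size_facts:
 assumes m: "mesh_partition Om \<T>" and ne: "Om ~= {}"
 shows "mesh_size \<T> > 0" "!!K. K \<in> \<T> ==> diameter K <= mesh_size \<T>" "!!K. K \<in> \<T> ==> bounded K"
proof -
 have fin: "finite \<T>" and U: "\<Union>\<T> = closure Om" and P: "!!K. K \<in> \<T> ==> polytope K & interior K ~= {}" using m by (auto simp: mesh_partition_def)
 show b: "!!K. K \<in> \<T> ==> bounded K" using P polytope_imp_bounded by blast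
 show d: "!!K. K \<in> \<T> ==> diameter K <= mesh_size \<T>" unfolding mesh_size_def using fin by auto
 have "\<T> ~= {}" using U ne closure_subset[of Om] by auto
 then obtain K where K: "K \<in> \<T>" by blast
 then obtain x r where "r > 0" "ball x r <= K" using P mem_interior by (metis ex_in_conv)
 then have "2 * r <= diameter K" using diameter_subset[of "ball x r" K] b[OF K] by simp
 with \<open>r > 0\<close> d[OF K] show "mesh_size \<T> > 0" by linarith
qed

lemma W_norm_0:
 fixes v :: "real^'d::finite => 'b::euclidean_space"
 assumes U: "open U" and v: "in_Lp U 2 v"
 shows "W_norm U 0 \<infinity> v = sn U v" "W_norm U 0 2 v = nrm U v"
proof -
 note l = in_L2_locally_integrable[OF U v]
 have h: "hwd U [] v (wd U [] v)" by (rule has_weak_deriv_weak_deriv[OF has_weak_deriv_Nil[OF l]])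
 note ae = weak_deriv_AE[OF U has_weak_deriv_Nil[OF l]]
 have m: "wd U [] v \<in> bm (lon U)" using h unfolding has_weak_deriv_def by (intro locally_integrable_measurable[OF U]) blast
 have vm: "v \<in> bm (lon U)" using v by (simp add: in_L2_iff)
 have s: "{is :: 'd list. length is <= 0} = {[]}" by auto
 show "W_norm U 0 \<infinity> v = sn U v" unfolding W_norm_def s using Linf_norm_cong_AE[OF ae m vm, of \<infinity>] by simp
 have "(H_norm U 0 v)\<^sup>2 = (nrm U v)\<^sup>2" unfolding H_norm_sq s using L2_norm_cong_AE[OF ae m vm] by simp
 then show "W_norm U 0 2 v = nrm U v" by (simp add: power2_eq_iff_nonneg)
qed

text \<open>For \<open>d = 3\<close> the gradient part of the local estimate scales like
  \<open>h m^2\<close> and the mass part like \<open>1/(h m^3)\<close>. The choice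
  \<open>m = h^(-2/5)\<close> balances them, and with \<open>h = r^5\<close> both are of order
  \<open>r\<close>.\<close>

lemma discrete_exponents:
 fixes r h :: real
 assumes r: "0 < r" "r <= 1" and h: "h = r^5" and d: "d = 2 \<or> d = (3::nat)"
  and m: "m = nat \<lceil>1/r\<^sup>2\<rceil>"
 shows "m \<ge> 1" "h\<^sup>2/h^d * (h * real m)\<^sup>2 <= 4 * r" "h\<^sup>2/h^d * (2/real m^d) <= 2 * r"
proof -
 have r2: "1 <= 1/r\<^sup>2" using r by (simp add: power_le_one)
 have m1: "1/r\<^sup>2 <= real m" unfolding m by linarith
 have m2: "real m <= 2/r\<^sup>2" unfolding m using r2 by linarith
 show "m \<ge> 1" using r2 m1 by linarith
 have hp: "h > 0" using r h by simp
 have m3: "(real m)\<^sup>2 <= 4/r^4"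
 proof -
  have "(real m)\<^sup>2 <= (2/r\<^sup>2)\<^sup>2" using m2 by (intro power_mono) auto
  also have "... = 4/r^4" by (simp add: power_divide)
  finally show ?thesis .
 qed
 have le1: "h\<^sup>2/h^d * h\<^sup>2 <= h"
 proof -
  have "h <= 1" unfolding h using r by (intro power_le_one) auto
  then show ?thesis using d hp by (auto simp: power2_eq_square power3_eq_cube mult_left_le)
 qed
 have "h\<^sup>2/h^d * (h * real m)\<^sup>2 = (h\<^sup>2/h^d * h\<^sup>2)*(real m)\<^sup>2" by (simp add: power_mult_distrib)
 also have "... <= h * (4/r^4)" using le1 m3 hp by (intro mult_mono) auto
 also have "... = 4 * r" using r h by (simp add: field_simps flip: power_Suc power_Suc2)
 finally show "h\<^sup>2/h^d * (h * real m)\<^sup>2 <= 4 * r" .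
 have md: "2/real m^d <= 2*(r\<^sup>2)^d"
 proof -
  have "(1/r\<^sup>2)^d <= real m^d" using m1 by (intro power_mono) auto
  then have "2/real m^d <= 2/(1/r\<^sup>2)^d" using r m1 \<open>m \<ge> 1\<close> by (intro divide_left_mono mult_pos_pos zero_less_power) auto
  then show ?thesis by (simp add: power_divide)
 qed
 have "h\<^sup>2/h^d * (2/real m^d) <= h\<^sup>2/h^d * (2*(r\<^sup>2)^d)" using md hp by (intro mult_left_mono) auto
 also have "... <= 2 * r" using d
 proof
  assume "d = 2"
  then have "h\<^sup>2/h^d * (2*(r\<^sup>2)^d) = 2*(r * r^3)" using hp by (simp add: power2_eq_square power3_eq_cube mult_ac)
  also have "... <= 2*(r * 1)" using r by (intro mult_left_mono) (auto simp: power_le_one)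
  finally show ?thesis by simp
 next
  assume "d = 3"
  then have "h\<^sup>2/h^d * (2*(r\<^sup>2)^d) = 2 * r" using r h by (simp add: field_simps eval_nat_numeral)
  then show ?thesis by simp
 qed
 finally show "h\<^sup>2/h^d * (2/real m^d) <= 2 * r" .
qed

text \<open>The elementwise inverse inequality from \<open>L2\<close> to the sup norm meets the
  local mass estimate. The element diameter enters with a negative power, and quasi-uniformity
  bounds it below by \<open>\<gamma>\<close> times the mesh size.\<close>

lemma discrete_sup_local:
 fixes v :: "real^'d::finite => real^'d"
 assumes Om: "open Om" "lipschitz_boundary Om" "Om ~= {}" and M: "mesh_partition Om \<T>"
  and \<gamma>: "\<gamma> > 0" "!!K. K \<in> \<T> ==> \<exists>x. ball x (\<gamma> * mesh_size \<T>) <= K"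
  and c: "c > 0" and inv: "inverse_inequalities Om \<T> Vh c" and v: "v \<in> Vh" "in_H10 Om v" "in_Lp Om \<infinity> v"
  and m: "m \<ge> (1::nat)"
 shows "(sn Om v)\<^sup>2 <= c\<^sup>2/(\<gamma> * mesh_size \<T>) ^ CARD('d) *
  (8 * real CARD('d)^3*(mesh_size \<T> * real m)\<^sup>2*(nrm Om (grad Om v))\<^sup>2+2/real m ^ CARD('d)*(nrm Om v)\<^sup>2)"
proof -
 let ?h = "mesh_size \<T>" and ?d = "real CARD('d)"
 note hv = in_H10_in_H1[OF v(2)]
 have v2: "in_Lp Om 2 v" by (rule in_W_self(1)[OF Om(1) hv]) simp
 have S: "Om \<in> sets lebesgue" using Om by simp
 note ms = mesh_size_facts[OF M Om(3)]
 let ?X = "8 * real CARD('d)^3*(?h * real m)\<^sup>2*(nrm Om (grad Om v))\<^sup>2+2/real m ^ CARD('d)*(nrm Om v)\<^sup>2"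
 have X0: "0 <= ?X" by auto
 let ?a = "c * (\<gamma> * ?h) powr (- ?d/2)"
 have loc: "AE x in lon Om. x \<in> interior K --> norm (v x) <= ?a * sqrt ?X" if K: "K \<in> \<T>" for K
 proof -
  let ?U = "interior K"
  have U: "open ?U" "?U <= Om" "?U \<in> sets lebesgue" using mesh_interior_subset[OF Om(1,2) M K] by auto
  note vU = L2_norm_subset(1)[OF U(3) S U(2) v2]
  have ioU: "AE x in lon ?U. norm (v x) <= sn Om v" using Linf_norm_AE[OF v(3)] U(2) S unfolding AE_lebesgue_on_iff[OF U(3)] AE_lebesgue_on_iff[OF S] by (elim AE_mp) (auto intro!: AE_I2)
  have vi: "in_Lp ?U \<infinity> v" using ioU vU by (auto simp: in_Linf_iff in_L2_iff)
  \<comment> \<open>In \<open>ereal\<close> the reciprocal of \<open>\<infinity>\<close> is 0, so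
    only the exponent \<open>- d/2\<close> survives.\<close>
  have ex: "real 0-real 0 - ?d * real_of_ereal (1/2-1/\<infinity>) = - ?d/2" by (simp add: numeral_eq_ereal one_ereal_def)
  have "\<forall>m n. \<forall>p q :: ereal. n <= m & m <= 1 & 1 <= q & q <= p -->
  W_norm ?U m p v <= c * diameter K powr (real n-real m - ?d * real_of_ereal (1/q-1/p)) * W_norm ?U n q v" using inv v(1) K unfolding inverse_inequalities_def by blast
  moreover have "(1::ereal) <= 2" "(2::ereal) <= \<infinity>" by (simp_all add: numeral_eq_ereal one_ereal_def)
  ultimately have "W_norm ?U 0 \<infinity> v <= c * diameter K powr (real 0-real 0 - ?d * real_of_ereal (1/2-1/\<infinity>)) * W_norm ?U 0 2 v" by (metis le_refl zero_le)
  then have 1: "Lp_norm ?U \<infinity> v <= c * diameter K powr (- ?d/2) * nrm ?U v" unfolding ex W_norm_0[OF U(1) vU] .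
  obtain x where "ball x (\<gamma> * ?h) <= K" using \<gamma>(2)[OF K] by blast
  then have "\<gamma> * ?h <= diameter K" using diameter_subset[of "ball x (\<gamma> * ?h)" K] ms(3)[OF K] mult_pos_pos[OF \<gamma>(1) ms(1)] by simp
  then have 2: "diameter K powr (- ?d/2) <= (\<gamma> * ?h) powr (- ?d/2)" using \<gamma>(1) ms(1) by (intro powr_mono2') auto
  have "(nrm ?U v)\<^sup>2 <= ?X"
  proof (rule in_H10_local_estimate[OF Om(1) v(2) _ U(2) ms(1) m])
  fix x y assume "x \<in> ?U" "y \<in> ?U"
  then have "dist x y <= diameter K" using interior_subset[of K] by (intro diameter_bounded_bound ms(3)[OF K]) auto
  then show "norm (x-y) <= ?h" using ms(2)[OF K] by (simp add: dist_norm)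
  qed simp
  then have 3: "nrm ?U v <= sqrt ?X" by (rule real_le_rsqrt)
  have "c * diameter K powr (- ?d/2) * nrm ?U v <= ?a * sqrt ?X" using 2 3 c by (intro mult_mono mult_left_mono) auto
  with 1 have le: "Lp_norm ?U \<infinity> v <= ?a * sqrt ?X" by linarith
  have "AE x in lon ?U. norm (v x) <= ?a * sqrt ?X" using Linf_norm_AE[OF vi] by eventually_elim (rule order_trans[OF _ le])
  then show ?thesis unfolding AE_lebesgue_on_iff[OF U(3)] AE_lebesgue_on_iff[OF S] by (elim AE_mp) (auto intro!: AE_I2)
 qed
 have fin: "finite \<T>" using M by (simp add: mesh_partition_def)
 have "AE x in lon Om. \<forall>K\<in>\<T>. x \<in> interior K --> norm (v x) <= ?a * sqrt ?X" by (intro AE_finite_allI fin loc)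
 then have "AE x in lon Om. norm (v x) <= ?a * sqrt ?X" using mesh_AE_interior[OF Om(1) M] by eventually_elim blast
 moreover have "0 <= ?a * sqrt ?X" using c X0 by simp
 ultimately have "sn Om v <= ?a * sqrt ?X" using v2 by (intro Linf_norm_le) (auto simp: in_L2_iff)
 then have "(sn Om v)\<^sup>2 <= (?a * sqrt ?X)\<^sup>2" by (intro power_mono) auto
 also have "... = (c\<^sup>2*((\<gamma> * ?h) powr (- ?d/2))\<^sup>2) * ?X" using X0 by (simp only: power_mult_distrib real_sqrt_pow2)
 also have "((\<gamma> * ?h) powr (- ?d/2))\<^sup>2 = 1/(\<gamma> * ?h) ^ CARD('d)"
 proof -
  have "((\<gamma> * ?h) powr (- ?d/2))\<^sup>2 = (\<gamma> * ?h) powr (- ?d)" by (simp add: power2_eq_square powr_add[symmetric])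
  also have "... = 1/(\<gamma> * ?h) ^ CARD('d)" using \<gamma>(1) ms(1) by (simp add: powr_minus powr_realpow inverse_eq_divide)
  finally show ?thesis .
 qed
 finally show ?thesis by simp
qed

text \<open>For the squares, the gain over the plain inverse inequality is a factor of order
  \<open>h^(1/5)\<close>, and the threshold puts this factor below \<open>ep^2/C\<close>.\<close>

theorem discrete_sup_bound:
 fixes Om :: "(real^'d::finite) set"
 assumes d: "CARD('d) = 2 \<or> CARD('d) = 3" and Om: "open Om" "lipschitz_boundary Om" "Om ~= {}"
  and fe: "finite_element_family Om k l \<T> Vh Qh \<beta> c" and c: "c > 0" and ep: "ep > 0"
 obtains h\<^sub>1 where "h\<^sub>1 > 0" "!!i v. mesh_size (\<T> i) < h\<^sub>1 ==> v \<in> Vh i ==>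
  mesh_size (\<T> i) * sn Om v <= ep * (nrm Om (grad Om v)+nrm Om v)"
proof -
 obtain \<gamma> where \<gamma>: "\<gamma> > 0" "!!i K. K \<in> \<T> i ==> \<exists>x. ball x (\<gamma> * mesh_size (\<T> i)) <= K" using fe unfolding finite_element_family_def quasi_uniform_def by blast
 define C where "C = c\<^sup>2/\<gamma> ^ CARD('d)*(32 * real CARD('d)^3+2)"
 have C: "C > 0" unfolding C_def using c \<gamma>(1) by (intro mult_pos_pos divide_pos_pos) (auto intro!: add_nonneg_pos)
 define h\<^sub>1 where "h\<^sub>1 = min 1 ((ep\<^sup>2/C)^5)"
 have h1: "h\<^sub>1 > 0" using C ep by (simp add: h\<^sub>1_def)
 show thesis
 proof (rule that[OF h1])
  fix i v assume h: "mesh_size (\<T> i) < h\<^sub>1" and v: "v \<in> Vh i"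
  let ?h = "mesh_size (\<T> i)"
  let ?g = "nrm Om (grad Om v)" and ?n = "nrm Om v"
  have M: "mesh_partition Om (\<T> i)" and v10: "in_H10 Om v" and pp: "!!j. piecewise_poly (\<T> i) k (%x. v x $ j)"
  and inv: "inverse_inequalities Om (\<T> i) (Vh i) c" using fe v unfolding finite_element_family_def by blast+
  note vi = FE_in_Linf(1)[OF Om(1,2) M in_H10_in_H1[OF v10] pp]
  have h0: "?h > 0" by (rule mesh_size_facts(1)[OF M Om(3)])
  define r where "r = root 5 ?h"
  have r: "0 < r" "r <= 1" "?h = r^5" "r <= ep\<^sup>2/C"
  proof -
  show "0 < r" "?h = r^5" using h0 by (simp_all add: r_def)
  have "?h < 1" "?h < (ep\<^sup>2/C)^5" using h by (simp_all add: h\<^sub>1_def)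
  then show "r <= 1" unfolding r_def using h0 by simp
  have "root 5 ?h <= root 5 ((ep\<^sup>2/C)^5)" using \<open>?h < (ep\<^sup>2 / C) ^ 5\<close> by simp
  then show "r <= ep\<^sup>2/C" unfolding r_def using C by (simp add: real_root_power_cancel)
  qed
  define m where "m = nat \<lceil>1/r\<^sup>2\<rceil>"
  note e = discrete_exponents[OF r(1,2,3) d m_def]
  have "(?h * sn Om v)\<^sup>2 = ?h\<^sup>2*(sn Om v)\<^sup>2" by (simp add: power_mult_distrib)
  also have "... <= ?h\<^sup>2*(c\<^sup>2/(\<gamma> * ?h) ^ CARD('d) *
  (8 * real CARD('d)^3*(?h * real m)\<^sup>2 * ?g\<^sup>2+2/real m ^ CARD('d) * ?n\<^sup>2))" by (intro mult_left_mono discrete_sup_local[OF Om M \<gamma> c inv v v10 vi e(1)]) auto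
  also have "... = c\<^sup>2/\<gamma> ^ CARD('d)*(8 * real CARD('d)^3 * ?g\<^sup>2*(?h\<^sup>2 / ?h ^ CARD('d)*(?h * real m)\<^sup>2)
  + ?n\<^sup>2*(?h\<^sup>2 / ?h ^ CARD('d)*(2/real m ^ CARD('d))))" by (simp add: power_mult_distrib algebra_simps)
  also have "... <= c\<^sup>2/\<gamma> ^ CARD('d)*(8 * real CARD('d)^3 * ?g\<^sup>2*(4 * r) + ?n\<^sup>2*(2 * r))" using \<gamma>(1) by (intro mult_left_mono add_mono e) auto
  also have "... <= c\<^sup>2/\<gamma> ^ CARD('d)*((32 * real CARD('d)^3+2) * r * (?g + ?n)\<^sup>2)"
  proof (rule mult_left_mono)
  have gn: "?g\<^sup>2 <= (?g + ?n)\<^sup>2" "?n\<^sup>2 <= (?g + ?n)\<^sup>2" by (simp_all add: power_mono)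
  have "8 * real CARD('d)^3 * ?g\<^sup>2*(4 * r) + ?n\<^sup>2*(2 * r)
  <= 8 * real CARD('d)^3*(?g + ?n)\<^sup>2*(4 * r)+(?g + ?n)\<^sup>2*(2 * r)" using gn r(1) by (intro add_mono mult_right_mono mult_left_mono) auto
  then show "8 * real CARD('d)^3 * ?g\<^sup>2*(4 * r) + ?n\<^sup>2*(2 * r) <= (32 * real CARD('d)^3+2) * r * (?g + ?n)\<^sup>2" by (simp add: algebra_simps)
  qed (use \<gamma>(1) in simp)
  also have "... = C * r * (?g + ?n)\<^sup>2" by (simp add: C_def)
  also have "... <= C * (ep\<^sup>2/C)*(?g + ?n)\<^sup>2" using r(4) C by (intro mult_right_mono mult_left_mono) auto
  also have "... = (ep * (?g + ?n))\<^sup>2" using C by (simp add: power_mult_distrib)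
  finally show "?h * sn Om v <= ep * (?g + ?n)" by (rule power2_le_imp_le) (use ep in \<open>auto intro!: mult_nonneg_nonneg add_nonneg_nonneg\<close>)
 qed
qed

section \<open>Projection onto a finite element space\<close>

text \<open>Finite dimension is expressed by a finite family \<open>B\<close> that spans
  \<open>S\<close> up to null sets, and the induction is over \<open>B\<close>. Without
  \<open>b\<close> the span cuts out a subspace \<open>S0\<close>; if it differs from
  \<open>S\<close>, a single further element \<open>q1\<close> spans the rest and is orthogonalised
  against \<open>S0\<close>.\<close>

lemma L2_projection_abstract:
 fixes S :: "('a::euclidean_space => real) set" and B :: "('a => real) set"
 assumes "finite B" and "function_subspace S" and "!!q. q \<in> S ==> in_Lp Om 2 q"
  and "!!q. q \<in> S ==> \<exists>c. AE x in lon Om. q x = (\<Sum>b\<in>B. c b * b x)"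
  and "in_Lp Om 2 p"
 shows "\<exists>\<pi>\<in>S. \<forall>r\<in>S. ip Om (%x. p x-\<pi> x) r = 0" using assms
proof (induction B arbitrary: S p rule: finite_induct)
 case empty
 have "ip Om (%x. p x-0) r = 0" if r: "r \<in> S" for r
 proof -
  have "AE x in lon Om. r x = 0" using empty(3)[OF r] by simp
  then have "nrm Om r = 0" using L2_norm_eq_0_iff[OF empty(2)[OF r]] by simp
  then show ?thesis using L2_Cauchy_Schwarz[OF empty(4) empty(2)[OF r]] by simp
 qed
 moreover have "(%x. 0) \<in> S" using empty(1) by (simp add: function_subspace_def)
 ultimately show ?case by (intro bexI[of _ "%x. 0"]) simp_all
next
 case (insert b B)
 note sub = insert(4)[unfolded function_subspace_def]
 have add: "(%x. v x+w x) \<in> S" if "v \<in> S" "w \<in> S" for v w using sub that by blast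
 have scale: "(%x. c * v x) \<in> S" if "v \<in> S" for v c using sub that by simp
 note L2 = insert(5)
 define S0 where "S0 = {q\<in>S. \<exists>c. AE x in lon Om. q x = (\<Sum>b\<in>B. c b * b x)}"
 have S0I: "q \<in> S0" if "q \<in> S" "AE x in lon Om. q x = (\<Sum>b\<in>B. c b * b x)" for q c unfolding S0_def mem_Collect_eq by (intro conjI exI) (rule that)+
 have sub0: "function_subspace S0" unfolding function_subspace_def
 proof (intro conjI ballI allI)
  show "(%x. 0) \<in> S0" by (rule S0I[where c="%_. 0"]) (use sub in simp_all)
  fix v assume v: "v \<in> S0"
  then obtain cv where cv: "AE x in lon Om. v x = (\<Sum>b\<in>B. cv b * b x)" by (auto simp: S0_def)
  { fix w assume w: "w \<in> S0"
  then obtain cw where cw: "AE x in lon Om. w x = (\<Sum>b\<in>B. cw b * b x)" by (auto simp: S0_def)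
  have "AE x in lon Om. v x+w x = (\<Sum>b\<in>B. (cv b + cw b) * b x)" using cv cw by eventually_elim (simp add: sum.distrib distrib_right)
  then show "(%x. v x+w x) \<in> S0" by (rule S0I[rotated]) (use v w add in \<open>auto simp: S0_def\<close>) }
  fix c :: real
  have "AE x in lon Om. c * v x = (\<Sum>b\<in>B. (c * cv b) * b x)" using cv by eventually_elim (simp add: sum_distrib_left mult.assoc)
  then have "(%x. c * v x) \<in> S0" by (rule S0I[rotated]) (use v scale in \<open>auto simp: S0_def\<close>)
  then show "(%x. c *. v x) \<in> S0" by simp
 qed
 have IH: "\<exists>\<pi>\<in>S0. \<forall>r\<in>S0. ip Om (%x. g x-\<pi> x) r = 0" if "in_Lp Om 2 g" for g by (rule insert(3)[OF sub0]) (use L2 that in \<open>auto simp: S0_def\<close>)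
 obtain \<pi>0 where \<pi>0: "\<pi>0 \<in> S0" "!!r. r \<in> S0 ==> ip Om (%x. p x-\<pi>0 x) r = 0" using IH[OF insert(7)] by blast
 show ?case
 proof (cases "S <= S0")
  case True
  then show ?thesis using \<pi>0 S0_def by blast
 next
  case False
  then obtain q1 where q1: "q1 \<in> S" "q1 \<notin> S0" by blast
  obtain c1 where c1: "AE x in lon Om. q1 x = (\<Sum>b\<in>insert b B. c1 b * b x)" using insert(6)[OF q1(1)] by blast
  have c1b: "c1 b ~= 0"
  proof
  assume "c1 b = 0"
  then have "AE x in lon Om. q1 x = (\<Sum>b\<in>B. c1 b * b x)" using c1 insert(1,2) by simp
  then have "q1 \<in> S0" by (rule S0I[OF q1(1)])
  then show False using q1(2) by simp
  qed
  have decomp: "\<exists>s. (%x. r x-s * q1 x) \<in> S0" if r: "r \<in> S" for r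
  proof -
  obtain c where c: "AE x in lon Om. r x = (\<Sum>b\<in>insert b B. c b * b x)" using insert(6)[OF r] by blast
  let ?s = "c b/c1 b"
  have "AE x in lon Om. r x - ?s * q1 x = (\<Sum>b\<in>B. (c b - ?s * c1 b) * b x)" using c c1
  proof eventually_elim
  case (elim x)
  have "r x - ?s * q1 x = (c b - ?s * c1 b) * b x+((\<Sum>b\<in>B. c b * b x) - ?s * (\<Sum>b\<in>B. c1 b * b x))" using elim insert(1,2) by (simp add: algebra_simps)
  also have "c b - ?s * c1 b = 0" using c1b by simp
  finally show ?case by (simp add: sum_distrib_left sum_subtractf left_diff_distrib mult.assoc)
  qed
  moreover have "(%x. r x - ?s * q1 x) \<in> S" using add[OF r scale[OF q1(1), of "- ?s"]] by simp
  ultimately have "(%x. r x - ?s * q1 x) \<in> S0" by (rule S0I[rotated])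
  then show ?thesis by (rule exI)
  qed
  obtain \<pi>1 where \<pi>1: "\<pi>1 \<in> S0" "!!r. r \<in> S0 ==> ip Om (%x. q1 x-\<pi>1 x) r = 0" using IH[OF L2[OF q1(1)]] by blast
  define r1 where "r1 x = q1 x-\<pi>1 x" for x
  have \<pi>S: "\<pi>0 \<in> S" "\<pi>1 \<in> S" using \<pi>0 \<pi>1 by (auto simp: S0_def)
  have r1S: "r1 \<in> S" using add[OF q1(1) scale[OF \<pi>S(2), of "-1"]] by (simp add: r1_def[abs_def])
  have r1o: "ip Om r1 r = 0" if "r \<in> S0" for r using \<pi>1(2)[OF that] by (simp add: r1_def[abs_def])
  \<comment> \<open>If \<open>r1\<close> has norm 0, division by zero makes \<open>t = 0\<close>,
    and Cauchy-Schwarz gives orthogonality of \<open>p\<close> and \<open>r1\<close> anyway.\<close>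
  define t where "t = ip Om p r1/ip Om r1 r1"
  have pr1: "ip Om p r1 = t * ip Om r1 r1"
  proof (cases "ip Om r1 r1 = 0")
  case True
  then have "nrm Om r1 = 0" by (simp add: L2_norm_def)
  then show ?thesis using L2_Cauchy_Schwarz[OF insert(7) L2[OF r1S]] True by simp
  qed (simp add: t_def)
  define \<pi> where "\<pi> x = \<pi>0 x+t * r1 x" for x
  have \<pi>S': "\<pi> \<in> S" unfolding \<pi>_def[abs_def] by (intro add scale \<pi>S r1S)
  have pi_r: "ip Om (%x. p x-\<pi> x) r = ip Om (%x. p x-\<pi>0 x) r-t * ip Om r1 r" if "r \<in> S" for r
  proof -
  have "ip Om (%x. (p x-\<pi>0 x)-t * r1 x) r = ip Om (%x. p x-\<pi>0 x) r-ip Om (%x. t * r1 x) r" by (intro L2_inner_diff_left in_L2_diff in_L2_mult_left insert(7) L2 \<pi>S r1S that)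
  then show ?thesis by (simp add: \<pi>_def L2_inner_mult_left algebra_simps)
  qed
  have S0o: "ip Om (%x. p x-\<pi> x) r = 0" if "r \<in> S0" for r using pi_r[of r] \<pi>0(2)[OF that] r1o[OF that] that by (simp add: S0_def)
  have r1oo: "ip Om (%x. p x-\<pi> x) r1 = 0"
  proof -
  have "ip Om (%x. p x-\<pi>0 x) r1 = ip Om p r1-ip Om \<pi>0 r1" by (intro L2_inner_diff_left insert(7) L2 \<pi>S r1S)
  then show ?thesis using pi_r[OF r1S] pr1 r1o[OF \<pi>0(1)] by (simp add: L2_inner_commute)
  qed
  have "ip Om (%x. p x-\<pi> x) r = 0" if r: "r \<in> S" for r
  proof -
  obtain s where s: "(%x. r x-s * q1 x) \<in> S0" using decomp[OF r] by blast
  let ?r0 = "%x. r x-s * q1 x"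
  have r0S: "?r0 \<in> S" using s by (simp add: S0_def)
  note pd = in_L2_diff[OF insert(7) L2[OF \<pi>S']]
  have "r = (%x. (?r0 x+s * \<pi>1 x)+s * r1 x)" by (auto simp: r1_def algebra_simps)
  then have "ip Om (%x. p x-\<pi> x) r = ip Om (%x. p x-\<pi> x) (%x. (?r0 x+s * \<pi>1 x)+s * r1 x)" by simp
  also have "... = ip Om (%x. p x-\<pi> x) ?r0+s * ip Om (%x. p x-\<pi> x) \<pi>1+s * ip Om (%x. p x-\<pi> x) r1" using L2_inner_add_right[OF in_L2_add[OF L2[OF r0S] in_L2_mult_left[OF L2[OF \<pi>S(2)]]] in_L2_mult_left[OF L2[OF r1S]] pd, of s s]
  L2_inner_add_right[OF L2[OF r0S] in_L2_mult_left[OF L2[OF \<pi>S(2)]] pd, of s] by (simp add: L2_inner_mult_right)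
  also have "... = 0" using S0o[OF s] S0o[OF \<pi>1(1)] r1oo by simp
  finally show ?thesis .
  qed
  then show ?thesis using \<pi>S' by blast
 qed
qed

lemma finite_multi_indices: "finite {al :: 'd::finite => nat. (\<Sum>i\<in>UNIV. al i) <= k}"
proof (rule finite_subset)
 show "{al :: 'd => nat. (\<Sum>i\<in>UNIV. al i) <= k} <= PiE UNIV (%_. {..k})"
 proof
  fix al :: "'d => nat" assume "al \<in> {al. (\<Sum>i\<in>UNIV. al i) <= k}"
  moreover have "al i <= (\<Sum>i\<in>UNIV. al i)" for i by (rule member_le_sum) auto
  ultimately show "al \<in> PiE UNIV (%_. {..k})" by (auto intro: order_trans)
 qed
 show "finite (PiE UNIV (%_ :: 'd. {..k}))" by (intro finite_PiE) auto
qed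

text \<open>Monomials times indicators of element interiors span the piecewise polynomials.
  Existence is an issue because \<open>pressure_projection_bound\<close> speaks about every
  projection without asserting that there is one.\<close>

lemma L2_projection_exists:
 fixes Om :: "(real^'d::finite) set"
 assumes Om: "open Om" and M: "mesh_partition Om \<T>" and sub: "function_subspace Q"
  and Q: "!!q. q \<in> Q ==> in_L20 Om q & piecewise_poly \<T> l q" and p: "in_Lp Om 2 p"
 shows "\<exists>\<pi>. is_L2_projection Om Q p \<pi>"
proof -
 have fin: "finite \<T>" and dis: "!!K K'. K \<in> \<T> ==> K' \<in> \<T> ==> K ~= K' ==> interior K \<inter> interior K' = {}" using M by (auto simp: mesh_partition_def)
 let ?I = "{al :: 'd => nat. (\<Sum>i\<in>UNIV. al i) <= l}"
 define b where "b K al x = (ind (interior K) x * (\<Prod>i\<in>UNIV. (x $ i)^al i) :: real)" for K and al :: "'d => nat" and x :: "real^'d"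
 define B where "B = (%(K, al). b K al) ` (\<T> \<times> ?I)"
 have finB: "finite B" unfolding B_def using fin finite_multi_indices by auto
 have span: "\<exists>c. AE x in lon Om. q x = (\<Sum>g\<in>B. c g * g x)" if q: "q \<in> Q" for q
 proof -
  have "\<forall>K\<in>\<T>. \<exists>c. \<forall>x\<in>interior K. q x = (\<Sum>al\<in>?I. c al * (\<Prod>i\<in>UNIV. (x $ i)^al i))"
  proof
  fix K assume "K \<in> \<T>"
  then obtain q' where q': "poly_deg_le l q'" "!!x. x \<in> interior K ==> q x = q' x" using Q[OF q] unfolding piecewise_poly_def by blast
  obtain c where "!!x. q' x = (\<Sum>al\<in>?I. c al * (\<Prod>i\<in>UNIV. (x $ i)^al i))" using q'(1) unfolding poly_deg_le_def by blast
  with q'(2) show "\<exists>c. \<forall>x\<in>interior K. q x = (\<Sum>al\<in>?I. c al * (\<Prod>i\<in>UNIV. (x $ i)^al i))" by (intro exI[of _ c]) simp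
  qed
  from bchoice[OF this] obtain c where "\<forall>K\<in>\<T>. \<forall>x\<in>interior K. q x = (\<Sum>al\<in>?I. c K al * (\<Prod>i\<in>UNIV. (x $ i)^al i))" ..
  then have c: "q x = (\<Sum>al\<in>?I. c K al * (\<Prod>i\<in>UNIV. (x $ i)^al i))" if "K \<in> \<T>" "x \<in> interior K" for K x using that by blast
  \<comment> \<open>Different pairs of an element and a multi-index might produce the same function;
    its coefficient collects all of them.\<close>
  define e where "e g = (\<Sum>z\<in>{z\<in>\<T> \<times> ?I. (%(K, al). b K al) z = g}. (%(K, al). c K al) z)" for g
  have "AE x in lon Om. q x = (\<Sum>g\<in>B. e g * g x)" using mesh_AE_interior[OF Om M]
  proof eventually_elim
  case (elim x)
  then obtain K where K: "K \<in> \<T>" "x \<in> interior K" by blast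
  have "(\<Sum>g\<in>B. e g * g x) = (\<Sum>g\<in>B. \<Sum>z\<in>{z\<in>\<T> \<times> ?I. (%(K, al). b K al) z = g}. (%(K, al). c K al * b K al x) z)" unfolding e_def sum_distrib_right by (intro sum.cong refl) auto
  also have "... = (\<Sum>z\<in>\<T> \<times> ?I. (%(K, al). c K al * b K al x) z)" unfolding B_def by (rule sum.image_gen[symmetric]) (use fin finite_multi_indices in auto)
  also have "... = (\<Sum>K'\<in>\<T>. \<Sum>al\<in>?I. c K' al * b K' al x)" by (simp add: sum.cartesian_product)
  also have "... = (\<Sum>K'\<in>\<T>. if K' = K then \<Sum>al\<in>?I. c K al * b K al x else 0)"
  proof (intro sum.cong refl)
  fix K' assume K': "K' \<in> \<T>"
  show "(\<Sum>al\<in>?I. c K' al * b K' al x) = (if K' = K then \<Sum>al\<in>?I. c K al * b K al x else 0)"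
  proof (cases "K' = K")
  case False
  then have "x \<notin> interior K'" using dis[OF K' K(1)] K(2) by blast
  then show ?thesis using False by (simp add: b_def)
  qed simp
  qed
  also have "... = (\<Sum>al\<in>?I. c K al * b K al x)" using fin K(1) by simp
  also have "... = q x" using c[OF K] K(2) by (simp add: b_def)
  finally show ?case by simp
  qed
  then show ?thesis by blast
 qed
 have "\<exists>\<pi>\<in>Q. \<forall>r\<in>Q. ip Om (%x. p x-\<pi> x) r = 0" by (rule L2_projection_abstract[OF finB sub _ span p]) (use Q in \<open>auto simp: in_L20_def\<close>)
 then show ?thesis unfolding is_L2_projection_def by blast
qed

section \<open>Time increments\<close>

lemma time_increment:
 fixes w :: "real => real^'d::finite => 'b::euclidean_space"
 assumes w: "has_time_deriv Om T w w'" and v: "in_Lp Om 2 v" and st: "0 <= s" "s <= t" "t <= T"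
  and M: "AE tt in lon {0<..<T}. \<bar>ip Om (w' tt) v\<bar> <= M tt"
  and Mi: "set_integrable lebesgue {s..t} M"
 shows "\<bar>ip Om (w t) v-ip Om (w s) v\<bar> <= (LINT tt:{s..t}|lebesgue. M tt)"
proof -
 have i: "set_integrable lebesgue {s..t} (%tt. ip Om (w' tt) v)"
  and eq: "(LINT tt:{s..t}|lebesgue. ip Om (w' tt) v) = ip Om (w t) v-ip Om (w s) v" using w v st unfolding has_time_deriv_def by blast+
 have "\<bar>LINT tt|lebesgue. ind {s..t} tt *. ip Om (w' tt) v\<bar> <= (LINT tt|lebesgue. ind {s..t} tt *. M tt)"
 proof (rule order_trans[OF integral_abs_bound integral_mono_AE])
  show "integrable lebesgue (%tt. \<bar>ind {s..t} tt *. ip Om (w' tt) v\<bar>)" using i unfolding set_integrable_def by (rule integrable_abs)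
  show "integrable lebesgue (%tt. ind {s..t} tt *. M tt)" using Mi unfolding set_integrable_def .
  have ae: "AE tt in lebesgue. tt \<in> {0<..<T} --> \<bar>ip Om (w' tt) v\<bar> <= M tt" using M by (simp add: AE_lebesgue_on_iff)
  \<comment> \<open>The majorant is known on the open time interval only; its endpoints are a null
    set.\<close>
  have e0: "AE tt in lebesgue. tt \<notin> {0, T}" by (rule AE_not_in) (simp add: negligible_iff_null_sets[symmetric])
  show "AE tt in lebesgue. \<bar>ind {s..t} tt *. ip Om (w' tt) v\<bar> <= ind {s..t} tt *. M tt" using ae e0
  proof eventually_elim
  case (elim tt)
  show ?case
  proof (cases "tt \<in> {s..t}")
  case True
  then have "tt \<in> {0<..<T}" using elim(2) st by auto
  then show ?thesis using elim(1) True by simp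
  qed simp
  qed
 qed
 then show ?thesis using eq unfolding set_lebesgue_integral_def by simp
qed

lemma set_integral_const_Icc:
 fixes c :: real
 assumes "s <= t"
 shows "set_integrable lebesgue {s..t} (%_. c)" "(LINT tt:{s..t}|lebesgue. c) = (t-s) * c"
proof -
 show "set_integrable lebesgue {s..t} (%_. c)" unfolding set_integrable_def by (simp add: integrable_mult_left_iff emeasure_lborel_Icc_eq)
 show "(LINT tt:{s..t}|lebesgue. c) = (t-s) * c" unfolding set_lebesgue_integral_def using assms by simp
qed

text \<open>\<open>\<Phi>\<close> is the primitive of \<open>N\<^sup>2\<close>.\<close>

lemma L2_time_majorant:
 fixes N :: "real => real"
 assumes N: "in_Lp {0<..<T} 2 N"
 obtains \<Phi> :: "real => real" where "!!s t. s <= t ==> \<Phi> s <= \<Phi> t" "!!t. 0 <= \<Phi> t" "!!t. \<Phi> t <= (nrm {0<..<T} N)\<^sup>2"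
  "!!s t. set_integrable lebesgue {s..t} (%tt. ind {0<..<T} tt * N tt)"
  "!!s t. s <= t ==> (LINT tt:{s..t}|lebesgue. ind {0<..<T} tt * N tt)\<^sup>2 <= (t-s)*(\<Phi> t-\<Phi> s)"
proof -
 define N' where "N' tt = ind {0<..<T} tt * N tt" for tt
 have sq: "(N' tt)\<^sup>2 = ind {0<..<T} tt *. (norm (N tt))\<^sup>2" for tt by (simp add: N'_def indicator_def)
 have i: "integrable lebesgue (%tt. (N' tt)\<^sup>2)" using N unfolding sq in_L2_iff by (simp add: integrable_restrict_space)
 have mN: "N' \<in> bm lebesgue" using lebesgue_measurable_extend[of N "{0<..<T}"] N by (simp add: in_L2_iff N'_def[abs_def])
 have iA: "integrable lebesgue (%tt. ind A tt * (N' tt)\<^sup>2)" if "A \<in> sets lebesgue" for A by (rule Bochner_Integration.integrable_bound[OF i])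
  (use that borel_measurable_integrable[OF i] in \<open>auto simp: indicator_def intro!: borel_measurable_times borel_measurable_indicator\<close>)
 define \<Phi> where "\<Phi> t = (LINT tt|lebesgue. ind {..t} tt * (N' tt)\<^sup>2)" for t
 have diff: "(LINT tt|lebesgue. ind {s..t} tt * (N' tt)\<^sup>2) = \<Phi> t-\<Phi> s" if "s <= t" for s t
 proof -
  have "(LINT tt|lebesgue. ind {s..t} tt * (N' tt)\<^sup>2) = (LINT tt|lebesgue. ind {..t} tt * (N' tt)\<^sup>2-ind {..s} tt * (N' tt)\<^sup>2)"
  proof (rule integral_cong_AE)
  have "AE tt in lebesgue. tt \<notin> {s}" by (rule AE_not_in) (simp add: negligible_iff_null_sets[symmetric])
  then show "AE tt in lebesgue. ind {s..t} tt * (N' tt)\<^sup>2 = ind {..t} tt * (N' tt)\<^sup>2-ind {..s} tt * (N' tt)\<^sup>2" by eventually_elim (use that in \<open>auto simp: indicator_def\<close>)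
  show "(%tt. ind {..t} tt * (N' tt)\<^sup>2-ind {..s} tt * (N' tt)\<^sup>2) \<in> bm lebesgue" by (intro borel_measurable_diff borel_measurable_integrable[OF iA]) auto
  qed (intro borel_measurable_integrable[OF iA], simp)
  also have "... = \<Phi> t-\<Phi> s" unfolding \<Phi>_def by (rule Bochner_Integration.integral_diff) (intro iA; simp)+
  finally show ?thesis .
 qed
 have N2: "in_Lp {s..t} 2 N'" for s t unfolding in_L2_iff using mN iA[of "{s..t}"] by (auto simp: integrable_restrict_space intro: measurable_restrict_space1)
 have lm: "{s..t} \<in> lmeasurable" for s t :: real by simp
 show thesis
 proof (rule that[of \<Phi>])
  show "\<Phi> s <= \<Phi> t" if "s <= t" for s t unfolding \<Phi>_def by (rule integral_mono[OF iA iA]) (use that in \<open>auto simp: indicator_def\<close>)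
  show "0 <= \<Phi> t" for t unfolding \<Phi>_def by (intro Bochner_Integration.integral_nonneg) simp
  show "\<Phi> t <= (nrm {0<..<T} N)\<^sup>2" for t
  proof -
  have "\<Phi> t <= (LINT tt|lebesgue. (N' tt)\<^sup>2)" unfolding \<Phi>_def by (rule integral_mono[OF iA i]) (auto simp: indicator_def)
  also have "... = (nrm {0<..<T} N)\<^sup>2" unfolding sq by (subst L2_norm_sq_support) auto
  finally show ?thesis .
  qed
  show "set_integrable lebesgue {s..t} (%tt. ind {0<..<T} tt * N tt)" for s t using L1_le_L2(1)[OF lm N2, of s t] unfolding set_integrable_def N'_def[symmetric] by (simp add: integrable_restrict_space)
  show "(LINT tt:{s..t}|lebesgue. ind {0<..<T} tt * N tt)\<^sup>2 <= (t-s)*(\<Phi> t-\<Phi> s)" if "s <= t" for s t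
  proof -
  have "(LINT tt:{s..t}|lebesgue. N' tt) = (LINT tt|lon {s..t}. N' tt)" unfolding set_lebesgue_integral_def by (subst integral_restrict_space) auto
  then have "\<bar>LINT tt:{s..t}|lebesgue. N' tt\<bar> <= sqrt (t-s) * nrm {s..t} N'" using order_trans[OF integral_abs_bound L1_le_L2(2)[OF lm N2, of s t]] that by simp
  then have "\<bar>LINT tt:{s..t}|lebesgue. N' tt\<bar>\<^sup>2 <= (sqrt (t-s) * nrm {s..t} N')\<^sup>2" by (intro power_mono) auto
  also have "... = (t-s)*(LINT tt|lebesgue. ind {s..t} tt * (N' tt)\<^sup>2)" using that by (simp add: power_mult_distrib L2_norm_sq_support)
  also have "... = (t-s)*(\<Phi> t-\<Phi> s)" by (simp only: diff[OF that])
  finally show ?thesis by (simp add: N'_def)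
  qed
 qed
qed

text \<open>Plays the part of Taylor's formula with remainder: an integrand within \<open>K\<close>
  of a continuous derivative \<open>P'\<close> has an integral within \<open>(t - s) K\<close> of
  the increment of \<open>P\<close>. Applied twice, it avoids double integrals.\<close>

lemma primitive_close:
 fixes f P P' :: "real => real"
 assumes st: "s <= t" and f: "set_integrable lebesgue {s..t} f" and F: "(LINT tt:{s..t}|lebesgue. f tt) = F"
  and P: "!!tt. (P has_real_derivative P' tt) (at tt)" and cont: "continuous_on UNIV P'"
  and close: "!!tt. tt \<in> {s..t} ==> \<bar>f tt-P' tt\<bar> <= K"
 shows "\<bar>F-(P t-P s)\<bar> <= (t-s) * K"
proof -
 have ip: "integrable lborel (%tt. ind {s..t} tt *. P' tt)" by (rule borel_integrable_compact) (auto intro: continuous_on_subset[OF cont])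
 have Ip: "(LINT tt|lborel. ind {s..t} tt *. P' tt) = P t-P s" by (rule integral_FTC_atLeastAtMost[OF st])
  (use P in \<open>auto intro!: continuous_on_subset[OF cont] simp: has_real_derivative_iff_has_vector_derivative[symmetric] intro: has_field_derivative_at_within\<close>)
 have ip': "set_integrable lebesgue {s..t} P'" unfolding set_integrable_def using ip by (simp add: integrable_completion borel_measurable_integrable)
 have Ip': "(LINT tt:{s..t}|lebesgue. P' tt) = P t-P s" unfolding set_lebesgue_integral_def Ip[symmetric] by (rule integral_completion) (use ip in simp)
 have "F-(P t-P s) = (LINT tt:{s..t}|lebesgue. f tt-P' tt)" unfolding F[symmetric] Ip'[symmetric] by (rule set_integral_diff(2)[symmetric, OF f ip'])
 also have "\<bar>...\<bar> <= (LINT tt:{s..t}|lebesgue. K)" unfolding set_lebesgue_integral_def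
 proof (rule order_trans[OF integral_abs_bound integral_mono])
  show "integrable lebesgue (%tt. \<bar>ind {s..t} tt *. (f tt-P' tt)\<bar>)" using set_integral_diff(1)[OF f ip'] unfolding set_integrable_def by (rule integrable_abs)
  show "integrable lebesgue (%tt. ind {s..t} tt *. K)" using set_integral_const_Icc(1)[OF st] unfolding set_integrable_def .
  show "\<bar>ind {s..t} tt *. (f tt-P' tt)\<bar> <= ind {s..t} tt *. K" for tt using close[of tt] by (auto simp: indicator_def)
 qed
 also have "... = (t-s) * K" by (rule set_integral_const_Icc(2)[OF st])
 finally show ?thesis .
qed

lemma time_integral:
 assumes "has_time_deriv Om T w w'" "in_Lp Om 2 v" "0 <= s" "s <= t" "t <= T"
 shows "set_integrable lebesgue {s..t} (%tt. ip Om (w' tt) v)"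
  "(LINT tt:{s..t}|lebesgue. ip Om (w' tt) v) = ip Om (w t) v-ip Om (w s) v" using assms unfolding has_time_deriv_def by blast+

text \<open>On the whole interval the pairing with \<open>w'\<close> stays within the integral of
  \<open>M\<close> of its value at the endpoint \<open>r\<close>; the comparison primitive is linear
  with that slope.\<close>

lemma first_order_consistency:
 fixes w :: "real => real^'d::finite => 'b::euclidean_space"
 assumes w: "has_time_deriv Om T w w'" and w': "has_time_deriv Om T w' w''"
  and v: "in_Lp Om 2 v" and st: "0 <= s" "s <= t" "t <= T"
  and M: "AE tt in lon {0<..<T}. \<bar>ip Om (w'' tt) v\<bar> <= M tt"
  and Mi: "!!s t. set_integrable lebesgue {s..t} M" and Mpos: "!!tt. 0 <= M tt"
  and r: "r = s \<or> r = t"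
 shows "\<bar>ip Om (w t) v-ip Om (w s) v-(t-s) * ip Om (w' r) v\<bar> <= (t-s)*(LINT tt:{s..t}|lebesgue. M tt)"
proof -
 have mono: "(LINT tt:{a..b}|lebesgue. M tt) <= (LINT tt:{s..t}|lebesgue. M tt)" if "{a..b} <= {s..t}" for a b unfolding set_lebesgue_integral_def by (rule integral_mono) (use that Mi Mpos in \<open>auto simp: set_integrable_def indicator_def\<close>)
 have "\<bar>(ip Om (w t) v-ip Om (w s) v)-(t * ip Om (w' r) v-s * ip Om (w' r) v)\<bar> <= (t-s)*(LINT tt:{s..t}|lebesgue. M tt)"
 proof (rule primitive_close[OF st(2) time_integral[OF w v st]])
  show "((%tt. tt * ip Om (w' r) v) has_real_derivative ip Om (w' r) v) (at tt)" for tt by (auto intro!: derivative_eq_intros)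
  fix tt assume tt: "tt \<in> {s..t}"
  show "\<bar>ip Om (w' tt) v-ip Om (w' r) v\<bar> <= (LINT tt:{s..t}|lebesgue. M tt)" using r
  proof
  assume "r = s"
  then show ?thesis using time_increment[OF w' v _ _ _ M Mi, of s tt] mono[of s tt] tt st by auto
  next
  assume "r = t"
  then show ?thesis using time_increment[OF w' v _ _ _ M Mi, of tt t] mono[of tt t] tt st by (auto simp: abs_minus_commute)
  qed
 qed simp
 then show ?thesis by (simp add: algebra_simps)
qed

text \<open>Both one-sided increments are compared with \<open>dt\<close> times the derivative at
  the middle time, which cancels in the difference.\<close>

lemma second_difference:
 fixes w :: "real => real^'d::finite => 'b::euclidean_space"
 assumes w: "has_time_deriv Om T w w'" and w': "has_time_deriv Om T w' w''"
  and v: "in_Lp Om 2 v" and st: "0 <= t-dt" "0 <= dt" "t+dt <= T"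
  and M: "AE tt in lon {0<..<T}. \<bar>ip Om (w'' tt) v\<bar> <= M tt"
  and Mi: "!!s t. set_integrable lebesgue {s..t} M" and Mpos: "!!tt. 0 <= M tt"
 shows "\<bar>ip Om (w (t+dt)) v-2 * ip Om (w t) v+ip Om (w (t-dt)) v\<bar>
  <= 2 * dt * (LINT tt:{t-dt..t+dt}|lebesgue. M tt)"
proof -
 have mono: "(LINT tt:{a..b}|lebesgue. M tt) <= (LINT tt:{t-dt..t+dt}|lebesgue. M tt)" if "{a..b} <= {t-dt..t+dt}" for a b unfolding set_lebesgue_integral_def by (rule integral_mono) (use that Mi Mpos in \<open>auto simp: set_integrable_def indicator_def\<close>)
 have "\<bar>ip Om (w (t+dt)) v-ip Om (w t) v-dt * ip Om (w' t) v\<bar> <= dt * (LINT tt:{t..t+dt}|lebesgue. M tt)" using first_order_consistency[OF w w' v _ _ _ M Mi Mpos, of t "t+dt" t] st by simp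
 moreover have "\<bar>ip Om (w t) v-ip Om (w (t-dt)) v-dt * ip Om (w' t) v\<bar> <= dt * (LINT tt:{t-dt..t}|lebesgue. M tt)" using first_order_consistency[OF w w' v _ _ _ M Mi Mpos, of "t-dt" t t] st by simp
 moreover have "dt * (LINT tt:{t..t+dt}|lebesgue. M tt) <= dt * (LINT tt:{t-dt..t+dt}|lebesgue. M tt)"
  "dt * (LINT tt:{t-dt..t}|lebesgue. M tt) <= dt * (LINT tt:{t-dt..t+dt}|lebesgue. M tt)" using st by (intro mult_left_mono mono; simp)+
 ultimately show ?thesis by linarith
qed

text \<open>Second order Taylor expansion at the new time, with first derivative \<open>b\<close>
  and second derivative \<open>a\<close> there. The stencil is twice the one-step increment minus
  half the two-step increment: the \<open>a\<close> terms cancel, \<open>dt * b\<close> remains, and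
  the remainders add up to \<open>2 + 4/2 = 4\<close>.\<close>

lemma bdf_consistency:
 fixes w :: "real => real^'d::finite => 'b::euclidean_space"
 assumes w: "has_time_deriv Om T w w'" and w': "has_time_deriv Om T w' w''" and w'': "has_time_deriv Om T w'' w'''"
  and v: "in_Lp Om 2 v" and st: "0 <= t-dt" "0 <= dt" "t+dt <= T"
  and M: "AE tt in lon {0<..<T}. \<bar>ip Om (w''' tt) v\<bar> <= M tt"
  and Mi: "!!s t. set_integrable lebesgue {s..t} M" and Mpos: "!!tt. 0 <= M tt"
 shows "\<bar>3/2 * ip Om (w (t+dt)) v-2 * ip Om (w t) v+1/2 * ip Om (w (t-dt)) v
  - dt * ip Om (w' (t+dt)) v\<bar> <= 4 * dt\<^sup>2*(LINT tt:{t-dt..t+dt}|lebesgue. M tt)"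
proof -
 let ?G = "LINT tt:{t-dt..t+dt}|lebesgue. M tt"
 let ?r = "t+dt"
 define a where "a = ip Om (w'' ?r) v"
 define b where "b = ip Om (w' ?r) v"
 have mono: "(LINT tt:{a..b}|lebesgue. M tt) <= ?G" if "{a..b} <= {t-dt..t+dt}" for a b unfolding set_lebesgue_integral_def by (rule integral_mono) (use that Mi Mpos in \<open>auto simp: set_integrable_def indicator_def\<close>)
 have d1: "\<bar>b-ip Om (w' tt) v-(?r-tt) * a\<bar> <= (?r-tt) * ?G" if "tt \<in> {t-dt..?r}" for tt
 proof -
  have "\<bar>b-ip Om (w' tt) v-(?r-tt) * a\<bar> <= (?r-tt)*(LINT tt:{tt..?r}|lebesgue. M tt)" unfolding a_def b_def by (rule first_order_consistency[OF w' w'' v _ _ _ M Mi Mpos]) (use that st in auto)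
  also have "... <= (?r-tt) * ?G" using that by (intro mult_left_mono mono) auto
  finally show ?thesis .
 qed
 have G0: "0 <= ?G" unfolding set_lebesgue_integral_def using Mpos by (intro Bochner_Integration.integral_nonneg) simp
 have d2: "\<bar>(ip Om (w ?r) v-ip Om (w s) v)-((?r-s) * b-(?r-s)\<^sup>2/2 * a)\<bar> <= (?r-s)*((?r-s) * ?G)"
  if s: "s \<in> {t-dt..?r}" for s
 proof -
  have "\<bar>(ip Om (w ?r) v-ip Om (w s) v)-((?r * b+(?r - ?r)\<^sup>2/2 * a)-(s * b+(?r-s)\<^sup>2/2 * a))\<bar> <= (?r-s)*((?r-s) * ?G)"
  proof (rule primitive_close[OF _ time_integral[OF w v]])
  show "((%tt. tt * b+(?r-tt)\<^sup>2/2 * a) has_real_derivative (b-(?r-tt) * a)) (at tt)" for tt by (auto intro!: derivative_eq_intros simp: field_simps)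
  show "continuous_on UNIV (%tt. b-(?r-tt) * a)" by (intro continuous_intros)
  fix tt assume tt: "tt \<in> {s..?r}"
  have "\<bar>ip Om (w' tt) v-(b-(?r-tt) * a)\<bar> <= (?r-tt) * ?G" using d1[of tt] tt s by auto
  also have "... <= (?r-s) * ?G" using tt G0 by (intro mult_right_mono) auto
  finally show "\<bar>ip Om (w' tt) v-(b-(?r-tt) * a)\<bar> <= (?r-s) * ?G" .
  qed (use s st in auto)
  then show ?thesis by (simp add: algebra_simps)
 qed
 have e1: "\<bar>(ip Om (w ?r) v-ip Om (w t) v)-(dt * b-dt\<^sup>2/2 * a)\<bar> <= dt * (dt * ?G)" using d2[of t] st by simp
 have e2: "\<bar>(ip Om (w ?r) v-ip Om (w (t-dt)) v)-(2 * dt * b-2 * dt\<^sup>2 * a)\<bar> <= 4*(dt * (dt * ?G))" using d2[of "t-dt"] st by (simp add: power2_eq_square algebra_simps)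
 have "4 * dt\<^sup>2 * ?G = 4*(dt * (dt * ?G))" by (simp add: power2_eq_square)
 then show ?thesis unfolding b_def[symmetric] using e1 e2 by (auto simp: abs_le_iff algebra_simps)
qed

section \<open>Values at individual times\<close>

text \<open>Bounds that hold for almost every time pass to every time, by continuity in \<open>L\<^sup>2\<close>.\<close>

lemma AE_time_nearby:
 fixes T t dt :: real
 assumes T: "T > 0" and P: "AE tt in lon {0<..<T}. P tt" and t: "t \<in> {0..T}" and dt: "dt > 0"
 obtains tt where "tt \<in> {0<..<T}" "\<bar>tt-t\<bar> < dt" "P tt"
proof (rule ccontr)
 assume contra: "\<not> thesis"
 define a where "a = max 0 (t-dt)"
 define b where "b = min T (t+dt)"
 have ab: "a < b" using T t dt by (auto simp: a_def b_def max_def min_def)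
 have "AE tt in lebesgue. tt \<in> {0<..<T} --> P tt" using P by (simp add: AE_lebesgue_on_iff)
 then have "AE tt in lebesgue. tt \<notin> {a<..<b}"
 proof eventually_elim
  case (elim tt)
  show ?case
  proof
  assume "tt \<in> {a<..<b}"
  then have "tt \<in> {0<..<T}" "\<bar>tt-t\<bar> < dt" by (auto simp: a_def b_def)
  with elim that contra show False by blast
  qed
 qed
 then have "{a<..<b} \<in> null_sets lebesgue" by (simp add: AE_iff_null_sets)
 then have "emeasure lebesgue {a<..<b} = 0" by auto
 then show False using ab by simp
qed

lemma AE_time_sequence:
 fixes w :: "real => real^'d::finite => 'b::euclidean_space"
 assumes T: "T > 0" and P: "AE tt in lon {0<..<T}. P tt" and t: "t \<in> {0..T}"
  and c: "((%tt. nrm Om (%x. w tt x-w t x)) \<longlongrightarrow> 0) (at t within {0..T})"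
 obtains tt :: "nat => real" where "!!n. tt n \<in> {0<..<T}" "!!n. P (tt n)"
  "(%n. nrm Om (%x. w t x-w (tt n) x)) \<longlonglongrightarrow> 0"
proof -
 have "\<exists>tt. tt \<in> {0<..<T} & P tt & nrm Om (%x. w t x-w tt x) < inverse (real (Suc n))" for n
 proof -
  have "eventually (%tt. nrm Om (%x. w tt x-w t x) < inverse (real (Suc n))) (at t within {0..T})" by (rule order_tendstoD(2)[OF c]) simp
  then obtain dt where dt: "dt > 0" "!!tt. tt \<in> {0..T} ==> tt ~= t ==> dist tt t < dt ==> nrm Om (%x. w tt x-w t x) < inverse (real (Suc n))" unfolding eventually_at by auto
  obtain tt where tt: "tt \<in> {0<..<T}" "\<bar>tt-t\<bar> < dt" "P tt" by (rule AE_time_nearby[OF T P t dt(1)])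
  have "nrm Om (%x. w t x-w tt x) < inverse (real (Suc n))"
  proof (cases "tt = t")
  case False
  then show ?thesis using dt(2)[of tt] tt by (simp add: dist_real_def L2_norm_minus_commute[of Om "w t"] del: of_nat_Suc)
  qed simp
  with tt show ?thesis by blast
 qed
 then obtain tt where tt: "!!n. tt n \<in> {0<..<T}" "!!n. P (tt n)"
  "!!n. nrm Om (%x. w t x-w (tt n) x) < inverse (real (Suc n))" by metis
 have "(%n. nrm Om (%x. w t x-w (tt n) x)) \<longlonglongrightarrow> 0" by (rule Lim_null_comparison[OF _ LIMSEQ_inverse_real_of_nat])
  (use tt(3) in \<open>auto intro!: always_eventually less_imp_le simp del: of_nat_Suc\<close>)
 with tt(1,2) show thesis using that by blast
qed

text \<open>The excess of the norm of \<open>f\<close> over \<open>U\<close> is pointwise at most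
  the distance from \<open>f\<close> to \<open>g n\<close>, so its \<open>L2\<close> norm is
  0.\<close>

lemma Linf_limit:
 fixes f :: "real^'d::finite => 'b::euclidean_space"
 assumes Om: "Om \<in> lmeasurable" and f: "in_Lp Om 2 f" and g: "!!n. in_Lp Om 2 (g n)"
  and lim: "(%n. nrm Om (%x. f x-g n x)) \<longlonglongrightarrow> 0" and U: "!!n :: nat. AE x in lon Om. norm (g n x) <= U"
 shows "AE x in lon Om. norm (f x) <= U"
proof -
 have fm: "f \<in> bm (lon Om)" using f by (simp add: in_L2_iff)
 define r where "r x = max 0 (norm (f x)-U)" for x
 have rm: "r \<in> bm (lon Om)" unfolding r_def using fm by measurable
 have le: "AE x in lon Om. norm (r x) <= 1 * norm (f x-g n x)" for n using U[of n]
 proof eventually_elim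
  case (elim x)
  have "norm (f x) <= norm (f x-g n x)+norm (g n x)" by (metis diff_add_cancel norm_triangle_ineq)
  with elim show ?case by (auto simp: r_def)
 qed
 have r2: "in_Lp Om 2 r" by (rule in_L2_dominated[OF rm in_L2_diff[OF f g] le])
 have "nrm Om r <= nrm Om (%x. f x-g n x)" for n using L2_norm_dominated[OF rm in_L2_diff[OF f g] _ le, of n] by simp
 then have "nrm Om r <= 0" by (intro LIMSEQ_le_const[OF lim]) blast
 then have "nrm Om r = 0" using L2_norm_nonneg[of Om r] by linarith
 then have "AE x in lon Om. r x = 0" using L2_norm_eq_0_iff[OF r2] by simp
 then show ?thesis by eventually_elim (auto simp: r_def max_def split: if_splits)
qed

lemma weak_deriv_pairing_limit:
 fixes f :: "real^'d::finite => 'b::euclidean_space"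
 assumes Om: "open Om" and f: "in_H Om m f" and g: "!!n. in_H Om m (g n)" and l: "length is <= m"
  and lim: "(%n. nrm Om (%x. f x-g n x)) \<longlonglongrightarrow> 0" and fi: "tf Om fi"
 shows "(%n. ip Om (%x. wd Om is (g n) x \<bullet> b) fi) \<longlonglongrightarrow> ip Om (%x. wd Om is f x \<bullet> b) fi"
proof -
 have S: "Om \<in> sets lebesgue" using Om by simp
 note t = test_partials_list[OF fi, of "is"]
 have eq: "ip Om (%x. wd Om is h x \<bullet> b) fi = (-1)^length is * ip Om h (%x. pd is fi x *. b)"
  if h: "in_H Om m h" for h :: "real^'d => 'b"
 proof -
  have "hwd Om is (%x. h x \<bullet> b) (%x. wd Om is h x \<bullet> b)" by (rule has_weak_deriv_bounded_linear[OF Om bounded_linear_inner_left in_W_weak_deriv(1)[OF Om h l]])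
  then have "(LINT x|lon Om. pd is fi x * (h x \<bullet> b)) = (-1)^length is * (LINT x|lon Om. fi x * (wd Om is h x \<bullet> b))" using fi by (simp add: has_weak_deriv_def)
  then have "(-1)^length is * (LINT x|lon Om. pd is fi x * (h x \<bullet> b)) = ((-1)^length is * (-1)^length is)*(LINT x|lon Om. fi x * (wd Om is h x \<bullet> b))" by simp
  also have "((-1)^length is * (-1)^length is) = (1 :: real)" by (simp add: power_mult_distrib[symmetric])
  finally show ?thesis by (simp add: L2_inner_def mult.commute)
 qed
 have tb: "in_Lp Om 2 (%x. pd is fi x *. b)" by (rule test_in_L2[OF test_scaleR[OF t smooth_const] S])
 have self: "in_Lp Om 2 h" if "in_H Om m h" for h :: "real^'d => 'b" by (rule in_W_self(1)[OF Om that]) simp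
 show ?thesis unfolding eq[OF f] eq[OF g] by (intro tendsto_mult tendsto_const L2_inner_tendsto self f g tb lim)
qed

lemma in_L2_inner_Basis:
 fixes f :: "'a::euclidean_space => 'b::euclidean_space"
 assumes "in_Lp S 2 f" "b \<in> Basis"
 shows "in_Lp S 2 (%x. f x \<bullet> b)" "nrm S (%x. f x \<bullet> b) <= nrm S f"
proof -
 have m: "(%x. f x \<bullet> b) \<in> bm (lon S)" using assms by (auto simp: in_L2_iff)
 have le: "AE x in lon S. norm (f x \<bullet> b) <= 1 * norm (f x)" using Basis_le_norm[OF assms(2)] by simp
 show "in_Lp S 2 (%x. f x \<bullet> b)" by (rule in_L2_dominated[OF m assms(1) le])
 show "nrm S (%x. f x \<bullet> b) <= nrm S f" using L2_norm_dominated[OF m assms(1) _ le] by simp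
qed

lemma L2_norm_sq_Basis:
 fixes f :: "'a::euclidean_space => 'b::euclidean_space"
 assumes "in_Lp S 2 f"
 shows "(nrm S f)\<^sup>2 = (\<Sum>b\<in>Basis. (nrm S (%x. f x \<bullet> b))\<^sup>2)"
proof -
 have "(norm (f x))\<^sup>2 = (\<Sum>b\<in>Basis. (norm (f x \<bullet> b))\<^sup>2)" for x by (simp only: power2_norm_eq_inner inner_real_def euclidean_inner[of "f x" "f x"])
 then show ?thesis unfolding L2_norm_sq using in_L2_inner_Basis(1)[OF assms] by (simp add: in_L2_iff Bochner_Integration.integral_sum)
qed

text \<open>Weak lower semicontinuity, by duality with test functions for each derivative and each
  component. Working componentwise costs the square root of their number, which the generic constant
  absorbs.\<close>

lemma H_norm_limit:
 fixes f :: "real^'d::finite => 'b::euclidean_space"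
 assumes Om: "open Om" and f: "in_H Om m f" and g: "!!n. in_H Om m (g n)"
  and lim: "(%n. nrm Om (%x. f x-g n x)) \<longlonglongrightarrow> 0" and B: "!!n. H_norm Om m (g n) <= B"
 shows "H_norm Om m f <= sqrt (real (card {is :: 'd list. length is <= m}) * real DIM('b)) * B"
proof -
 have S: "Om \<in> sets lebesgue" using Om by simp
 have B0: "0 <= B" using B[of 0] H_norm_nonneg[of Om m "g 0"] by linarith
 have one: "nrm Om (%x. wd Om is f x \<bullet> b) <= B" if l: "length is <= m" and b: "b \<in> Basis" for "is" and b :: 'b
 proof -
  have w2: "in_Lp Om 2 (wd Om is h)" if "in_H Om m h" for h :: "real^'d => 'b" by (rule in_W_weak_deriv(3)[OF Om that l]) simp
  have "nrm Om (%x. wd Om is f x \<bullet> b) <= B \<or> nrm Om (%x. wd Om is f x \<bullet> b) = 0"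
  proof (rule L2_norm_dual_test[OF Om in_L2_inner_Basis(1)[OF w2[OF f] b]])
  fix fi :: "real^'d => real" assume fi: "tf Om fi"
  have "\<bar>ip Om (%x. wd Om is (g n) x \<bullet> b) fi\<bar> <= B * nrm Om fi" for n
  proof -
  have "\<bar>ip Om (%x. wd Om is (g n) x \<bullet> b) fi\<bar> <= nrm Om (%x. wd Om is (g n) x \<bullet> b) * nrm Om fi" by (rule L2_Cauchy_Schwarz[OF in_L2_inner_Basis(1)[OF w2[OF g] b] test_in_L2[OF fi S]])
  also have "nrm Om (%x. wd Om is (g n) x \<bullet> b) <= B" using in_L2_inner_Basis(2)[OF w2[OF g] b, of n] L2_weak_deriv_le_H_norm[OF l, of Om "g n"] B[of n] by linarith
  finally show ?thesis by (simp add: mult_right_mono)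
  qed
  then show "\<bar>ip Om (%x. wd Om is f x \<bullet> b) fi\<bar> <= B * nrm Om fi" by (intro LIMSEQ_le_const2[OF tendsto_rabs[OF weak_deriv_pairing_limit[OF Om f g l lim fi]]]) blast
  qed
  then show ?thesis using B0 by auto
 qed
 have "(H_norm Om m f)\<^sup>2 <= (\<Sum>is :: 'd list | length is <= m. \<Sum>b\<in>(Basis :: 'b set). B\<^sup>2)" unfolding H_norm_sq
 proof (rule sum_mono)
  fix "is" :: "'d list" assume "is \<in> {is. length is <= m}"
  then have l: "length is <= m" by simp
  have "(nrm Om (wd Om is f))\<^sup>2 = (\<Sum>b\<in>Basis. (nrm Om (%x. wd Om is f x \<bullet> b))\<^sup>2)" by (rule L2_norm_sq_Basis[OF in_W_weak_deriv(3)[OF Om f l]]) simp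
  also have "... <= (\<Sum>b\<in>(Basis :: 'b set). B\<^sup>2)" by (intro sum_mono power_mono one l) auto
  finally show "(nrm Om (wd Om is f))\<^sup>2 <= (\<Sum>b\<in>(Basis :: 'b set). B\<^sup>2)" .
 qed
 also have "... = (sqrt (real (card {is :: 'd list. length is <= m}) * real DIM('b)) * B)\<^sup>2" by (simp add: power_mult_distrib)
 finally show ?thesis by (rule power2_le_imp_le) (use B0 in simp)
qed

text \<open>The same duality, now against the \<open>L1\<close> norm of the test function. The
  factor \<open>d^2\<close> comes from bounding the norm of a matrix by the sum of its
  entries.\<close>

lemma grad_Linf_limit:
 fixes f :: "real^'d::finite => real^'d"
 assumes Om: "open Om" "Om \<in> lmeasurable" and f: "in_H Om 1 f" and g: "!!n. in_H Om 1 (g n)"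
  and lim: "(%n. nrm Om (%x. f x-g n x)) \<longlonglongrightarrow> 0"
  and W: "!!n :: nat. in_W Om 1 \<infinity> (g n)" "!!n. W_norm Om 1 \<infinity> (g n) <= W"
 shows "in_Lp Om \<infinity> (grad Om f)" "sn Om (grad Om f) <= (real CARD('d))\<^sup>2 * W"
proof -
 have S: "Om \<in> sets lebesgue" using Om by simp
 have W0: "0 <= W" using W(2)[of 0] W_norm_inf_nonneg[of Om 1 "g 0"] by linarith
 have w2: "in_Lp Om 2 (wd Om [i] h)" if "in_H Om 1 h" for h :: "real^'d => real^'d" and i by (rule in_W_weak_deriv(3)[OF Om(1) that]) auto
 have one: "AE x in lon Om. \<bar>grad Om f x $ j $ i\<bar> <= W" for i j
 proof -
  have ax: "(axis j 1 :: real^'d) \<in> Basis" by simp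
  have "AE x in lon Om. \<bar>wd Om [i] f x \<bullet> axis j 1\<bar> <= W"
  proof (rule Linf_dual_test[OF Om in_L2_inner_Basis(1)[OF w2[OF f] ax] W0])
  fix fi :: "real^'d => real" assume fi: "tf Om fi"
  note p2 = test_in_L2[OF fi S]
  have "\<bar>ip Om (%x. wd Om [i] (g n) x \<bullet> axis j 1) fi\<bar> <= W * (LINT x|lon Om. \<bar>fi x\<bar>)" for n
  proof -
  note gi = in_W_weak_deriv(3)[OF Om(1) W(1)[of n], of "[i]", simplified]
  have "\<bar>ip Om (%x. wd Om [i] (g n) x \<bullet> axis j 1) fi\<bar> <= (LINT x|lon Om. \<bar>(wd Om [i] (g n) x \<bullet> axis j 1) * fi x\<bar>)" unfolding L2_inner_def inner_real_def by (rule integral_abs_bound)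
  also have "... <= (LINT x|lon Om. W * \<bar>fi x\<bar>)"
  proof (rule integral_mono_AE)
  show "integrable (lon Om) (%x. \<bar>(wd Om [i] (g n) x \<bullet> axis j 1) * fi x\<bar>)" using integrable_inner_L2[OF in_L2_inner_Basis(1)[OF w2[OF g] ax] p2, of i n] by (intro integrable_abs) simp
  show "integrable (lon Om) (%x. W * \<bar>fi x\<bar>)" using L1_le_L2(1)[OF Om(2) p2] by simp
  show "AE x in lon Om. \<bar>(wd Om [i] (g n) x \<bullet> axis j 1) * fi x\<bar> <= W * \<bar>fi x\<bar>" using Linf_norm_AE[OF gi]
  proof eventually_elim
  case (elim x)
  have "\<bar>wd Om [i] (g n) x \<bullet> axis j 1\<bar> <= norm (wd Om [i] (g n) x)" by (rule Basis_le_norm[OF ax])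
  also have "... <= W" using elim W_norm_inf_ge[of "[i]" 1 Om "g n"] W(2)[of n] by simp
  finally show ?case by (simp add: abs_mult mult_right_mono)
  qed
  qed
  also have "... = W * (LINT x|lon Om. \<bar>fi x\<bar>)" by simp
  finally show ?thesis .
  qed
  then show "\<bar>ip Om (%x. wd Om [i] f x \<bullet> axis j 1) fi\<bar> <= W * (LINT x|lon Om. \<bar>fi x\<bar>)" by (intro LIMSEQ_le_const2[OF tendsto_rabs[OF weak_deriv_pairing_limit[OF Om(1) f g _ lim fi]]]) auto
  qed
  then show ?thesis by (simp add: grad_nth inner_axis)
 qed
 have "AE x in lon Om. \<forall>i\<in>UNIV. \<forall>j\<in>UNIV. \<bar>grad Om f x $ j $ i\<bar> <= W" by (intro AE_finite_allI one) auto
 then have ae: "AE x in lon Om. norm (grad Om f x) <= (real CARD('d))\<^sup>2 * W"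
 proof eventually_elim
  case (elim x)
  have "norm (grad Om f x) <= (\<Sum>j\<in>UNIV. norm (grad Om f x $ j))" unfolding norm_vec_def by (rule L2_set_le_sum) simp
  also have "... <= (\<Sum>j\<in>UNIV. \<Sum>i\<in>UNIV. \<bar>grad Om f x $ j $ i\<bar>)" by (intro sum_mono norm_le_l1_cart)
  also have "... <= (\<Sum>j\<in>(UNIV :: 'd set). \<Sum>i\<in>(UNIV :: 'd set). W)" using elim by (intro sum_mono) auto
  also have "... = (real CARD('d))\<^sup>2 * W" by (simp add: power2_eq_square)
  finally show ?case .
 qed
 have gm: "grad Om f \<in> bm (lon Om)" using grad_in_L2(1)[OF Om(1) f] by (simp add: in_L2_iff)
 show "in_Lp Om \<infinity> (grad Om f)" using gm ae by (auto simp: in_Linf_iff)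
 show "sn Om (grad Om f) <= (real CARD('d))\<^sup>2 * W" by (rule Linf_norm_le[OF gm _ ae]) (use W0 in simp)
qed

section \<open>A discrete Gronwall argument for the two-step scheme\<close>

text \<open>\<open>(1 + 2 x) (1 - x) = 1 + x (1 - 2 x)\<close>. Here the factor 2 in the exponent of
  the final estimate originates.\<close>

lemma exp_bound_half: "exp (2 * x)*(1-x) \<ge> 1" if "0 <= x" "x <= 1/2" for x :: real
proof -
 have "1+2 * x <= exp (2 * x)" using exp_ge_add_one_self[of "2 * x"] by simp
 then have "(1+2 * x)*(1-x) <= exp (2 * x)*(1-x)" using that by (intro mult_right_mono) auto
 moreover have "1 <= (1+2 * x)*(1-x)"
 proof -
  have "0 <= x * (1-2 * x)" using that by (intro mult_nonneg_nonneg) auto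
  then show ?thesis by (simp add: algebra_simps)
 qed
 ultimately show ?thesis by linarith
qed

text \<open>The sum on the right includes the current index, so each step divides by
  \<open>1 - x j\<close>; the restriction to \<open>x j \<le> 1/2\<close> controls this quotient by
  \<open>exp (2 * x j)\<close>.\<close>

lemma discrete_gronwall:
 fixes a x :: "nat => real"
 assumes B: "0 <= B" and x: "!!j. 2 <= j ==> j <= m ==> 0 <= x j & x j <= 1/2"
  and a: "!!j. 2 <= j ==> j <= m ==> a j <= B+(\<Sum>i=2..j. x i * a i)"
  and m: "1 <= m"
 shows "B+(\<Sum>i=2..m. x i * a i) <= exp (2*(\<Sum>i=2..m. x i)) * B" using m x a
proof (induction m rule: dec_induct)
 case base
 then show ?case by simp
next
 case (step m)
 have IH: "B+(\<Sum>i=2..m. x i * a i) <= exp (2*(\<Sum>i=2..m. x i)) * B" by (rule step.IH) (use step.prems in auto)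
 have m2: "2 <= Suc m" using step.hyps by simp
 have xm: "0 <= x (Suc m)" "x (Suc m) <= 1/2" using step.prems(1)[of "Suc m"] m2 by auto
 have s: "(\<Sum>i=2..Suc m. h i) = (\<Sum>i=2..m. h i)+h (Suc m)" for h :: "nat => real" using m2 by simp
 let ?Y = "B+(\<Sum>i=2..Suc m. x i * a i)"
 have "a (Suc m) <= ?Y" using step.prems(2)[of "Suc m"] m2 by simp
 then have "x (Suc m) * a (Suc m) <= x (Suc m) * ?Y" using xm by (intro mult_left_mono) auto
 then have "?Y * (1-x (Suc m)) <= B+(\<Sum>i=2..m. x i * a i)" unfolding s by (simp add: algebra_simps)
 then have le: "?Y * (1-x (Suc m)) <= exp (2*(\<Sum>i=2..m. x i)) * B" using IH by linarith
 have p: "0 <= exp (2 * x (Suc m))" by simp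
 have "exp (2 * x (Suc m))*(?Y * (1-x (Suc m))) <= exp (2 * x (Suc m))*(exp (2*(\<Sum>i=2..m. x i)) * B)" using le by (rule mult_left_mono) simp
 also have "... = exp (2*(\<Sum>i=2..Suc m. x i)) * B" unfolding s by (simp add: exp_add distrib_left mult_ac)
 finally have le2: "?Y * (exp (2 * x (Suc m))*(1-x (Suc m))) <= exp (2*(\<Sum>i=2..Suc m. x i)) * B" by (simp add: mult_ac)
 show ?case
 proof (cases "0 <= ?Y")
  case True
  have "?Y * 1 <= ?Y * (exp (2 * x (Suc m))*(1-x (Suc m)))" using exp_bound_half[OF xm] True by (intro mult_left_mono) auto
  from order_trans[OF this le2] show ?thesis by simp
 next
  case False
  moreover have "0 <= exp (2*(\<Sum>i=2..Suc m. x i)) * B" using B by simp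
  ultimately show ?thesis by linarith
 qed
qed

lemma sum_shift1:
 fixes f :: "nat => real"
 assumes nn: "!!j. 0 <= f j" and m: "2 <= m"
 shows "(\<Sum>j=2..m. f (j-1)) <= f 1+(\<Sum>j=2..m. f j)"
proof -
 have "(\<Sum>j=2..m. f (j-1))+f m = f 1+(\<Sum>j=2..m. f j)" using m
 proof (induction m rule: dec_induct)
  case (step m)
  then have "2 <= Suc m" by simp
  then show ?case using step.IH by simp
 qed simp
 then show ?thesis using nn[of m] by linarith
qed

text \<open>For \<open>m = 2\<close> only the index 0 occurs, which the general formula with its
  separate term \<open>f 1\<close> cannot express.\<close>

lemma sum_shift2:
 fixes f :: "nat => real"
 assumes "2 <= m"
 shows "(\<Sum>j=2..m. f (j-2)) = (if m = 2 then f 0 else f 0+f 1+(\<Sum>j=2..m-2. f j))" using assms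
proof (induction m rule: dec_induct)
 case base
 then show ?case by simp
next
 case (step m)
 show ?case
 proof (cases "m = 2")
  case True
  then show ?thesis by (simp add: numeral_eq_Suc)
 next
  case False
  then obtain l where l: "m = Suc (Suc (Suc l))" using step.hyps by (metis One_nat_def Suc_1 Suc_le_D Suc_le_mono le_antisym not_less_eq_eq)
  then show ?thesis using step.IH by (cases l) (auto simp: numeral_eq_Suc)
 qed
qed

text \<open>After the index shifts the growth weights at \<open>a j\<close> are
  \<open>1/2 S (j-1)\<close>, \<open>3 S j\<close> and \<open>3/2 S (j+1)\<close>, the shape of
  \<open>stab_const\<close>; the last one is absent at \<open>j = m\<close> because no later step
  refers to \<open>a m\<close>. The factor 4 on the left pays for \<open>2 + 1/3 + 1/6\<close> of
  the divergence terms and \<open>3/5 + 3/10 + 1/10\<close> of the gradient terms, and at least 1 is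
  left of each.\<close>

lemma bdf2_error_recursion:
 fixes a g q S Z E \<beta> :: "nat => real"
 assumes pos: "\<nu> > 0" "\<mu> > 0" "T > 0" "\<kappa> > 0" "dt > 0"
  and nn: "!!j. 0 <= a j" "!!j. 0 <= g j" "!!j. 0 <= q j" "!!j. 0 <= S j"
  and zero: "a 0 = 0" "g 0 = 0" "q 0 = 0" and E: "!!j. a j <= E j" "E 1 = 5 * a 1"
  and m: "2 <= m"
  and lam: "!!j. lm j = 4*(1/2 * S (j-1)+9/(2*\<mu>)*(Z (j-1))\<^sup>2+3 * S j+3/2*(if j = m then 0 else S (j+1)))"
  and dt2: "dt * (4*((\<kappa>+1)/T)+lm 2) <= 1/2"
  and stp: "!!j. 2 <= j ==> j <= m ==>
  E j+4*\<nu> * dt * g j+4*\<mu> * dt * q j <= E (j-1)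
  + 4 * dt * (S (j-1)*(1/2 * a j+3 * a (j-1)+3/2 * a (j-2))+9/(2*\<mu>)*(Z (j-1))\<^sup>2 * a j)
  + \<mu> * dt/18*(6 * q (j-1)+3 * q (j-2))+dt * ((2*\<kappa>+3)/T) * a j
  + \<nu> * dt/10*(6 * g (j-1)+3 * g (j-2)+g j)+2*\<mu> * dt * q j+\<beta> j"
 shows "a m+(\<Sum>j=2..m. \<nu> * dt * g j)+\<mu>*(\<Sum>j=2..m. dt * q j)
  <= 9 * a 1+\<nu> * dt * g 1+1/2*\<mu> * dt * q 1+(\<Sum>j=2..m. \<beta> j)
  + (\<Sum>j=2..m. dt * (4*((\<kappa>+1)/T)+lm j) * a j)"
proof -
 define R where "R j = 4 * dt * (S (j-1)*(1/2 * a j+3 * a (j-1)+3/2 * a (j-2))+9/(2*\<mu>)*(Z (j-1))\<^sup>2 * a j)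
  + \<mu> * dt/18*(6 * q (j-1)+3 * q (j-2))+dt * ((2*\<kappa>+3)/T) * a j
  + \<nu> * dt/10*(6 * g (j-1)+3 * g (j-2)+g j)+2*\<mu> * dt * q j+\<beta> j" for j
 have tele: "E i+(\<Sum>j=2..i. 4*\<nu> * dt * g j+4*\<mu> * dt * q j) <= E 1+(\<Sum>j=2..i. R j)" if "1 <= i" "i <= m" for i using that
 proof (induction i rule: dec_induct)
  case (step i)
  have "2 <= Suc i" using step.hyps by simp
  moreover have "E (Suc i)+4*\<nu> * dt * g (Suc i)+4*\<mu> * dt * q (Suc i) <= E i + R (Suc i)" using stp[of "Suc i"] step.hyps step.prems unfolding R_def by simp
  ultimately show ?case using step by simp
 qed simp
 have le: "E m+(\<Sum>j=2..m. 4*\<nu> * dt * g j+4*\<mu> * dt * q j) <= E 1+(\<Sum>j=2..m. R j)" using tele[of m] m by simp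
 define S' where "S' j = (if j = m then 0 else S (j+1))" for j
 have sh: "(\<Sum>j=2..m. f (j-1)) <= f 1+(\<Sum>j=2..m. f j)" if "!!j. 0 <= f j" for f :: "nat => real" by (rule sum_shift1[OF that m])
 have sh2: "(\<Sum>j=2..m. f (j-2)) <= f 0+f 1+(\<Sum>j=2..m. f j)" if "!!j. 0 <= f j" for f :: "nat => real"
 proof -
  have "(\<Sum>j=2..m-2. f j) <= (\<Sum>j=2..m. f j)" by (rule sum_mono2) (use that in auto)
  moreover have "0 <= (\<Sum>j=2..m. f j)" by (rule sum_nonneg) (rule that)
  ultimately show ?thesis unfolding sum_shift2[OF m, of f] using that[of 1] by auto
 qed
 have s1: "(\<Sum>j=2..m. S (j-1) * a (j-1)) <= S 1 * a 1+(\<Sum>j=2..m. S j * a j)" using sh[of "%j. S j * a j"] nn by simp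
 have s2: "(\<Sum>j=2..m. S (j-1) * a (j-2)) <= S 2 * a 1+(\<Sum>j=2..m. S' j * a j)"
 proof -
  have "(\<Sum>j=2..m. S (j-1) * a (j-2)) = (\<Sum>j=2..m. (%j. S (j+1) * a j) (j-2))" by (intro sum.cong refl) (auto simp: Suc_diff_Suc numeral_2_eq_2 Suc_le_eq)
  also have "... <= S 2 * a 1+(\<Sum>j=2..m-2. S (j+1) * a j)"
  proof -
  have "(\<Sum>j=2..m. (%j. S (j+1) * a j) (j-2)) = (if m = 2 then S (0+1) * a 0 else S (0+1) * a 0 + S (1+1) * a 1+(\<Sum>j=2..m-2. S (j+1) * a j))" by (rule sum_shift2[OF m])
  moreover have "0 <= S 2 * a 1" using nn by simp
  moreover have "(1+1 :: nat) = 2" by simp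
  ultimately show ?thesis using zero(1) by (cases "m = 2") (simp_all del: One_nat_def add_2_eq_Suc')
  qed
  also have "(\<Sum>j=2..m-2. S (j+1) * a j) = (\<Sum>j=2..m-2. S' j * a j)" using m by (intro sum.cong refl) (auto simp: S'_def)
  also have "... <= (\<Sum>j=2..m. S' j * a j)" by (rule sum_mono2) (use nn in \<open>auto simp: S'_def\<close>)
  finally show ?thesis by simp
 qed
 have q12: "(\<Sum>j=2..m. q (j-1)) <= q 1+(\<Sum>j=2..m. q j)" "(\<Sum>j=2..m. q (j-2)) <= q 1+(\<Sum>j=2..m. q j)" using sh[of q] sh2[of q] nn zero by simp_all
 have g12: "(\<Sum>j=2..m. g (j-1)) <= g 1+(\<Sum>j=2..m. g j)" "(\<Sum>j=2..m. g (j-2)) <= g 1+(\<Sum>j=2..m. g j)" using sh[of g] sh2[of g] nn zero by simp_all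
 define A1 where "A1 = (\<Sum>j=2..m. (1/2 * S (j-1)+9/(2*\<mu>)*(Z (j-1))\<^sup>2) * a j)"
 define Q where "Q = (\<Sum>j=2..m. q j)"
 define G where "G = (\<Sum>j=2..m. g j)"
 define A where "A = (\<Sum>j=2..m. a j)"
 have "(\<Sum>j=2..m. R j) = 4 * dt * A1+12 * dt * (\<Sum>j=2..m. S (j-1) * a (j-1))+6 * dt * (\<Sum>j=2..m. S (j-1) * a (j-2))
  + \<mu> * dt/3*(\<Sum>j=2..m. q (j-1))+\<mu> * dt/6*(\<Sum>j=2..m. q (j-2))+dt * ((2*\<kappa>+3)/T) * A
  + 3*\<nu> * dt/5*(\<Sum>j=2..m. g (j-1))+3*\<nu> * dt/10*(\<Sum>j=2..m. g (j-2))+\<nu> * dt/10 * G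
  + 2*\<mu> * dt * Q+(\<Sum>j=2..m. \<beta> j)" unfolding R_def A1_def Q_def G_def A_def sum_distrib_left sum.distrib[symmetric] by (intro sum.cong refl) (simp add: algebra_simps)
 also have "... <= 4 * dt * A1+12 * dt * (S 1 * a 1+(\<Sum>j=2..m. S j * a j))+6 * dt * (S 2 * a 1+(\<Sum>j=2..m. S' j * a j))
  + \<mu> * dt/3*(q 1 + Q)+\<mu> * dt/6*(q 1 + Q)+dt * ((2*\<kappa>+3)/T) * A
  + 3*\<nu> * dt/5*(g 1 + G)+3*\<nu> * dt/10*(g 1 + G)+\<nu> * dt/10 * G
  + 2*\<mu> * dt * Q+(\<Sum>j=2..m. \<beta> j)" using s1 s2 q12 g12 pos unfolding Q_def G_def by (intro add_mono mult_left_mono order_refl) auto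
 finally have Rle: "(\<Sum>j=2..m. R j) <= 4 * dt * A1+12 * dt * (S 1 * a 1+(\<Sum>j=2..m. S j * a j))+6 * dt * (S 2 * a 1+(\<Sum>j=2..m. S' j * a j))
  + \<mu> * dt/3*(q 1 + Q)+\<mu> * dt/6*(q 1 + Q)+dt * ((2*\<kappa>+3)/T) * A
  + 3*\<nu> * dt/5*(g 1 + G)+3*\<nu> * dt/10*(g 1 + G)+\<nu> * dt/10 * G
  + 2*\<mu> * dt * Q+(\<Sum>j=2..m. \<beta> j)" .
 have lamsum: "(\<Sum>j=2..m. dt * (4*((\<kappa>+1)/T)+lm j) * a j)
  = dt * (4*((\<kappa>+1)/T)) * A+4 * dt * A1+12 * dt * (\<Sum>j=2..m. S j * a j)+6 * dt * (\<Sum>j=2..m. S' j * a j)" unfolding A_def A1_def S'_def lam sum_distrib_left sum.distrib[symmetric] by (intro sum.cong refl) (simp add: algebra_simps)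
 have A0: "0 <= A" "0 <= Q" "0 <= G" unfolding A_def Q_def G_def by (auto intro!: sum_nonneg nn)
 have kt: "dt * ((2*\<kappa>+3)/T) * A <= dt * (4*((\<kappa>+1)/T)) * A" using pos A0 by (intro mult_right_mono mult_left_mono) (auto simp: field_simps)
 \<comment> \<open>The restriction at \<open>j = 2\<close> also controls the weights that the shifts
   place on the starting error \<open>a 1\<close>.\<close>
 have dS: "dt * S 1 <= 1/4" "dt * S 2 <= 1/24"
 proof -
  have "0 <= dt * (4*((\<kappa>+1)/T))" using pos by simp
  then have "dt * lm 2 <= 1/2" using dt2 unfolding distrib_left[of dt _ "lm 2"] by linarith
  moreover have "0 <= dt * (9/(2*\<mu>)*(Z 1)\<^sup>2)" using pos by simp
  moreover have "0 <= dt * (if 2 = m then 0 else S 3)" using pos nn by simp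
  moreover have "0 <= dt * S 1" "0 <= dt * S 2" using pos nn by simp_all
  moreover have "dt * lm 2 = 2*(dt * S 1)+4*(dt * (9/(2*\<mu>)*(Z 1)\<^sup>2))+12*(dt * S 2)+6*(dt * (if 2 = m then 0 else S 3))" unfolding lam by (simp add: algebra_simps numeral_3_eq_3)
  ultimately show "dt * S 1 <= 1/4" "dt * S 2 <= 1/24" by linarith+
 qed
 \<comment> \<open>\<open>12/4 + 6/24 \<le> 4\<close>; together with \<open>E 1 = 5 * a 1\<close>
   this gives the factor 9.\<close>
 have a1: "12 * dt * (S 1 * a 1)+6 * dt * (S 2 * a 1) <= 4 * a 1"
 proof -
  have "dt * S 1 * a 1 <= 1/4 * a 1" "dt * S 2 * a 1 <= 1/24 * a 1" using dS nn by (intro mult_right_mono; simp)+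
  then show ?thesis using nn(1)[of 1] by (simp add: mult_ac)
 qed
 have Qe: "(\<Sum>j=2..m. 4*\<nu> * dt * g j+4*\<mu> * dt * q j) = 4*(\<nu> * dt * G)+4*(\<mu> * dt * Q)" unfolding G_def Q_def by (simp add: sum.distrib sum_distrib_left mult.assoc)
 have Ge: "(\<Sum>j=2..m. \<nu> * dt * g j) = \<nu> * dt * G" "\<mu>*(\<Sum>j=2..m. dt * q j) = \<mu> * dt * Q" unfolding G_def Q_def by (simp_all add: sum_distrib_left mult_ac)
 have nG: "0 <= \<nu> * dt * G" "0 <= \<mu> * dt * Q" "0 <= \<nu> * dt * g 1" using A0 pos nn by simp_all
 show ?thesis unfolding Ge lamsum using le Rle kt a1 E(1)[of m] E(2) nG unfolding Qe by (simp add: algebra_simps)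
qed

section \<open>Young's inequality and the budget of one time step\<close>

lemma square_le_of_sum_squares: "(2 * x-y)\<^sup>2 <= 6 * x\<^sup>2+3 * y\<^sup>2" for x y :: real
proof -
 have "0 <= 2*(x+y)\<^sup>2" by simp
 then show ?thesis by (simp add: power2_eq_square algebra_simps)
qed

lemma young_scaled: "x * y <= c * x\<^sup>2+y\<^sup>2/(4 * c)" if "c > 0" for x y c :: real
proof -
 have "0 <= (2 * c * x-y)\<^sup>2" by simp
 then have "4 * c * (x * y) <= 4 * c * (c * x\<^sup>2)+y\<^sup>2" by (simp add: power2_eq_square algebra_simps)
 then show ?thesis using that by (simp add: field_simps)
qed

text \<open>The weights follow a budget. The second difference \<open>D\<close> may use at most
  \<open>D^2\<close>, here \<open>1/2 + 1/4\<close> of it; the new divergence may use half of the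
  \<open>4 \<mu>\<close> on the left; the \<open>A^2\<close> terms cost \<open>2 \<kappa>/T\<close>
  for transport and \<open>1/T\<close> each for truncation, for \<open>S'\<close> and for the cubic
  term.\<close>

lemma error_step_young:
 fixes A D G Qd A1 G1 Q1 Ainf :: real
 assumes pos: "\<nu> > 0" "\<mu> > 0" "T > 0" "\<delta> > 0" "h > 0" "c > 0" "0 <= U" "0 <= \<kappa>"
  and nn: "0 <= A" "0 <= D" "0 <= G" "0 <= Qd" "0 <= A1" "0 <= G1" "0 <= Q1" "0 <= S" "0 <= Z" "0 <= S'"
  and cfl: "64 * c\<^sup>2 * U\<^sup>2*(\<delta>/h\<^sup>2) <= \<kappa>/T" and S': "4*\<delta> * S'\<^sup>2 <= 1/T"
  and e: "0 < \<epsilon>" "\<epsilon> <= \<nu>/10" "5*\<epsilon>\<^sup>2 <= \<nu>/T" and nl: "4 * X <= \<epsilon> * G1*(G + A)"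
 shows "4*\<delta>*(\<tau> * A+\<mu>*\<eta> * Qd + P * Qd+(S * A1+1/2 * Z * Q1) * A+(4 * U * c/h+1/2 * S') * A * D + X)
  <= 4*\<delta>*(S * (1/2 * A\<^sup>2+1/2 * A1\<^sup>2)+9/(2*\<mu>) * Z\<^sup>2 * A\<^sup>2)+\<mu>*\<delta>/18 * Q1\<^sup>2
  + D\<^sup>2+\<delta>*((2*\<kappa>+3)/T) * A\<^sup>2+\<nu>*\<delta>/10*(G1\<^sup>2 + G\<^sup>2)+2*\<mu>*\<delta> * Qd\<^sup>2
  + (4 * T * \<delta>*\<tau>\<^sup>2+4*\<mu>*\<delta>*\<eta>\<^sup>2+4/\<mu>*\<delta> * P\<^sup>2)"
proof -
 have t1: "4*\<delta>*(\<tau> * A) <= \<delta>/T * A\<^sup>2+4 * T * \<delta>*\<tau>\<^sup>2"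
 proof -
  have "\<tau> * A <= T * \<tau>\<^sup>2 + A\<^sup>2/(4 * T)" by (rule young_scaled[OF pos(3)])
  then have "4*\<delta>*(\<tau> * A) <= 4*\<delta>*(T * \<tau>\<^sup>2 + A\<^sup>2/(4 * T))" using pos by (intro mult_left_mono) auto
  then show ?thesis using pos by (simp add: field_simps)
 qed
 have t2: "4*\<delta>*(\<mu>*\<eta> * Qd) <= \<mu>*\<delta> * Qd\<^sup>2+4*\<mu>*\<delta>*\<eta>\<^sup>2"
 proof -
  have "\<eta> * Qd <= 1*\<eta>\<^sup>2 + Qd\<^sup>2/(4*1)" by (rule young_scaled) simp
  then have "4*\<delta>*\<mu>*(\<eta> * Qd) <= 4*\<delta>*\<mu>*(1*\<eta>\<^sup>2 + Qd\<^sup>2/(4*1))" using pos by (intro mult_left_mono) auto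
  then show ?thesis by (simp add: algebra_simps)
 qed
 have t3: "4*\<delta>*(P * Qd) <= \<mu>*\<delta> * Qd\<^sup>2+4/\<mu>*\<delta> * P\<^sup>2"
 proof -
  have "P * Qd <= 1/\<mu> * P\<^sup>2 + Qd\<^sup>2/(4*(1/\<mu>))" by (rule young_scaled) (use pos in simp)
  then have "4*\<delta>*(P * Qd) <= 4*\<delta>*(1/\<mu> * P\<^sup>2 + Qd\<^sup>2/(4*(1/\<mu>)))" using pos by (intro mult_left_mono) auto
  then show ?thesis using pos by (simp add: field_simps)
 qed
 have t4: "4*\<delta>*(S * A1 * A) <= 4*\<delta>*(S * (1/2 * A\<^sup>2+1/2 * A1\<^sup>2))"
 proof -
  have "A1 * A <= 1/2 * A1\<^sup>2 + A\<^sup>2/(4*(1/2))" by (rule young_scaled) simp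
  then have "4*\<delta> * S * (A1 * A) <= 4*\<delta> * S * (1/2 * A1\<^sup>2 + A\<^sup>2/(4*(1/2)))" using pos nn by (intro mult_left_mono) auto
  then show ?thesis by (simp add: algebra_simps)
 qed
 \<comment> \<open>The weight \<open>18/\<mu>\<close> turns \<open>(1/2)^2\<close> into the
   \<open>9/2\<close> of \<open>stab_const\<close> and leaves \<open>\<mu>/18\<close> for the
   extrapolated divergence.\<close>
 have t5: "4*\<delta>*(1/2 * Z * Q1 * A) <= 4*\<delta>*(9/(2*\<mu>) * Z\<^sup>2 * A\<^sup>2)+\<mu>*\<delta>/18 * Q1\<^sup>2"
 proof -
  have "(1/2 * Z * A) * Q1 <= (18/\<mu>)*(1/2 * Z * A)\<^sup>2 + Q1\<^sup>2/(4*(18/\<mu>))" by (rule young_scaled) (use pos in simp)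
  then have "4*\<delta>*((1/2 * Z * A) * Q1) <= 4*\<delta>*((18/\<mu>)*(1/2 * Z * A)\<^sup>2 + Q1\<^sup>2/(4*(18/\<mu>)))" using pos by (intro mult_left_mono) auto
  also have "... = 4*\<delta>*(9/(2*\<mu>) * Z\<^sup>2 * A\<^sup>2)+\<mu>*\<delta>/18 * Q1\<^sup>2" using pos by (simp add: field_simps power2_eq_square)
  finally show ?thesis by (simp add: mult_ac)
 qed
 \<comment> \<open>The constant of the CFL condition: half of \<open>16^2\<close> is 128, twice the
   prescribed 64.\<close>
 have t6: "4*\<delta>*(4 * U * c/h * A * D) <= 1/2 * D\<^sup>2+\<delta>*(2*\<kappa>/T) * A\<^sup>2"
 proof -
  have "(16*\<delta> * U * c/h * A) * D <= (1/2)*(16*\<delta> * U * c/h * A)\<^sup>2 + D\<^sup>2/(4*(1/2))" by (rule young_scaled) simp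
  also have "(1/2)*(16*\<delta> * U * c/h * A)\<^sup>2 = 2*\<delta>*(64 * c\<^sup>2 * U\<^sup>2*(\<delta>/h\<^sup>2)) * A\<^sup>2" by (simp add: power2_eq_square field_simps)
  also have "... <= 2*\<delta>*(\<kappa>/T) * A\<^sup>2" using cfl pos by (intro mult_right_mono mult_left_mono) auto
  finally show ?thesis by (simp add: mult_ac)
 qed
 have t7: "4*\<delta>*(1/2 * S' * A * D) <= 1/4 * D\<^sup>2+\<delta>/T * A\<^sup>2"
 proof -
  have "(2*\<delta> * S' * A) * D <= 1*(2*\<delta> * S' * A)\<^sup>2 + D\<^sup>2/(4*1)" by (rule young_scaled) simp
  also have "1*(2*\<delta> * S' * A)\<^sup>2 = \<delta>*(4*\<delta> * S'\<^sup>2) * A\<^sup>2" by (simp add: power2_eq_square algebra_simps)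
  also have "... <= \<delta>*(1/T) * A\<^sup>2" using S' pos by (intro mult_right_mono mult_left_mono) auto
  finally show ?thesis by (simp add: mult_ac)
 qed
 \<comment> \<open>\<open>\<epsilon> \<le> \<nu>/10\<close> lets viscosity absorb the product of the
   two gradients, and \<open>5 \<epsilon>^2 \<le> \<nu>/T\<close> turns the mixed product into a
   gradient part plus \<open>A^2/T\<close>.\<close>
 have t8: "4*\<delta> * X <= \<nu>*\<delta>/10*(G1\<^sup>2 + G\<^sup>2)+\<delta>/T * A\<^sup>2"
 proof -
  have gg: "\<epsilon>*(G1 * G) <= \<nu>/20*(G1\<^sup>2 + G\<^sup>2)"
  proof -
  have "G1 * G <= 1/2 * G1\<^sup>2 + G\<^sup>2/(4*(1/2))" by (rule young_scaled) simp
  then have "\<epsilon>*(G1 * G) <= \<nu>/10*(1/2 * G1\<^sup>2 + G\<^sup>2/(4*(1/2)))" using e pos nn by (intro mult_mono) auto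
  then show ?thesis by (simp add: algebra_simps)
  qed
  have ga: "\<epsilon>*(G1 * A) <= \<nu>/20 * G1\<^sup>2+1/T * A\<^sup>2"
  proof -
  have "G1*(\<epsilon> * A) <= \<nu>/20 * G1\<^sup>2+(\<epsilon> * A)\<^sup>2/(4*(\<nu>/20))" by (rule young_scaled) (use pos in simp)
  also have "(\<epsilon> * A)\<^sup>2/(4*(\<nu>/20)) = (5*\<epsilon>\<^sup>2) * A\<^sup>2/\<nu>" by (simp add: power_mult_distrib)
  also have "... <= (\<nu>/T) * A\<^sup>2/\<nu>" using e pos by (intro divide_right_mono mult_right_mono) auto
  also have "... = 1/T * A\<^sup>2" using pos by simp
  finally show ?thesis by (simp add: mult_ac)
  qed
  have "\<nu>/20 * G1\<^sup>2 <= \<nu>/20*(G1\<^sup>2 + G\<^sup>2)" using pos by (intro mult_left_mono) auto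
  then have "4 * X <= \<nu>/10*(G1\<^sup>2 + G\<^sup>2)+1/T * A\<^sup>2" using nl gg ga by (simp add: algebra_simps)
  then have "\<delta>*(4 * X) <= \<delta>*(\<nu>/10*(G1\<^sup>2 + G\<^sup>2)+1/T * A\<^sup>2)" using pos by (intro mult_left_mono) auto
  then show ?thesis by (simp add: algebra_simps)
 qed
 have D0: "3/4 * D\<^sup>2 <= D\<^sup>2" by simp
 have kk: "\<delta>*((2*\<kappa>+3)/T) * A\<^sup>2 = \<delta>*(2*\<kappa>/T) * A\<^sup>2+3*(\<delta>/T * A\<^sup>2)" using pos by (simp add: field_simps)
 have L: "4*\<delta>*(\<tau> * A+\<mu>*\<eta> * Qd + P * Qd+(S * A1+1/2 * Z * Q1) * A+(4 * U * c/h+1/2 * S') * A * D + X)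
  = 4*\<delta>*(\<tau> * A)+4*\<delta>*(\<mu>*\<eta> * Qd)+4*\<delta>*(P * Qd)+4*\<delta>*(S * A1 * A)+4*\<delta>*(1/2 * Z * Q1 * A)
  + 4*\<delta>*(4 * U * c/h * A * D)+4*\<delta>*(1/2 * S' * A * D)+4*\<delta> * X" by (simp only: distrib_left distrib_right)
 have M: "4*\<delta>*(S * (1/2 * A\<^sup>2+1/2 * A1\<^sup>2)+9/(2*\<mu>) * Z\<^sup>2 * A\<^sup>2)
  = 4*\<delta>*(S * (1/2 * A\<^sup>2+1/2 * A1\<^sup>2))+4*\<delta>*(9/(2*\<mu>) * Z\<^sup>2 * A\<^sup>2)"
  "2*\<mu>*\<delta> * Qd\<^sup>2 = \<mu>*\<delta> * Qd\<^sup>2+\<mu>*\<delta> * Qd\<^sup>2" by (simp_all only: distrib_left)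
 show ?thesis unfolding kk L M using t1 t2 t3 t4 t5 t6 t7 t8 D0 by linarith
qed

section \<open>The trilinear form on bounded functions\<close>

text \<open>A class on which the trilinear form is genuinely trilinear: the sup bound makes products
  of values and gradients square integrable. The solution, the projection and their difference
  belong to it.\<close>

definition bdd_H1 :: "(real^'d::finite) set => (real^'d => real^'d) => bool" where
 "bdd_H1 Om v \<longleftrightarrow> in_H Om 1 v & in_Lp Om \<infinity> v"

lemma bdd_H1_L2: "open Om ==> bdd_H1 Om v ==> in_Lp Om 2 v" unfolding bdd_H1_def using in_W_self(1) by blast

lemma bdd_H1_lincomb:
 assumes "open Om" "bdd_H1 Om v" "bdd_H1 Om w"
 shows "bdd_H1 Om (%x. a *. v x+b *. w x)" using assms unfolding bdd_H1_def by (auto intro!: in_H_add in_H_scaleR in_Linf_add in_Linf_scaleR)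

lemma trilinear_pieces:
 fixes u v :: "real^'d::finite => real^'d"
 assumes "open Om" "bdd_H1 Om u" "bdd_H1 Om v"
 shows "in_Lp Om 2 (convection Om u v)" "in_Lp Om 2 (%x. (1/2 * dv Om u x) *. v x)"
  "in_Lp Om 2 (%x. convection Om u v x+(1/2 * dv Om u x) *. v x)" using assms convection_bounds(1)[OF assms(1), of v u] divergence_mult_bounds(1)[OF assms(1), of u v] unfolding bdd_H1_def by (auto intro!: in_L2_add)

lemma trilinear_lincomb_first:
 fixes u v w z :: "real^'d::finite => real^'d"
 assumes Om: "open Om" and u: "bdd_H1 Om u" "bdd_H1 Om w" and v: "bdd_H1 Om v" and z: "in_Lp Om 2 z"
 shows "trilinear Om (%x. a *. u x+b *. w x) v z = a * trilinear Om u v z+b * trilinear Om w v z"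
proof -
 note p = trilinear_pieces(3)[OF Om bdd_H1_lincomb[OF Om u] v, of a b]
 note p1 = trilinear_pieces(3)[OF Om u(1) v] and p2 = trilinear_pieces(3)[OF Om u(2) v]
 let ?c = "%u x. convection Om u v x+(1/2 * dv Om u x) *. v x"
 have "trilinear Om (%x. a *. u x+b *. w x) v z = ip Om (%x. a *. ?c u x+b *. ?c w x) z" unfolding trilinear_def
 proof (rule L2_inner_cong_AE)
  show "AE x in lon Om. ?c (%x. a *. u x+b *. w x) x = a *. ?c u x+b *. ?c w x" using divergence_lincomb[OF Om u[unfolded bdd_H1_def, THEN conjunct1], of a b]
  proof eventually_elim
  case (elim x)
  show ?case unfolding elim convection_def by (simp add: matrix_vector_right_distrib matrix_vector_mult_scaleR algebra_simps)
  qed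
 qed (use p in_L2_add[OF in_L2_scaleR[OF p1, of a] in_L2_scaleR[OF p2, of b]] z in \<open>auto simp: in_L2_iff\<close>)
 also have "... = a * trilinear Om u v z+b * trilinear Om w v z" unfolding trilinear_def by (simp only: L2_inner_add_left[OF in_L2_scaleR[OF p1] in_L2_scaleR[OF p2] z] L2_inner_scaleR_left)
 finally show ?thesis .
qed

lemma trilinear_lincomb_second:
 fixes u v w z :: "real^'d::finite => real^'d"
 assumes Om: "open Om" and u: "bdd_H1 Om u" "bdd_H1 Om w" and v: "bdd_H1 Om v" and z: "in_Lp Om 2 z"
 shows "trilinear Om v (%x. a *. u x+b *. w x) z = a * trilinear Om v u z+b * trilinear Om v w z"
proof -
 note p = trilinear_pieces(3)[OF Om v bdd_H1_lincomb[OF Om u], of a b]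
 note p1 = trilinear_pieces(3)[OF Om v u(1)] and p2 = trilinear_pieces(3)[OF Om v u(2)]
 let ?c = "%u x. convection Om v u x+(1/2 * dv Om v x) *. u x"
 have "trilinear Om v (%x. a *. u x+b *. w x) z = ip Om (%x. a *. ?c u x+b *. ?c w x) z" unfolding trilinear_def
 proof (rule L2_inner_cong_AE)
  show "AE x in lon Om. ?c (%x. a *. u x+b *. w x) x = a *. ?c u x+b *. ?c w x" using grad_lincomb[OF Om u[unfolded bdd_H1_def, THEN conjunct1], of a b]
  proof eventually_elim
  case (elim x)
  have "(a *. grad Om u x+b *. grad Om w x) *v v x = a *. (grad Om u x *v v x)+b *. (grad Om w x *v v x)" by (simp add: matrix_vector_mult_add_rdistrib scaleR_matrix_vector_assoc)
  then show ?case unfolding convection_def elim by (simp add: algebra_simps)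
  qed
 qed (use p in_L2_add[OF in_L2_scaleR[OF p1, of a] in_L2_scaleR[OF p2, of b]] z in \<open>auto simp: in_L2_iff\<close>)
 also have "... = a * trilinear Om v u z+b * trilinear Om v w z" unfolding trilinear_def by (simp only: L2_inner_add_left[OF in_L2_scaleR[OF p1] in_L2_scaleR[OF p2] z] L2_inner_scaleR_left)
 finally show ?thesis .
qed

lemma trilinear_bound:
 fixes w v z :: "real^'d::finite => real^'d"
 assumes Om: "open Om" and w: "bdd_H1 Om w" and v: "bdd_H1 Om v" and z: "in_Lp Om 2 z"
  and c: "nrm Om (convection Om w v) <= C" and d: "nrm Om (%x. (1/2 * dv Om w x) *. v x) <= D"
 shows "\<bar>trilinear Om w v z\<bar> <= (C + D) * nrm Om z"
proof -
 note p = trilinear_pieces[OF Om w v]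
 have "\<bar>trilinear Om w v z\<bar> <= \<bar>ip Om (convection Om w v) z\<bar>+\<bar>ip Om (%x. (1/2 * dv Om w x) *. v x) z\<bar>" unfolding trilinear_split[OF p(1,2) z] by (rule abs_triangle_ineq)
 also have "... <= nrm Om (convection Om w v) * nrm Om z+nrm Om (%x. (1/2 * dv Om w x) *. v x) * nrm Om z" by (intro add_mono L2_Cauchy_Schwarz p z)
 also have "... <= C * nrm Om z + D * nrm Om z" by (intro add_mono mult_right_mono c d) simp_all
 finally show ?thesis by (simp add: distrib_right)
qed

lemma divergence_Linf:
 fixes w :: "real^'d::finite => real^'d"
 assumes "in_Lp Om \<infinity> (grad Om w)"
 shows "in_Lp Om \<infinity> (dv Om w)" "sn Om (dv Om w) <= real CARD('d) * sn Om (grad Om w)"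
proof -
 have m: "dv Om w \<in> bm (lon Om)" using assms by (intro divergence_measurable) (simp add: in_Linf_iff)
 have le: "AE x in lon Om. norm (dv Om w x) <= real CARD('d) * sn Om (grad Om w)" using Linf_norm_AE[OF assms]
 proof eventually_elim
  case (elim x)
  have "\<bar>dv Om w x\<bar> <= real CARD('d) * norm (grad Om w x)" by (rule abs_divergence_le)
  also have "... <= real CARD('d) * sn Om (grad Om w)" using elim by (intro mult_left_mono) auto
  finally show ?case by simp
 qed
 show "in_Lp Om \<infinity> (dv Om w)" using m le by (auto simp: in_Linf_iff)
 show "sn Om (dv Om w) <= real CARD('d) * sn Om (grad Om w)" by (rule Linf_norm_le[OF m _ le]) simp
qed

lemma half_divergence_bound:
 fixes w v :: "real^'d::finite => real^'d"
 assumes w: "in_Lp Om \<infinity> (grad Om w)" and v: "in_Lp Om 2 v"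
 shows "nrm Om (%x. (1/2 * dv Om w x) *. v x) <= 1/2*(real CARD('d) * sn Om (grad Om w)) * nrm Om v"
proof -
 note d = divergence_Linf[OF w]
 have m: "(%x. dv Om w x *. v x) \<in> bm (lon Om)" using d v by (auto simp: in_L2_iff in_Linf_iff)
 have "nrm Om (%x. dv Om w x *. v x) <= sn Om (dv Om w) * nrm Om v" by (rule in_L2_Linf_mult(2)[OF d(1) v m]) simp
 also have "... <= (real CARD('d) * sn Om (grad Om w)) * nrm Om v" by (intro mult_right_mono d) simp
 finally have "1/2 * nrm Om (%x. dv Om w x *. v x) <= 1/2*((real CARD('d) * sn Om (grad Om w)) * nrm Om v)" by simp
 then show ?thesis using L2_norm_scaleR[of Om "1/2" "%x. dv Om w x *. v x"] by simp
qed

text \<open>The sup norm falls on the test function while the other two arguments stay in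
  \<open>L2\<close>. In this form the cubic term can meet the discrete Sobolev bound.\<close>

lemma trilinear_bound_test_Linf:
 fixes w v z :: "real^'d::finite => real^'d"
 assumes Om: "open Om" and w: "bdd_H1 Om w" and v: "bdd_H1 Om v" and z: "bdd_H1 Om z"
 shows "\<bar>trilinear Om w v z\<bar> <= (nrm Om w * nrm Om (grad Om v)+1/2*(real CARD('d) * nrm Om (grad Om w)) * nrm Om v) * sn Om z"
proof -
 have h: "in_H Om 1 w" "in_H Om 1 v" and zi: "in_Lp Om \<infinity> z" using w v z by (auto simp: bdd_H1_def)
 note L2 = bdd_H1_L2[OF Om w] bdd_H1_L2[OF Om v] bdd_H1_L2[OF Om z]
 note p = trilinear_pieces[OF Om w v] and gv = grad_in_L2(1)[OF Om h(2)] and dw = divergence_in_L2[OF Om h(1)]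
 let ?Z = "sn Om z"
 have n2: "in_Lp Om 2 (%x. norm (f x))" "nrm Om (%x. norm (f x)) = nrm Om f" if "in_Lp Om 2 f" for f :: "real^'d => 'b::euclidean_space" using that by (auto simp: in_L2_iff L2_norm_def L2_inner_def power2_norm_eq_inner power2_eq_square[symmetric])
 have prod: "\<bar>ip Om f z\<bar> <= ?Z * (nrm Om a * nrm Om b)"
  if f: "in_Lp Om 2 f" and a: "in_Lp Om 2 a" and b: "in_Lp Om 2 b" and le: "!!x. norm (f x) <= norm (a x) * norm (b x)"
  for f :: "real^'d => real^'d" and a :: "real^'d => 'b::euclidean_space" and b :: "real^'d => 'c::euclidean_space"
 proof -
  have "\<bar>ip Om f z\<bar> <= (LINT x|lon Om. \<bar>f x \<bullet> z x\<bar>)" unfolding L2_inner_def by (rule integral_abs_bound)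
  also have "... <= (LINT x|lon Om. ?Z * (norm (a x) \<bullet> norm (b x)))"
  proof (rule integral_mono_AE)
  show "integrable (lon Om) (%x. \<bar>f x \<bullet> z x\<bar>)" by (intro integrable_abs integrable_inner_L2 f L2)
  show "integrable (lon Om) (%x. ?Z * (norm (a x) \<bullet> norm (b x)))" by (intro integrable_mult_right integrable_inner_L2 n2 a b)
  show "AE x in lon Om. \<bar>f x \<bullet> z x\<bar> <= ?Z * (norm (a x) \<bullet> norm (b x))" using Linf_norm_AE[OF zi]
  proof eventually_elim
  case (elim x)
  have "\<bar>f x \<bullet> z x\<bar> <= norm (f x) * norm (z x)" by (rule Cauchy_Schwarz_ineq2)
  also have "... <= (norm (a x) * norm (b x)) * ?Z" using le elim by (intro mult_mono) auto
  finally show ?case by (simp add: mult_ac)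
  qed
  qed
  also have "... = ?Z * ip Om (%x. norm (a x)) (%x. norm (b x))" by (simp add: L2_inner_def)
  also have "... <= ?Z * (nrm Om a * nrm Om b)" using L2_Cauchy_Schwarz[OF n2(1)[OF a] n2(1)[OF b]] n2(2)[OF a] n2(2)[OF b] by (intro mult_left_mono) auto
  finally show ?thesis .
 qed
 have 1: "\<bar>ip Om (convection Om w v) z\<bar> <= ?Z * (nrm Om w * nrm Om (grad Om v))" by (rule prod[OF p(1) L2(1) gv]) (use norm_matrix_vector_mult_le in \<open>auto simp: convection_def mult.commute[of "norm (w _)"]\<close>)
 have 2: "\<bar>ip Om (%x. (1/2 * dv Om w x) *. v x) z\<bar> <= ?Z * (nrm Om (%x. 1/2 * dv Om w x) * nrm Om v)" by (rule prod[OF p(2) in_L2_mult_left[OF dw(1)] L2(2)]) simp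
 have "nrm Om (%x. 1/2 * dv Om w x) = 1/2 * nrm Om (dv Om w)" using L2_norm_scaleR[of Om "1/2" "dv Om w"] by simp
 then have 3: "?Z * (nrm Om (%x. 1/2 * dv Om w x) * nrm Om v) <= ?Z * (1/2*(real CARD('d) * nrm Om (grad Om w)) * nrm Om v)" using dw(2) by (intro mult_left_mono mult_right_mono) auto
 have "\<bar>trilinear Om w v z\<bar> <= \<bar>ip Om (convection Om w v) z\<bar>+\<bar>ip Om (%x. (1/2 * dv Om w x) *. v x) z\<bar>" unfolding trilinear_split[OF p(1,2) L2(3)] by (rule abs_triangle_ineq)
 then show ?thesis using 1 2 3 by (simp add: algebra_simps)
qed

section \<open>The error equation\<close>

text \<open>The discrete argument in isolation: of the exact solution only the projection
  \<open>s\<close>, the bound \<open>U\<close> and the consistency bounds are left. Consistency is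
  asked for discretely divergence-free test functions only, and its part \<open>P\<close> multiplies
  the divergence, where grad-div stabilisation can absorb it.\<close>

locale imex_error =
 fixes Om :: "(real^'d::finite) set" and V :: "(real^'d => real^'d) set" and Q :: "(real^'d => real) set"
  and \<nu> \<mu> dt T \<kappa> h c U S' ep0 :: real and N :: nat and f :: "real => real^'d => real^'d"
  and s uh :: "nat => real^'d => real^'d" and ph :: "nat => real^'d => real" and tt P \<eta> :: "nat => real"
 assumes Om: "open Om"
  and V_sub: "function_subspace V" and V_H10: "!!v. v \<in> V ==> in_H10 Om v" and V_Linf: "!!v. v \<in> V ==> in_Lp Om \<infinity> v"
  and V_grad: "!!v. v \<in> V ==> in_Lp Om \<infinity> (grad Om v)"
  and Q_sub: "function_subspace Q" and Q_L2: "!!q. q \<in> Q ==> in_Lp Om 2 q"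
  and pos: "\<nu> > 0" "\<mu> > 0" "dt > 0" "T > 0" "\<kappa> > 0" "h > 0" "c > 0" "0 <= U" "0 <= ep0" and T: "dt * real N = T"
  and inv: "!!v. v \<in> V ==> nrm Om (grad Om v) <= c/h * nrm Om v"
  and sup: "!!v. v \<in> V ==> h * sn Om v <= ep0*(nrm Om (grad Om v)+nrm Om v)"
  and imex: "imex_solution Om V Q \<nu> \<mu> dt N f (s 0) uh ph"
  and s_V: "!!j. j <= N ==> s j \<in> V"
  and s_div: "!!j q. j <= N ==> q \<in> Q ==> ip Om (dv Om (s j)) q = 0"
  and consistency: "!!n v. n < N ==> v \<in> V ==> (!!q. q \<in> Q ==> ip Om (dv Om v) q = 0) ==>
  \<bar>ip Om (%x. (1/dt) *. bdf s n x) v+\<nu> * ip Om (grad Om (s (n+1))) (grad Om v)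
  + trilinear Om (extrapolate s n) (extrapolate s n) v-ip Om (f (real (n+1) * dt)) v\<bar>
  <= tt (n+1) * nrm Om v + P (n+1) * nrm Om (dv Om v)"
  and \<eta>: "!!j. j <= N ==> nrm Om (dv Om (s j)) <= \<eta> j"
  and shat: "!!j. j < N ==> sn Om (extrapolate s j) <= 4 * U"
  "!!j. j < N ==> real CARD('d) * sn Om (grad Om (extrapolate s j)) <= S'"
  and cfl: "64 * c\<^sup>2 * U\<^sup>2*(dt/h\<^sup>2) <= \<kappa>/T" and S': "4 * dt * S'\<^sup>2 <= 1/T"
begin

definition e :: "nat => real^'d => real^'d" where "e j = (%x. s j x-uh j x)"

lemma V_lincomb: "v \<in> V ==> w \<in> V ==> (%x. a *. v x+b *. w x) \<in> V"
proof -
 assume v: "v \<in> V" "w \<in> V"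
 note sub = V_sub[unfolded function_subspace_def]
 note sc = sub[THEN conjunct2, THEN conjunct2, rule_format]
 show "(%x. a *. v x+b *. w x) \<in> V" by (rule sub[THEN conjunct2, THEN conjunct1, THEN bspec, THEN bspec, OF sc[OF v(1)] sc[OF v(2)]])
qed

lemma V_H1: "v \<in> V ==> in_H Om 1 v" by (rule in_H10_in_H1[OF V_H10])

lemma V_L2: "v \<in> V ==> in_Lp Om 2 v" using in_W_self(1)[OF Om V_H1] by blast

lemma V_bdd: "v \<in> V ==> bdd_H1 Om v" using V_H1 V_Linf by (simp add: bdd_H1_def)

lemma V_div: "v \<in> V ==> in_Lp Om 2 (dv Om v)" by (rule divergence_in_L2(1)[OF Om V_H1])

lemma V_gradL2: "v \<in> V ==> in_Lp Om 2 (grad Om v)" by (rule grad_in_L2(1)[OF Om V_H1])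

lemma uh_V: "j <= N ==> uh j \<in> V" using imex unfolding imex_solution_def by (cases j) auto

lemma e_lincomb: "e j = (%x. 1 *. s j x+(- 1) *. uh j x)" by (auto simp: e_def)

lemma e_V: "j <= N ==> e j \<in> V" unfolding e_lincomb by (intro V_lincomb s_V uh_V)

lemma extrapolate_V:
 assumes "!!j. j <= N ==> w j \<in> V" "n <= N"
 shows "extrapolate w n \<in> V"
proof (cases n)
 case (Suc m)
 have "(%x. 2 *. w n x+(- 1) *. w m x) \<in> V" using assms Suc by (intro V_lincomb) auto
 then show ?thesis using Suc by (simp add: extrapolate_def)
qed (use assms in \<open>simp add: extrapolate_def\<close>)

lemma extrapolate_s_V: "n <= N ==> extrapolate s n \<in> V"
 and extrapolate_uh_V: "n <= N ==> extrapolate uh n \<in> V"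
 and extrapolate_e_V: "n <= N ==> extrapolate e n \<in> V" by (rule extrapolate_V; (rule s_V uh_V e_V)?; assumption)+

lemma extrapolate_e: "extrapolate e n = (%x. 1 *. extrapolate s n x+(- 1) *. extrapolate uh n x)" by (auto simp: extrapolate_def e_def algebra_simps)

lemma imex_eq:
 assumes "n < N" "v \<in> V" "q \<in> Q"
 shows "ip Om (%x. (1/dt) *. bdf uh n x) v+\<nu> * ip Om (grad Om (uh (n+1))) (grad Om v)
  + trilinear Om (extrapolate uh n) (extrapolate uh n) v-ip Om (ph (n+1)) (dv Om v)
  + ip Om (dv Om (uh (n+1))) q+\<mu> * ip Om (dv Om (uh (n+1))) (dv Om v)
  = ip Om (f (real (n+1) * dt)) v" using imex assms unfolding imex_solution_def by blast

lemma Q_zero: "(%x. 0) \<in> Q" and V_zero: "(%x. 0) \<in> V" using Q_sub V_sub by (simp_all add: function_subspace_def)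

lemma L2_inner_lincomb_left:
 assumes "in_Lp Om 2 v" "in_Lp Om 2 w" "in_Lp Om 2 z"
 shows "ip Om (%x. a *. v x+b *. w x) z = a * ip Om v z+b * ip Om w z" by (simp add: L2_inner_add_left[OF in_L2_scaleR[OF assms(1)] in_L2_scaleR[OF assms(2)] assms(3)] L2_inner_scaleR_left)

lemma V_lincomb_inner:
 assumes v: "v \<in> V" "w \<in> V"
 shows "in_Lp Om 2 z ==> ip Om (dv Om (%x. a *. v x+b *. w x)) z
  = a * ip Om (dv Om v) z+b * ip Om (dv Om w) z"
  and "in_Lp Om 2 z' ==> ip Om (grad Om (%x. a *. v x+b *. w x)) z'
  = a * ip Om (grad Om v) z'+b * ip Om (grad Om w) z'"
proof -
 note vw = V_lincomb[OF v, of a b]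
 note m = in_L2_measurable
 show "ip Om (dv Om (%x. a *. v x+b *. w x)) z
  = a * ip Om (dv Om v) z+b * ip Om (dv Om w) z" if z: "in_Lp Om 2 z"
 proof -
  have "ip Om (dv Om (%x. a *. v x+b *. w x)) z
  = ip Om (%x. a *. dv Om v x+b *. dv Om w x) z" by (rule L2_inner_cong_AE[OF _ _ m[OF V_div[OF vw]] m[OF in_L2_add[OF in_L2_scaleR[OF V_div[OF v(1)]] in_L2_scaleR[OF V_div[OF v(2)]]]] m[OF z] m[OF z]])
  (use divergence_lincomb[OF Om V_H1[OF v(1)] V_H1[OF v(2)], of a b] in simp_all)
  also have "... = a * ip Om (dv Om v) z+b * ip Om (dv Om w) z" by (rule L2_inner_lincomb_left[OF V_div[OF v(1)] V_div[OF v(2)] z])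
  finally show ?thesis .
 qed
 show "ip Om (grad Om (%x. a *. v x+b *. w x)) z'
  = a * ip Om (grad Om v) z'+b * ip Om (grad Om w) z'" if z: "in_Lp Om 2 z'"
 proof -
  have "ip Om (grad Om (%x. a *. v x+b *. w x)) z'
  = ip Om (%x. a *. grad Om v x+b *. grad Om w x) z'" by (rule L2_inner_cong_AE[OF _ _ m[OF V_gradL2[OF vw]] m[OF in_L2_add[OF in_L2_scaleR[OF V_gradL2[OF v(1)]] in_L2_scaleR[OF V_gradL2[OF v(2)]]]] m[OF z] m[OF z]])
  (use grad_lincomb[OF Om V_H1[OF v(1)] V_H1[OF v(2)], of a b] in simp_all)
  also have "... = a * ip Om (grad Om v) z'+b * ip Om (grad Om w) z'" by (rule L2_inner_lincomb_left[OF V_gradL2[OF v(1)] V_gradL2[OF v(2)] z])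
  finally show ?thesis .
 qed
qed

lemma V_lincomb_norms:
 assumes v: "v \<in> V" "w \<in> V"
 shows "nrm Om (%x. a *. v x+b *. w x) <= \<bar>a\<bar> * nrm Om v+\<bar>b\<bar> * nrm Om w"
  and "nrm Om (grad Om (%x. a *. v x+b *. w x)) <= \<bar>a\<bar> * nrm Om (grad Om v)+\<bar>b\<bar> * nrm Om (grad Om w)"
  and "nrm Om (dv Om (%x. a *. v x+b *. w x)) <= \<bar>a\<bar> * nrm Om (dv Om v)+\<bar>b\<bar> * nrm Om (dv Om w)"
proof -
 note vw = V_lincomb[OF v, of a b]
 note m = in_L2_measurable
 have t: "nrm Om (%x. a *. v x+b *. w x) <= \<bar>a\<bar> * nrm Om v+\<bar>b\<bar> * nrm Om w"
  if "in_Lp Om 2 v" "in_Lp Om 2 w" for v w :: "real^'d => 'b::euclidean_space" using L2_norm_triangle[OF in_L2_scaleR[OF that(1), of a] in_L2_scaleR[OF that(2), of b]] by (simp add: L2_norm_scaleR)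
 show "nrm Om (%x. a *. v x+b *. w x) <= \<bar>a\<bar> * nrm Om v+\<bar>b\<bar> * nrm Om w" by (rule t) (intro V_L2 v)+
 have "nrm Om (grad Om (%x. a *. v x+b *. w x)) = nrm Om (%x. a *. grad Om v x+b *. grad Om w x)" by (rule L2_norm_cong_AE[OF grad_lincomb[OF Om V_H1[OF v(1)] V_H1[OF v(2)]]
  m[OF V_gradL2[OF vw]] m[OF in_L2_add[OF in_L2_scaleR[OF V_gradL2[OF v(1)]] in_L2_scaleR[OF V_gradL2[OF v(2)]]]]])
 then show "nrm Om (grad Om (%x. a *. v x+b *. w x)) <= \<bar>a\<bar> * nrm Om (grad Om v)+\<bar>b\<bar> * nrm Om (grad Om w)" using t[OF V_gradL2[OF v(1)] V_gradL2[OF v(2)]] by simp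
 have d: "AE x in lon Om. dv Om (%x. a *. v x+b *. w x) x = a *. dv Om v x+b *. dv Om w x" using divergence_lincomb[OF Om V_H1[OF v(1)] V_H1[OF v(2)], of a b] by simp
 have "nrm Om (dv Om (%x. a *. v x+b *. w x)) = nrm Om (%x. a *. dv Om v x+b *. dv Om w x)" by (rule L2_norm_cong_AE[OF d m[OF V_div[OF vw]] m[OF in_L2_add[OF in_L2_scaleR[OF V_div[OF v(1)]] in_L2_scaleR[OF V_div[OF v(2)]]]]])
 then show "nrm Om (dv Om (%x. a *. v x+b *. w x)) <= \<bar>a\<bar> * nrm Om (dv Om v)+\<bar>b\<bar> * nrm Om (dv Om w)" using t[OF V_div[OF v(1)] V_div[OF v(2)]] by simp
qed

text \<open>The scheme with velocity test function 0, once with \<open>q\<close> and once with 0,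
  isolates the divergence constraint, which it imposes from the first computed step on.\<close>

lemma e_div_free:
 assumes j: "1 <= j" "j <= N" and q: "q \<in> Q"
 shows "ip Om (dv Om (e j)) q = 0"
proof -
 obtain n where n: "j = n+1" "n < N" using j by (cases j) auto
 have "ip Om (dv Om (uh (n+1))) q = ip Om (dv Om (uh (n+1))) (%x. 0)" using imex_eq[OF n(2) V_zero q] imex_eq[OF n(2) V_zero Q_zero] by linarith
 then have "ip Om (dv Om (uh j)) q = 0" using n by simp
 then show ?thesis unfolding e_lincomb V_lincomb_inner(1)[OF s_V[OF j(2)] uh_V[OF j(2)] Q_L2[OF q]] using s_div[OF j(2) q] by simp
qed

text \<open>Initial value and projection agree only almost everywhere; the inverse inequality passes
  this on to the gradient.\<close>

lemma e0: "nrm Om (e 0) = 0" "nrm Om (grad Om (e 0)) = 0" "nrm Om (dv Om (e 0)) = 0"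
proof -
 have "AE x in lon Om. e 0 x = 0" using imex unfolding imex_solution_def e_def by auto
 then show 1: "nrm Om (e 0) = 0" using L2_norm_eq_0_iff[OF V_L2[OF e_V[of 0]]] by simp
 show 2: "nrm Om (grad Om (e 0)) = 0" using inv[OF e_V[of 0]] 1 L2_norm_nonneg[of Om "grad Om (e 0)"] by simp
 show "nrm Om (dv Om (e 0)) = 0" using divergence_in_L2(2)[OF Om V_H1[OF e_V[of 0]]] 2 L2_norm_nonneg[of Om "dv Om (e 0)"] by simp
qed

lemma bdf_split:
 assumes w: "!!j. j <= N ==> w j \<in> V" and n: "n < N"
 shows "in_Lp Om 2 (bdf w n)"
proof (cases "n = 0")
 case True
 then show ?thesis using V_L2[OF w[of 1]] V_L2[OF w[of 0]] n by (auto simp: bdf_def intro!: in_L2_diff)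
next
 case False
 then show ?thesis using V_L2[OF w[of "n+1"]] V_L2[OF w[of n]] V_L2[OF w[of "n-1"]] n by (auto simp: bdf_def intro!: in_L2_diff in_L2_add in_L2_scaleR)
qed

lemma bdf_e: "bdf e n = (%x. 1 *. bdf s n x+(- 1) *. bdf uh n x)" by (auto simp: bdf_def e_def algebra_simps)

text \<open>The new error is discretely divergence-free, so the discrete pressure drops out. With
  extrapolated arguments the convection difference is \<open>b(s,e) + b(e,s) - b(e,e)\<close>; the
  middle term is estimated here, and the others stay abstract as \<open>Y\<close> and
  \<open>X\<close>, because the Euler step and the later steps bound them differently.\<close>

lemma error_inequality:
 assumes n: "n < N"
  and Y: "\<bar>trilinear Om (extrapolate s n) (extrapolate e n) (e (n+1))\<bar> <= Y"
  and X: "\<bar>trilinear Om (extrapolate e n) (extrapolate e n) (e (n+1))\<bar> <= X"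
 shows "1/dt * ip Om (bdf e n) (e (n+1))+\<nu>*(nrm Om (grad Om (e (n+1))))\<^sup>2
  + \<mu>*(nrm Om (dv Om (e (n+1))))\<^sup>2
  <= tt (n+1) * nrm Om (e (n+1))+\<mu>*\<eta> (n+1) * nrm Om (dv Om (e (n+1)))
  + P (n+1) * nrm Om (dv Om (e (n+1)))
  + (sn Om (grad Om (extrapolate s n)) * nrm Om (extrapolate e n)
  + 1/2 * sn Om (extrapolate s n) * nrm Om (dv Om (extrapolate e n))) * nrm Om (e (n+1)) + Y + X"
proof -
 have j: "n+1 <= N" "n <= N" using n by auto
 let ?v = "e (n+1)" and ?s = "extrapolate s n" and ?u = "extrapolate uh n" and ?e = "extrapolate e n"
 note v = e_V[OF j(1)] and sV = extrapolate_s_V[OF j(2)] and uV = extrapolate_uh_V[OF j(2)] and eV = extrapolate_e_V[OF j(2)]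
 note bv = V_bdd[OF v] and bs = V_bdd[OF sV] and bu = V_bdd[OF uV] and be = V_bdd[OF eV] and v2 = V_L2[OF v]
 have df: "ip Om (dv Om ?v) q = 0" if "q \<in> Q" for q using e_div_free[OF _ j(1) that] by simp
 have "ph (n+1) \<in> Q" using imex n unfolding imex_solution_def by blast
 then have php: "ip Om (ph (n+1)) (dv Om ?v) = 0" using df L2_inner_commute by metis
 let ?r = "ip Om (%x. (1/dt) *. bdf s n x) ?v+\<nu> * ip Om (grad Om (s (n+1))) (grad Om ?v)
  + trilinear Om ?s ?s ?v-ip Om (f (real (n+1) * dt)) ?v"
 have r: "\<bar>?r\<bar> <= tt (n+1) * nrm Om ?v + P (n+1) * nrm Om (dv Om ?v)" by (rule consistency[OF n v df])
 have ie: "ip Om (%x. (1/dt) *. bdf uh n x) ?v+\<nu> * ip Om (grad Om (uh (n+1))) (grad Om ?v)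
  + trilinear Om ?u ?u ?v+\<mu> * ip Om (dv Om (uh (n+1))) (dv Om ?v)
  = ip Om (f (real (n+1) * dt)) ?v" using imex_eq[OF n v Q_zero] php by simp
 have b: "ip Om (bdf e n) ?v = ip Om (bdf s n) ?v-ip Om (bdf uh n) ?v" unfolding bdf_e by (subst L2_inner_lincomb_left[OF bdf_split[where w = s, OF s_V n] bdf_split[where w = uh, OF uh_V n] v2]) simp_all
 have e_eq: "e (n+1) = (%x. 1 *. s (n+1) x+(- 1) *. uh (n+1) x)" by (rule e_lincomb)
 have g: "(nrm Om (grad Om ?v))\<^sup>2 = ip Om (grad Om (s (n+1))) (grad Om ?v)-ip Om (grad Om (uh (n+1))) (grad Om ?v)" using V_lincomb_inner(2)[OF s_V[OF j(1)] uh_V[OF j(1)] V_gradL2[OF v], of 1 "- 1"] unfolding L2_norm_sq_inner e_eq[symmetric] by simp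
 have d: "(nrm Om (dv Om ?v))\<^sup>2 = ip Om (dv Om (s (n+1))) (dv Om ?v)-ip Om (dv Om (uh (n+1))) (dv Om ?v)" using V_lincomb_inner(1)[OF s_V[OF j(1)] uh_V[OF j(1)] V_div[OF v], of 1 "- 1"] unfolding L2_norm_sq_inner e_eq[symmetric] by simp
 have ue: "?u = (%x. 1 *. ?s x+(- 1) *. ?e x)" by (auto simp: extrapolate_e)
 have tri: "trilinear Om ?u ?u ?v = trilinear Om ?s ?s ?v-trilinear Om ?s ?e ?v-trilinear Om ?e ?s ?v+trilinear Om ?e ?e ?v"
 proof -
  have "trilinear Om ?u ?u ?v = 1 * trilinear Om ?s ?u ?v+(- 1) * trilinear Om ?e ?u ?v" using trilinear_lincomb_first[OF Om bs be bu v2, of 1 "- 1"] unfolding ue[symmetric] .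
  moreover have "trilinear Om ?s ?u ?v = 1 * trilinear Om ?s ?s ?v+(- 1) * trilinear Om ?s ?e ?v" using trilinear_lincomb_second[OF Om bs be bs v2, of 1 "- 1"] unfolding ue[symmetric] .
  moreover have "trilinear Om ?e ?u ?v = 1 * trilinear Om ?e ?s ?v+(- 1) * trilinear Om ?e ?e ?v" using trilinear_lincomb_second[OF Om bs be be v2, of 1 "- 1"] unfolding ue[symmetric] .
  ultimately show ?thesis by simp
 qed
 have t2: "\<bar>trilinear Om ?e ?s ?v\<bar> <= (sn Om (grad Om ?s) * nrm Om ?e+1/2*(sn Om ?s * nrm Om (dv Om ?e))) * nrm Om ?v" by (rule trilinear_bound[OF Om be bs v2 convection_bounds2(2)[OF V_grad[OF sV] V_L2[OF eV]] divergence_mult_bounds(2)[OF Om V_H1[OF eV] V_Linf[OF sV]]])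
 have ds: "\<bar>ip Om (dv Om (s (n+1))) (dv Om ?v)\<bar> <= \<eta> (n+1) * nrm Om (dv Om ?v)" by (rule order_trans[OF L2_Cauchy_Schwarz[OF V_div[OF s_V[OF j(1)]] V_div[OF v]]]) (intro mult_right_mono \<eta> j L2_norm_nonneg)
 then have ds': "\<mu> * ip Om (dv Om (s (n+1))) (dv Om ?v) <= \<mu>*(\<eta> (n+1) * nrm Om (dv Om ?v))" using pos by (intro mult_left_mono) auto
 have bb: "ip Om (%x. (1/dt) *. bdf w n x) ?v = 1/dt * ip Om (bdf w n) ?v" for w by (rule L2_inner_scaleR_left)
 have "1/dt * ip Om (bdf e n) ?v+\<nu>*(nrm Om (grad Om ?v))\<^sup>2+\<mu>*(nrm Om (dv Om ?v))\<^sup>2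
  = ?r+\<mu> * ip Om (dv Om (s (n+1))) (dv Om ?v)-trilinear Om ?s ?e ?v-trilinear Om ?e ?s ?v+trilinear Om ?e ?e ?v" using ie unfolding b g d tri bb right_diff_distrib by linarith
 also have "... <= (tt (n+1) * nrm Om ?v + P (n+1) * nrm Om (dv Om ?v))+\<mu>*(\<eta> (n+1) * nrm Om (dv Om ?v))
  + Y+(sn Om (grad Om ?s) * nrm Om ?e+1/2*(sn Om ?s * nrm Om (dv Om ?e))) * nrm Om ?v + X" using r ds' t2 X Y by linarith
 finally show ?thesis by (simp add: mult.assoc)
qed

text \<open>The extrapolated error of the Euler step is the initial error, which vanishes, so every
  convection term drops out. Multiplication by \<open>dt\<close> gives the truncation error the
  factor \<open>dt^2\<close> that makes up for the lower order of this step.\<close>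

lemma first_step:
 assumes N: "1 <= N"
 shows "(nrm Om (e 1))\<^sup>2+2*\<nu> * dt * (nrm Om (grad Om (e 1)))\<^sup>2+\<mu> * dt * (nrm Om (dv Om (e 1)))\<^sup>2
  <= dt\<^sup>2*(tt 1)\<^sup>2+2*\<mu> * dt * (\<eta> 1)\<^sup>2+2 * dt * (P 1)\<^sup>2/\<mu>"
proof -
 have n: "0 < N" using N by simp
 let ?v = "e (0+1)" and ?A = "nrm Om (e 1)" and ?Q = "nrm Om (dv Om (e 1))" and ?G = "nrm Om (grad Om (e 1))"
 have V: "e 0 \<in> V" "e 1 \<in> V" "s 0 \<in> V" using e_V s_V N by auto
 have ex: "extrapolate e 0 = e 0" "extrapolate s 0 = s 0" by (simp_all add: extrapolate_def)
 have x0: "\<bar>trilinear Om w (e 0) ?v\<bar> <= 0" if w: "w \<in> V" for w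
 proof -
  have 1: "nrm Om (convection Om w (e 0)) <= 0" using convection_bounds(2)[OF Om V_H1[OF V(1)] V_Linf[OF w]] e0 by simp
  have 2: "nrm Om (%x. (1/2 * dv Om w x) *. e 0 x) <= 0" using half_divergence_bound[OF V_grad[OF w] V_L2[OF V(1)]] e0 by simp
  show ?thesis using trilinear_bound[OF Om V_bdd[OF w] V_bdd[OF V(1)] V_L2[of ?v] 1 2] V(2) by simp
 qed
 have b: "ip Om (bdf e 0) ?v = ?A\<^sup>2"
 proof -
  have "\<bar>ip Om (e 0) (e 1)\<bar> <= 0" using L2_Cauchy_Schwarz[OF V_L2[OF V(1)] V_L2[OF V(2)]] e0 by simp
  then show ?thesis using L2_inner_diff_left[OF V_L2[OF V(2)] V_L2[OF V(1)] V_L2[OF V(2)]] by (simp add: bdf_def L2_norm_sq_inner)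
 qed
 have main: "1/dt * ?A\<^sup>2+\<nu> * ?G\<^sup>2+\<mu> * ?Q\<^sup>2 <= tt 1 * ?A+\<mu>*\<eta> 1 * ?Q + P 1 * ?Q" using error_inequality[OF n, where Y = 0 and X = 0] x0[OF V(1)] x0[OF V(3)] unfolding b ex e0 by simp
 have "dt * (1/dt * ?A\<^sup>2+\<nu> * ?G\<^sup>2+\<mu> * ?Q\<^sup>2) <= dt * (tt 1 * ?A+\<mu>*\<eta> 1 * ?Q + P 1 * ?Q)" using main pos by (intro mult_left_mono) auto
 then have m2: "?A\<^sup>2+\<nu> * dt * ?G\<^sup>2+\<mu> * dt * ?Q\<^sup>2 <= (dt * tt 1) * ?A+\<mu> * dt * (\<eta> 1 * ?Q)+dt * (P 1 * ?Q)" using pos by (simp add: algebra_simps)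
 have y1: "(dt * tt 1) * ?A <= 1/2*(dt * tt 1)\<^sup>2 + ?A\<^sup>2/(4*(1/2))" by (rule young_scaled) simp
 have y2: "\<mu> * dt * (\<eta> 1 * ?Q) <= \<mu> * dt * (1*(\<eta> 1)\<^sup>2 + ?Q\<^sup>2/(4*1))" using pos by (intro mult_left_mono young_scaled) auto
 have y3: "dt * (P 1 * ?Q) <= dt * (1/\<mu>*(P 1)\<^sup>2 + ?Q\<^sup>2/(4*(1/\<mu>)))" using pos by (intro mult_left_mono young_scaled) auto
 have y3': "dt * (1/\<mu>*(P 1)\<^sup>2 + ?Q\<^sup>2/(4*(1/\<mu>))) = dt * (P 1)\<^sup>2/\<mu>+\<mu> * dt * ?Q\<^sup>2/4" using pos by (simp add: field_simps)
 have y2': "\<mu> * dt * (1*(\<eta> 1)\<^sup>2 + ?Q\<^sup>2/(4*1)) = \<mu> * dt * (\<eta> 1)\<^sup>2+\<mu> * dt * ?Q\<^sup>2/4" by (simp add: field_simps)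
 have y1': "1/2*(dt * tt 1)\<^sup>2 = 1/2*(dt\<^sup>2*(tt 1)\<^sup>2)" by (simp add: power_mult_distrib)
 show ?thesis using m2 y1 y2 y3 unfolding y1' y2' y3' by simp
qed

section \<open>The energy inequality of a BDF2 step and its iteration\<close>

lemma extrapolate_e_norms:
 assumes n: "1 <= n" "n <= N"
 shows "nrm Om (extrapolate e n) <= 2 * nrm Om (e n)+nrm Om (e (n-1))"
  and "(nrm Om (extrapolate e n))\<^sup>2 <= 6*(nrm Om (e n))\<^sup>2+3*(nrm Om (e (n-1)))\<^sup>2"
  and "(nrm Om (grad Om (extrapolate e n)))\<^sup>2 <= 6*(nrm Om (grad Om (e n)))\<^sup>2+3*(nrm Om (grad Om (e (n-1))))\<^sup>2"
  and "(nrm Om (dv Om (extrapolate e n)))\<^sup>2 <= 6*(nrm Om (dv Om (e n)))\<^sup>2+3*(nrm Om (dv Om (e (n-1))))\<^sup>2"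
proof -
 have ex: "extrapolate e n = (%x. 2 *. e n x+(- 1) *. e (n-1) x)" using n by (auto simp: extrapolate_def)
 have V: "e n \<in> V" "e (n-1) \<in> V" using e_V n by auto
 note nn = V_lincomb_norms[OF V, of 2 "- 1", folded ex]
 show "nrm Om (extrapolate e n) <= 2 * nrm Om (e n)+nrm Om (e (n-1))" using nn(1) by simp
 have sq: "z\<^sup>2 <= 6 * x\<^sup>2+3 * y\<^sup>2" if "z <= 2 * x+y" "0 <= z" for x y z :: real
 proof -
  have "z\<^sup>2 <= (2 * x-(- y))\<^sup>2" using that by (intro power_mono) auto
  then show ?thesis using square_le_of_sum_squares[of x "- y"] by simp
 qed
 show "(nrm Om (extrapolate e n))\<^sup>2 <= 6*(nrm Om (e n))\<^sup>2+3*(nrm Om (e (n-1)))\<^sup>2" by (rule sq) (use nn(1) in simp_all)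
 show "(nrm Om (grad Om (extrapolate e n)))\<^sup>2 <= 6*(nrm Om (grad Om (e n)))\<^sup>2+3*(nrm Om (grad Om (e (n-1))))\<^sup>2" by (rule sq) (use nn(2) in simp_all)
 show "(nrm Om (dv Om (extrapolate e n)))\<^sup>2 <= 6*(nrm Om (dv Om (e n)))\<^sup>2+3*(nrm Om (dv Om (e (n-1))))\<^sup>2" by (rule sq) (use nn(3) in simp_all)
qed

text \<open>The G-stability identity of BDF2. It holds pointwise for vectors, so it is verified
  under the integral sign.\<close>

lemma bdf_identity:
 assumes n: "1 <= n" "n < N"
 shows "4 * ip Om (bdf e n) (e (n+1))
  = ((nrm Om (e (n+1)))\<^sup>2+(nrm Om (%x. 2 *. e (n+1) x-e n x))\<^sup>2)
  - ((nrm Om (e n))\<^sup>2+(nrm Om (%x. 2 *. e n x-e (n-1) x))\<^sup>2)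
  + (nrm Om (%x. e (n+1) x-extrapolate e n x))\<^sup>2"
proof -
 let ?a = "e (n+1)" and ?b = "e n" and ?c = "e (n-1)"
 have L: "in_Lp Om 2 ?a" "in_Lp Om 2 ?b" "in_Lp Om 2 ?c" using V_L2[OF e_V] n by auto
 have ip: "integrable (lon Om) (%x. u x \<bullet> v x)" if "in_Lp Om 2 u" "in_Lp Om 2 v" for u v :: "real^'d => real^'d" by (rule integrable_inner_L2[OF that])
 have L': "in_Lp Om 2 (bdf e n)" "in_Lp Om 2 (%x. 2 *. ?a x - ?b x)" "in_Lp Om 2 (%x. 2 *. ?b x - ?c x)" "in_Lp Om 2 (%x. ?a x-extrapolate e n x)" using L n by (auto simp: bdf_def extrapolate_def intro!: in_L2_diff in_L2_add in_L2_scaleR)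
 have "((nrm Om ?a)\<^sup>2+(nrm Om (%x. 2 *. ?a x - ?b x))\<^sup>2)
  - ((nrm Om ?b)\<^sup>2+(nrm Om (%x. 2 *. ?b x - ?c x))\<^sup>2)+(nrm Om (%x. ?a x-extrapolate e n x))\<^sup>2
  = (LINT x|lon Om. ((?a x \<bullet> ?a x+(2 *. ?a x - ?b x) \<bullet> (2 *. ?a x - ?b x))-(?b x \<bullet> ?b x+(2 *. ?b x - ?c x) \<bullet> (2 *. ?b x - ?c x)))
  + (?a x-extrapolate e n x) \<bullet> (?a x-extrapolate e n x))" unfolding L2_norm_sq_inner L2_inner_def by (subst Bochner_Integration.integral_add Bochner_Integration.integral_diff, (intro Bochner_Integration.integrable_add Bochner_Integration.integrable_diff ip L L')+)+ simp
 also have "... = (LINT x|lon Om. 4*(bdf e n x \<bullet> ?a x))" by (rule Bochner_Integration.integral_cong[OF refl])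
  (use n in \<open>simp add: bdf_def extrapolate_def inner_diff_left inner_diff_right inner_add_left inner_add_right inner_commute algebra_simps\<close>)
 also have "... = 4 * ip Om (bdf e n) ?a" unfolding L2_inner_def by simp
 finally show ?thesis by simp
qed

text \<open>Four times the squared G-norm of two consecutive errors. At \<open>j = 1\<close> it is
  five times the squared norm of \<open>e 1\<close>, because \<open>e 0\<close> vanishes.\<close>

definition lyap :: "nat => real" where
 "lyap j = (nrm Om (e j))\<^sup>2+(nrm Om (%x. 2 *. e j x-e (j-1) x))\<^sup>2"

definition source :: "nat => real" where
 "source j = 4 * T * dt * (tt j)\<^sup>2+4*\<mu> * dt * (\<eta> j)\<^sup>2+4/\<mu> * dt * (P j)\<^sup>2"

lemma error_step:
 assumes j: "2 <= j" "j <= N" and K: "0 <= K" "nrm Om (e (j-1)) <= K * h" "nrm Om (e (j-2)) <= K * h"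
  and ep: "12*(1+real CARD('d)/2) * K * ep0 <= ep" "0 < ep" "ep <= \<nu>/10" "5 * ep\<^sup>2 <= \<nu>/T"
 shows "lyap j+4*\<nu> * dt * (nrm Om (grad Om (e j)))\<^sup>2+4*\<mu> * dt * (nrm Om (dv Om (e j)))\<^sup>2 <= lyap (j-1)
  + 4 * dt * (sn Om (grad Om (extrapolate s (j-1)))*(1/2*(nrm Om (e j))\<^sup>2+3*(nrm Om (e (j-1)))\<^sup>2+3/2*(nrm Om (e (j-2)))\<^sup>2)
  + 9/(2*\<mu>)*(sn Om (extrapolate s (j-1)))\<^sup>2*(nrm Om (e j))\<^sup>2)
  + \<mu> * dt/18*(6*(nrm Om (dv Om (e (j-1))))\<^sup>2+3*(nrm Om (dv Om (e (j-2))))\<^sup>2)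
  + dt * ((2*\<kappa>+3)/T)*(nrm Om (e j))\<^sup>2
  + \<nu> * dt/10*(6*(nrm Om (grad Om (e (j-1))))\<^sup>2+3*(nrm Om (grad Om (e (j-2))))\<^sup>2+(nrm Om (grad Om (e j)))\<^sup>2)
  + 2*\<mu> * dt * (nrm Om (dv Om (e j)))\<^sup>2+source j"
proof -
 obtain n where n: "j = n+1" "1 <= n" "n < N" using j by (cases j) auto
 have nN: "n <= N" "n+1 <= N" using n by auto
 let ?v = "e (n+1)" and ?s = "extrapolate s n" and ?e = "extrapolate e n"
 let ?D = "%x. ?v x - ?e x"
 note v = e_V[OF nN(2)] and sV = extrapolate_s_V[OF nN(1)] and eV = extrapolate_e_V[OF nN(1)]
 have Deq: "?D = (%x. 1 *. ?v x+(- 1) *. ?e x)" by auto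
 have DV: "?D \<in> V" unfolding Deq by (rule V_lincomb[OF v eV])
 let ?A = "nrm Om ?v" and ?S = "sn Om (grad Om ?s)" and ?Z = "sn Om ?s" and ?Dn = "nrm Om ?D"
 let ?A1 = "nrm Om ?e" and ?G1 = "nrm Om (grad Om ?e)" and ?Q1 = "nrm Om (dv Om ?e)"
 let ?G = "nrm Om (grad Om ?v)" and ?Qd = "nrm Om (dv Om ?v)"
 \<comment> \<open>As \<open>trilinear Om ?s ?v ?v\<close> vanishes, the transport term can be
   rewritten with \<open>?D\<close> in the last slot. Only then does the derivative fall on
   \<open>?v\<close>, at the price of a factor \<open>c/h\<close>.\<close>
 have Y: "\<bar>trilinear Om ?s ?e ?v\<bar> <= (4 * U * c/h+1/2 * S') * ?A * ?Dn"
 proof -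
  note sk = trilinear_skew[OF Om V_H10[OF sV] V_Linf[OF sV]]
  have z: "trilinear Om ?s ?v ?v = 0" using sk[OF V_H10[OF v] V_Linf[OF v] V_H1[OF v] V_Linf[OF v]] by simp
  have "trilinear Om ?s ?D ?v = 1 * trilinear Om ?s ?v ?v+(- 1) * trilinear Om ?s ?e ?v" unfolding Deq by (rule trilinear_lincomb_second[OF Om V_bdd[OF v] V_bdd[OF eV] V_bdd[OF sV] V_L2[OF v]])
  then have "trilinear Om ?s ?e ?v = trilinear Om ?s ?v ?D" using z sk[OF V_H10[OF DV] V_Linf[OF DV] V_H1[OF v] V_Linf[OF v]] by simp
  moreover have "\<bar>trilinear Om ?s ?v ?D\<bar> <= (4 * U * (c/h * ?A)+1/2 * S' * ?A) * ?Dn"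
  proof (rule trilinear_bound[OF Om V_bdd[OF sV] V_bdd[OF v] V_L2[OF DV]])
  show "nrm Om (convection Om ?s ?v) <= 4 * U * (c/h * ?A)" by (rule order_trans[OF convection_bounds(2)[OF Om V_H1[OF v] V_Linf[OF sV]]])
  (intro mult_mono shat n(3) inv v L2_norm_nonneg, use pos in simp)
  show "nrm Om (%x. (1/2 * dv Om ?s x) *. ?v x) <= 1/2 * S' * ?A" by (rule order_trans[OF half_divergence_bound[OF V_grad[OF sV] V_L2[OF v]]])
  (intro mult_right_mono mult_left_mono shat n(3) L2_norm_nonneg, simp)
  qed
  ultimately show ?thesis by (simp add: algebra_simps)
 qed
 define X where "X = \<bar>trilinear Om ?e ?e ?v\<bar>"
 \<comment> \<open>Smallness of the two earlier errors gives \<open>2 K h + K h\<close> for the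
   extrapolation. The new error is not assumed small and keeps its sup norm.\<close>
 have A1K: "?A1 <= 3 * K * h" using extrapolate_e_norms(1)[OF n(2) nN(1)] K n by simp
 have X: "4 * X <= ep * ?G1*(?G + ?A)"
 proof -
  have "X <= (?A1 * ?G1+1/2*(real CARD('d) * ?G1) * ?A1) * sn Om ?v" unfolding X_def by (rule trilinear_bound_test_Linf[OF Om V_bdd[OF eV] V_bdd[OF eV] V_bdd[OF v]])
  also have "... = (1+real CARD('d)/2) * ?G1*(?A1 * sn Om ?v)" by (simp add: algebra_simps)
  also have "... <= (1+real CARD('d)/2) * ?G1*(3 * K * (ep0*(?G + ?A)))"
  proof (intro mult_left_mono)
  have "?A1 * sn Om ?v <= 3 * K * h * sn Om ?v" using A1K by (intro mult_right_mono) auto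
  also have "... = 3 * K * (h * sn Om ?v)" by simp
  also have "... <= 3 * K * (ep0*(?G + ?A))" using K by (intro mult_left_mono sup v) auto
  finally show "?A1 * sn Om ?v <= 3 * K * (ep0*(?G + ?A))" .
  qed simp
  finally have "4 * X <= 4*((1+real CARD('d)/2) * ?G1*(3 * K * (ep0*(?G + ?A))))" by linarith
  also have "... = (12*(1+real CARD('d)/2) * K * ep0)*(?G1*(?G + ?A))" by (simp add: algebra_simps)
  also have "... <= ep * (?G1*(?G + ?A))" using ep by (intro mult_right_mono) auto
  finally show ?thesis by (simp add: mult.assoc)
 qed
 have S'0: "0 <= S'" using order_trans[OF _ shat(2)[OF n(3)]] by simp
 have ineq: "1/dt * ip Om (bdf e n) ?v+\<nu> * ?G\<^sup>2+\<mu> * ?Qd\<^sup>2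
  <= tt j * ?A+\<mu>*\<eta> j * ?Qd + P j * ?Qd+(?S * ?A1+1/2 * ?Z * ?Q1) * ?A+(4 * U * c/h+1/2 * S') * ?A * ?Dn + X" using error_inequality[OF n(3) Y, of X] unfolding X_def n(1) by simp
 have "4 * dt * (1/dt * ip Om (bdf e n) ?v+\<nu> * ?G\<^sup>2+\<mu> * ?Qd\<^sup>2) <= 4 * dt * (tt j * ?A+\<mu>*\<eta> j * ?Qd + P j * ?Qd+(?S * ?A1+1/2 * ?Z * ?Q1) * ?A+(4 * U * c/h+1/2 * S') * ?A * ?Dn + X)" using ineq pos by (intro mult_left_mono) auto
 also have "... <= 4 * dt * (?S * (1/2 * ?A\<^sup>2+1/2 * ?A1\<^sup>2)+9/(2*\<mu>) * ?Z\<^sup>2 * ?A\<^sup>2)+\<mu> * dt/18 * ?Q1\<^sup>2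
  + ?Dn\<^sup>2+dt * ((2*\<kappa>+3)/T) * ?A\<^sup>2+\<nu> * dt/10*(?G1\<^sup>2 + ?G\<^sup>2)+2*\<mu> * dt * ?Qd\<^sup>2
  + (4 * T * dt * (tt j)\<^sup>2+4*\<mu> * dt * (\<eta> j)\<^sup>2+4/\<mu> * dt * (P j)\<^sup>2)" by (rule error_step_young[where U = U and c = c and h = h and T = T and \<nu> = \<nu> and \<epsilon> = ep])
  (use pos cfl S' ep X S'0 in simp_all)
 finally have main: "4 * dt * (1/dt * ip Om (bdf e n) ?v+\<nu> * ?G\<^sup>2+\<mu> * ?Qd\<^sup>2) <= 4 * dt * (?S * (1/2 * ?A\<^sup>2+1/2 * ?A1\<^sup>2)+9/(2*\<mu>) * ?Z\<^sup>2 * ?A\<^sup>2)+\<mu> * dt/18 * ?Q1\<^sup>2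
  + ?Dn\<^sup>2+dt * ((2*\<kappa>+3)/T) * ?A\<^sup>2+\<nu> * dt/10*(?G1\<^sup>2 + ?G\<^sup>2)+2*\<mu> * dt * ?Qd\<^sup>2
  + source j" unfolding source_def .
 have lhs: "4 * dt * (1/dt * ip Om (bdf e n) ?v+\<nu> * ?G\<^sup>2+\<mu> * ?Qd\<^sup>2)
  = lyap j-lyap (j-1) + ?Dn\<^sup>2+4*\<nu> * dt * ?G\<^sup>2+4*\<mu> * dt * ?Qd\<^sup>2"
 proof -
  have "4 * dt * (1/dt * ip Om (bdf e n) ?v+\<nu> * ?G\<^sup>2+\<mu> * ?Qd\<^sup>2)
  = 4 * ip Om (bdf e n) ?v+4*\<nu> * dt * ?G\<^sup>2+4*\<mu> * dt * ?Qd\<^sup>2" using pos by (simp add: algebra_simps)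
  also have "4 * ip Om (bdf e n) ?v = lyap j-lyap (j-1) + ?Dn\<^sup>2" unfolding bdf_identity[OF n(2,3)] lyap_def n(1) using n(2) by simp
  finally show ?thesis by simp
 qed
 note ee = extrapolate_e_norms(2-4)[OF n(2) nN(1)]
 have m1: "4 * dt * (?S * (1/2 * ?A\<^sup>2+1/2 * ?A1\<^sup>2)+9/(2*\<mu>) * ?Z\<^sup>2 * ?A\<^sup>2)
  <= 4 * dt * (?S * (1/2 * ?A\<^sup>2+3*(nrm Om (e n))\<^sup>2+3/2*(nrm Om (e (n-1)))\<^sup>2)+9/(2*\<mu>) * ?Z\<^sup>2 * ?A\<^sup>2)" using pos ee(1) by (intro mult_left_mono add_right_mono) auto
 have m2: "\<mu> * dt/18 * ?Q1\<^sup>2 <= \<mu> * dt/18*(6*(nrm Om (dv Om (e n)))\<^sup>2+3*(nrm Om (dv Om (e (n-1))))\<^sup>2)" using pos ee(3) by (intro mult_left_mono) auto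
 have m3: "\<nu> * dt/10*(?G1\<^sup>2 + ?G\<^sup>2) <= \<nu> * dt/10*(6*(nrm Om (grad Om (e n)))\<^sup>2+3*(nrm Om (grad Om (e (n-1))))\<^sup>2 + ?G\<^sup>2)" using pos ee(2) by (intro mult_left_mono) auto
 have idx: "j-1 = n" "j-2 = n-1" "e j = ?v" using n(1) by auto
 have lhs': "4 * dt * (1/dt * ip Om (bdf e n) ?v+\<nu> * ?G\<^sup>2+\<mu> * ?Qd\<^sup>2)
  = lyap j-lyap n + ?Dn\<^sup>2+4*\<nu> * dt * ?G\<^sup>2+4*\<mu> * dt * ?Qd\<^sup>2" using lhs unfolding idx .
 show ?thesis unfolding idx using main[unfolded lhs'] m1 m2 m3 by linarith
qed

text \<open>Strong induction on the last index \<open>m\<close>. The steps up to \<open>m\<close>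
  use smallness of errors with index below \<open>m\<close> only, so Gronwall's lemma applies to the
  complete system of inequalities and returns the estimate, hence smallness, at
  \<open>m\<close>.\<close>

theorem imex_error_estimate:
 assumes n: "1 <= n" "n+1 <= N"
  and stab: "!!j. j \<in> {2..n+1} ==> dt * (4*((\<kappa>+1)/T)+stab_const Om \<mu> s n j) <= 1/2"
  "!!j. j \<in> {2..n+1} ==> stab_const Om \<mu> s n j <= \<Lambda>" "0 <= \<Lambda>"
  and B: "10*(dt\<^sup>2*(tt 1)\<^sup>2+2*\<mu> * dt * (\<eta> 1)\<^sup>2+2 * dt * (P 1)\<^sup>2/\<mu>)+(\<Sum>j=2..N. source j) <= B"
  and K: "0 <= K" "exp (8*(\<kappa>+1)+2 * T * \<Lambda>) * B <= (K * h)\<^sup>2"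
  and ep: "12*(1+real CARD('d)/2) * K * ep0 <= ep" "0 < ep" "ep <= \<nu>/10" "5 * ep\<^sup>2 <= \<nu>/T"
 shows "(nrm Om (e (n+1)))\<^sup>2+(\<Sum>j=2..n+1. \<nu> * dt * (nrm Om (grad Om (e j)))\<^sup>2)
  + \<mu>*(\<Sum>j=2..n+1. dt * (nrm Om (dv Om (e j)))\<^sup>2) <= exp (8*(\<kappa>+1)+2 * T * \<Lambda>) * B"
proof -
 define F where "F = exp (8*(\<kappa>+1)+2 * T * \<Lambda>)"
 define a where "a j = (nrm Om (e j))\<^sup>2" for j
 define g where "g j = (nrm Om (grad Om (e j)))\<^sup>2" for j
 define q where "q j = (nrm Om (dv Om (e j)))\<^sup>2" for j
 define S where "S j = sn Om (grad Om (extrapolate s j))" for j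
 define Z where "Z j = sn Om (extrapolate s j)" for j
 define X1 where "X1 = dt\<^sup>2*(tt 1)\<^sup>2+2*\<mu> * dt * (\<eta> 1)\<^sup>2+2 * dt * (P 1)\<^sup>2/\<mu>"
 have nn: "0 <= a j" "0 <= g j" "0 <= q j" "0 <= S j" for j by (simp_all add: a_def g_def q_def S_def)
 have srcnn: "0 <= source j" for j unfolding source_def using pos by simp
 have X10: "0 <= X1" unfolding X1_def using pos by simp
 have B0: "0 <= B" using B X10 sum_nonneg[of "{2..N}" source] srcnn unfolding X1_def[symmetric] by force
 have F1: "1 <= F" unfolding F_def using pos stab(3) by simp
 have fs: "a 1+2*\<nu> * dt * g 1+\<mu> * dt * q 1 <= X1" unfolding a_def g_def q_def X1_def by (rule first_step) (use n in simp)
 have a1X: "a 1 <= X1" using fs pos nn[of 1] by (smt (verit) mult_nonneg_nonneg)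
 have small: "nrm Om (e j) <= K * h" if "a j <= F * B" for j
 proof (rule power2_le_imp_le)
  show "(nrm Om (e j))\<^sup>2 <= (K * h)\<^sup>2" using that K unfolding a_def F_def by linarith
  show "0 <= K * h" using K pos by simp
 qed
 define R where "R m \<longleftrightarrow> a m+(\<Sum>j=2..m. \<nu> * dt * g j)+\<mu>*(\<Sum>j=2..m. dt * q j) <= F * B" for m
 have Ra: "a m <= F * B" if "R m" for m
 proof -
  have "0 <= (\<Sum>j=2..m. \<nu> * dt * g j)" "0 <= \<mu>*(\<Sum>j=2..m. dt * q j)" using pos nn by (auto intro!: sum_nonneg mult_nonneg_nonneg)
  then show ?thesis using that unfolding R_def by linarith
 qed
 have "R m" if m: "1 <= m" "m <= n+1" for m using m
 proof (induction m rule: less_induct)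
  case (less m)
  show ?case
  proof (cases "m = 1")
  case True
  have "X1 <= 10 * X1" using X10 by simp
  also have "... <= B" using B sum_nonneg[of "{2..N}" source] srcnn unfolding X1_def[symmetric] by force
  also have "B <= F * B" using mult_right_mono[OF F1 B0] by simp
  finally have "a 1 <= F * B" using a1X by linarith
  then show ?thesis unfolding R_def True by simp
  next
  case False
  then have m2: "2 <= m" "m <= N" "m <= n+1" using less.prems n by auto
  have sm: "nrm Om (e j) <= K * h" if "j < m" for j
  proof (cases "j = 0")
  case True
  then show ?thesis using e0(1) K pos by simp
  next
  case False
  then show ?thesis using small[OF Ra[OF less.IH[of j]]] that m2 by simp
  qed
  \<comment> \<open>\<open>stab_const\<close> with \<open>m\<close> in the role of
    \<open>n + 1\<close>. It is the smaller of the two, so the step restriction for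
    \<open>n + 1\<close> suffices.\<close>
  define lm where "lm j = 4*(1/2 * S (j-1)+9/(2*\<mu>)*(Z (j-1))\<^sup>2+3 * S j+3/2*(if j = m then 0 else S (j+1)))" for j
  have lm_le: "lm j <= stab_const Om \<mu> s n j" if j: "2 <= j" "j <= m" for j
  proof -
  have "(if j = m then 0 else S (j+1)) <= (if j = n+1 then 0 else S (j+1))" using j m2 nn(4)[of "j+1"] by auto
  then show ?thesis unfolding lm_def stab_const_def S_def Z_def by simp
  qed
  have lm0: "0 <= lm j" for j unfolding lm_def using pos nn by (auto intro!: add_nonneg_nonneg mult_nonneg_nonneg)
  define x where "x j = dt * (4*((\<kappa>+1)/T)+lm j)" for j
  have x0: "0 <= x j" for j unfolding x_def using pos lm0[of j] by (intro mult_nonneg_nonneg add_nonneg_nonneg) auto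
  have x2: "x j <= 1/2" if j: "2 <= j" "j <= m" for j
  proof -
  have "x j <= dt * (4*((\<kappa>+1)/T)+stab_const Om \<mu> s n j)" unfolding x_def using lm_le[OF j] pos by (intro mult_left_mono) auto
  also have "... <= 1/2" using stab(1)[of j] j m2 by simp
  finally show ?thesis .
  qed
  have stp: "lyap j+4*\<nu> * dt * g j+4*\<mu> * dt * q j <= lyap (j-1)
  + 4 * dt * (S (j-1)*(1/2 * a j+3 * a (j-1)+3/2 * a (j-2))+9/(2*\<mu>)*(Z (j-1))\<^sup>2 * a j)
  + \<mu> * dt/18*(6 * q (j-1)+3 * q (j-2))+dt * ((2*\<kappa>+3)/T) * a j
  + \<nu> * dt/10*(6 * g (j-1)+3 * g (j-2)+g j)+2*\<mu> * dt * q j+source j" if j: "2 <= j" "j <= m" for j unfolding a_def g_def q_def S_def Z_def by (rule error_step[OF j(1) _ K(1) sm sm ep]) (use j m2 in auto)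
  have rec: "a i+(\<Sum>j=2..i. \<nu> * dt * g j)+\<mu>*(\<Sum>j=2..i. dt * q j) <= B+(\<Sum>j=2..i. x j * a j)" if i: "2 <= i" "i <= m" for i
  proof -
  \<comment> \<open>The sum that ends at \<open>i\<close> drops the weight \<open>S (i+1)\<close>
    instead. Comparison with \<open>lm\<close> gives Gronwall's lemma one fixed sequence of
    weights.\<close>
  define li where "li j = 4*(1/2 * S (j-1)+9/(2*\<mu>)*(Z (j-1))\<^sup>2+3 * S j+3/2*(if j = i then 0 else S (j+1)))" for j
  have li: "li j <= lm j" if "j <= i" for j
  proof -
  have "(if j = i then 0 else S (j+1)) <= (if j = m then 0 else S (j+1))" using that i nn(4)[of "j+1"] by auto
  then show ?thesis unfolding lm_def li_def by simp
  qed
  have "a i+(\<Sum>j=2..i. \<nu> * dt * g j)+\<mu>*(\<Sum>j=2..i. dt * q j)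
  <= 9 * a 1+\<nu> * dt * g 1+1/2*\<mu> * dt * q 1+(\<Sum>j=2..i. source j)+(\<Sum>j=2..i. dt * (4*((\<kappa>+1)/T)+li j) * a j)"
  proof (rule bdf2_error_recursion[where E = lyap and S = S and Z = Z])
  show "a 0 = 0" "g 0 = 0" "q 0 = 0" using e0 by (simp_all add: a_def g_def q_def)
  show "a j <= lyap j" for j by (simp add: a_def lyap_def)
  show "lyap 1 = 5 * a 1"
  proof -
  have V: "e 0 \<in> V" "e 1 \<in> V" using e_V n by auto
  have "nrm Om (%x. 2 *. e 1 x-e 0 x) = nrm Om (%x. 2 *. e 1 x)"
  proof (rule L2_norm_cong_AE)
  show "AE x in lon Om. 2 *. e 1 x-e 0 x = 2 *. e 1 x" using e0(1) L2_norm_eq_0_iff[OF V_L2[OF V(1)]] by auto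
  qed (use V_L2[OF V(1)] V_L2[OF V(2)] in \<open>auto simp: in_L2_iff\<close>)
  then show ?thesis by (simp add: lyap_def a_def L2_norm_scaleR power_mult_distrib)
  qed
  show "dt * (4*((\<kappa>+1)/T)+li 2) <= 1/2"
  proof -
  have "dt * (4*((\<kappa>+1)/T)+li 2) <= x 2" unfolding x_def using li[of 2] i pos by (intro mult_left_mono) auto
  also have "x 2 <= 1/2" by (rule x2) (use i in auto)
  finally show ?thesis .
  qed
  qed (use pos nn i stp in \<open>auto simp: li_def\<close>)
  also have "... <= B+(\<Sum>j=2..i. x j * a j)"
  proof -
  have "0 <= \<nu> * dt * g 1" "0 <= \<mu> * dt * q 1" using pos nn by simp_all
  then have "9 * a 1+\<nu> * dt * g 1+1/2*\<mu> * dt * q 1 <= 10 * X1" using fs a1X X10 by linarith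
  moreover have "(\<Sum>j=2..i. source j) <= (\<Sum>j=2..N. source j)" by (rule sum_mono2) (use srcnn i m2 in auto)
  moreover have "(\<Sum>j=2..i. dt * (4*((\<kappa>+1)/T)+li j) * a j) <= (\<Sum>j=2..i. x j * a j)" unfolding x_def by (intro sum_mono mult_right_mono mult_left_mono add_left_mono li nn) (use pos in auto)
  ultimately show ?thesis using B unfolding X1_def[symmetric] by linarith
  qed
  finally show ?thesis .
  qed
  have gw: "B+(\<Sum>j=2..m. x j * a j) <= exp (2*(\<Sum>j=2..m. x j)) * B"
  proof (rule discrete_gronwall[OF B0])
  fix j assume j: "2 <= j" "j <= m"
  show "0 <= x j & x j <= 1/2" using x0 x2 j by auto
  have "0 <= (\<Sum>i=2..j. \<nu> * dt * g i)" "0 <= \<mu>*(\<Sum>i=2..j. dt * q i)" using pos nn by (auto intro!: sum_nonneg mult_nonneg_nonneg)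
  then show "a j <= B+(\<Sum>i=2..j. x i * a i)" using rec[OF j] by linarith
  qed (use m2 in auto)
  have "(\<Sum>j=2..m. x j) <= (\<Sum>j=2..m. dt * (4*((\<kappa>+1)/T)+\<Lambda>))" unfolding x_def by (intro sum_mono mult_left_mono add_left_mono) (use lm_le stab(2) m2 pos in \<open>force+\<close>)
  also have "... = real (m-1)*(dt * (4*((\<kappa>+1)/T)+\<Lambda>))" using m2 by simp
  also have "... <= real N * (dt * (4*((\<kappa>+1)/T)+\<Lambda>))" using pos stab(3) m2 by (intro mult_right_mono mult_nonneg_nonneg add_nonneg_nonneg) auto
  also have "... = T * (4*((\<kappa>+1)/T)+\<Lambda>)" using T by (metis mult.assoc mult.commute)
  also have "... = 4*(\<kappa>+1) + T * \<Lambda>" using pos by (simp add: field_simps)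
  finally have "exp (2*(\<Sum>j=2..m. x j)) <= F" unfolding F_def by simp
  then have "exp (2*(\<Sum>j=2..m. x j)) * B <= F * B" using B0 by (rule mult_right_mono)
  then show ?thesis unfolding R_def using rec[of m] gw m2 by linarith
  qed
 qed
 from this[of "n+1"] show ?thesis unfolding R_def F_def a_def g_def q_def by simp
qed

end

section \<open>Time differences in norm\<close>

text \<open>Every pairing estimate carries the norm of the fixed function as a factor; duality
  removes it, so vector-valued time integrals never appear.\<close>

lemma L2_norm_le_of_inner_integral:
 fixes M :: "real => real"
 assumes F: "in_Lp S 2 F" and c: "0 <= c" and M: "!!tt. 0 <= M tt"
  and le: "!!v. in_Lp S 2 v ==> \<bar>ip S F v\<bar> <= c * (LINT tt:{s..t}|lebesgue. M tt * nrm S v)"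
 shows "nrm S F <= c * (LINT tt:{s..t}|lebesgue. M tt)"
proof (rule L2_norm_le_of_inner[OF F])
 show "0 <= c * (LINT tt:{s..t}|lebesgue. M tt)" using c M unfolding set_lebesgue_integral_def by (intro mult_nonneg_nonneg Bochner_Integration.integral_nonneg) (auto simp: indicator_def)
 show "\<bar>ip S F v\<bar> <= c * (LINT tt:{s..t}|lebesgue. M tt) * nrm S v" if "in_Lp S 2 v" for v using le[OF that] by (simp add: mult.assoc)
qed

lemma set_integrable_const_Icc: "set_integrable lebesgue {s..t} (%_. c)" for s t c :: real using set_integral_const_Icc(1)[of s t c] by (cases "s <= t") (simp_all add: set_integrable_def)

lemma time_derivative_majorant:
 assumes w: "has_time_deriv Om T w w'" and M: "AE tt in lon {0<..<T}. nrm Om (w' tt) <= M tt" and v: "in_Lp Om 2 v"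
 shows "AE tt in lon {0<..<T}. \<bar>ip Om (w' tt) v\<bar> <= M tt * nrm Om v"
proof -
 have "AE tt in lon {0<..<T}. in_Lp Om 2 (w' tt)" using w by (simp add: has_time_deriv_def)
 with M show ?thesis
 proof eventually_elim
  case (elim tt)
  show ?case by (rule order_trans[OF L2_Cauchy_Schwarz[OF elim(2) v] mult_right_mono[OF elim(1)]]) simp
 qed
qed

lemma time_deriv_L2: "has_time_deriv Om T w w' ==> t \<in> {0..T} ==> in_Lp Om 2 (w t)" by (simp add: has_time_deriv_def)

context
 fixes Om :: "(real^'d::finite) set" and w w' w'' w''' :: "real => real^'d => 'b::euclidean_space" and T s t :: real and M :: "real => real"
 assumes w: "has_time_deriv Om T w w'" and st: "0 <= s" "s <= t" "t <= T"
  and Mi: "!!s t. set_integrable lebesgue {s..t} M" and Mpos: "!!tt. 0 <= M tt"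
begin

lemma time_increment_norm:
 assumes M: "AE tt in lon {0<..<T}. nrm Om (w' tt) <= M tt"
 shows "nrm Om (%x. w t x-w s x) <= 1*(LINT tt:{s..t}|lebesgue. M tt)"
proof (rule L2_norm_le_of_inner_integral)
 have L: "in_Lp Om 2 (w t)" "in_Lp Om 2 (w s)" using time_deriv_L2[OF w] st by auto
 then show "in_Lp Om 2 (%x. w t x-w s x)" by (rule in_L2_diff)
 fix v :: "real^'d => 'b" assume v: "in_Lp Om 2 v"
 show "\<bar>ip Om (%x. w t x-w s x) v\<bar> <= 1*(LINT tt:{s..t}|lebesgue. M tt * nrm Om v)" unfolding L2_inner_diff_left[OF L v] mult_1 by (rule time_increment[OF w v st time_derivative_majorant[OF w M v]]) (intro set_integrable_mult_left Mi)
qed (use Mpos in simp_all)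

lemma first_order_norm:
 assumes w': "has_time_deriv Om T w' w''" and M: "AE tt in lon {0<..<T}. nrm Om (w'' tt) <= M tt" and r: "r = s \<or> r = t"
 shows "nrm Om (%x. w t x-w s x-(t-s) *. w' r x) <= (t-s)*(LINT tt:{s..t}|lebesgue. M tt)"
proof (rule L2_norm_le_of_inner_integral)
 have L: "in_Lp Om 2 (w t)" "in_Lp Om 2 (w s)" "in_Lp Om 2 (w' r)" using time_deriv_L2[OF w] time_deriv_L2[OF w'] st r by auto
 then show "in_Lp Om 2 (%x. w t x-w s x-(t-s) *. w' r x)" by (intro in_L2_diff in_L2_scaleR)
 fix v :: "real^'d => 'b" assume v: "in_Lp Om 2 v"
 show "\<bar>ip Om (%x. w t x-w s x-(t-s) *. w' r x) v\<bar> <= (t-s)*(LINT tt:{s..t}|lebesgue. M tt * nrm Om v)" unfolding L2_inner_diff_left[OF in_L2_diff[OF L(1,2)] in_L2_scaleR[OF L(3)] v] L2_inner_diff_left[OF L(1,2) v] L2_inner_scaleR_left by (rule first_order_consistency[OF w w' v st time_derivative_majorant[OF w' M v] _ _ r])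
  (use Mi Mpos in \<open>auto intro!: set_integrable_mult_left mult_nonneg_nonneg\<close>)
qed (use Mpos st in simp_all)

end

context
 fixes Om :: "(real^'d::finite) set" and w w' w'' w''' :: "real => real^'d => 'b::euclidean_space" and T dt t :: real and M :: "real => real"
 assumes w: "has_time_deriv Om T w w'" and w': "has_time_deriv Om T w' w''" and st: "0 <= t-dt" "0 <= dt" "t+dt <= T"
  and Mi: "!!s t. set_integrable lebesgue {s..t} M" and Mpos: "!!tt. 0 <= M tt"
begin

lemma second_difference_norm:
 assumes M: "AE tt in lon {0<..<T}. nrm Om (w'' tt) <= M tt"
 shows "nrm Om (%x. w (t+dt) x-2 *. w t x+w (t-dt) x) <= 2 * dt * (LINT tt:{t-dt..t+dt}|lebesgue. M tt)"
proof (rule L2_norm_le_of_inner_integral)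
 have L: "in_Lp Om 2 (w (t+dt))" "in_Lp Om 2 (w t)" "in_Lp Om 2 (w (t-dt))" using time_deriv_L2[OF w] st by auto
 then show "in_Lp Om 2 (%x. w (t+dt) x-2 *. w t x+w (t-dt) x)" by (intro in_L2_add in_L2_diff in_L2_scaleR)
 fix v :: "real^'d => 'b" assume v: "in_Lp Om 2 v"
 show "\<bar>ip Om (%x. w (t+dt) x-2 *. w t x+w (t-dt) x) v\<bar> <= 2 * dt * (LINT tt:{t-dt..t+dt}|lebesgue. M tt * nrm Om v)" unfolding L2_inner_add_left[OF in_L2_diff[OF L(1) in_L2_scaleR[OF L(2)]] L(3) v] L2_inner_diff_left[OF L(1) in_L2_scaleR[OF L(2)] v] L2_inner_scaleR_left by (rule second_difference[OF w w' v st time_derivative_majorant[OF w' M v]])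
  (use Mi Mpos in \<open>auto intro!: set_integrable_mult_left mult_nonneg_nonneg\<close>)
qed (use Mpos st in simp_all)

lemma bdf_norm:
 assumes w'': "has_time_deriv Om T w'' w'''" and M: "AE tt in lon {0<..<T}. nrm Om (w''' tt) <= M tt"
 shows "nrm Om (%x. (3/2) *. w (t+dt) x-2 *. w t x+(1/2) *. w (t-dt) x-dt *. w' (t+dt) x)
  <= 4 * dt\<^sup>2*(LINT tt:{t-dt..t+dt}|lebesgue. M tt)"
proof (rule L2_norm_le_of_inner_integral)
 have L: "in_Lp Om 2 (w (t+dt))" "in_Lp Om 2 (w t)" "in_Lp Om 2 (w (t-dt))" "in_Lp Om 2 (w' (t+dt))" using time_deriv_L2[OF w] time_deriv_L2[OF w'] st by auto
 note L3 = in_L2_scaleR[OF L(1), of "3/2"] in_L2_scaleR[OF L(2), of 2] in_L2_scaleR[OF L(3), of "1/2"] in_L2_scaleR[OF L(4), of dt]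
 then show "in_Lp Om 2 (%x. (3/2) *. w (t+dt) x-2 *. w t x+(1/2) *. w (t-dt) x-dt *. w' (t+dt) x)" by (intro in_L2_add in_L2_diff)
 fix v :: "real^'d => 'b" assume v: "in_Lp Om 2 v"
 show "\<bar>ip Om (%x. (3/2) *. w (t+dt) x-2 *. w t x+(1/2) *. w (t-dt) x-dt *. w' (t+dt) x) v\<bar>
  <= 4 * dt\<^sup>2*(LINT tt:{t-dt..t+dt}|lebesgue. M tt * nrm Om v)" unfolding L2_inner_diff_left[OF in_L2_add[OF in_L2_diff[OF L3(1,2)] L3(3)] L3(4) v] L2_inner_add_left[OF in_L2_diff[OF L3(1,2)] L3(3) v]
  L2_inner_diff_left[OF L3(1,2) v] L2_inner_scaleR_left by (rule bdf_consistency[OF w w' w'' v st time_derivative_majorant[OF w'' M v]])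
  (use Mi Mpos in \<open>auto intro!: set_integrable_mult_left mult_nonneg_nonneg\<close>)
qed (use Mpos st in simp_all)

end

section \<open>Time increments of the gradient\<close>

lemma weak_deriv_pairing:
 fixes h :: "real^'d::finite => 'b::euclidean_space"
 assumes Om: "open Om" and h: "in_H Om 1 h" and fi: "tf Om fi"
 shows "ip Om (%x. wd Om [i] h x \<bullet> b) fi = - ip Om h (%x. pd [i] fi x *. b)"
  "in_Lp Om 2 (%x. pd [i] fi x *. b)"
proof -
 have "hwd Om [i] (%x. h x \<bullet> b) (%x. wd Om [i] h x \<bullet> b)" by (rule has_weak_deriv_bounded_linear[OF Om bounded_linear_inner_left in_W_weak_deriv(1)[OF Om h]]) simp
 then have "(LINT x|lon Om. pd [i] fi x * (h x \<bullet> b)) = - (LINT x|lon Om. fi x * (wd Om [i] h x \<bullet> b))" using fi by (simp add: has_weak_deriv_def del: partials.simps)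
 then show "ip Om (%x. wd Om [i] h x \<bullet> b) fi = - ip Om h (%x. pd [i] fi x *. b)" by (simp add: L2_inner_def mult.commute del: partials.simps)
 show "in_Lp Om 2 (%x. pd [i] fi x *. b)" by (rule test_in_L2[OF test_scaleR[OF test_partials_list[OF fi] smooth_const]]) (use Om in simp)
qed

text \<open>Entrywise duality with the derivative moved to the test function. Time increments of the
  gradient thereby reduce to scalar increments of the function itself, for which the time estimates
  are available. The factor \<open>d\<close> is the square root of the number of entries.\<close>

lemma grad_norm_le_of_pairing:
 fixes F :: "real^'d::finite => real^'d"
 assumes Om: "open Om" and F: "in_H Om 1 F" and B: "0 <= B"
  and le: "!!i b fi. b \<in> Basis ==> tf Om fi ==> \<bar>ip Om F (%x. pd [i] fi x *. b)\<bar> <= B * nrm Om fi"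
 shows "nrm Om (grad Om F) <= real CARD('d) * B"
proof (rule power2_le_imp_le)
 have w2: "in_Lp Om 2 (wd Om [i] F)" for i by (rule in_W_weak_deriv(3)[OF Om F]) simp_all
 have one: "nrm Om (%x. wd Om [i] F x \<bullet> b) <= B" if b: "b \<in> Basis" for i b
 proof -
  have "nrm Om (%x. wd Om [i] F x \<bullet> b) <= B \<or> nrm Om (%x. wd Om [i] F x \<bullet> b) = 0"
  proof (rule L2_norm_dual_test[OF Om in_L2_inner_Basis(1)[OF w2 b]])
  show "\<bar>ip Om (%x. wd Om [i] F x \<bullet> b) fi\<bar> <= B * nrm Om fi" if "tf Om fi" for fi using le[OF b that, of i] unfolding weak_deriv_pairing(1)[OF Om F that] by simp
  qed
  then show ?thesis using B by linarith
 qed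
 have "(nrm Om (grad Om F))\<^sup>2 = (\<Sum>i\<in>UNIV. \<Sum>b\<in>Basis. (nrm Om (%x. wd Om [i] F x \<bullet> b))\<^sup>2)" unfolding grad_in_L2(2)[OF Om F] L2_norm_sq_Basis[OF w2] ..
 also have "... <= (\<Sum>i\<in>(UNIV :: 'd set). \<Sum>b\<in>(Basis :: (real^'d) set). B\<^sup>2)" by (intro sum_mono power_mono one) auto
 also have "... = (real CARD('d) * B)\<^sup>2" by (simp add: power2_eq_square)
 finally show "(nrm Om (grad Om F))\<^sup>2 <= (real CARD('d) * B)\<^sup>2" .
qed (use B in simp)

lemma grad_time_majorant:
 fixes w' :: "real => real^'d::finite => real^'d"
 assumes Om: "open Om" and M: "AE tt in lon {0<..<T}. in_H Om 1 (w' tt) & H_norm Om 1 (w' tt) <= M tt"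
  and b: "b \<in> Basis" and fi: "tf Om fi"
 shows "AE tt in lon {0<..<T}. \<bar>ip Om (w' tt) (%x. pd [i] fi x *. b)\<bar> <= M tt * nrm Om fi" using M
proof eventually_elim
 case (elim tt)
 then have H: "in_H Om 1 (w' tt)" by simp
 have w2: "in_Lp Om 2 (wd Om [i] (w' tt))" by (rule in_W_weak_deriv(3)[OF Om H]) simp_all
 have "\<bar>ip Om (w' tt) (%x. pd [i] fi x *. b)\<bar> = \<bar>ip Om (%x. wd Om [i] (w' tt) x \<bullet> b) fi\<bar>" unfolding weak_deriv_pairing(1)[OF Om H fi] by simp
 also have "... <= nrm Om (%x. wd Om [i] (w' tt) x \<bullet> b) * nrm Om fi" by (rule L2_Cauchy_Schwarz[OF in_L2_inner_Basis(1)[OF w2 b] test_in_L2[OF fi]]) (use Om in simp)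
 also have "... <= M tt * nrm Om fi" using in_L2_inner_Basis(2)[OF w2 b] L2_weak_deriv_le_H_norm[of "[i]" 1 Om "w' tt"] elim by (intro mult_right_mono) auto
 finally show ?case .
qed

lemma set_integral_nonneg_Icc: "(!!tt. 0 <= M tt) ==> 0 <= (LINT tt:{s..t}|lebesgue. (M tt :: real))" unfolding set_lebesgue_integral_def by (intro Bochner_Integration.integral_nonneg) (auto simp: indicator_def)

lemma grad_increment_norm:
 fixes w :: "real => real^'d::finite => real^'d"
 assumes Om: "open Om" and w: "has_time_deriv Om T w w'" and H: "in_H Om 1 (w t)" "in_H Om 1 (w s)" and st: "0 <= s" "s <= t" "t <= T"
  and M: "AE tt in lon {0<..<T}. in_H Om 1 (w' tt) & H_norm Om 1 (w' tt) <= M tt"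
  and Mi: "!!s t. set_integrable lebesgue {s..t} M" and Mpos: "!!tt. 0 <= M tt"
 shows "nrm Om (grad Om (%x. w t x-w s x)) <= real CARD('d)*(LINT tt:{s..t}|lebesgue. M tt)"
proof (rule grad_norm_le_of_pairing[OF Om in_H_diff[OF Om H] set_integral_nonneg_Icc[OF Mpos]])
 fix i :: 'd and b :: "real^'d" and fi :: "real^'d => real" assume b: "b \<in> Basis" and fi: "tf Om fi"
 note v = weak_deriv_pairing(2)[OF Om H(1) fi, of i b]
 have L: "in_Lp Om 2 (w t)" "in_Lp Om 2 (w s)" using in_W_self(1)[OF Om] H by auto
 have "\<bar>ip Om (w t) (%x. pd [i] fi x *. b)-ip Om (w s) (%x. pd [i] fi x *. b)\<bar> <= (LINT tt:{s..t}|lebesgue. M tt * nrm Om fi)" by (rule time_increment[OF w v st grad_time_majorant[OF Om M b fi]]) (intro set_integrable_mult_left Mi)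
 then show "\<bar>ip Om (%x. w t x-w s x) (%x. pd [i] fi x *. b)\<bar> <= (LINT tt:{s..t}|lebesgue. M tt) * nrm Om fi" by (simp add: L2_inner_diff_left[OF L v] del: partials.simps)
qed

lemma grad_second_difference_norm:
 fixes w :: "real => real^'d::finite => real^'d"
 assumes Om: "open Om" and w: "has_time_deriv Om T w w'" "has_time_deriv Om T w' w''" and H: "!!t. t \<in> {0..T} ==> in_H Om 1 (w t)"
  and st: "0 <= t-dt" "0 <= dt" "t+dt <= T"
  and M: "AE tt in lon {0<..<T}. in_H Om 1 (w'' tt) & H_norm Om 1 (w'' tt) <= M tt"
  and Mi: "!!s t. set_integrable lebesgue {s..t} M" and Mpos: "!!tt. 0 <= M tt"
 shows "nrm Om (grad Om (%x. w (t+dt) x-2 *. w t x+w (t-dt) x)) <= real CARD('d)*(2 * dt * (LINT tt:{t-dt..t+dt}|lebesgue. M tt))"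
proof (rule grad_norm_le_of_pairing[OF Om])
 have H3: "in_H Om 1 (w (t+dt))" "in_H Om 1 (w t)" "in_H Om 1 (w (t-dt))" using H st by auto
 then show "in_H Om 1 (%x. w (t+dt) x-2 *. w t x+w (t-dt) x)" by (intro in_H_add in_H_diff in_H_scaleR Om)
 show "0 <= 2 * dt * (LINT tt:{t-dt..t+dt}|lebesgue. M tt)" using set_integral_nonneg_Icc[of M, OF Mpos] st by (intro mult_nonneg_nonneg) auto
 fix i :: 'd and b :: "real^'d" and fi :: "real^'d => real" assume b: "b \<in> Basis" and fi: "tf Om fi"
 note v = weak_deriv_pairing(2)[OF Om H3(1) fi, of i b]
 have L: "in_Lp Om 2 (w (t+dt))" "in_Lp Om 2 (w t)" "in_Lp Om 2 (w (t-dt))" using in_W_self(1)[OF Om] H3 by auto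
 let ?\<psi> = "%x. pd [i] fi x *. b"
 have "\<bar>ip Om (w (t+dt)) ?\<psi>-2 * ip Om (w t) ?\<psi>+ip Om (w (t-dt)) ?\<psi>\<bar>
  <= 2 * dt * (LINT tt:{t-dt..t+dt}|lebesgue. M tt * nrm Om fi)" by (rule second_difference[OF w v st grad_time_majorant[OF Om M b fi]])
  (use Mi Mpos in \<open>auto intro!: set_integrable_mult_left mult_nonneg_nonneg\<close>)
 then show "\<bar>ip Om (%x. w (t+dt) x-2 *. w t x+w (t-dt) x) ?\<psi>\<bar> <= 2 * dt * (LINT tt:{t-dt..t+dt}|lebesgue. M tt) * nrm Om fi" by (simp add: L2_inner_add_left[OF in_L2_diff[OF L(1) in_L2_scaleR[OF L(2)]] L(3) v] L2_inner_diff_left[OF L(1) in_L2_scaleR[OF L(2)] v] L2_inner_scaleR_left mult.assoc del: partials.simps)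
qed

section \<open>The exact solution\<close>

lemma in_bochner_AE:
 assumes "in_bochner T \<infinity> inX X w"
 shows "AE t in lon {0<..<T}. inX (w t) & X (w t) <= bochner_norm T \<infinity> X w"
proof -
 have "in_Lp {0<..<T} \<infinity> (%t. X (w t))" "AE t in lon {0<..<T}. inX (w t)" using assms by (simp_all add: in_bochner_def)
 from Linf_norm_AE[OF this(1)] this(2) show ?thesis unfolding bochner_norm_def by eventually_elim auto
qed

text \<open>An essentially bounded time derivative makes \<open>w\<close> Lipschitz in time with
  values in \<open>L2\<close>.\<close>

lemma time_continuous:
 assumes w: "has_time_deriv Om T w w'" and M: "AE tt in lon {0<..<T}. nrm Om (w' tt) <= M" "0 <= M" and t: "t \<in> {0..T}"
 shows "((%tt. nrm Om (%x. w tt x-w t x)) \<longlongrightarrow> 0) (at t within {0..T})"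
proof (rule tendsto_sandwich[OF _ _ tendsto_const])
 have le: "nrm Om (%x. w b x-w a x) <= \<bar>b-a\<bar> * M" if "0 <= a" "a <= b" "b <= T" for a b using time_increment_norm[OF w that set_integrable_const_Icc M(2) M(1)] that by (cases "a <= b") (simp_all add: set_integral_const_Icc)
 show "\<forall>\<^sub>F tt in at t within {0..T}. nrm Om (%x. w tt x-w t x) <= \<bar>tt-t\<bar> * M" unfolding eventually_at_filter
 proof (intro always_eventually allI impI)
  fix tt assume "tt \<in> {0..T}"
  then show "nrm Om (%x. w tt x-w t x) <= \<bar>tt-t\<bar> * M" using le[of t tt] le[of tt t] t by (cases "t <= tt") (auto simp: L2_norm_minus_commute[of Om "w tt"] abs_minus_commute)
 qed
 show "((%tt. \<bar>tt-t\<bar> * M) \<longlongrightarrow> 0) (at t within {0..T})" by (rule tendsto_eq_intros refl | simp)+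
qed simp

locale exact_solution =
 fixes Om :: "(real^'d::finite) set" and T \<nu> :: real and k l :: nat and f :: "real => real^'d => real^'d" and u0
  and u ut utt uttt :: "real => real^'d => real^'d" and p :: "real => real^'d => real"
 assumes Om: "open Om" "Om \<in> lmeasurable" and T: "T > 0"
  and ns: "navier_stokes_solution Om T \<nu> k l f u0 u ut utt uttt p"
begin

definition "U = bochner_norm T \<infinity> (sn Om) u"
definition "W = bochner_norm T \<infinity> (W_norm Om 1 \<infinity>) u"
text \<open>\<open>HU\<close> and \<open>HP\<close> carry the constants of
  \<open>H_norm_limit\<close>: they bound the norms at every time, whereas the Bochner norms do so
  at almost every time.\<close>

definition "HU = sqrt (real (card {is :: 'd list. length is <= k+1}) * real CARD('d)) * bochner_norm T \<infinity> (H_norm Om (k+1)) u"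
definition "HP = sqrt (real (card {is :: 'd list. length is <= l+1})) * bochner_norm T \<infinity> (H_norm Om (l+1)) p"

lemma nonneg: "0 <= U" "0 <= W" "0 <= HU" "0 <= HP" by (simp_all add: U_def W_def HU_def HP_def bochner_norm_def)

lemmas ns' = ns[unfolded navier_stokes_solution_def]

lemma derivs: "has_time_deriv Om T u ut" "has_time_deriv Om T ut utt" "has_time_deriv Om T utt uttt" using ns' by blast+

lemma at_t:
 assumes "t \<in> {0..T}"
 shows "in_H10 Om (u t)" "in_H Om (k+1) (u t)" "in_W Om 1 \<infinity> (u t)" "in_L20 Om (p t)" "in_H Om (l+1) (p t)" "in_Lp Om 2 (f t)"
  "AE x in lon Om. dv Om (u t) x = 0"
  "AE x in lon Om. ut t x-\<nu> *. laplacian Om (u t) x + convection Om (u t) (u t) x+grad_scalar Om (p t) x = f t x" using ns' assms by blast+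

lemma bochner_bounds:
 "AE t in lon {0<..<T}. in_H Om (k+1) (u t) & H_norm Om (k+1) (u t) <= bochner_norm T \<infinity> (H_norm Om (k+1)) u"
 "AE t in lon {0<..<T}. in_Lp Om \<infinity> (u t) & sn Om (u t) <= U"
 "AE t in lon {0<..<T}. in_W Om 1 \<infinity> (u t) & W_norm Om 1 \<infinity> (u t) <= W"
 "AE t in lon {0<..<T}. in_Lp Om 2 (ut t) & nrm Om (ut t) <= bochner_norm T \<infinity> (nrm Om) ut"
 "AE t in lon {0<..<T}. in_H Om 1 (ut t) & H_norm Om 1 (ut t) <= bochner_norm T \<infinity> (H_norm Om 1) ut"
 "AE t in lon {0<..<T}. in_Lp Om 2 (utt t) & nrm Om (utt t) <= bochner_norm T \<infinity> (nrm Om) utt"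
 "AE t in lon {0<..<T}. in_H Om (l+1) (p t) & H_norm Om (l+1) (p t) <= bochner_norm T \<infinity> (H_norm Om (l+1)) p" unfolding U_def W_def by (rule in_bochner_AE; use ns' in blast)+

lemma bochner_nonneg: "0 <= bochner_norm T \<infinity> X w" by (simp add: bochner_norm_def)

lemma u_continuous:
 assumes "t \<in> {0..T}"
 shows "((%tt. nrm Om (%x. u tt x-u t x)) \<longlongrightarrow> 0) (at t within {0..T})"
proof (rule time_continuous[OF derivs(1) _ bochner_nonneg assms])
 show "AE tt in lon {0<..<T}. nrm Om (ut tt) <= bochner_norm T \<infinity> (nrm Om) ut" using bochner_bounds(4) by eventually_elim simp
qed

lemma u_bounds:
 assumes t: "t \<in> {0..T}"
 shows "in_Lp Om \<infinity> (u t)" "sn Om (u t) <= U" "in_Lp Om \<infinity> (grad Om (u t))"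
  "sn Om (grad Om (u t)) <= (real CARD('d))\<^sup>2 * W" "H_norm Om (k+1) (u t) <= HU"
proof -
 have P: "AE tt in lon {0<..<T}. (in_H Om (k+1) (u tt) & H_norm Om (k+1) (u tt) <= bochner_norm T \<infinity> (H_norm Om (k+1)) u)
  & (in_Lp Om \<infinity> (u tt) & sn Om (u tt) <= U) & (in_W Om 1 \<infinity> (u tt) & W_norm Om 1 \<infinity> (u tt) <= W)" using bochner_bounds(1-3) by eventually_elim simp
 obtain \<sigma> :: "nat => real" where \<sigma>: "!!n. \<sigma> n \<in> {0<..<T}"
  "!!n. (in_H Om (k+1) (u (\<sigma> n)) & H_norm Om (k+1) (u (\<sigma> n)) <= bochner_norm T \<infinity> (H_norm Om (k+1)) u)
  & (in_Lp Om \<infinity> (u (\<sigma> n)) & sn Om (u (\<sigma> n)) <= U) & (in_W Om 1 \<infinity> (u (\<sigma> n)) & W_norm Om 1 \<infinity> (u (\<sigma> n)) <= W)"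
  "(%n. nrm Om (%x. u t x-u (\<sigma> n) x)) \<longlonglongrightarrow> 0" by (rule AE_time_sequence[OF T P t u_continuous[OF t]]) blast
 have L2: "in_Lp Om 2 (u tt)" if "tt \<in> {0..T}" for tt using derivs(1) that by (rule time_deriv_L2)
 have L2s: "in_Lp Om 2 (u (\<sigma> n))" for n using L2[of "\<sigma> n"] \<sigma>(1)[of n] by simp
 have H1: "in_H Om 1 (u t)" "!!n. in_H Om 1 (u (\<sigma> n))" using at_t(2)[OF t] \<sigma>(2) in_W_mono[of Om "k+1" 2 _ 1] by auto
 have le: "AE x in lon Om. norm (u t x) <= U"
 proof (rule Linf_limit[OF Om(2) L2[OF t] L2s \<sigma>(3)])
  fix n
  have a: "in_Lp Om \<infinity> (u (\<sigma> n))" "sn Om (u (\<sigma> n)) <= U" using \<sigma>(2)[of n] by auto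
  show "AE x in lon Om. norm (u (\<sigma> n) x) <= U" using Linf_norm_AE[OF a(1)] by eventually_elim (use a(2) in linarith)
 qed
 have m: "u t \<in> bm (lon Om)" by (rule in_L2_measurable[OF L2[OF t]])
 show "in_Lp Om \<infinity> (u t)" using m le by (auto simp: in_Linf_iff)
 show "sn Om (u t) <= U" by (rule Linf_norm_le[OF m nonneg(1) le])
 have w: "!!n. in_W Om 1 \<infinity> (u (\<sigma> n))" "!!n. W_norm Om 1 \<infinity> (u (\<sigma> n)) <= W" using \<sigma>(2) by auto
 show "in_Lp Om \<infinity> (grad Om (u t))" "sn Om (grad Om (u t)) <= (real CARD('d))\<^sup>2 * W" by (rule grad_Linf_limit[OF Om H1 \<sigma>(3) w])+
 have hk: "!!n. in_H Om (k+1) (u (\<sigma> n))" "!!n. H_norm Om (k+1) (u (\<sigma> n)) <= bochner_norm T \<infinity> (H_norm Om (k+1)) u" using \<sigma>(2) by auto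
 show "H_norm Om (k+1) (u t) <= HU" unfolding HU_def using H_norm_limit[OF Om(1) at_t(2)[OF t] hk(1) \<sigma>(3) hk(2)] by simp
qed

lemma p_bound:
 assumes t: "t \<in> {0..T}"
 shows "H_norm Om (l+1) (p t) <= HP"
proof -
 have c: "((%tt. nrm Om (%x. p tt x-p t x)) \<longlongrightarrow> 0) (at t within {0..T})" using ns' t by blast
 obtain \<sigma> :: "nat => real" where \<sigma>: "!!n. in_H Om (l+1) (p (\<sigma> n)) & H_norm Om (l+1) (p (\<sigma> n)) <= bochner_norm T \<infinity> (H_norm Om (l+1)) p"
  "(%n. nrm Om (%x. p t x-p (\<sigma> n) x)) \<longlonglongrightarrow> 0" by (rule AE_time_sequence[OF T bochner_bounds(7) t c]) blast
 show ?thesis unfolding HP_def using H_norm_limit[OF Om(1) at_t(5)[OF t] _ \<sigma>(2)] \<sigma>(1) by simp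
qed

text \<open>Allows the sup norm to be replaced by \<open>W\<close> in the spatial convection error,
  as \<open>C1_sq\<close> contains only the latter.\<close>

lemma U_le_W: "U <= W"
proof -
 have "in_Lp {0<..<T} \<infinity> (%t. sn Om (u t))" using ns' unfolding in_bochner_def by blast
 then have m: "(%t. sn Om (u t)) \<in> bm (lon {0<..<T})" by (rule in_L2_measurable)
 have "AE t in lon {0<..<T}. norm (sn Om (u t)) <= W" using bochner_bounds(3)
 proof eventually_elim
  case (elim t)
  then have w: "in_W Om 1 \<infinity> (u t)" by simp
  have "sn Om (wd Om [] (u t)) = sn Om (u t)" by (rule Linf_norm_cong_AE[OF in_W_self(2)[OF Om(1) w] in_W_weak_deriv(2)[OF Om(1) w] in_L2_measurable[OF in_W_self(1)[OF Om(1) w]]]) simp_all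
  then show ?case using W_norm_inf_ge[of "[]" 1 Om "u t"] elim by simp
 qed
 then show ?thesis unfolding U_def bochner_norm_def by (rule Linf_norm_le[OF m nonneg(2)])
qed

text \<open>If \<open>u\<close> vanishes at all times, the first order estimate reads
  \<open>\<eta> * nrm Om (ut t) \<le> \<eta>^2 M\<close> for all small steps \<open>\<eta>\<close>
  to one side of \<open>t\<close>, which forces the norm to be 0.\<close>

lemma zero_solution:
 assumes U: "U = 0" and t: "t \<in> {0..T}"
 shows "AE x in lon Om. u t x = 0" "nrm Om (ut t) = 0"
proof -
 have z: "AE x in lon Om. u t x = 0" if "t \<in> {0..T}" for t using Linf_norm_AE[OF u_bounds(1)[OF that]]
 proof eventually_elim
  case (elim x)
  then have "norm (u t x) <= 0" using u_bounds(2)[OF that] U by linarith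
  then show ?case by simp
 qed
 then show "AE x in lon Om. u t x = 0" using t .
 have L: "in_Lp Om 2 (u tt)" "in_Lp Om 2 (ut tt)" if "tt \<in> {0..T}" for tt using time_deriv_L2[OF derivs(1) that] time_deriv_L2[OF derivs(2) that] .
 define M where "M = bochner_norm T \<infinity> (nrm Om) utt"
 have M: "AE tt in lon {0<..<T}. nrm Om (utt tt) <= M" "0 <= M" using bochner_bounds(6) bochner_nonneg unfolding M_def by auto
 have fo: "(b-a) * nrm Om (ut t) <= (b-a)*((b-a) * M)" if ab: "0 <= a" "a <= b" "b <= T" "t = a \<or> t = b" for a b
 proof -
  have ab': "a \<in> {0..T}" "b \<in> {0..T}" using ab by auto
  have "nrm Om (%x. u b x-u a x-(b-a) *. ut t x) = nrm Om (%x. (- (b-a)) *. ut t x)"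
  proof (rule L2_norm_cong_AE)
  show "AE x in lon Om. u b x-u a x-(b-a) *. ut t x = (- (b-a)) *. ut t x" using z[OF ab'(1)] z[OF ab'(2)] by eventually_elim (simp add: scaleR_diff_left)
  qed (use L[OF ab'(1)] L[OF ab'(2)] L[OF t] in \<open>auto simp: in_L2_iff\<close>)
  then have "nrm Om (%x. u b x-u a x-(b-a) *. ut t x) = (b-a) * nrm Om (ut t)" using ab by (simp add: L2_norm_scaleR)
  moreover have "nrm Om (%x. u b x-u a x-(b-a) *. ut t x) <= (b-a)*((b-a) * M)" using first_order_norm[OF derivs(1) ab(1-3) set_integrable_const_Icc M(2) derivs(2) M(1) ab(4)] ab by (cases "a <= b") (simp_all add: set_integral_const_Icc)
  ultimately show ?thesis by simp
 qed
 show "nrm Om (ut t) = 0"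
 proof (rule ccontr)
  assume "nrm Om (ut t) ~= 0"
  then have p: "nrm Om (ut t) > 0" using L2_norm_nonneg[of Om "ut t"] by linarith
  \<comment> \<open>\<open>T/2\<close> keeps \<open>t + \<eta>\<close> or \<open>t - \<eta>\<close>
    in the time interval; the other term makes \<open>\<eta> * M\<close> smaller than the
    norm.\<close>
  define \<eta> where "\<eta> = min (T/2) (nrm Om (ut t)/(2*(M+1)))"
  have \<eta>: "\<eta> > 0" "\<eta> <= T/2" "\<eta> * M < nrm Om (ut t)"
  proof -
  show "\<eta> > 0" using T p M unfolding \<eta>_def by simp
  show "\<eta> <= T/2" unfolding \<eta>_def by (rule min.cobounded1)
  have "\<eta> * M <= nrm Om (ut t)/(2*(M+1)) * M" using M unfolding \<eta>_def by (intro mult_right_mono) auto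
  also have "... < nrm Om (ut t)" using p M(2) mult_nonneg_nonneg[OF M(2) less_imp_le[OF p]] by (simp add: field_simps add_nonneg_pos)
  finally show "\<eta> * M < nrm Om (ut t)" .
  qed
  have "\<eta> * nrm Om (ut t) <= \<eta>*(\<eta> * M)"
  proof (cases "t <= T/2")
  case True
  then show ?thesis using fo[of t "t+\<eta>"] \<eta> t by simp
  next
  case False
  then show ?thesis using fo[of "t-\<eta>" t] \<eta> t by simp
  qed
  then show False using \<eta> by simp
 qed
qed

end

section \<open>Linear combinations in sup norms\<close>

lemma in_Linf_cong_AE:
 assumes "f \<in> bm (lon S)" "in_Lp S \<infinity> g" "AE x in lon S. f x = g x"
 shows "in_Lp S \<infinity> f"
proof -
 have "AE x in lon S. norm (f x) <= sn S g" using Linf_norm_AE[OF assms(2)] assms(3) by eventually_elim simp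
 then show ?thesis using assms(1) by (auto simp: in_Linf_iff)
qed

lemma Linf_lincomb:
 assumes v: "in_Lp Om \<infinity> v" "in_Lp Om \<infinity> w"
 shows "in_Lp Om \<infinity> (%x. a *. v x+b *. w x)"
  and "sn Om (%x. a *. v x+b *. w x) <= \<bar>a\<bar> * sn Om v+\<bar>b\<bar> * sn Om w"
proof -
 note av = in_Linf_scaleR[OF v(1), of a] and bw = in_Linf_scaleR[OF v(2), of b]
 show "in_Lp Om \<infinity> (%x. a *. v x+b *. w x)" by (rule in_Linf_add(1)[OF av(1) bw(1)])
 show "sn Om (%x. a *. v x+b *. w x) <= \<bar>a\<bar> * sn Om v+\<bar>b\<bar> * sn Om w" using in_Linf_add(2)[OF av(1) bw(1)] av(2) bw(2) by linarith
qed

lemma Linf_grad_lincomb: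
 fixes v w :: "real^'d::finite => real^'d"
 assumes Om: "open Om" and H: "in_H Om 1 v" "in_H Om 1 w" and v: "in_Lp Om \<infinity> (grad Om v)" "in_Lp Om \<infinity> (grad Om w)"
 shows "in_Lp Om \<infinity> (grad Om (%x. a *. v x+b *. w x))"
  and "sn Om (grad Om (%x. a *. v x+b *. w x)) <= \<bar>a\<bar> * sn Om (grad Om v)+\<bar>b\<bar> * sn Om (grad Om w)"
proof -
 note l = Linf_lincomb[OF v, of a b] and g = grad_lincomb[OF Om H, of a b]
 have m: "grad Om (%x. a *. v x+b *. w x) \<in> bm (lon Om)" by (rule in_L2_measurable[OF grad_in_L2(1)[OF Om in_H_add[OF Om in_H_scaleR[OF Om H(1)] in_H_scaleR[OF Om H(2)]]]])
 show "in_Lp Om \<infinity> (grad Om (%x. a *. v x+b *. w x))" by (rule in_Linf_cong_AE[OF m l(1) g])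
 show "sn Om (grad Om (%x. a *. v x+b *. w x)) <= \<bar>a\<bar> * sn Om (grad Om v)+\<bar>b\<bar> * sn Om (grad Om w)" unfolding Linf_norm_cong_AE[OF g m in_L2_measurable[OF l(1)], of "\<infinity>"] by (rule l(2))
qed

lemma L2_grad_lincomb:
 fixes v w :: "real^'d::finite => real^'d"
 assumes Om: "open Om" and H: "in_H Om 1 v" "in_H Om 1 w"
 shows "nrm Om (grad Om (%x. a *. v x+b *. w x)) <= \<bar>a\<bar> * nrm Om (grad Om v)+\<bar>b\<bar> * nrm Om (grad Om w)"
proof -
 note g = grad_in_L2(1)[OF Om H(1)] grad_in_L2(1)[OF Om H(2)]
 have m: "grad Om (%x. a *. v x+b *. w x) \<in> bm (lon Om)" by (rule in_L2_measurable[OF grad_in_L2(1)[OF Om in_H_add[OF Om in_H_scaleR[OF Om H(1)] in_H_scaleR[OF Om H(2)]]]])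
 have "nrm Om (grad Om (%x. a *. v x+b *. w x)) = nrm Om (%x. a *. grad Om v x+b *. grad Om w x)" by (rule L2_norm_cong_AE[OF grad_lincomb[OF Om H] m in_L2_measurable[OF in_L2_add[OF in_L2_scaleR[OF g(1)] in_L2_scaleR[OF g(2)]]]])
 also have "... <= \<bar>a\<bar> * nrm Om (grad Om v)+\<bar>b\<bar> * nrm Om (grad Om w)" using L2_norm_triangle[OF in_L2_scaleR[OF g(1), of a] in_L2_scaleR[OF g(2), of b]] by (simp add: L2_norm_scaleR)
 finally show ?thesis .
qed

lemma abs_combination:
 fixes a b c d e f g :: real
 assumes "\<bar>a\<bar> <= A" "\<bar>b\<bar> <= B" "\<bar>c\<bar> <= C" "\<bar>d\<bar>+\<bar>e\<bar> <= D" "\<bar>f\<bar> <= F" "\<bar>g\<bar> <= G"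
 shows "\<bar>a-b + c-d-e+f+g\<bar> <= A + B + D + F + G + C"
proof -
 have "\<bar>d+e\<bar> <= D" using assms(4) abs_triangle_ineq[of d e] by (rule order_trans[rotated])
 then show ?thesis using abs_le_D1[OF assms(1)] abs_le_D2[OF assms(1)] abs_le_D1[OF assms(2)] abs_le_D2[OF assms(2)] abs_le_D1[OF assms(3)] abs_le_D2[OF assms(3)]
  abs_le_D1[OF \<open>\<bar>d + e\<bar> <= D\<close>] abs_le_D2[OF \<open>\<bar>d + e\<bar> <= D\<close>] abs_le_D1[OF assms(5)] abs_le_D2[OF assms(5)] abs_le_D1[OF assms(6)] abs_le_D2[OF assms(6)] by (intro abs_leI) simp_all
qed

section \<open>The projected solution and consistency\<close>

text \<open>The setting on a single mesh. The bound \<open>4/3 U\<close> leaves \<open>U/3\<close>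
  for the projection error and makes an extrapolation, with weights 2 and 1, at most
  \<open>4 U\<close>, the value that the CFL constant is built on.\<close>

locale projected_solution = exact_solution +
 fixes V :: "(real^'a => real^'a) set" and Q :: "(real^'a => real) set" and h C_pi Cs C_inf :: real
  and s :: "real => real^'a => real^'a" and lam :: "real => real^'a => real"
 assumes V_sub: "function_subspace V" and V_H10: "!!v. v \<in> V ==> in_H10 Om v" and V_Linf: "!!v. v \<in> V ==> in_Lp Om \<infinity> v"
  and V_grad: "!!v. v \<in> V ==> in_Lp Om \<infinity> (grad Om v)"
  and Q_L2: "!!q. q \<in> Q ==> in_Lp Om 2 q"
  and par: "0 <= C_pi" "0 <= Cs" "0 <= C_inf" "0 < h" "h <= 1"
  and proj: "!!t. t \<in> {0..T} ==> is_stokes_projection Om \<nu> V Q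
  (%x. f t x-ut t x-convection Om (u t) (u t) x-grad_scalar Om (p t) x) (s t) (lam t)"
  and e_bound: "!!t. t \<in> {0..T} ==> nrm Om (%x. u t x-s t x)+h * H_norm Om 1 (%x. u t x-s t x) <= Cs * h^(k+1) * H_norm Om (k+1) (u t)"
  and grad_bound: "!!t. t \<in> {0..T} ==> sn Om (grad Om (%x. u t x-s t x)) <= C_inf * sn Om (grad Om (u t))"
  and s_sup: "!!t. t \<in> {0..T} ==> sn Om (s t) <= 4/3 * U"
  and pi: "!!t. t \<in> {0..T} ==> \<exists>\<pi>\<in>Q. nrm Om (%x. p t x-\<pi> x) <= C_pi * h^(l+1) * H_norm Om (l+1) (p t)"
begin

definition es :: "real => real^'a => real^'a" where "es t = (%x. u t x-s t x)"

text \<open>With equal times it gives back \<open>w a\<close>. As \<open>0 - 1 = 0\<close> for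
  natural numbers, the one formula at the times of \<open>n\<close> and \<open>n - 1\<close> covers
  the first step as well.\<close>

definition hat :: "(real => real^'a => real^'a) => real => real => real^'a => real^'a" where
 "hat w a b = (%x. 2 *. w a x+(- 1) *. w b x)"

definition "Es = Cs * h^k * HU"
definition "Gs = (1 + C_inf)*((real CARD('a))\<^sup>2 * W)"
text \<open>Collects the convection terms that contain the projection error:
  \<open>9 Gs Es + 6 d U Es\<close> when it is the transporting field and \<open>9 U Es\<close> when
  it is transported, with \<open>U \<le> W\<close>.\<close>

definition "c1 = (9*(1 + C_inf)*(real CARD('a))\<^sup>2+6 * real CARD('a)+9) * Cs"

lemma nonneg': "0 <= Es" "0 <= Gs" "0 <= c1" using par nonneg by (simp_all add: Es_def Gs_def c1_def)

context
 fixes t :: real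
 assumes t: "t \<in> {0..T}"
begin

lemma s_V: "s t \<in> V" and s_div: "q \<in> Q ==> ip Om (dv Om (s t)) q = 0" using proj[OF t] by (simp_all add: is_stokes_projection_def)

lemma u_H1: "in_H Om 1 (u t)" by (rule in_H10_in_H1[OF at_t(1)[OF t]])

lemma s_H1: "in_H Om 1 (s t)" by (rule in_H10_in_H1[OF V_H10[OF s_V]])

lemma es_H1: "in_H Om 1 (es t)" unfolding es_def by (rule in_H_diff[OF Om(1) u_H1 s_H1])

lemma bdd: "bdd_H1 Om (u t)" "bdd_H1 Om (s t)" "bdd_H1 Om (es t)"
proof -
 show u: "bdd_H1 Om (u t)" using u_H1 u_bounds(1)[OF t] by (simp add: bdd_H1_def)
 show s: "bdd_H1 Om (s t)" using s_H1 V_Linf[OF s_V] by (simp add: bdd_H1_def)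
 show "bdd_H1 Om (es t)" using es_H1 u s in_Linf_diff(1) unfolding bdd_H1_def es_def by blast
qed

lemma es_norms: "nrm Om (es t) <= Es" "nrm Om (grad Om (es t)) <= Es" "nrm Om (dv Om (es t)) <= real CARD('a) * Es"
proof -
 have "Cs * h^(k+1) * H_norm Om (k+1) (u t) <= Cs * h^(k+1) * HU" using u_bounds(5)[OF t] par by (intro mult_left_mono) auto
 then have le: "nrm Om (es t)+h * H_norm Om 1 (es t) <= h * Es" using e_bound[OF t] unfolding es_def Es_def by (simp add: mult_ac)
 have 1: "h * H_norm Om 1 (es t) <= h * Es" using le L2_norm_nonneg[of Om "es t"] by linarith
 have 2: "nrm Om (es t) <= h * Es" using le mult_nonneg_nonneg[OF less_imp_le[OF par(4)] H_norm_nonneg[of Om 1 "es t"]] by linarith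
 also have "... <= 1 * Es" using par nonneg' by (intro mult_right_mono) auto
 finally show "nrm Om (es t) <= Es" by simp
 show g: "nrm Om (grad Om (es t)) <= Es" using 1 par L2_grad_le_H_norm[OF Om(1) es_H1] by simp
 show "nrm Om (dv Om (es t)) <= real CARD('a) * Es" by (rule order_trans[OF divergence_in_L2(2)[OF Om(1) es_H1]]) (use g in \<open>intro mult_left_mono; simp\<close>)
qed

lemma s_div_norm: "nrm Om (dv Om (s t)) <= real CARD('a) * Es"
proof -
 have e: "AE x in lon Om. dv Om (es t) x = 1 * dv Om (u t) x+(- 1) * dv Om (s t) x" using divergence_lincomb[OF Om(1) u_H1 s_H1, of 1 "- 1"] by (simp add: es_def)
 have "AE x in lon Om. dv Om (s t) x = - dv Om (es t) x" using e at_t(7)[OF t] by eventually_elim simp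
 then have "nrm Om (dv Om (s t)) = nrm Om (%x. - dv Om (es t) x)" by (rule L2_norm_cong_AE) (intro in_L2_measurable[of _ 2] in_L2_uminus divergence_in_L2 Om s_H1 es_H1)+
 then show ?thesis using es_norms(3) by (simp add: L2_norm_uminus)
qed

lemma s_grad: "sn Om (grad Om (s t)) <= Gs"
proof -
 have es_eq: "es t = (%x. 1 *. u t x+(- 1) *. s t x)" and s_eq: "s t = (%x. 1 *. u t x+(- 1) *. es t x)" by (auto simp: es_def)
 have gi: "in_Lp Om \<infinity> (grad Om (es t))" unfolding es_eq by (rule Linf_grad_lincomb(1)[OF Om(1) u_H1 s_H1 u_bounds(3)[OF t] V_grad[OF s_V]])
 have "sn Om (grad Om (s t)) <= \<bar>1\<bar> * sn Om (grad Om (u t))+\<bar>- 1\<bar> * sn Om (grad Om (es t))" using Linf_grad_lincomb(2)[OF Om(1) u_H1 es_H1 u_bounds(3)[OF t] gi, of 1 "- 1"] unfolding s_eq[symmetric] .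
 also have "... <= (1 + C_inf) * sn Om (grad Om (u t))" using grad_bound[OF t] by (simp add: es_def algebra_simps)
 also have "... <= Gs" unfolding Gs_def using par by (intro mult_left_mono u_bounds t) auto
 finally show ?thesis .
qed

end

lemma hat_bounds:
 assumes ab: "a \<in> {0..T}" "b \<in> {0..T}"
 shows "bdd_H1 Om (hat u a b)" "bdd_H1 Om (hat s a b)" "bdd_H1 Om (hat es a b)"
  "sn Om (hat u a b) <= 3 * U" "sn Om (grad Om (hat u a b)) <= 3*((real CARD('a))\<^sup>2 * W)" "in_Lp Om \<infinity> (grad Om (hat u a b))"
  "sn Om (hat s a b) <= 4 * U" "sn Om (grad Om (hat s a b)) <= 3 * Gs" "in_Lp Om \<infinity> (grad Om (hat s a b))"
  "nrm Om (hat es a b) <= 3 * Es" "nrm Om (grad Om (hat es a b)) <= 3 * Es" "nrm Om (dv Om (hat es a b)) <= 3*(real CARD('a) * Es)"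
  "AE x in lon Om. dv Om (hat u a b) x = 0"
proof -
 note A = ab(1) and B = ab(2)
 show "bdd_H1 Om (hat u a b)" "bdd_H1 Om (hat s a b)" and eb: "bdd_H1 Om (hat es a b)" unfolding hat_def by (intro bdd_H1_lincomb Om bdd ab)+
 show "sn Om (hat u a b) <= 3 * U" using Linf_lincomb(2)[OF u_bounds(1)[OF A] u_bounds(1)[OF B], of 2 "- 1"] u_bounds(2)[OF A] u_bounds(2)[OF B] by (simp add: hat_def)
 show "in_Lp Om \<infinity> (grad Om (hat u a b))" unfolding hat_def by (rule Linf_grad_lincomb(1)[OF Om(1) u_H1[OF A] u_H1[OF B] u_bounds(3)[OF A] u_bounds(3)[OF B]])
 show "sn Om (grad Om (hat u a b)) <= 3*((real CARD('a))\<^sup>2 * W)" using Linf_grad_lincomb(2)[OF Om(1) u_H1[OF A] u_H1[OF B] u_bounds(3)[OF A] u_bounds(3)[OF B], of 2 "- 1"] u_bounds(4)[OF A] u_bounds(4)[OF B] by (simp add: hat_def)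
 show "sn Om (hat s a b) <= 4 * U" using Linf_lincomb(2)[OF V_Linf[OF s_V[OF A]] V_Linf[OF s_V[OF B]], of 2 "- 1"] s_sup[OF A] s_sup[OF B] by (simp add: hat_def)
 show "in_Lp Om \<infinity> (grad Om (hat s a b))" unfolding hat_def by (rule Linf_grad_lincomb(1)[OF Om(1) s_H1[OF A] s_H1[OF B] V_grad[OF s_V[OF A]] V_grad[OF s_V[OF B]]])
 show "sn Om (grad Om (hat s a b)) <= 3 * Gs" using Linf_grad_lincomb(2)[OF Om(1) s_H1[OF A] s_H1[OF B] V_grad[OF s_V[OF A]] V_grad[OF s_V[OF B]], of 2 "- 1"] s_grad[OF A] s_grad[OF B] by (simp add: hat_def)
 show "nrm Om (hat es a b) <= 3 * Es" using L2_norm_triangle[OF in_L2_scaleR[OF bdd_H1_L2[OF Om(1) bdd(3)[OF A]], of 2] in_L2_scaleR[OF bdd_H1_L2[OF Om(1) bdd(3)[OF B]], of "- 1"]] es_norms(1)[OF A] es_norms(1)[OF B] unfolding hat_def L2_norm_scaleR by simp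
 show "nrm Om (grad Om (hat es a b)) <= 3 * Es" using L2_grad_lincomb[OF Om(1) es_H1[OF A] es_H1[OF B], of 2 "- 1"] es_norms(2)[OF A] es_norms(2)[OF B] by (simp add: hat_def)
 then have "real CARD('a) * nrm Om (grad Om (hat es a b)) <= real CARD('a)*(3 * Es)" by (intro mult_left_mono) auto
 then show "nrm Om (dv Om (hat es a b)) <= 3*(real CARD('a) * Es)" using divergence_in_L2(2)[OF Om(1) conjunct1[OF eb[unfolded bdd_H1_def]]] by linarith
 show "AE x in lon Om. dv Om (hat u a b) x = 0" using divergence_lincomb[OF Om(1) u_H1[OF A] u_H1[OF B], of 2 "- 1"] at_t(7)[OF A] at_t(7)[OF B] unfolding hat_def by eventually_elim simp
qed

lemma half_divergence_zero:
 assumes z: "bdd_H1 Om z" "AE x in lon Om. dv Om z x = 0" and v: "bdd_H1 Om v"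
 shows "nrm Om (%x. (1/2 * dv Om z x) *. v x) <= 0" using divergence_mult_bounds(2)[OF Om(1), of z v] L2_norm_eq_0_iff[OF divergence_in_L2(1)[OF Om(1), of z]] z v by (simp add: bdd_H1_def)

text \<open>The Stokes equation of the projection removes the viscous term exactly, so
  \<open>\<nu>\<close> does not enter the bound. The pressure is reduced to its projection error
  because \<open>v\<close> is discretely divergence-free. In the convection difference,
  divergence-free transporting fields make the half divergence vanish; it survives only where the
  projection error transports.\<close>

lemma consistency_step:
 assumes t: "t \<in> {0..T}" and ab: "a \<in> {0..T}" "b \<in> {0..T}" and v: "v \<in> V" and vd: "!!q. q \<in> Q ==> ip Om (dv Om v) q = 0"
  and D: "in_Lp Om 2 Du" "in_Lp Om 2 De"
 shows "\<bar>ip Om (%x. Du x-De x) v+\<nu> * ip Om (grad Om (s t)) (grad Om v)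
  + trilinear Om (hat s a b) (hat s a b) v-ip Om (f t) v\<bar>
  <= (nrm Om (%x. Du x-ut t x)+nrm Om De + c1 * W * HU * h^k
  + 3*((real CARD('a))\<^sup>2 * W) * nrm Om (%x. hat u a b x-u t x) + U * nrm Om (grad Om (%x. hat u a b x-u t x))) * nrm Om v
  + C_pi * h^(l+1) * HP * nrm Om (dv Om v)"
proof -
 have vH1: "in_H Om 1 v" by (rule in_H10_in_H1[OF V_H10[OF v]])
 have v2: "in_Lp Om 2 v" using in_W_self(1)[OF Om(1) vH1] by blast
 have dv2: "in_Lp Om 2 (dv Om v)" by (rule divergence_in_L2(1)[OF Om(1) vH1])
 note bu = bdd(1)[OF t] and hb = hat_bounds[OF ab]
 have pH: "in_H Om 1 (p t)" using at_t(5)[OF t] in_W_mono by fastforce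
 note pbp = pressure_by_parts[OF Om(1) V_H10[OF v] pH]
 have p2: "in_Lp Om 2 (p t)" using in_W_self(1)[OF Om(1) pH] by blast
 note ut2 = time_deriv_L2[OF derivs(2) t] and f2 = at_t(6)[OF t]
 note cu = trilinear_pieces(1)[OF Om(1) bu bu]
 obtain \<pi> where \<pi>: "\<pi> \<in> Q" "nrm Om (%x. p t x-\<pi> x) <= C_pi * h^(l+1) * H_norm Om (l+1) (p t)" using pi[OF t] by blast
 have lam: "lam t \<in> Q" and st: "\<nu> * ip Om (grad Om (s t)) (grad Om v)-ip Om (dv Om v) (lam t)
  = ip Om (%x. f t x-ut t x-convection Om (u t) (u t) x-grad_scalar Om (p t) x) v" using proj[OF t] v by (simp_all add: is_stokes_projection_def)
 have g: "\<nu> * ip Om (grad Om (s t)) (grad Om v) = ip Om (f t) v-ip Om (ut t) v-ip Om (convection Om (u t) (u t)) v+ip Om (dv Om v) (p t)" using st vd[OF lam] pbp(2) unfolding L2_inner_diff_left[OF in_L2_diff[OF in_L2_diff[OF f2 ut2] cu] pbp(1) v2]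
  L2_inner_diff_left[OF in_L2_diff[OF f2 ut2] cu v2] L2_inner_diff_left[OF f2 ut2 v2] by simp
 have press: "\<bar>ip Om (dv Om v) (p t)\<bar> <= C_pi * h^(l+1) * HP * nrm Om (dv Om v)"
 proof -
  note pi2 = Q_L2[OF \<pi>(1)]
  have "ip Om (dv Om v) (p t) = ip Om (dv Om v) (%x. p t x-\<pi> x)" unfolding L2_inner_diff_right[OF p2 pi2 dv2] vd[OF \<pi>(1)] by simp
  also have "\<bar>...\<bar> <= nrm Om (dv Om v) * nrm Om (%x. p t x-\<pi> x)" by (rule L2_Cauchy_Schwarz[OF dv2 in_L2_diff[OF p2 pi2]])
  also have "... <= nrm Om (dv Om v)*(C_pi * h^(l+1) * HP)"
  proof (rule mult_left_mono[OF order_trans[OF \<pi>(2)]])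
  show "C_pi * h^(l+1) * H_norm Om (l+1) (p t) <= C_pi * h^(l+1) * HP" using par by (intro mult_left_mono p_bound t) auto
  qed simp
  finally show ?thesis by (simp add: mult_ac)
 qed
 let ?u = "hat u a b" and ?s = "hat s a b" and ?e = "hat es a b"
 define w where "w = (%x. ?u x-u t x)"
 have w_eq: "w = (%x. 1 *. ?u x+(- 1) *. u t x)" by (auto simp: w_def)
 have bw: "bdd_H1 Om w" unfolding w_eq by (rule bdd_H1_lincomb[OF Om(1) hb(1) bu])
 have wd: "AE x in lon Om. dv Om w x = 0" using divergence_lincomb[OF Om(1), of ?u "u t" 1 "- 1"] hb(1,13) bu at_t(7)[OF t] unfolding bdd_H1_def w_eq by (auto elim: eventually_elim2)
 note half = half_divergence_zero
 have uu: "trilinear Om (u t) (u t) v = ip Om (convection Om (u t) (u t)) v"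
 proof -
  note tp = trilinear_pieces[OF Om(1) bu bu]
  have "nrm Om (%x. (1/2 * dv Om (u t) x) *. u t x) * nrm Om v <= 0" using half[OF bu at_t(7)[OF t] bu] by (intro mult_nonpos_nonneg) auto
  then have "\<bar>ip Om (%x. (1/2 * dv Om (u t) x) *. u t x) v\<bar> <= 0" using L2_Cauchy_Schwarz[OF tp(2) v2] by linarith
  then show ?thesis unfolding trilinear_split[OF tp(1,2) v2] by simp
 qed
 \<comment> \<open>The projection is replaced by the solution in either slot, then the extrapolated
   solution by \<open>u t\<close>; \<open>w\<close> is the extrapolation error.\<close>
 have tri: "trilinear Om ?s ?s v = trilinear Om (u t) (u t) v-trilinear Om ?e ?s v-trilinear Om ?u ?e v+trilinear Om w ?u v+trilinear Om (u t) w v"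
 proof -
  have s_eq: "?s = (%x. 1 *. ?u x+(- 1) *. ?e x)" by (auto simp: hat_def es_def algebra_simps)
  have u_eq: "?u = (%x. 1 *. u t x+1 *. w x)" by (auto simp: w_def)
  have "trilinear Om ?s ?s v = 1 * trilinear Om ?u ?s v+(- 1) * trilinear Om ?e ?s v" using trilinear_lincomb_first[OF Om(1) hb(1,3,2) v2, of 1 "- 1"] unfolding s_eq[symmetric] .
  moreover have "trilinear Om ?u ?s v = 1 * trilinear Om ?u ?u v+(- 1) * trilinear Om ?u ?e v" using trilinear_lincomb_second[OF Om(1) hb(1,3,1) v2, of 1 "- 1"] unfolding s_eq[symmetric] .
  moreover have "trilinear Om ?u ?u v = 1 * trilinear Om (u t) ?u v+1 * trilinear Om w ?u v" using trilinear_lincomb_first[OF Om(1) bu bw hb(1) v2, of 1 1] unfolding u_eq[symmetric] .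
  moreover have "trilinear Om (u t) ?u v = 1 * trilinear Om (u t) (u t) v+1 * trilinear Om (u t) w v" using trilinear_lincomb_second[OF Om(1) bu bw bu v2, of 1 1] unfolding u_eq[symmetric] .
  ultimately show ?thesis by simp
 qed
 have H1: "in_H Om 1 ?e" "in_H Om 1 w" and Li: "in_Lp Om \<infinity> ?s" "in_Lp Om \<infinity> ?u" "in_Lp Om \<infinity> (u t)" using hb(1-3) bw bu by (auto simp: bdd_H1_def)
 have L2: "in_Lp Om 2 ?e" "in_Lp Om 2 w" using bdd_H1_L2[OF Om(1)] hb(3) bw by auto
 have T1: "\<bar>trilinear Om ?e ?s v\<bar> <= (3 * Gs * (3 * Es)+1/2*(4 * U * (3*(real CARD('a) * Es)))) * nrm Om v"
 proof (rule trilinear_bound[OF Om(1) hb(3,2) v2])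
  show "nrm Om (convection Om ?e ?s) <= 3 * Gs * (3 * Es)" by (rule order_trans[OF convection_bounds2(2)[OF hb(9) L2(1)]]) (intro mult_mono hb L2_norm_nonneg, use nonneg' in simp)
  show "nrm Om (%x. (1/2 * dv Om ?e x) *. ?s x) <= 1/2*(4 * U * (3*(real CARD('a) * Es)))" by (rule order_trans[OF divergence_mult_bounds(2)[OF Om(1) H1(1) Li(1)]]) (intro mult_left_mono mult_mono hb L2_norm_nonneg, use nonneg in simp_all)
 qed
 have T2: "\<bar>trilinear Om ?u ?e v\<bar> <= (3 * U * (3 * Es)+0) * nrm Om v" by (rule trilinear_bound[OF Om(1) hb(1,3) v2 order_trans[OF convection_bounds(2)[OF Om(1) H1(1) Li(2)]] half[OF hb(1,13,3)]])
  (intro mult_mono hb L2_norm_nonneg, use nonneg in simp)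
 have T3: "\<bar>trilinear Om w ?u v\<bar> <= (3*((real CARD('a))\<^sup>2 * W) * nrm Om w+0) * nrm Om v" by (rule trilinear_bound[OF Om(1) bw hb(1) v2 order_trans[OF convection_bounds2(2)[OF hb(6) L2(2)]] half[OF bw wd hb(1)]])
  (intro mult_right_mono hb L2_norm_nonneg)
 have T4: "\<bar>trilinear Om (u t) w v\<bar> <= (U * nrm Om (grad Om w)+0) * nrm Om v" by (rule trilinear_bound[OF Om(1) bu bw v2 order_trans[OF convection_bounds(2)[OF Om(1) H1(2) Li(3)]] half[OF bu at_t(7)[OF t] bw]])
  (intro mult_right_mono u_bounds t L2_norm_nonneg)
 have c: "(3 * Gs * (3 * Es)+1/2*(4 * U * (3*(real CARD('a) * Es))))+3 * U * (3 * Es) <= c1 * W * HU * h^k"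
 proof -
  have "U * ((6 * real CARD('a)+9) * Es) <= W * ((6 * real CARD('a)+9) * Es)" using U_le_W nonneg' by (intro mult_right_mono) auto
  moreover have "c1 * W * HU * h^k = 9*(Gs * Es) + W * ((6 * real CARD('a)+9) * Es)" unfolding c1_def Gs_def Es_def by (simp add: algebra_simps)
  ultimately show ?thesis by (simp add: algebra_simps)
 qed
 have T12: "\<bar>trilinear Om ?e ?s v\<bar>+\<bar>trilinear Om ?u ?e v\<bar> <= c1 * W * HU * h^k * nrm Om v"
 proof -
  have "((3 * Gs * (3 * Es)+1/2*(4 * U * (3*(real CARD('a) * Es))))+3 * U * (3 * Es)) * nrm Om v <= c1 * W * HU * h^k * nrm Om v" by (rule mult_right_mono[OF c]) simp
  then show ?thesis using T1 T2 unfolding distrib_right[of _ _ "nrm Om v"] by linarith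
 qed
 have du: "\<bar>ip Om (%x. Du x-ut t x) v\<bar> <= nrm Om (%x. Du x-ut t x) * nrm Om v" by (rule L2_Cauchy_Schwarz[OF in_L2_diff[OF D(1) ut2] v2])
 have de: "\<bar>ip Om De v\<bar> <= nrm Om De * nrm Om v" by (rule L2_Cauchy_Schwarz[OF D(2) v2])
 have id: "ip Om (%x. Du x-De x) v+\<nu> * ip Om (grad Om (s t)) (grad Om v)+trilinear Om ?s ?s v-ip Om (f t) v
  = ip Om (%x. Du x-ut t x) v-ip Om De v+ip Om (dv Om v) (p t)
  - trilinear Om ?e ?s v-trilinear Om ?u ?e v+trilinear Om w ?u v+trilinear Om (u t) w v" unfolding g tri uu L2_inner_diff_left[OF D v2] L2_inner_diff_left[OF D(1) ut2 v2] by simp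
 have T34: "\<bar>trilinear Om w ?u v\<bar> <= 3*((real CARD('a))\<^sup>2 * W) * nrm Om w * nrm Om v" "\<bar>trilinear Om (u t) w v\<bar> <= U * nrm Om (grad Om w) * nrm Om v" using T3 T4 by simp_all
 show ?thesis unfolding id w_def[symmetric] distrib_right[of _ _ "nrm Om v"] by (rule abs_combination[OF du de press T12 T34])
qed

end

text \<open>\<open>\<Phi>\<close> is the primitive of the squared norm: Cauchy-Schwarz on one time
  step produces an increment of it, and such increments telescope over the grid.\<close>

lemma bochner_majorant:
 fixes X :: "('a => 'b) => real"
 assumes w: "in_bochner T 2 inX X w" and X: "!!g. 0 <= X g"
 obtains \<Phi> M :: "real => real" where "!!s t. s <= t ==> \<Phi> s <= \<Phi> t" "!!t. 0 <= \<Phi> t" "!!t. \<Phi> t <= (bochner_norm T 2 X w)\<^sup>2"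
  "!!s t. set_integrable lebesgue {s..t} M" "!!tt. 0 <= M tt"
  "!!s t. s <= t ==> (LINT tt:{s..t}|lebesgue. M tt)\<^sup>2 <= (t-s)*(\<Phi> t-\<Phi> s)"
  "AE tt in lon {0<..<T}. inX (w tt) & X (w tt) <= M tt"
proof -
 have N: "in_Lp {0<..<T} 2 (%t. X (w t))" and AE: "AE t in lon {0<..<T}. inX (w t)" using w by (simp_all add: in_bochner_def)
 obtain \<Phi> :: "real => real" where \<Phi>: "!!s t. s <= t ==> \<Phi> s <= \<Phi> t" "!!t. 0 <= \<Phi> t" "!!t. \<Phi> t <= (nrm {0<..<T} (%t. X (w t)))\<^sup>2"
  "!!s t. set_integrable lebesgue {s..t} (%tt. ind {0<..<T} tt * X (w tt))"
  "!!s t. s <= t ==> (LINT tt:{s..t}|lebesgue. ind {0<..<T} tt * X (w tt))\<^sup>2 <= (t-s)*(\<Phi> t-\<Phi> s)" by (rule L2_time_majorant[OF N]) blast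
 have AE': "AE tt in lon {0<..<T}. inX (w tt) & X (w tt) <= ind {0<..<T} tt * X (w tt)" using AE AE_space[of "lon {0<..<T}"] by eventually_elim simp
 show ?thesis by (rule that[of \<Phi> "%tt. ind {0<..<T} tt * X (w tt)", OF \<Phi>(1,2) _ \<Phi>(4) _ \<Phi>(5) AE'])
  (use \<Phi>(3) X in \<open>simp_all add: bochner_norm_def Lp_norm_2\<close>)
qed

text \<open>The stencils reach over two steps and overlap, so two boundary terms survive at each end
  and the total is counted twice.\<close>

lemma two_step_telescope:
 fixes F :: "nat => real"
 assumes "1 <= m"
 shows "(\<Sum>j=2..m. F j-F (j-2)) = F m + F (m-1)-F 1-F 0" using assms
proof (induction m rule: dec_induct)
 case (step m)
 then have "2 <= Suc m" "Suc m-2 = m-1" by auto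
 then show ?case using step.IH by simp
qed simp

lemma square_sum5: "(a+b + c+x+y)\<^sup>2 <= 5*(a\<^sup>2+b\<^sup>2 + c\<^sup>2+x\<^sup>2+y\<^sup>2)" for a b c x y :: real
proof -
 have "0 <= (a-b)\<^sup>2+(a-c)\<^sup>2+(a-x)\<^sup>2+(a-y)\<^sup>2+(b-c)\<^sup>2+(b-x)\<^sup>2+(b-y)\<^sup>2+(c-x)\<^sup>2+(c-y)\<^sup>2+(x-y)\<^sup>2" by simp
 then show ?thesis by (simp add: power2_eq_square algebra_simps)
qed

lemma square_integral_bound:
 fixes x :: real
 assumes "0 <= x" "x <= c * I" "I\<^sup>2 <= a * D"
 shows "x\<^sup>2 <= c\<^sup>2 * a * D"
proof -
 have "x\<^sup>2 <= (c * I)\<^sup>2" using assms by (intro power_mono) auto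
 also have "... <= c\<^sup>2*(a * D)" unfolding power_mult_distrib using assms by (intro mult_left_mono) auto
 finally show ?thesis by (simp add: mult.assoc)
qed

section \<open>Truncation errors and their sum over the time grid\<close>

context projected_solution
begin

text \<open>The summands follow \<open>consistency_step\<close>: time difference of
  \<open>u\<close>, time difference of the projection error, spatial convection error, and the two
  terms of the extrapolation error.\<close>

definition tau :: "real => nat => real" where
 "tau dt n = nrm Om (%x. (1/dt) *. bdf (%j. u (real j * dt)) n x-ut (real (n+1) * dt) x)
  + nrm Om (%x. (1/dt) *. bdf (%j. es (real j * dt)) n x) + c1 * W * HU * h^k
  + 3*((real CARD('a))\<^sup>2 * W) * nrm Om (%x. hat u (real n * dt) (real (n-1) * dt) x-u (real (n+1) * dt) x)
  + U * nrm Om (grad Om (%x. hat u (real n * dt) (real (n-1) * dt) x-u (real (n+1) * dt) x))"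

context
 fixes N :: nat and dt :: real and e' :: "real => real^'a => real^'a"
 assumes dt: "dt > 0" "dt * real N = T"
  and e': "has_time_deriv Om T es e'" "AE t in lon {0<..<T}. nrm Om (e' t) <= Cs * h^k * H_norm Om k (ut t)"
begin

lemma grid: "j <= N ==> real j * dt \<in> {0..T}" using dt mult_left_mono[of "real j" "real N" dt] by (simp add: mult.commute)

lemma N_pos: "1 <= N" using dt T by (cases N) auto

lemma zero_terms:
 assumes n: "n < N" and U: "U = 0"
 shows "nrm Om (%x. (1/dt) *. bdf (%j. u (real j * dt)) n x-ut (real (n+1) * dt) x) = 0"
  "nrm Om (%x. hat u (real n * dt) (real (n-1) * dt) x-u (real (n+1) * dt) x) = 0"
proof -
 have g: "real (n+1) * dt \<in> {0..T}" "real n * dt \<in> {0..T}" "real (n-1) * dt \<in> {0..T}" using n by (intro grid; simp)+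
 have u2: "in_Lp Om 2 (u t)" if "t \<in> {0..T}" for t by (rule time_deriv_L2[OF derivs(1) that])
 have ut2: "in_Lp Om 2 (ut (real (n+1) * dt))" by (rule time_deriv_L2[OF derivs(2) g(1)])
 note z = zero_solution(1)[OF U g(1)] zero_solution(1)[OF U g(2)] zero_solution(1)[OF U g(3)]
 have ut0: "AE x in lon Om. ut (real (n+1) * dt) x = 0" using zero_solution(2)[OF U g(1)] L2_norm_eq_0_iff[OF ut2] by blast
 have "AE x in lon Om. (1/dt) *. bdf (%j. u (real j * dt)) n x-ut (real (n+1) * dt) x = 0" using z ut0 by eventually_elim (cases n, auto simp: bdf_def)
 moreover have "in_Lp Om 2 (%x. (1/dt) *. bdf (%j. u (real j * dt)) n x-ut (real (n+1) * dt) x)" using u2[OF g(1)] u2[OF g(2)] u2[OF g(3)] ut2 by (cases "n = 0") (auto simp: bdf_def intro!: in_L2_diff in_L2_add in_L2_scaleR)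
 ultimately show "nrm Om (%x. (1/dt) *. bdf (%j. u (real j * dt)) n x-ut (real (n+1) * dt) x) = 0" using L2_norm_eq_0_iff by blast
 have "AE x in lon Om. hat u (real n * dt) (real (n-1) * dt) x-u (real (n+1) * dt) x = 0" using z by eventually_elim (simp add: hat_def)
 moreover have "in_Lp Om 2 (%x. hat u (real n * dt) (real (n-1) * dt) x-u (real (n+1) * dt) x)" using u2[OF g(1)] u2[OF g(2)] u2[OF g(3)] unfolding hat_def by (intro in_L2_diff in_L2_add in_L2_scaleR)
 ultimately show "nrm Om (%x. hat u (real n * dt) (real (n-1) * dt) x-u (real (n+1) * dt) x) = 0" using L2_norm_eq_0_iff by blast
qed

lemma grad_minus: "in_H Om 1 g ==> nrm Om (grad Om (%x. - g x)) <= nrm Om (grad Om g)" using L2_grad_lincomb[OF Om(1), of g g "- 1" 0] by simp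

lemma u_H1': "t \<in> {0..T} ==> in_H Om 1 (u t)" by (rule u_H1)

lemma es_increment:
 assumes M: "AE tt in lon {0<..<T}. in_H Om k (ut tt) & H_norm Om k (ut tt) <= M tt"
  and Mi: "!!s t. set_integrable lebesgue {s..t} M" and Mp: "!!tt. 0 <= M tt" and st: "0 <= a" "a <= b" "b <= T"
 shows "nrm Om (%x. es b x-es a x) <= (Cs * h^k)*(LINT tt:{a..b}|lebesgue. M tt)"
proof -
 have "AE tt in lon {0<..<T}. nrm Om (e' tt) <= M tt * (Cs * h^k)" using e'(2) M
 proof eventually_elim
  case (elim t)
  have "Cs * h^k * H_norm Om k (ut t) <= Cs * h^k * M t" using elim par by (intro mult_left_mono) auto
  then show ?case using elim by (simp add: mult.commute)
 qed
 from time_increment_norm[OF e'(1) st _ _ this] show ?thesis using Mi Mp par by (simp add: set_integrable_mult_left mult.commute)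
qed

text \<open>The Euler step is first order only, so its squared error is of order
  \<open>dt^2\<close>; the missing \<open>dt^2\<close> is supplied by \<open>first_step\<close>. The
  factors \<open>of_bool\<close> record that the terms caused by time discretisation of
  \<open>u\<close> vanish together with \<open>U\<close>.\<close>

lemma tau_first:
 assumes n: "(0 :: nat) < N"
 shows "(tau dt 0)\<^sup>2 <= 5*(of_bool (U ~= 0)*(dt\<^sup>2*(bochner_norm T \<infinity> (nrm Om) utt)\<^sup>2)
  + Cs\<^sup>2 * h^(2 * k)*(bochner_norm T 2 (H_norm Om k) ut)\<^sup>2/dt+(c1 * W * HU * h^k)\<^sup>2
  + of_bool (U ~= 0)*(9 * real CARD('a)^4 * W\<^sup>2*(dt\<^sup>2*(bochner_norm T \<infinity> (nrm Om) ut)\<^sup>2))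
  + of_bool (U ~= 0)*(U\<^sup>2*(real CARD('a)^2*(dt\<^sup>2*(bochner_norm T \<infinity> (H_norm Om 1) ut)\<^sup>2))))"
proof -
 have st: "0 <= (0::real)" "0 <= dt" "dt <= T" using grid[of 1] N_pos dt by auto
 have g: "dt \<in> {0..T}" "0 \<in> {0..T}" using st by auto
 let ?A = "nrm Om (%x. (1/dt) *. bdf (%j. u (real j * dt)) 0 x-ut (real (0+1) * dt) x)"
 let ?B = "nrm Om (%x. (1/dt) *. bdf (%j. es (real j * dt)) 0 x)"
 let ?w = "%x. hat u (real 0 * dt) (real (0-1) * dt) x-u (real (0+1) * dt) x"
 have w: "?w = (%x. - (u dt x-u 0 x))" by (auto simp: hat_def algebra_simps scaleR_2)
 have A: "?A\<^sup>2 <= of_bool (U ~= 0)*(dt\<^sup>2*(bochner_norm T \<infinity> (nrm Om) utt)\<^sup>2)"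
 proof (cases "U = 0")
  case False
  have "nrm Om (%x. u dt x-u 0 x-(dt-0) *. ut dt x) <= (dt-0)*(LINT tt:{0..dt}|lebesgue. bochner_norm T \<infinity> (nrm Om) utt)" by (rule first_order_norm[OF derivs(1) st set_integrable_const_Icc bochner_nonneg derivs(2)]) (use bochner_bounds(6) in auto)
  moreover have "(%x. (1/dt) *. bdf (%j. u (real j * dt)) 0 x-ut (real (0+1) * dt) x) = (%x. (1/dt) *. (u dt x-u 0 x-(dt-0) *. ut dt x))" using dt by (auto simp: bdf_def algebra_simps)
  ultimately have "?A <= 1/dt * (dt * (dt * bochner_norm T \<infinity> (nrm Om) utt))" using dt unfolding L2_norm_scaleR by (simp only: L2_norm_scaleR) (intro mult_mono, auto simp: set_integral_const_Icc)
  then have "?A <= dt * bochner_norm T \<infinity> (nrm Om) utt" using dt by simp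
  then have "?A\<^sup>2 <= (dt * bochner_norm T \<infinity> (nrm Om) utt)\<^sup>2" by (intro power_mono) auto
  then show ?thesis using False by (simp add: power_mult_distrib)
 qed (use zero_terms(1)[OF n] in simp)
 have B: "?B\<^sup>2 <= Cs\<^sup>2 * h^(2 * k)*(bochner_norm T 2 (H_norm Om k) ut)\<^sup>2/dt"
 proof -
  have ib: "in_bochner T 2 (in_H Om k) (H_norm Om k) ut" using ns' by blast
  obtain \<Phi> M :: "real => real" where M: "!!s t. s <= t ==> \<Phi> s <= \<Phi> t" "!!t. 0 <= \<Phi> t" "!!t. \<Phi> t <= (bochner_norm T 2 (H_norm Om k) ut)\<^sup>2"
  "!!s t. set_integrable lebesgue {s..t} M" "!!tt. 0 <= M tt"
  "!!s t. s <= t ==> (LINT tt:{s..t}|lebesgue. M tt)\<^sup>2 <= (t-s)*(\<Phi> t-\<Phi> s)"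
  "AE tt in lon {0<..<T}. in_H Om k (ut tt) & H_norm Om k (ut tt) <= M tt" by (rule bochner_majorant[OF ib]) (simp, blast)
  note inc = es_increment[OF M(7,4,5) st]
  have "?B = 1/dt * nrm Om (%x. es dt x-es 0 x)" using dt by (simp add: bdf_def L2_norm_scaleR)
  also have "... <= 1/dt * ((Cs * h^k)*(LINT tt:{0..dt}|lebesgue. M tt))" using inc dt by (intro mult_left_mono) auto
  finally have "?B <= (1/dt * (Cs * h^k))*(LINT tt:{0..dt}|lebesgue. M tt)" by (simp only: mult.assoc)
  from square_integral_bound[OF L2_norm_nonneg this M(6)[OF st(2)]]
  have "?B\<^sup>2 <= (1/dt * (Cs * h^k))\<^sup>2*(dt-0)*(\<Phi> dt-\<Phi> 0)" .
  also have "... <= (1/dt * (Cs * h^k))\<^sup>2*(dt-0)*(bochner_norm T 2 (H_norm Om k) ut)\<^sup>2" using M(2)[of 0] M(3)[of dt] dt by (intro mult_left_mono) auto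
  also have "... = Cs\<^sup>2 * h^(2 * k)*(bochner_norm T 2 (H_norm Om k) ut)\<^sup>2/dt"
  proof -
  have hk: "h^(2 * k) = h^k * h^k" by (simp add: mult_2 power_add)
  show ?thesis unfolding hk using dt by (simp add: power2_eq_square field_simps)
  qed
  finally show ?thesis .
 qed
 have C: "(3*((real CARD('a))\<^sup>2 * W) * nrm Om ?w)\<^sup>2 <= of_bool (U ~= 0)*(9 * real CARD('a)^4 * W\<^sup>2*(dt\<^sup>2*(bochner_norm T \<infinity> (nrm Om) ut)\<^sup>2))"
 proof (cases "U = 0")
  case False
  have "nrm Om (%x. u dt x-u 0 x) <= 1*(LINT tt:{0..dt}|lebesgue. bochner_norm T \<infinity> (nrm Om) ut)" by (rule time_increment_norm[OF derivs(1) st set_integrable_const_Icc bochner_nonneg]) (use bochner_bounds(4) in auto)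
  then have "nrm Om ?w <= dt * bochner_norm T \<infinity> (nrm Om) ut" unfolding w L2_norm_uminus using dt by (simp add: set_integral_const_Icc)
  then have "(nrm Om ?w)\<^sup>2 <= (dt * bochner_norm T \<infinity> (nrm Om) ut)\<^sup>2" by (intro power_mono) auto
  then have "9 * real CARD('a)^4 * W\<^sup>2*(nrm Om ?w)\<^sup>2 <= 9 * real CARD('a)^4 * W\<^sup>2*(dt * bochner_norm T \<infinity> (nrm Om) ut)\<^sup>2" by (intro mult_left_mono) auto
  then show ?thesis using False by (simp add: power_mult_distrib mult.assoc)
 qed (use zero_terms(2)[OF n] in simp)
 have D: "(U * nrm Om (grad Om ?w))\<^sup>2 <= of_bool (U ~= 0)*(U\<^sup>2*(real CARD('a)^2*(dt\<^sup>2*(bochner_norm T \<infinity> (H_norm Om 1) ut)\<^sup>2)))"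
 proof (cases "U = 0")
  case False
  have "nrm Om (grad Om (%x. u dt x-u 0 x)) <= real CARD('a)*(LINT tt:{0..dt}|lebesgue. bochner_norm T \<infinity> (H_norm Om 1) ut)" by (rule grad_increment_norm[OF Om(1) derivs(1) u_H1[OF g(1)] u_H1[OF g(2)] st bochner_bounds(5) set_integrable_const_Icc bochner_nonneg])
  then have "nrm Om (grad Om ?w) <= real CARD('a)*(dt * bochner_norm T \<infinity> (H_norm Om 1) ut)" unfolding w using dt grad_minus[OF in_H_diff[OF Om(1) u_H1[OF g(1)] u_H1[OF g(2)]]] by (simp add: set_integral_const_Icc)
  then have "(nrm Om (grad Om ?w))\<^sup>2 <= (real CARD('a)*(dt * bochner_norm T \<infinity> (H_norm Om 1) ut))\<^sup>2" by (intro power_mono) auto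
  then have "U\<^sup>2*(nrm Om (grad Om ?w))\<^sup>2 <= U\<^sup>2*(real CARD('a)*(dt * bochner_norm T \<infinity> (H_norm Om 1) ut))\<^sup>2" by (intro mult_left_mono) auto
  then show ?thesis using False by (simp add: power_mult_distrib)
 qed simp
 show ?thesis unfolding tau_def by (rule order_trans[OF square_sum5]) (intro mult_left_mono add_mono A B C D order_refl, simp)
qed

text \<open>Every time-dependent term becomes a power of \<open>dt\<close> times the increment of a
  primitive over the stencil, ready for telescoping. For the projection error only one time
  derivative is available; there BDF2 is written as \<open>3/2\<close> of the new increment minus
  \<open>1/2\<close> of the old one.\<close>

lemma tau_step:
 assumes j: "2 <= j" "j <= N"
  and p3: "!!s t. s <= t ==> (LINT tt:{s..t}|lebesgue. M3 tt)\<^sup>2 <= (t-s)*(F3 t-F3 s)" "!!s t. set_integrable lebesgue {s..t} M3" "!!tt. 0 <= M3 tt"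
  "AE tt in lon {0<..<T}. in_Lp Om 2 (uttt tt) & nrm Om (uttt tt) <= M3 tt"
  and pk: "!!s t. s <= t ==> (LINT tt:{s..t}|lebesgue. Mk tt)\<^sup>2 <= (t-s)*(Fk t-Fk s)" "!!s t. set_integrable lebesgue {s..t} Mk" "!!tt. 0 <= Mk tt"
  "AE tt in lon {0<..<T}. in_H Om k (ut tt) & H_norm Om k (ut tt) <= Mk tt" "!!s t :: real. s <= t ==> Fk s <= Fk t"
  and p2: "!!s t. s <= t ==> (LINT tt:{s..t}|lebesgue. M2 tt)\<^sup>2 <= (t-s)*(F2 t-F2 s)" "!!s t. set_integrable lebesgue {s..t} M2" "!!tt. 0 <= M2 tt"
  "AE tt in lon {0<..<T}. in_Lp Om 2 (utt tt) & nrm Om (utt tt) <= M2 tt"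
  and p1: "!!s t. s <= t ==> (LINT tt:{s..t}|lebesgue. M1 tt)\<^sup>2 <= (t-s)*(F1 t-F1 s)" "!!s t. set_integrable lebesgue {s..t} M1" "!!tt. 0 <= M1 tt"
  "AE tt in lon {0<..<T}. in_H Om 1 (utt tt) & H_norm Om 1 (utt tt) <= M1 tt"
 shows "(tau dt (j-1))\<^sup>2 <= 5*(of_bool (U ~= 0)*(32 * dt^3*(F3 (real j * dt)-F3 (real (j-2) * dt)))
  + 4*(Cs\<^sup>2 * h^(2 * k))/dt * (Fk (real j * dt)-Fk (real (j-2) * dt))+(c1 * W * HU * h^k)\<^sup>2
  + of_bool (U ~= 0)*(72 * real CARD('a)^4 * W\<^sup>2 * dt^3*(F2 (real j * dt)-F2 (real (j-2) * dt)))
  + of_bool (U ~= 0)*(8 * U\<^sup>2 * real CARD('a)^2 * dt^3*(F1 (real j * dt)-F1 (real (j-2) * dt))))"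
proof -
 obtain n where n: "j = n+1" "1 <= n" "n < N" using j by (cases j) auto
 define t where "t = real n * dt"
 have e1: "real (n+1) * dt = t+dt" and e2: "real (n-1) * dt = t-dt" using n unfolding t_def by (auto simp: algebra_simps of_nat_diff)
 have idx: "j-1 = n" "real j * dt = t+dt" "real (j-2) * dt = t-dt" using n e1 e2 by auto
 have g: "t+dt \<in> {0..T}" "t \<in> {0..T}" "t-dt \<in> {0..T}" using grid[of "n+1"] grid[of n] grid[of "n-1"] n e1 e2 unfolding t_def by auto
 then have st: "0 <= t-dt" "0 <= dt" "t+dt <= T" using dt by auto
 have le: "t-dt <= t+dt" "t-dt <= t" "t <= t+dt" and w2: "t+dt-(t-dt) = 2 * dt" using dt by auto
 let ?A = "nrm Om (%x. (1/dt) *. bdf (%j. u (real j * dt)) n x-ut (real (n+1) * dt) x)"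
 let ?B = "nrm Om (%x. (1/dt) *. bdf (%j. es (real j * dt)) n x)"
 let ?w = "%x. hat u (real n * dt) (real (n-1) * dt) x-u (real (n+1) * dt) x"
 let ?z = "%x. u (t+dt) x-2 *. u t x+u (t-dt) x"
 have w: "?w = (%x. - ?z x)" unfolding e1 e2 t_def[symmetric] by (auto simp: hat_def)
 have A: "?A\<^sup>2 <= of_bool (U ~= 0)*(32 * dt^3*(F3 (t+dt)-F3 (t-dt)))"
 proof (cases "U = 0")
  case False
  let ?F = "%x. (3/2) *. u (t+dt) x-2 *. u t x+(1/2) *. u (t-dt) x-dt *. ut (t+dt) x"
  have b: "nrm Om ?F <= 4 * dt\<^sup>2*(LINT tt:{t-dt..t+dt}|lebesgue. M3 tt)" by (rule bdf_norm[OF derivs(1,2) st p3(2,3) derivs(3)]) (use p3(4) in auto)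
  have "(%x. (1/dt) *. bdf (%j. u (real j * dt)) n x-ut (real (n+1) * dt) x) = (%x. (1/dt) *. ?F x)" using n dt unfolding bdf_def e1 e2 t_def[symmetric] by (simp add: scaleR_diff_right)
  then have "?A = 1/dt * nrm Om ?F" using dt by (simp only: L2_norm_scaleR) simp
  also have "... <= 1/dt * (4 * dt\<^sup>2*(LINT tt:{t-dt..t+dt}|lebesgue. M3 tt))" by (rule mult_left_mono[OF b]) (use dt in simp)
  also have "... = 4 * dt * (LINT tt:{t-dt..t+dt}|lebesgue. M3 tt)" using dt by (simp add: power2_eq_square)
  finally have "?A\<^sup>2 <= (4 * dt)\<^sup>2*(t+dt-(t-dt))*(F3 (t+dt)-F3 (t-dt))" by (rule square_integral_bound[OF L2_norm_nonneg _ p3(1)[OF le(1)]])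
  also have "... = of_bool (U ~= 0)*(32 * dt^3*(F3 (t+dt)-F3 (t-dt)))" unfolding w2 using False by (simp add: power2_eq_square power3_eq_cube)
  finally show ?thesis .
 qed (use zero_terms(1)[OF n(3)] in simp)
 have B: "?B\<^sup>2 <= 4*(Cs\<^sup>2 * h^(2 * k))/dt * (Fk (t+dt)-Fk (t-dt))"
 proof -
  define D where "D = Fk (t+dt)-Fk (t-dt)"
  define q where "q = sqrt ((Cs * h^k)\<^sup>2 * dt * D)"
  have D: "0 <= D" "Fk (t+dt)-Fk t <= D" "Fk t-Fk (t-dt) <= D" unfolding D_def using pk(5)[OF le(1)] pk(5)[OF le(2)] pk(5)[OF le(3)] by auto
  have inc: "nrm Om (%x. es b x-es a x) <= q" if ab: "0 <= a" "a <= b" "b <= T" "b-a = dt" "Fk b-Fk a <= D" for a b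
  proof -
  have "(nrm Om (%x. es b x-es a x))\<^sup>2 <= (Cs * h^k)\<^sup>2*(b-a)*(Fk b-Fk a)" by (rule square_integral_bound[OF L2_norm_nonneg es_increment[OF pk(4,2,3) ab(1-3)] pk(1)[OF ab(2)]])
  also have "... <= (Cs * h^k)\<^sup>2 * dt * D" unfolding ab(4) using ab(5) dt by (intro mult_left_mono) auto
  finally show ?thesis unfolding q_def by (rule real_le_rsqrt)
  qed
  have q: "nrm Om (%x. es (t+dt) x-es t x) <= q" "nrm Om (%x. es t x-es (t-dt) x) <= q" using inc[of t "t+dt"] inc[of "t-dt" t] g D dt by auto
  have E: "in_Lp Om 2 (es (t+dt))" "in_Lp Om 2 (es t)" "in_Lp Om 2 (es (t-dt))" using time_deriv_L2[OF e'(1)] g by auto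
  have "(%x. (1/dt) *. bdf (%j. es (real j * dt)) n x) = (%x. (1/dt) *. ((3/2) *. (es (t+dt) x-es t x)+(- 1/2) *. (es t x-es (t-dt) x)))"
  proof
  fix x
  have "2 *. es t x = (3/2) *. es t x+(1/2) *. es t x" by (simp flip: scaleR_add_left)
  then have "(3/2) *. es (t+dt) x-2 *. es t x+(1/2) *. es (t-dt) x = (3/2) *. (es (t+dt) x-es t x)+(- 1/2) *. (es t x-es (t-dt) x)" by (simp add: scaleR_diff_right)
  then show "(1/dt) *. bdf (%j. es (real j * dt)) n x = (1/dt) *. ((3/2) *. (es (t+dt) x-es t x)+(- 1/2) *. (es t x-es (t-dt) x))" using n unfolding bdf_def e1 e2 t_def[symmetric] by simp
  qed
  then have "?B = 1/dt * nrm Om (%x. (3/2) *. (es (t+dt) x-es t x)+(- 1/2) *. (es t x-es (t-dt) x))" using dt by (simp only: L2_norm_scaleR) simp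
  also have "... <= 1/dt * (2 * q)"
  proof (rule mult_left_mono)
  show "nrm Om (%x. (3/2) *. (es (t+dt) x-es t x)+(- 1/2) *. (es t x-es (t-dt) x)) <= 2 * q" using L2_norm_triangle[OF in_L2_scaleR[OF in_L2_diff[OF E(1,2)], of "3/2"] in_L2_scaleR[OF in_L2_diff[OF E(2,3)], of "- 1/2"]] q unfolding L2_norm_scaleR by simp
  qed (use dt in simp)
  finally have "?B\<^sup>2 <= (1/dt * (2 * q))\<^sup>2" by (intro power_mono) auto
  also have "... = 4/dt\<^sup>2*((Cs * h^k)\<^sup>2 * dt * D)" unfolding q_def power_mult_distrib power_divide using D dt by simp
  also have "... = 4*(Cs\<^sup>2 * h^(2 * k))/dt * D" using dt by (simp add: power_mult_distrib power2_eq_square mult_2 power_add)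
  finally show ?thesis unfolding D_def .
 qed
 have C: "(3*((real CARD('a))\<^sup>2 * W) * nrm Om ?w)\<^sup>2 <= of_bool (U ~= 0)*(72 * real CARD('a)^4 * W\<^sup>2 * dt^3*(F2 (t+dt)-F2 (t-dt)))"
 proof (cases "U = 0")
  case False
  have "nrm Om ?w <= 2 * dt * (LINT tt:{t-dt..t+dt}|lebesgue. M2 tt)" unfolding w L2_norm_uminus by (rule second_difference_norm[OF derivs(1,2) st p2(2,3)]) (use p2(4) in auto)
  from square_integral_bound[OF L2_norm_nonneg this p2(1)[OF le(1)]]
  have "9 * real CARD('a)^4 * W\<^sup>2*(nrm Om ?w)\<^sup>2 <= 9 * real CARD('a)^4 * W\<^sup>2*((2 * dt)\<^sup>2*(t+dt-(t-dt))*(F2 (t+dt)-F2 (t-dt)))" by (intro mult_left_mono) auto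
  moreover have "(3*((real CARD('a))\<^sup>2 * W) * nrm Om ?w)\<^sup>2 = 9 * real CARD('a)^4 * W\<^sup>2*(nrm Om ?w)\<^sup>2" by (simp add: power_mult_distrib flip: power_mult)
  moreover have "dt^3 = dt * dt\<^sup>2" by (simp add: power2_eq_square power3_eq_cube)
  ultimately show ?thesis unfolding w2 using False by (simp add: mult_ac)
 qed (use zero_terms(2)[OF n(3)] in simp)
 have Dd: "(U * nrm Om (grad Om ?w))\<^sup>2 <= of_bool (U ~= 0)*(8 * U\<^sup>2 * real CARD('a)^2 * dt^3*(F1 (t+dt)-F1 (t-dt)))"
 proof (cases "U = 0")
  case False
  have z1: "in_H Om 1 ?z" by (intro in_H_add in_H_diff in_H_scaleR Om u_H1 g)
  have "nrm Om (grad Om ?z) <= real CARD('a)*(2 * dt * (LINT tt:{t-dt..t+dt}|lebesgue. M1 tt))" by (rule grad_second_difference_norm[OF Om(1) derivs(1,2) u_H1 st p1(4,2,3)])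
  then have "nrm Om (grad Om ?w) <= (real CARD('a)*(2 * dt))*(LINT tt:{t-dt..t+dt}|lebesgue. M1 tt)" unfolding w using grad_minus[OF z1] by (simp add: mult.assoc)
  from square_integral_bound[OF L2_norm_nonneg this p1(1)[OF le(1)]]
  have "U\<^sup>2*(nrm Om (grad Om ?w))\<^sup>2 <= U\<^sup>2*((real CARD('a)*(2 * dt))\<^sup>2*(t+dt-(t-dt))*(F1 (t+dt)-F1 (t-dt)))" by (intro mult_left_mono) auto
  then show ?thesis unfolding w2 using False by (simp add: power_mult_distrib power2_eq_square power3_eq_cube mult_ac)
 qed simp
 show ?thesis unfolding tau_def idx by (rule order_trans[OF square_sum5]) (intro mult_left_mono add_mono A B C Dd order_refl, simp)
qed

text \<open>One \<open>dt\<close> from the scheme times \<open>dt^3\<close> per step gives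
  \<open>dt^4\<close>, while at most \<open>T/dt\<close> copies of the spatial error, weighted with
  \<open>T * dt\<close>, give \<open>T^2\<close>. The largest numerical factor is
  \<open>4 * 5 * 72 * 2 = 2880\<close>.\<close>

lemma source_bound:
 defines "b0 \<equiv> bochner_norm T \<infinity> (nrm Om)" and "b1 \<equiv> bochner_norm T \<infinity> (H_norm Om 1)"
  and "q0 \<equiv> bochner_norm T 2 (nrm Om)" and "q1 \<equiv> bochner_norm T 2 (H_norm Om 1)"
 shows "10*(dt\<^sup>2*(tau dt 0)\<^sup>2)+(\<Sum>j=2..N. 4 * T * dt * (tau dt (j-1))\<^sup>2)
  <= of_bool (U ~= 0)*(2880 * real CARD('a)^4*(((b0 utt)\<^sup>2 + W\<^sup>2*(b0 ut)\<^sup>2 + U\<^sup>2*(b1 ut)\<^sup>2)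
  + T * ((q0 uttt)\<^sup>2 + W\<^sup>2*(q0 utt)\<^sup>2 + U\<^sup>2*(q1 utt)\<^sup>2)) * dt^4)
  + 210 * T * (Cs\<^sup>2 * h^(2 * k)*(bochner_norm T 2 (H_norm Om k) ut)\<^sup>2)+70 * T\<^sup>2*(c1 * W * HU * h^k)\<^sup>2"
proof -
 have ib: "in_bochner T 2 (in_Lp Om 2) (nrm Om) uttt" "in_bochner T 2 (in_H Om k) (H_norm Om k) ut" "in_bochner T 2 (in_H Om 1) (H_norm Om 1) utt" using ns' by blast+
 have ib2: "in_bochner T 2 (in_Lp Om 2) (nrm Om) utt"
 proof -
  have b: "in_bochner T \<infinity> (in_Lp Om 2) (nrm Om) utt" using ns' by blast
  have "in_Lp {0<..<T} 2 (%t. nrm Om (utt t))" by (rule in_Linf_imp_L2) (use b in \<open>simp_all add: in_bochner_def\<close>)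
  then show ?thesis using b by (simp add: in_bochner_def)
 qed
 obtain F3 M3 :: "real => real" where p3: "!!s t. s <= t ==> F3 s <= F3 t" "!!t. 0 <= F3 t" "!!t. F3 t <= (q0 uttt)\<^sup>2"
  "!!s t. set_integrable lebesgue {s..t} M3" "!!tt. 0 <= M3 tt" "!!s t. s <= t ==> (LINT tt:{s..t}|lebesgue. M3 tt)\<^sup>2 <= (t-s)*(F3 t-F3 s)"
  "AE tt in lon {0<..<T}. in_Lp Om 2 (uttt tt) & nrm Om (uttt tt) <= M3 tt" unfolding q0_def by (rule bochner_majorant[OF ib(1)]) (simp, blast)
 obtain Fk Mk :: "real => real" where pk: "!!s t. s <= t ==> Fk s <= Fk t" "!!t. 0 <= Fk t" "!!t. Fk t <= (bochner_norm T 2 (H_norm Om k) ut)\<^sup>2"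
  "!!s t. set_integrable lebesgue {s..t} Mk" "!!tt. 0 <= Mk tt" "!!s t. s <= t ==> (LINT tt:{s..t}|lebesgue. Mk tt)\<^sup>2 <= (t-s)*(Fk t-Fk s)"
  "AE tt in lon {0<..<T}. in_H Om k (ut tt) & H_norm Om k (ut tt) <= Mk tt" by (rule bochner_majorant[OF ib(2)]) (simp, blast)
 obtain F2 M2 :: "real => real" where p2: "!!s t. s <= t ==> F2 s <= F2 t" "!!t. 0 <= F2 t" "!!t. F2 t <= (q0 utt)\<^sup>2"
  "!!s t. set_integrable lebesgue {s..t} M2" "!!tt. 0 <= M2 tt" "!!s t. s <= t ==> (LINT tt:{s..t}|lebesgue. M2 tt)\<^sup>2 <= (t-s)*(F2 t-F2 s)"
  "AE tt in lon {0<..<T}. in_Lp Om 2 (utt tt) & nrm Om (utt tt) <= M2 tt" unfolding q0_def by (rule bochner_majorant[OF ib2]) (simp, blast)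
 obtain F1 M1 :: "real => real" where p1: "!!s t. s <= t ==> F1 s <= F1 t" "!!t. 0 <= F1 t" "!!t. F1 t <= (q1 utt)\<^sup>2"
  "!!s t. set_integrable lebesgue {s..t} M1" "!!tt. 0 <= M1 tt" "!!s t. s <= t ==> (LINT tt:{s..t}|lebesgue. M1 tt)\<^sup>2 <= (t-s)*(F1 t-F1 s)"
  "AE tt in lon {0<..<T}. in_H Om 1 (utt tt) & H_norm Om 1 (utt tt) <= M1 tt" unfolding q1_def by (rule bochner_majorant[OF ib(3)]) (simp, blast)
 have tele: "(\<Sum>j=2..N. F (real j * dt)-F (real (j-2) * dt)) <= 2 * R" if "!!t. 0 <= F t" "!!t. F t <= R" for F :: "real => real" and R using two_step_telescope[OF N_pos, of "%j. F (real j * dt)"] that(1)[of "real 1 * dt"] that(1)[of "real 0 * dt"] that(2)[of "real N * dt"] that(2)[of "real (N-1) * dt"] by linarith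
 define x :: real where "x = of_bool (U ~= 0)"
 have x: "0 <= x" by (simp add: x_def)
 define d where "d = real CARD('a)"
 have d1: "1 <= d" unfolding d_def by (simp add: Suc_leI)
 define cc where "cc = (c1 * W * HU * h^k)\<^sup>2"
 define Ck where "Ck = Cs\<^sup>2 * h^(2 * k)"
 define r where "r = (bochner_norm T 2 (H_norm Om k) ut)\<^sup>2"
 have dtT: "dt <= T" using grid[of 1] N_pos by simp
 have nn: "0 <= cc" "0 <= Ck" "0 <= r" "0 < dt" "0 < T" using dt T by (simp_all add: cc_def Ck_def r_def par less_imp_le)
 have s0: "(tau dt 0)\<^sup>2 <= 5*(x * (dt\<^sup>2*(b0 utt)\<^sup>2) + Ck * r/dt + cc+x * (9 * d^4 * W\<^sup>2*(dt\<^sup>2*(b0 ut)\<^sup>2))+x * (U\<^sup>2*(d\<^sup>2*(dt\<^sup>2*(b1 ut)\<^sup>2))))" using tau_first N_pos unfolding x_def Ck_def r_def cc_def d_def b0_def b1_def by simp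
 define D where "D F j = F (real j * dt)-F (real (j-2) * dt)" for F :: "real => real" and j :: nat
 have D2: "(\<Sum>j=2..N. D F3 j) <= 2*(q0 uttt)\<^sup>2" "(\<Sum>j=2..N. D Fk j) <= 2 * r" "(\<Sum>j=2..N. D F2 j) <= 2*(q0 utt)\<^sup>2" "(\<Sum>j=2..N. D F1 j) <= 2*(q1 utt)\<^sup>2" unfolding D_def r_def by (intro tele p3 pk p2 p1)+
 have sj: "(tau dt (j-1))\<^sup>2 <= 5*(x * (32 * dt^3 * D F3 j)+4 * Ck/dt * D Fk j + cc
  + x * (72 * d^4 * W\<^sup>2 * dt^3 * D F2 j)+x * (8 * U\<^sup>2 * d\<^sup>2 * dt^3 * D F1 j))" if "2 <= j" "j <= N" for j unfolding x_def Ck_def cc_def d_def D_def by (rule tau_step[OF that p3(6,4,5,7) pk(6,4,5,7,1) p2(6,4,5,7) p1(6,4,5,7)])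
 have "(\<Sum>j=2..N. (tau dt (j-1))\<^sup>2) <= (\<Sum>j=2..N. 5*(x * (32 * dt^3 * D F3 j)+4 * Ck/dt * D Fk j + cc
  + x * (72 * d^4 * W\<^sup>2 * dt^3 * D F2 j)+x * (8 * U\<^sup>2 * d\<^sup>2 * dt^3 * D F1 j)))" by (rule sum_mono) (use sj in auto)
 also have "... = 5*(x * (32 * dt^3*(\<Sum>j=2..N. D F3 j))+4 * Ck/dt * (\<Sum>j=2..N. D Fk j)+real (N-1) * cc
  + x * (72 * d^4 * W\<^sup>2 * dt^3*(\<Sum>j=2..N. D F2 j))+x * (8 * U\<^sup>2 * d\<^sup>2 * dt^3*(\<Sum>j=2..N. D F1 j)))" by (simp add: sum.distrib flip: sum_distrib_left sum_divide_distrib)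
 also have "... <= 5*(x * (32 * dt^3*(2*(q0 uttt)\<^sup>2))+4 * Ck/dt * (2 * r)+(T/dt) * cc
  + x * (72 * d^4 * W\<^sup>2 * dt^3*(2*(q0 utt)\<^sup>2))+x * (8 * U\<^sup>2 * d\<^sup>2 * dt^3*(2*(q1 utt)\<^sup>2)))"
 proof (intro mult_left_mono[of _ _ "5::real"] add_mono mult_left_mono mult_right_mono x)
  have "real (N-1) * dt <= T" using grid[of "N-1"] by simp
  then show "real (N-1) <= T/dt" using nn by (simp add: field_simps)
 qed (use nn d1 D2 in simp_all)
 finally have S: "(\<Sum>j=2..N. (tau dt (j-1))\<^sup>2) <= 5*(x * (32 * dt^3*(2*(q0 uttt)\<^sup>2))+4 * Ck/dt * (2 * r)+(T/dt) * cc
  + x * (72 * d^4 * W\<^sup>2 * dt^3*(2*(q0 utt)\<^sup>2))+x * (8 * U\<^sup>2 * d\<^sup>2 * dt^3*(2*(q1 utt)\<^sup>2)))" .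
 define y where "y = x * dt^4"
 have y: "0 <= y" using x nn by (simp add: y_def)
 \<comment> \<open>All dimensional factors are raised to \<open>d^4\<close>, so that one constant
   serves every time term.\<close>
 have dd: "1 <= d\<^sup>2" "1 <= d^4" "d\<^sup>2 <= d^4" using d1 by (auto intro: one_le_power power_increasing)
 have "10*(dt\<^sup>2*(tau dt 0)\<^sup>2) <= 10*(dt\<^sup>2*(5*(x * (dt\<^sup>2*(b0 utt)\<^sup>2) + Ck * r/dt + cc+x * (9 * d^4 * W\<^sup>2*(dt\<^sup>2*(b0 ut)\<^sup>2))+x * (U\<^sup>2*(d\<^sup>2*(dt\<^sup>2*(b1 ut)\<^sup>2))))))" by (intro mult_left_mono s0) auto
 also have "... = 50*(y * (b0 utt)\<^sup>2)+50*(dt * (Ck * r))+50*(dt\<^sup>2 * cc)+450*(d^4*(y * (W\<^sup>2*(b0 ut)\<^sup>2)))+50*(d\<^sup>2*(y * (U\<^sup>2*(b1 ut)\<^sup>2)))" unfolding y_def using nn by (simp add: field_simps power2_eq_square power4_eq_xxxx)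
 finally have E1: "10*(dt\<^sup>2*(tau dt 0)\<^sup>2) <= 50*(y * (b0 utt)\<^sup>2)+50*(dt * (Ck * r))+50*(dt\<^sup>2 * cc)+450*(d^4*(y * (W\<^sup>2*(b0 ut)\<^sup>2)))+50*(d\<^sup>2*(y * (U\<^sup>2*(b1 ut)\<^sup>2)))" .
 have "(\<Sum>j=2..N. 4 * T * dt * (tau dt (j-1))\<^sup>2) = 4 * T * dt * (\<Sum>j=2..N. (tau dt (j-1))\<^sup>2)" by (simp add: sum_distrib_left)
 also have "... <= 4 * T * dt * (5*(x * (32 * dt^3*(2*(q0 uttt)\<^sup>2))+4 * Ck/dt * (2 * r)+(T/dt) * cc
  + x * (72 * d^4 * W\<^sup>2 * dt^3*(2*(q0 utt)\<^sup>2))+x * (8 * U\<^sup>2 * d\<^sup>2 * dt^3*(2*(q1 utt)\<^sup>2))))" by (rule mult_left_mono[OF S]) (use nn in simp)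
 also have "... = 1280*(T * (y * (q0 uttt)\<^sup>2))+160*(T * (Ck * r))+20*(T\<^sup>2 * cc)+2880*(d^4*(T * (y * (W\<^sup>2*(q0 utt)\<^sup>2))))+320*(d\<^sup>2*(T * (y * (U\<^sup>2*(q1 utt)\<^sup>2))))" unfolding y_def using nn by (simp add: field_simps power2_eq_square power3_eq_cube power4_eq_xxxx)
 finally have E2: "(\<Sum>j=2..N. 4 * T * dt * (tau dt (j-1))\<^sup>2) <= 1280*(T * (y * (q0 uttt)\<^sup>2))+160*(T * (Ck * r))+20*(T\<^sup>2 * cc)+2880*(d^4*(T * (y * (W\<^sup>2*(q0 utt)\<^sup>2))))+320*(d\<^sup>2*(T * (y * (U\<^sup>2*(q1 utt)\<^sup>2))))" .
 have up: "z <= d^4 * z" "d\<^sup>2 * z <= d^4 * z" "0 <= d^4 * z" if "0 <= z" for z using mult_right_mono[OF dd(2) that] mult_right_mono[OF dd(3) that] that dd by auto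
 have z: "0 <= y * (b0 utt)\<^sup>2" "0 <= y * (W\<^sup>2*(b0 ut)\<^sup>2)" "0 <= y * (U\<^sup>2*(b1 ut)\<^sup>2)" "0 <= T * (y * (q0 uttt)\<^sup>2)" "0 <= T * (y * (U\<^sup>2*(q1 utt)\<^sup>2))" using y nn by simp_all
 have kr: "dt * (Ck * r) <= T * (Ck * r)" "dt\<^sup>2 * cc <= T\<^sup>2 * cc" using dtT nn by (auto intro!: mult_right_mono power_mono)
 have "10*(dt\<^sup>2*(tau dt 0)\<^sup>2)+(\<Sum>j=2..N. 4 * T * dt * (tau dt (j-1))\<^sup>2)
  <= 2880*(d^4*(y * (b0 utt)\<^sup>2))+2880*(d^4*(y * (W\<^sup>2*(b0 ut)\<^sup>2)))+2880*(d^4*(y * (U\<^sup>2*(b1 ut)\<^sup>2)))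
  + 2880*(d^4*(T * (y * (q0 uttt)\<^sup>2)))+2880*(d^4*(T * (y * (W\<^sup>2*(q0 utt)\<^sup>2))))+2880*(d^4*(T * (y * (U\<^sup>2*(q1 utt)\<^sup>2))))
  + 210*(T * (Ck * r))+70*(T\<^sup>2 * cc)" using E1 E2 up(1)[OF z(1)] up(3)[OF z(1)] up(3)[OF z(2)] up(2)[OF z(3)] up(3)[OF z(3)] up(1)[OF z(4)] up(3)[OF z(4)] up(2)[OF z(5)] up(3)[OF z(5)] kr by linarith
 also have "... = x * (2880 * d^4*(((b0 utt)\<^sup>2 + W\<^sup>2*(b0 ut)\<^sup>2 + U\<^sup>2*(b1 ut)\<^sup>2) + T * ((q0 uttt)\<^sup>2 + W\<^sup>2*(q0 utt)\<^sup>2 + U\<^sup>2*(q1 utt)\<^sup>2)) * dt^4)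
  + 210 * T * (Ck * r)+70 * T\<^sup>2 * cc" unfolding y_def by (simp add: algebra_simps)
 finally show ?thesis unfolding x_def d_def Ck_def r_def cc_def .
qed

end

end

section \<open>The error estimate\<close>

text \<open>The pressure projection bound is given in the broken norm. Its order 0 dominates the
  norm on \<open>Om\<close> because the open elements cover \<open>Om\<close> up to a null
  set.\<close>

lemma L2_le_broken_norm:
 fixes f :: "real^'d::finite => real"
 assumes Om: "open Om" "lipschitz_boundary Om" and m: "mesh_partition Om \<T>" and f: "in_Lp Om 2 f"
 shows "nrm Om f <= broken_H_norm \<T> 0 f"
proof -
 have S: "Om \<in> sets lebesgue" using Om by simp
 have fin: "finite \<T>" using m by (simp add: mesh_partition_def)
 have fK: "in_Lp (interior K) 2 f" if "K \<in> \<T>" for K by (rule L2_norm_subset(1)[OF _ S mesh_interior_subset[OF Om m that] f]) simp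
 have iS: "interior K \<in> sets lebesgue" for K :: "(real^'d) set" by simp
 have int: "integrable lebesgue (%x. ind A x * (norm (f x))\<^sup>2)" if "in_Lp A 2 f" "A \<in> sets lebesgue" for A using that integrable_restrict_space[of A lebesgue "%x. (norm (f x))\<^sup>2"] by (simp add: in_L2_iff)
 have "(nrm Om f)\<^sup>2 = (LINT x|lebesgue. ind Om x * (norm (f x))\<^sup>2)" by (rule L2_norm_sq_support[OF S])
 also have "... <= (LINT x|lebesgue. (\<Sum>K\<in>\<T>. ind (interior K) x * (norm (f x))\<^sup>2))"
 proof (rule integral_mono_AE)
  show "integrable lebesgue (%x. ind Om x * (norm (f x))\<^sup>2)" by (rule int[OF f S])
  show "integrable lebesgue (%x. \<Sum>K\<in>\<T>. ind (interior K) x * (norm (f x))\<^sup>2)" by (intro Bochner_Integration.integrable_sum int fK) simp_all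
  have "AE x in lebesgue. x \<in> Om --> (\<exists>K\<in>\<T>. x \<in> interior K)" using mesh_AE_interior[OF Om(1) m] unfolding AE_lebesgue_on_iff[OF S] .
  then show "AE x in lebesgue. ind Om x * (norm (f x))\<^sup>2 <= (\<Sum>K\<in>\<T>. ind (interior K) x * (norm (f x))\<^sup>2)"
  proof eventually_elim
  case (elim x)
  show ?case
  proof (cases "x \<in> Om")
  case True
  then obtain K where K: "K \<in> \<T>" "x \<in> interior K" using elim by blast
  have "ind (interior K) x * (norm (f x))\<^sup>2 <= (\<Sum>K\<in>\<T>. ind (interior K) x * (norm (f x))\<^sup>2)" by (rule member_le_sum[OF K(1) _ fin]) simp
  then show ?thesis using K True by simp
  qed (auto intro!: sum_nonneg)
  qed
 qed
 also have "... = (\<Sum>K\<in>\<T>. (LINT x|lebesgue. ind (interior K) x * (norm (f x))\<^sup>2))" by (intro Bochner_Integration.integral_sum int fK) simp_all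
 also have "... = (\<Sum>K\<in>\<T>. (H_norm (interior K) 0 f)\<^sup>2)" by (intro sum.cong refl) (simp only: W_norm_0(2)[OF open_interior fK] L2_norm_sq_support[OF iS])
 finally show ?thesis unfolding broken_H_norm_def by (rule real_le_rsqrt)
qed

lemma weak_deriv_AE_zero:
 fixes f :: "real^'d::finite => 'b::euclidean_space"
 assumes Om: "open Om" and f: "in_W Om m p f" and l: "length is <= m" and z: "AE x in lon Om. f x = 0"
 shows "AE x in lon Om. wd Om is f x = 0" by (rule has_weak_deriv_unique[OF Om in_W_weak_deriv(1)[OF Om f l] has_weak_deriv_zero z])

lemma H_norm_AE_zero:
 fixes f :: "real^'d::finite => 'b::euclidean_space"
 assumes Om: "open Om" and f: "in_H Om m f" and z: "AE x in lon Om. f x = 0"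
 shows "H_norm Om m f = 0"
proof -
 have "nrm Om (wd Om is f) = 0" if l: "length is <= m" for "is"
 proof -
  have "in_Lp Om 2 (wd Om is f)" by (rule in_W_weak_deriv(3)[OF Om f l]) simp
  then show ?thesis using weak_deriv_AE_zero[OF Om f l z] L2_norm_eq_0_iff by blast
 qed
 then have "(H_norm Om m f)\<^sup>2 = 0" unfolding H_norm_sq by simp
 then show ?thesis by simp
qed

lemma grad_Linf_AE_zero:
 fixes v :: "real^'d::finite => real^'d"
 assumes Om: "open Om" and v: "in_H Om 1 v" and z: "AE x in lon Om. v x = 0"
 shows "sn Om (grad Om v) = 0"
proof -
 have "AE x in lon Om. \<forall>j. wd Om [j] v x = 0" unfolding AE_all_countable using weak_deriv_AE_zero[OF Om v _ z] by simp
 then have "AE x in lon Om. norm (grad Om v x) <= 0"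
 proof eventually_elim
  case (elim x)
  then have "grad Om v x = 0" by (simp add: vec_eq_iff grad_nth)
  then show ?case by simp
 qed
 from Linf_norm_le[OF in_L2_measurable[OF grad_in_L2(1)[OF Om v]] order_refl this] show ?thesis using Linf_norm_nonneg[of Om "grad Om v"] by linarith
qed

text \<open>\<open>ln y = 2 * ln (sqrt y)\<close> is at most \<open>2 * sqrt y\<close>, hence
  \<open>h * ln (a/h)\<close> is at most \<open>2 * sqrt (a * h)\<close>, which is below
  \<open>e\<close> for small \<open>h\<close>.\<close>

lemma log_threshold:
 fixes a e :: real
 assumes a: "0 < a" and e: "0 < e" and r: "r <= (1::nat)"
 obtains h2 where "0 < h2" "!!h. 0 < h ==> h < h2 ==> h * ln (a/h)^r <= e"
proof (rule that[of "min e ((e/2)\<^sup>2/a)"])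
 show "0 < min e ((e/2)\<^sup>2/a)" using a e by simp
 fix h assume h: "0 < h" "h < min e ((e/2)\<^sup>2/a)"
 show "h * ln (a/h)^r <= e"
 proof (cases "r = 0")
  case False
  then have "r = 1" using r by simp
  have "ln (a/h) = 2 * ln (sqrt (a/h))" using a h by (simp add: ln_sqrt)
  also have "... <= 2 * sqrt (a/h)" using ln_le_minus_one[of "sqrt (a/h)"] a h by simp
  finally have "h * ln (a/h) <= h * (2 * sqrt (a/h))" using h by (intro mult_left_mono) auto
  also have "... = 2 * sqrt (a * h)"
  proof -
  have "h * sqrt (a/h) = sqrt (h\<^sup>2) * sqrt (a/h)" using h by simp
  also have "... = sqrt (h\<^sup>2*(a/h))" by (simp only: real_sqrt_mult)
  also have "h\<^sup>2*(a/h) = a * h" using h by (simp add: power2_eq_square)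
  finally show ?thesis by simp
  qed
  also have "... <= e"
  proof -
  have "a * h <= (e/2)\<^sup>2" using h a by (simp add: field_simps)
  then have "sqrt (a * h) <= e/2" using e by (intro real_le_lsqrt) auto
  then show ?thesis by simp
  qed
  finally show ?thesis using \<open>r = 1\<close> by simp
 qed (use h in simp)
qed

context projected_solution
begin

lemma extrapolate_hat: "extrapolate (%j. w (real j * dt)) n = hat w (real n * dt) (real (n-1) * dt)" by (auto simp: extrapolate_def hat_def scaleR_2)

lemma bdf_diff: "bdf (%j. s (real j * dt)) n = (%x. bdf (%j. u (real j * dt)) n x-bdf (%j. es (real j * dt)) n x)" by (auto simp: bdf_def es_def algebra_simps)

text \<open>Once the discrete argument is instantiated, the sources are compared with the constants
  of the bound. Each requirement on \<open>C\<close> pays for one group: time truncation, time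
  derivative of the projection error, spatial convection error, divergence of the projection in the
  grad-div term, and pressure.\<close>

theorem projected_error_estimate:
 fixes uh :: "nat => real^'a => real^'a" and ph :: "nat => real^'a => real" and dt \<mu> \<kappa> c ep0 S' \<Lambda> C K ep :: real and N n :: nat
 defines "sh \<equiv> %n. s (real n * dt)"
 defines "Bs \<equiv> of_bool (U ~= 0)*((C0_sq C Om T u ut utt + T * C3_sq C Om T u utt uttt) * dt^4)
  + T * (C1_sq C Om T \<mu> k u ut * h^(2 * k) + C2_sq C Om T \<mu> l p * h^(2 * l+2))"
 assumes dt: "dt > 0" "dt * real N = T"
  and e': "has_time_deriv Om T es e'" "AE t in lon {0<..<T}. nrm Om (e' t) <= Cs * h^k * H_norm Om k (ut t)"
  and Q_sub: "function_subspace Q" and pos: "\<nu> > 0" "\<mu> > 0" "\<kappa> > 0" "c > 0" "0 <= ep0"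
  and inv: "!!v. v \<in> V ==> nrm Om (grad Om v) <= c/h * nrm Om v"
  and sup: "!!v. v \<in> V ==> h * sn Om v <= ep0*(nrm Om (grad Om v)+nrm Om v)"
  and imex: "imex_solution Om V Q \<nu> \<mu> dt N f (sh 0) uh ph"
  and S': "!!a b. a \<in> {0..T} ==> b \<in> {0..T} ==> real CARD('a) * sn Om (grad Om (hat s a b)) <= S'" "4 * dt * S'\<^sup>2 <= 1/T"
  and cfl: "64 * c\<^sup>2 * U\<^sup>2*(dt/h\<^sup>2) <= \<kappa>/T"
  and n: "1 <= n" "n+1 <= N"
  and stab: "!!j. j \<in> {2..n+1} ==> dt * (4*((\<kappa>+1)/T)+stab_const Om \<mu> sh n j) <= 1/2"
  "!!j. j \<in> {2..n+1} ==> stab_const Om \<mu> sh n j <= \<Lambda>" "0 <= \<Lambda>"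
  and C: "2880 * real CARD('a)^4 <= C" "210 * Cs\<^sup>2 <= C"
  "70 * c1\<^sup>2*(real (card {is :: 'a list. length is <= k+1}) * real CARD('a)) <= C * measure lebesgue Om powr (2/real CARD('a))"
  "24*(real CARD('a))\<^sup>2 * Cs\<^sup>2*(real (card {is :: 'a list. length is <= k+1}) * real CARD('a)) <= C"
  "24 * C_pi\<^sup>2 * real (card {is :: 'a list. length is <= l+1}) <= C"
  and K: "0 <= K" "exp (8*(\<kappa>+1)+2 * T * \<Lambda>) * Bs <= (K * h)\<^sup>2"
  and ep: "12*(1+real CARD('a)/2) * K * ep0 <= ep" "0 < ep" "ep <= \<nu>/10" "5 * ep\<^sup>2 <= \<nu>/T"
 shows "(nrm Om (%x. sh (n+1) x-uh (n+1) x))\<^sup>2+(\<Sum>j=2..n+1. \<nu> * dt * (nrm Om (grad Om (%x. sh j x-uh j x)))\<^sup>2)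
  + \<mu>*(\<Sum>j=2..n+1. dt * (nrm Om (dv Om (%x. sh j x-uh j x)))\<^sup>2) <= exp (8*(\<kappa>+1)+2 * T * \<Lambda>) * Bs"
proof -
 note gr = grid[OF dt e']
 interpret X: imex_error Om V Q \<nu> \<mu> dt T \<kappa> h c U S' ep0 N f sh uh ph "%j. tau dt (j-1)" "%_. C_pi * h^(l+1) * HP" "%_. real CARD('a) * Es"
 proof
  show "0 < T" "0 < h" "0 <= U" using T par nonneg by auto
  show "sh j \<in> V" if "j <= N" for j unfolding sh_def by (rule s_V[OF gr[OF that]])
  show "ip Om (dv Om (sh j)) q = 0" if "j <= N" "q \<in> Q" for j q unfolding sh_def by (rule s_div[OF gr[OF that(1)] that(2)])
  show "nrm Om (dv Om (sh j)) <= real CARD('a) * Es" if "j <= N" for j unfolding sh_def by (rule s_div_norm[OF gr[OF that]])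
  show "sn Om (extrapolate sh j) <= 4 * U" if "j < N" for j unfolding sh_def extrapolate_hat by (rule hat_bounds(7)) (use that in \<open>intro gr; simp\<close>)+
  show "real CARD('a) * sn Om (grad Om (extrapolate sh j)) <= S'" if "j < N" for j unfolding sh_def extrapolate_hat by (rule S'(1)) (use that in \<open>intro gr; simp\<close>)+
  fix n v assume n: "n < N" and v: "v \<in> V" and vd: "!!q. q \<in> Q ==> ip Om (dv Om v) q = 0"
  have g: "real (n+1) * dt \<in> {0..T}" "real n * dt \<in> {0..T}" "real (n-1) * dt \<in> {0..T}" using n by (intro gr; simp)+
  have bL: "in_Lp Om 2 (%x. (1/dt) *. bdf (%j. w (real j * dt)) n x)" if w: "!!t. t \<in> {0..T} ==> in_Lp Om 2 (w t)" for w :: "real => real^'a => real^'a" using w[OF g(1)] w[OF g(2)] w[OF g(3)] by (cases "n = 0") (auto simp: bdf_def intro!: in_L2_diff in_L2_add in_L2_scaleR)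
  have eq: "(%x. (1/dt) *. bdf sh n x) = (%x. (1/dt) *. bdf (%j. u (real j * dt)) n x-(1/dt) *. bdf (%j. es (real j * dt)) n x)" unfolding sh_def bdf_diff by (simp add: scaleR_diff_right)
  show "\<bar>ip Om (%x. (1/dt) *. bdf sh n x) v+\<nu> * ip Om (grad Om (sh (n+1))) (grad Om v)
  + trilinear Om (extrapolate sh n) (extrapolate sh n) v-ip Om (f (real (n+1) * dt)) v\<bar>
  <= tau dt (n+1-1) * nrm Om v + C_pi * h^(l+1) * HP * nrm Om (dv Om v)" unfolding eq unfolding sh_def extrapolate_hat add_diff_cancel_right' tau_def by (rule consistency_step[OF g v vd bL[OF time_deriv_L2[OF derivs(1)]] bL[OF time_deriv_L2[OF e'(1)]]])
 qed (use assms Om V_H10 V_Linf V_grad V_sub Q_L2 in \<open>simp_all add: sh_def\<close>)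
 define x :: real where "x = of_bool (U ~= 0)"
 define d where "d = real CARD('a)"
 define R where "R = ((bochner_norm T \<infinity> (nrm Om) utt)\<^sup>2 + W\<^sup>2*(bochner_norm T \<infinity> (nrm Om) ut)\<^sup>2 + U\<^sup>2*(bochner_norm T \<infinity> (H_norm Om 1) ut)\<^sup>2)
  + T * ((bochner_norm T 2 (nrm Om) uttt)\<^sup>2 + W\<^sup>2*(bochner_norm T 2 (nrm Om) utt)\<^sup>2 + U\<^sup>2*(bochner_norm T 2 (H_norm Om 1) utt)\<^sup>2)"
 define qk where "qk = (bochner_norm T 2 (H_norm Om k) ut)\<^sup>2"
 define bk where "bk = (bochner_norm T \<infinity> (H_norm Om (k+1)) u)\<^sup>2"
 define bp where "bp = (bochner_norm T \<infinity> (H_norm Om (l+1)) p)\<^sup>2"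
 define nk where "nk = real (card {is :: 'a list. length is <= k+1}) * real CARD('a)"
 define np where "np = real (card {is :: 'a list. length is <= l+1})"
 define Z where "Z = h^(2 * k)"
 define Y where "Y = h^(2 * l+2)"
 define mm where "mm = measure lebesgue Om powr (2/real CARD('a))"
 have HU2: "HU\<^sup>2 = nk * bk" unfolding HU_def nk_def bk_def by (simp add: power_mult_distrib)
 have HP2: "HP\<^sup>2 = np * bp" unfolding HP_def np_def bp_def by (simp add: power_mult_distrib)
 have hk: "(h^k)\<^sup>2 = Z" unfolding Z_def power_mult[symmetric] by (simp only: mult.commute)
 have hl: "(h^(l+1))\<^sup>2 = Y" unfolding Y_def power_mult[symmetric] by (rule arg_cong[where f = "power h"]) simp
 have nn: "0 <= R" "0 <= qk" "0 <= bk" "0 <= bp" "0 <= Z" "0 <= Y" "0 <= x" using T par by (simp_all add: R_def qk_def bk_def bp_def Z_def Y_def x_def)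
 have Bs: "Bs = x * (C * R * dt^4) + T * ((C * (qk+(\<mu> + T * mm * W\<^sup>2) * bk)) * Z + C/\<mu> * bp * Y)" unfolding Bs_def C0_sq_def C1_sq_def C2_sq_def C3_sq_def x_def R_def qk_def bk_def bp_def Z_def Y_def mm_def W_def U_def by (simp add: algebra_simps)
 define \<eta>2 where "\<eta>2 = (real CARD('a) * Es)\<^sup>2"
 define P2 where "P2 = (C_pi * h^(l+1) * HP)\<^sup>2"
 have e2: "\<eta>2 = d\<^sup>2 * Cs\<^sup>2 * nk * (bk * Z)" unfolding \<eta>2_def Es_def power_mult_distrib HU2 hk d_def by simp
 have P2: "P2 = C_pi\<^sup>2 * np * (bp * Y)" unfolding P2_def power_mult_distrib HP2 hl by simp
 have cc: "(c1 * W * HU * h^k)\<^sup>2 = c1\<^sup>2 * nk * (W\<^sup>2 * bk * Z)" unfolding power_mult_distrib HU2 hk by simp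
 have N1: "dt <= T" "real (N-1) * dt <= T" using gr[of 1] gr[of "N-1"] n by auto
 have e0: "0 <= \<mu>*\<eta>2" "0 <= P2/\<mu>" using pos by (simp_all add: \<eta>2_def P2_def)
 have srcsum: "(\<Sum>j=2..N. X.source j) = (\<Sum>j=2..N. 4 * T * dt * (tau dt (j-1))\<^sup>2)+real (N-1) * dt * (4*(\<mu>*\<eta>2)+4*(P2/\<mu>))" unfolding X.source_def \<eta>2_def[symmetric] P2_def[symmetric] by (simp add: sum.distrib algebra_simps)
 \<comment> \<open>The coefficient 24 is 20 from the tenfold first step plus 4 from the later
   steps.\<close>
 have ident: "10*(dt\<^sup>2*(tau dt (1-1))\<^sup>2+2*\<mu> * dt * \<eta>2+2 * dt * P2/\<mu>) = 10*(dt\<^sup>2*(tau dt 0)\<^sup>2)+dt * (20*(\<mu>*\<eta>2)+20*(P2/\<mu>))"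
  "T * (24*(\<mu>*\<eta>2)+24*(P2/\<mu>)) = T * (4*(\<mu>*\<eta>2)+4*(P2/\<mu>)) + T * (20*(\<mu>*\<eta>2)+20*(P2/\<mu>))" by (simp_all add: algebra_simps)
 have "real (N-1) * dt * (4*(\<mu>*\<eta>2)+4*(P2/\<mu>)) <= T * (4*(\<mu>*\<eta>2)+4*(P2/\<mu>))" using N1 e0 by (intro mult_right_mono) auto
 moreover have "dt * (20*(\<mu>*\<eta>2)+20*(P2/\<mu>)) <= T * (20*(\<mu>*\<eta>2)+20*(P2/\<mu>))" using N1 e0 by (intro mult_right_mono) auto
 moreover note source_bound[OF dt e', folded x_def d_def R_def qk_def Z_def, unfolded cc]
 ultimately have "10*(dt\<^sup>2*(tau dt (1-1))\<^sup>2+2*\<mu> * dt * \<eta>2+2 * dt * P2/\<mu>)+(\<Sum>j=2..N. X.source j)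
  <= x * (2880 * d^4 * R * dt^4)+210 * T * (Cs\<^sup>2 * Z * qk)+70 * T\<^sup>2*(c1\<^sup>2 * nk * (W\<^sup>2 * bk * Z)) + T * (24*(\<mu>*\<eta>2)+24*(P2/\<mu>))" unfolding srcsum ident by linarith
 also have "... = (2880 * d^4)*(x * R * dt^4)+(210 * Cs\<^sup>2)*(T * qk * Z)+(70 * c1\<^sup>2 * nk)*(T\<^sup>2 * W\<^sup>2 * bk * Z)
  + (24 * d\<^sup>2 * Cs\<^sup>2 * nk)*(T * \<mu> * bk * Z)+(24 * C_pi\<^sup>2 * np)*(T * bp * Y/\<mu>)" unfolding e2 P2 by (simp add: algebra_simps)
 also have "... <= C * (x * R * dt^4) + C * (T * qk * Z)+(C * mm)*(T\<^sup>2 * W\<^sup>2 * bk * Z) + C * (T * \<mu> * bk * Z) + C * (T * bp * Y/\<mu>)" by (intro add_mono mult_right_mono C[folded d_def nk_def np_def mm_def]) (use nn T pos dt in simp_all)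
 also have "... = Bs" unfolding Bs by (simp add: algebra_simps power2_eq_square)
 finally have B: "10*(dt\<^sup>2*(tau dt (1-1))\<^sup>2+2*\<mu> * dt * \<eta>2+2 * dt * P2/\<mu>)+(\<Sum>j=2..N. X.source j) <= Bs" .
 show ?thesis using X.imex_error_estimate[OF n stab B[unfolded \<eta>2_def P2_def] K ep] unfolding X.e_def .
qed

end

text \<open>For \<open>U = 0\<close> a sup error relative to \<open>U\<close> is out of reach;
  instead the \<open>L2\<close> error bound forces the projection to vanish with the
  solution.\<close>

lemma (in exact_solution) projection_sup:
 assumes t: "t \<in> {0..T}" and v: "in_H Om 1 v" "in_Lp Om \<infinity> v" and h: "0 <= h"
  and e: "nrm Om (%x. u t x-v x)+h * H_norm Om 1 (%x. u t x-v x) <= c * H_norm Om (k+1) (u t)"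
  and U: "U ~= 0 ==> sn Om (%x. u t x-v x) <= U/3"
 shows "sn Om v <= 4/3 * U" "U = 0 ==> AE x in lon Om. v x = 0"
proof -
 have L: "in_Lp Om 2 (u t)" "in_Lp Om 2 v" using time_deriv_L2[OF derivs(1) t] in_W_self(1)[OF Om(1) v(1)] by auto
 show z: "AE x in lon Om. v x = 0" if U0: "U = 0"
 proof -
  note uz = zero_solution(1)[OF U0 t]
  have "nrm Om (%x. u t x-v x) <= 0" using e H_norm_AE_zero[OF Om(1) at_t(2)[OF t] uz] mult_nonneg_nonneg[OF h H_norm_nonneg[of Om 1 "%x. u t x-v x"]] by simp
  then have "nrm Om (%x. u t x-v x) = 0" using L2_norm_nonneg[of Om "%x. u t x-v x"] by linarith
  then have "AE x in lon Om. u t x-v x = 0" using L2_norm_eq_0_iff[OF in_L2_diff[OF L]] by blast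
  then show ?thesis using uz by eventually_elim simp
 qed
 show "sn Om v <= 4/3 * U"
 proof (cases "U = 0")
  case True
  have "AE x in lon Om. norm (v x) <= 0" using z[OF True] by eventually_elim simp
  from Linf_norm_le[OF in_L2_measurable[OF L(2)] order_refl this] show ?thesis using True by simp
 next
  case False
  have "v = (%x. 1 *. u t x+(- 1) *. (u t x-v x))" by auto
  then have "sn Om v <= \<bar>1\<bar> * sn Om (u t)+\<bar>- 1\<bar> * sn Om (%x. u t x-v x)" using Linf_lincomb(2)[OF u_bounds(1)[OF t] in_Linf_diff(1)[OF u_bounds(1)[OF t] v(2)], of 1 "- 1"] by simp
  then show ?thesis using u_bounds(2)[OF t] U[OF False] by simp
 qed
qed

theorem theorem1:
  fixes \<Omega> :: "(real^'d::finite) set"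
    and \<T> :: "'i \<Rightarrow> (real^'d) set set"
    and Vh :: "'i \<Rightarrow> (real^'d \<Rightarrow> real^'d) set"
    and Qh :: "'i \<Rightarrow> (real^'d \<Rightarrow> real) set"
    and k l :: nat
    and \<beta>\<^sub>0 c_inv C_pi C\<^sub>s C_inf :: real
  assumes "CARD('d) = 2 \<or> CARD('d) = 3"
    and "polyhedral_lipschitz_domain \<Omega>"
    and "k \<ge> 1"
    and "\<beta>\<^sub>0 > 0" and "c_inv > 0" and "C_pi > 0" and "C\<^sub>s > 0" and "C_inf > 0"
    and "finite_element_family \<Omega> k l \<T> Vh Qh \<beta>\<^sub>0 c_inv"
  shows "\<exists>C>0. \<forall>\<nu>>0. \<forall>\<mu>>0. \<forall>T>0. \<forall>\<kappa>>0. \<forall>f u0 u ut utt uttt p s lam.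
    navier_stokes_solution \<Omega> T \<nu> k l f u0 u ut utt uttt p \<and>
    pressure_projection_bound \<Omega> l \<T> Qh C_pi T p \<and>
    projection_of_solution \<Omega> T \<nu> Vh Qh f u ut p s lam \<and>
    stokes_projection_bounds \<Omega> k \<T> C\<^sub>s C_inf T u ut s \<longrightarrow>
    (\<exists>h\<^sub>0>0. \<forall>i N uh ph.
      let h = mesh_size (\<T> i); \<Delta>t = T / real N; sh = (\<lambda>n. s i (real n * \<Delta>t));
          e = (\<lambda>n x. sh n x - uh n x)
      in N \<ge> 1 \<and> h < h\<^sub>0 \<and>
         imex_solution \<Omega> (Vh i) (Qh i) \<nu> \<mu> \<Delta>t N f (sh 0) uh ph \<and>
         64 * c_inv\<^sup>2 * (bochner_norm T \<infinity> (Lp_norm \<Omega> \<infinity>) u)\<^sup>2 * (\<Delta>t / h\<^sup>2) \<le> \<kappa> / T \<longrightarrow>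
         (\<forall>n. 1 \<le> n \<and> n \<le> N - 1 \<and>
            (\<forall>j\<in>{2..n + 1}. \<Delta>t * (4 * ((\<kappa> + 1) / T) + stab_const \<Omega> \<mu> sh n j) \<le> 1/2) \<longrightarrow>
            (L2_norm \<Omega> (e (n + 1)))\<^sup>2
              + (\<Sum>j=2..n + 1. \<nu> * \<Delta>t * (L2_norm \<Omega> (grad \<Omega> (e j)))\<^sup>2)
              + \<mu> * (\<Sum>j=2..n + 1. \<Delta>t * (L2_norm \<Omega> (divergence \<Omega> (e j)))\<^sup>2)
            \<le> exp (8 * (\<kappa> + 1) + 2 * T * Max (stab_const \<Omega> \<mu> sh n ` {2..n + 1}))
              * ((C0_sq C \<Omega> T u ut utt + T * C3_sq C \<Omega> T u utt uttt) * \<Delta>t ^ 4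
                 + T * (C1_sq C \<Omega> T \<mu> k u ut * h ^ (2 * k) + C2_sq C \<Omega> T \<mu> l p * h ^ (2 * l + 2)))))"
proof -
 let ?d = "real CARD('d)"
 have \<Omega>: "open \<Omega>" "lipschitz_boundary \<Omega>" "\<Omega> ~= {}" "bounded \<Omega>" using assms(2) by (auto simp: polyhedral_lipschitz_domain_def)
 have \<Omega>m: "\<Omega> \<in> lmeasurable" by (rule lmeasurable_open[OF \<Omega>(4,1)])
 have "measure lebesgue \<Omega> ~= 0" using open_not_negligible[OF \<Omega>(1,3)] negligible_iff_measure0[OF \<Omega>m] by blast
 then have meas: "measure lebesgue \<Omega> > 0" using measure_nonneg[of lebesgue \<Omega>] by linarith
 define mm where "mm = measure lebesgue \<Omega> powr (2 / ?d)"
 have mm: "mm > 0" using meas by (simp add: mm_def)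
 define nk where "nk = real (card {is :: 'd list. length is <= k+1}) * ?d"
 define np where "np = real (card {is :: 'd list. length is <= l+1})"
 define c1 where "c1 = (9*(1 + C_inf) * ?d\<^sup>2+6 * ?d+9) * C\<^sub>s"
 \<comment> \<open>Every summand serves one requirement of \<open>projected_error_estimate\<close>,
   and all depend on the domain, the degrees and the given constants only, so \<open>C\<close> can
   precede \<open>\<nu>\<close>, \<open>\<mu>\<close>, \<open>T\<close> and the solution. The
   division by \<open>mm\<close> offsets the power of the measure of the domain in
   \<open>C1_sq\<close>.\<close>
 define C where "C = 2880 * ?d^4+210 * C\<^sub>s\<^sup>2+70 * c1\<^sup>2 * nk/mm+24 * ?d\<^sup>2 * C\<^sub>s\<^sup>2 * nk+24 * C_pi\<^sup>2 * np"
 have pieces: "0 < 2880 * ?d^4" "0 <= 210 * C\<^sub>s\<^sup>2" "0 <= 70 * c1\<^sup>2 * nk/mm" "0 <= 24 * ?d\<^sup>2 * C\<^sub>s\<^sup>2 * nk" "0 <= 24 * C_pi\<^sup>2 * np" using mm by (simp_all add: nk_def np_def)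
 have C: "2880 * ?d^4 <= C" "210 * C\<^sub>s\<^sup>2 <= C" "70 * c1\<^sup>2 * nk <= C * mm" "24 * ?d\<^sup>2 * C\<^sub>s\<^sup>2 * nk <= C" "24 * C_pi\<^sup>2 * np <= C" "0 < C"
 proof -
  have "70 * c1\<^sup>2 * nk/mm <= C" unfolding C_def using pieces by linarith
  then show "70 * c1\<^sup>2 * nk <= C * mm" using mm by (simp add: field_simps)
 qed (use pieces in \<open>unfold C_def, linarith+\<close>)
 note fe = assms(9)[unfolded finite_element_family_def]
 have M: "mesh_partition \<Omega> (\<T> i)" and V_sub: "function_subspace (Vh i)" and Q_sub: "function_subspace (Qh i)"
  and inv: "inverse_inequalities \<Omega> (\<T> i) (Vh i) c_inv" for i using fe by blast+
 have V: "in_H10 \<Omega> v" "!!j. piecewise_poly (\<T> i) k (%x. v x $ j)" if "v \<in> Vh i" for i v using fe that by blast+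
 have Q: "in_L20 \<Omega> q & piecewise_poly (\<T> i) l q" if "q \<in> Qh i" for i q using fe that by blast
 have V_Linf: "in_Lp \<Omega> \<infinity> v" "in_Lp \<Omega> \<infinity> (grad \<Omega> v)" if "v \<in> Vh i" for i v using FE_in_Linf[OF \<Omega>(1,2) M in_H10_in_H1[OF V(1)[OF that]] V(2)[OF that]] by auto
 show ?thesis
 proof (rule exI[of _ C], intro conjI allI impI)
  show "0 < C" by (rule C(6))
  fix \<nu> \<mu> T \<kappa> :: real and f u0 u ut utt uttt p s lam
  assume pos: "0 < \<nu>" "0 < \<mu>" "0 < T" "0 < \<kappa>"
  and A: "navier_stokes_solution \<Omega> T \<nu> k l f u0 u ut utt uttt p & pressure_projection_bound \<Omega> l \<T> Qh C_pi T p &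
  projection_of_solution \<Omega> T \<nu> Vh Qh f u ut p s lam & stokes_projection_bounds \<Omega> k \<T> C\<^sub>s C_inf T u ut s"
  interpret E: exact_solution \<Omega> T \<nu> k l f u0 u ut utt uttt p by unfold_locales (use \<Omega> \<Omega>m pos A in auto)
  note sb = A[THEN conjunct2, THEN conjunct2, THEN conjunct2, unfolded stokes_projection_bounds_def]
  \<comment> \<open>The CFL condition solved for the time step: \<open>dt \<le> \<theta> h^2\<close>
    if \<open>E.U\<close> is nonzero. If it is zero, division by zero gives 0 and no bound on
    \<open>dt\<close> is claimed.\<close>
  define \<theta> where "\<theta> = \<kappa>/(64 * c_inv\<^sup>2 * E.U\<^sup>2 * T)"
  define Gs where "Gs = (1 + C_inf)*(?d\<^sup>2 * E.W)"
  \<comment> \<open>If \<open>E.U = 0\<close>, the projection and its gradient vanish; otherwise the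
    extrapolation contributes the factor 3 and the divergence the factor \<open>d\<close>.\<close>
  define S' where "S' = (if E.U = 0 then 0 else ?d * (3 * Gs))"
  \<comment> \<open>Bounds \<open>stab_const\<close> on all fine meshes:
    \<open>3/2 + 9 + 9/2 = 15\<close> times \<open>Gs\<close>, and
    \<open>9/2 * 16 = 72\<close>.\<close>
  define \<Lambda>0 where "\<Lambda>0 = 4*(15 * Gs+72 * E.U\<^sup>2/\<mu>)"
  define X where "X = C0_sq C \<Omega> T u ut utt + T * C3_sq C \<Omega> T u utt uttt"
  define X1 where "X1 = C1_sq C \<Omega> T \<mu> k u ut"
  define X2 where "X2 = C2_sq C \<Omega> T \<mu> l p"
  have X: "0 <= X" "0 <= X1" "0 <= X2" using C(6) pos unfolding X_def X1_def X2_def C0_sq_def C1_sq_def C2_sq_def C3_sq_def by (auto intro!: add_nonneg_nonneg mult_nonneg_nonneg)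
  \<comment> \<open>\<open>KB * h^2\<close> will dominate the right-hand side, and \<open>K\<close>
    is the resulting bootstrap level. Neither may depend on the mesh, since the threshold of the
    discrete Sobolev bound is chosen from \<open>K\<close>.\<close>
  define KB where "KB = of_bool (E.U ~= 0)*(X * \<theta>^4) + T * (X1 + X2)"
  have KB: "0 <= KB" using X pos unfolding KB_def by (intro add_nonneg_nonneg mult_nonneg_nonneg) auto
  define K where "K = sqrt (exp (8*(\<kappa>+1)+2 * T * \<Lambda>0) * KB)"
  have K: "0 <= K" "K\<^sup>2 = exp (8*(\<kappa>+1)+2 * T * \<Lambda>0) * KB" using KB by (simp_all add: K_def)
  \<comment> \<open>The two entries are what the absorption of the cubic term demands in
    \<open>error_step_young\<close>.\<close>
  define \<epsilon> where "\<epsilon> = min (\<nu>/10) (sqrt (\<nu>/(5 * T)))"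
  have \<epsilon>: "0 < \<epsilon>" "\<epsilon> <= \<nu>/10" using pos by (simp_all add: \<epsilon>_def)
  have \<epsilon>2: "5*\<epsilon>\<^sup>2 <= \<nu>/T"
  proof -
  have "\<epsilon> <= sqrt (\<nu>/(5 * T))" unfolding \<epsilon>_def by (rule min.cobounded2)
  then have "\<epsilon>\<^sup>2 <= (sqrt (\<nu>/(5 * T)))\<^sup>2" using \<epsilon> by (intro power_mono) auto
  then show ?thesis using pos by simp
  qed
  \<comment> \<open>\<open>K + 1\<close> in place of \<open>K\<close> keeps the denominator positive
    when \<open>K = 0\<close>.\<close>
  define \<epsilon>0 where "\<epsilon>0 = \<epsilon>/(12*(1 + ?d/2)*(K+1))"
  have den: "0 < 12*(1 + ?d/2)" "0 < 12*(1 + ?d/2)*(K+1)" using K by (auto intro!: mult_pos_pos add_pos_nonneg add_nonneg_pos)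
  have \<epsilon>0: "0 < \<epsilon>0" using \<epsilon> den by (simp add: \<epsilon>0_def)
  have \<epsilon>K: "12*(1 + ?d/2) * K * \<epsilon>0 <= \<epsilon>"
  proof -
  have "12*(1 + ?d/2) * K * \<epsilon>0 <= 12*(1 + ?d/2)*(K+1)*\<epsilon>0" using den \<epsilon>0 by (intro mult_right_mono mult_left_mono) auto
  also have "... = \<epsilon>" unfolding \<epsilon>0_def times_divide_eq_right by (rule nonzero_mult_div_cancel_left[OF less_imp_neq[OF den(2), symmetric]])
  finally show ?thesis .
  qed
  obtain h1 where h1: "h1 > 0" "!!i v. mesh_size (\<T> i) < h1 ==> v \<in> Vh i ==>
  mesh_size (\<T> i) * Lp_norm \<Omega> \<infinity> v <= \<epsilon>0*(L2_norm \<Omega> (grad \<Omega> v) + L2_norm \<Omega> v)" by (rule discrete_sup_bound[OF assms(1) \<Omega>(1-3) assms(9,5) \<epsilon>0]) blast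
  define r :: nat where "r = (if k = 1 then 0 else 1)"
  define a where "a = measure lebesgue \<Omega> powr (1 / ?d)"
  obtain h3 where h3: "h3 > 0" "!!i t. mesh_size (\<T> i) < h3 ==> t \<in> {0..T} ==>
  Lp_norm \<Omega> \<infinity> (%x. u t x-s i t x) <= C_inf * mesh_size (\<T> i) * ln (a/mesh_size (\<T> i))^r * Lp_norm \<Omega> \<infinity> (grad \<Omega> (u t))" using sb unfolding r_def a_def by blast
  \<comment> \<open>Makes the logarithmic sup bound at most \<open>E.U/3\<close>; the added 1 guards
    against a zero denominator.\<close>
  define el where "el = (if E.U = 0 then 1 else E.U/(3*(C_inf * (?d\<^sup>2 * E.W)+1)))"
  have GW: "0 <= C_inf * (?d\<^sup>2 * E.W)" "0 <= Gs" using assms(8) E.nonneg by (simp_all add: Gs_def)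
  have el: "0 < el" using E.nonneg GW unfolding el_def by (auto intro!: divide_pos_pos add_nonneg_pos)
  obtain h2 where h2: "0 < h2" "!!h. 0 < h ==> h < h2 ==> h * ln (a/h)^r <= el" by (rule log_threshold[of a el r]) (use meas el in \<open>auto simp: a_def r_def\<close>)
  \<comment> \<open>Ensures \<open>4 * dt * S'^2 \<le> 1/T\<close> by way of
    \<open>dt \<le> \<theta> * h\<close>.\<close>
  define h4 where "h4 = 1/(T * (4*\<theta> * S'\<^sup>2+1))"
  have \<theta>: "0 <= \<theta>" using pos by (simp add: \<theta>_def)
  have h4p: "0 < T * (4*\<theta> * S'\<^sup>2+1)" using pos \<theta> by (intro mult_pos_pos add_nonneg_pos) auto
  then have h4: "0 < h4" by (simp add: h4_def)
  define h0 where "h0 = Min {1, h1, h2, h3, h4}"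
  show "\<exists>h\<^sub>0>0. \<forall>i N uh ph.
  let h = mesh_size (\<T> i); \<Delta>t = T/real N; sh = (%n. s i (real n * \<Delta>t));
  e = (%n x. sh n x-uh n x)
  in N \<ge> 1 & h < h\<^sub>0 &
  imex_solution \<Omega> (Vh i) (Qh i) \<nu> \<mu> \<Delta>t N f (sh 0) uh ph &
  64 * c_inv\<^sup>2*(bochner_norm T \<infinity> (Lp_norm \<Omega> \<infinity>) u)\<^sup>2*(\<Delta>t/h\<^sup>2) <= \<kappa>/T -->
  (\<forall>n. 1 <= n & n <= N-1 &
  (\<forall>j\<in>{2..n+1}. \<Delta>t * (4*((\<kappa>+1)/T)+stab_const \<Omega> \<mu> sh n j) <= 1/2) -->
  (L2_norm \<Omega> (e (n+1)))\<^sup>2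
  + (\<Sum>j=2..n+1. \<nu>*\<Delta>t * (L2_norm \<Omega> (grad \<Omega> (e j)))\<^sup>2)
  + \<mu>*(\<Sum>j=2..n+1. \<Delta>t * (L2_norm \<Omega> (divergence \<Omega> (e j)))\<^sup>2)
  <= exp (8*(\<kappa>+1)+2 * T * Max (stab_const \<Omega> \<mu> sh n ` {2..n+1}))
  * ((C0_sq C \<Omega> T u ut utt + T * C3_sq C \<Omega> T u utt uttt)*\<Delta>t^4
  + T * (C1_sq C \<Omega> T \<mu> k u ut * h^(2 * k) + C2_sq C \<Omega> T \<mu> l p * h^(2 * l+2))))"
  proof (rule exI[of _ h0], intro conjI allI)
  show "0 < h0" using h1 h2 h3 h4 by (simp add: h0_def)
  next
  fix i N uh ph
  define h where "h = mesh_size (\<T> i)"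
  define dt where "dt = T/real N"
  define sh where "sh = (%n. s i (real n * dt))"
  have main: "(L2_norm \<Omega> (%x. sh (n+1) x-uh (n+1) x))\<^sup>2
  + (\<Sum>j=2..n+1. \<nu> * dt * (L2_norm \<Omega> (grad \<Omega> (%x. sh j x-uh j x)))\<^sup>2)
  + \<mu>*(\<Sum>j=2..n+1. dt * (L2_norm \<Omega> (divergence \<Omega> (%x. sh j x-uh j x)))\<^sup>2)
  <= exp (8*(\<kappa>+1)+2 * T * Max (stab_const \<Omega> \<mu> sh n ` {2..n+1}))
  * (X * dt^4 + T * (X1 * h^(2 * k) + X2 * h^(2 * l+2)))"
  if N: "N \<ge> 1" and hh0: "h < h0" and imex: "imex_solution \<Omega> (Vh i) (Qh i) \<nu> \<mu> dt N f (sh 0) uh ph"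
  and cfl: "64 * c_inv\<^sup>2 * E.U\<^sup>2*(dt/h\<^sup>2) <= \<kappa>/T" and n: "1 <= n" "n <= N-1"
  and stab: "\<forall>j\<in>{2..n+1}. dt * (4*((\<kappa>+1)/T)+stab_const \<Omega> \<mu> sh n j) <= 1/2" for n
  proof -
  have hb: "h < 1" "h < h1" "h < h2" "h < h3" "h < h4" using hh0 by (simp_all add: h0_def)
  have h: "0 < h" using mesh_size_facts(1)[OF M \<Omega>(3)] by (simp add: h_def)
  have dt: "dt > 0" "dt * real N = T" using pos N by (simp_all add: dt_def)
  have proj: "is_stokes_projection \<Omega> \<nu> (Vh i) (Qh i) (%x. f t x-ut t x-convection \<Omega> (u t) (u t) x-grad_scalar \<Omega> (p t) x) (s i t) (lam i t)" if "t \<in> {0..T}" for t using A that unfolding projection_of_solution_def by blast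
  have sV: "s i t \<in> Vh i" if "t \<in> {0..T}" for t using proj[OF that] by (simp add: is_stokes_projection_def)
  have eb: "L2_norm \<Omega> (%x. u t x-s i t x)+h * H_norm \<Omega> 1 (%x. u t x-s i t x) <= C\<^sub>s * h^(k+1) * H_norm \<Omega> (k+1) (u t)" if "t \<in> {0..T}" for t using sb that unfolding h_def by blast
  have sup: "Lp_norm \<Omega> \<infinity> (%x. u t x-s i t x) <= E.U/3" if t: "t \<in> {0..T}" and U: "E.U ~= 0" for t
  proof -
  have "Lp_norm \<Omega> \<infinity> (%x. u t x-s i t x) <= (C_inf * Lp_norm \<Omega> \<infinity> (grad \<Omega> (u t)))*(h * ln (a/h)^r)" using h3(2)[of i t] hb(4) t unfolding h_def by (simp add: mult_ac)
  also have "... <= (C_inf * Lp_norm \<Omega> \<infinity> (grad \<Omega> (u t))) * el" using h2(2)[OF h hb(3)] assms(8) by (intro mult_left_mono) auto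
  also have "... <= (C_inf * (?d\<^sup>2 * E.W)) * el" using E.u_bounds(4)[OF t] assms(8) el by (intro mult_right_mono mult_left_mono) auto
  also have "... <= (C_inf * (?d\<^sup>2 * E.W)+1) * el" using el by (intro mult_right_mono) auto
  also have "... = E.U/3" using U GW unfolding el_def by (simp add: field_simps add_nonneg_eq_0_iff)
  finally show ?thesis .
  qed
  note ps = E.projection_sup[OF _ in_H10_in_H1[OF V(1)[OF sV]] V_Linf(1)[OF sV] less_imp_le[OF h] eb sup]
  interpret P: projected_solution \<Omega> T \<nu> k l f u0 u ut utt uttt p "Vh i" "Qh i" h C_pi C\<^sub>s C_inf "s i" "lam i"
  proof
  show "Lp_norm \<Omega> \<infinity> (grad \<Omega> (%x. u t x-s i t x)) <= C_inf * Lp_norm \<Omega> \<infinity> (grad \<Omega> (u t))" if "t \<in> {0..T}" for t using sb that by blast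
  show "\<exists>\<pi>\<in>Qh i. L2_norm \<Omega> (%x. p t x-\<pi> x) <= C_pi * h^(l+1) * H_norm \<Omega> (l+1) (p t)" if t: "t \<in> {0..T}" for t
  proof -
  have p2: "in_Lp \<Omega> 2 (p t)" using E.at_t(4)[OF t] by (simp add: in_L20_def)
  obtain \<pi> where \<pi>: "is_L2_projection \<Omega> (Qh i) (p t) \<pi>" using L2_projection_exists[OF \<Omega>(1) M Q_sub Q p2] by blast
  then have \<pi>Q: "\<pi> \<in> Qh i" by (simp add: is_L2_projection_def)
  have "L2_norm \<Omega> (%x. p t x-\<pi> x) <= broken_H_norm (\<T> i) 0 (%x. p t x-\<pi> x)" by (rule L2_le_broken_norm[OF \<Omega>(1,2) M in_L2_diff[OF p2]]) (use Q[OF \<pi>Q] in \<open>simp add: in_L20_def\<close>)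
  also have "... <= C_pi * mesh_size (\<T> i)^(l+1-0) * H_norm \<Omega> (l+1) (p t)" using A t \<pi> unfolding pressure_projection_bound_def by blast
  finally show ?thesis using \<pi>Q by (auto simp: h_def)
  qed
  show "Lp_norm \<Omega> \<infinity> (s i t) <= 4/3 * E.U" if "t \<in> {0..T}" for t by (rule ps(1)) (use that in auto)
  qed (use V V_Linf V_sub Q h hb proj eb assms(6-8) in \<open>auto simp: in_L20_def\<close>)
  have es: "P.es = (%t x. u t x-s i t x)" by (rule ext) (simp add: P.es_def)
  obtain e' where e': "has_time_deriv \<Omega> T P.es e'" "AE t in lebesgue_on {0<..<T}. L2_norm \<Omega> (e' t) <= C\<^sub>s * h^k * H_norm \<Omega> k (ut t)" using sb unfolding es h_def by blast
  have inv': "L2_norm \<Omega> (grad \<Omega> v) <= c_inv/h * L2_norm \<Omega> v" if "v \<in> Vh i" for v using inv[of i] that h unfolding inverse_inequalities_def h_def by (simp add: powr_minus_divide)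
  have sup': "h * Lp_norm \<Omega> \<infinity> v <= \<epsilon>0*(L2_norm \<Omega> (grad \<Omega> v) + L2_norm \<Omega> v)" if "v \<in> Vh i" for v using h1(2)[of i v] hb(2) that unfolding h_def by blast
  have dt\<theta>: "dt <= \<theta> * h\<^sup>2" if U: "E.U ~= 0"
  proof -
  have "0 < 64 * c_inv\<^sup>2 * E.U\<^sup>2" using U assms(5) by simp
  then show ?thesis using cfl h pos unfolding \<theta>_def by (simp add: field_simps)
  qed
  have h21: "h\<^sup>2 <= h" using h hb(1) by (simp add: power2_eq_square mult_left_le_one_le)
  have gs: "?d * Lp_norm \<Omega> \<infinity> (grad \<Omega> (P.hat (s i) x y)) <= S'" if xy: "x \<in> {0..T}" "y \<in> {0..T}" for x y
  proof (cases "E.U = 0")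
  case True
  have z: "AE w in lebesgue_on \<Omega>. s i t w = 0" if "t \<in> {0..T}" for t by (rule ps(2)) (use that True in auto)
  have "AE w in lebesgue_on \<Omega>. P.hat (s i) x y w = 0" using z[OF xy(1)] z[OF xy(2)] by eventually_elim (simp add: P.hat_def)
  moreover have "in_H \<Omega> 1 (P.hat (s i) x y)" using P.hat_bounds(2)[OF xy] by (simp add: bdd_H1_def)
  ultimately show ?thesis using grad_Linf_AE_zero[OF \<Omega>(1)] True by (simp add: S'_def)
  next
  case False
  then show ?thesis using P.hat_bounds(8)[OF xy] unfolding S'_def Gs_def P.Gs_def by (simp add: mult_left_mono)
  qed
  have S'2: "4 * dt * S'\<^sup>2 <= 1/T"
  proof (cases "E.U = 0")
  case False
  have "dt <= \<theta> * h" using dt\<theta>[OF False] mult_left_mono[OF h21 \<theta>] by linarith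
  then have "4 * S'\<^sup>2 * dt <= 4 * S'\<^sup>2*(\<theta> * h)" by (intro mult_left_mono) auto
  also have "... = (4*\<theta> * S'\<^sup>2) * h" by simp
  also have "... <= (4*\<theta> * S'\<^sup>2+1) * h" using h by (intro mult_right_mono) auto
  also have "... <= 1/T" using hb(5) h4p pos unfolding h4_def by (simp add: field_simps)
  finally show ?thesis by (simp add: mult_ac)
  qed (use pos in \<open>simp add: S'_def\<close>)
  define \<Lambda> where "\<Lambda> = Max (stab_const \<Omega> \<mu> sh n ` {2..n+1})"
  have grid: "real j * dt \<in> {0..T}" if "j <= N" for j by (rule P.grid[OF dt e' that])
  have ex: "Lp_norm \<Omega> \<infinity> (extrapolate sh j) <= 4 * E.U" "Lp_norm \<Omega> \<infinity> (grad \<Omega> (extrapolate sh j)) <= 3 * Gs" if "j <= N" for j using P.hat_bounds(7,8)[OF grid[OF that] grid[of "j-1"]] that unfolding sh_def P.extrapolate_hat Gs_def P.Gs_def by simp_all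
  have st: "0 <= stab_const \<Omega> \<mu> sh n j & stab_const \<Omega> \<mu> sh n j <= \<Lambda>0" if j: "j \<in> {2..n+1}" for j
  proof -
  have jN: "j-1 <= N" "j <= N" "j ~= n+1 ==> j+1 <= N" using j n by auto
  have "(Lp_norm \<Omega> \<infinity> (extrapolate sh (j-1)))\<^sup>2 <= (4 * E.U)\<^sup>2" by (intro power_mono ex jN) simp
  then have z: "9/(2*\<mu>)*(Lp_norm \<Omega> \<infinity> (extrapolate sh (j-1)))\<^sup>2 <= 9/(2*\<mu>)*(4 * E.U)\<^sup>2" using pos by (intro mult_left_mono) auto
  have z': "9/(2*\<mu>)*(4 * E.U)\<^sup>2 = 72 * E.U\<^sup>2/\<mu>" by (simp add: power2_eq_square)
  have "(if j = n+1 then 0 else Lp_norm \<Omega> \<infinity> (grad \<Omega> (extrapolate sh (j+1)))) <= 3 * Gs" using ex(2) jN(3) GW(2) by auto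
  then show ?thesis unfolding stab_const_def \<Lambda>0_def using z ex(2)[OF jN(1)] ex(2)[OF jN(2)] pos unfolding z' by auto
  qed
  have \<Lambda>le: "stab_const \<Omega> \<mu> sh n j <= \<Lambda>" if "j \<in> {2..n+1}" for j unfolding \<Lambda>_def using that by (intro Max_ge) auto
  have \<Lambda>: "0 <= \<Lambda>" "\<Lambda> <= \<Lambda>0"
  proof -
  have 2: "2 \<in> {2..n+1}" using n by auto
  then show "0 <= \<Lambda>" using \<Lambda>le[OF 2] st[OF 2] by linarith
  show "\<Lambda> <= \<Lambda>0" unfolding \<Lambda>_def by (rule Max.boundedI) (use st 2 in auto)
  qed
  define Bs where "Bs = of_bool (E.U ~= 0)*(X * dt^4) + T * (X1 * h^(2 * k) + X2 * h^(2 * l+2))"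
  have pw: "h^(2 * k) <= h\<^sup>2" "h^(2 * l+2) <= h\<^sup>2" "h^8 <= h\<^sup>2" by (rule power_decreasing; use h hb(1) assms(3) in simp)+
  have "Bs <= KB * h\<^sup>2"
  proof -
  have 1: "of_bool (E.U ~= 0)*(X * dt^4) <= of_bool (E.U ~= 0)*(X * \<theta>^4) * h\<^sup>2"
  proof (cases "E.U = 0")
  case False
  have "dt^4 <= (\<theta> * h\<^sup>2)^4" using dt\<theta>[OF False] dt by (intro power_mono) auto
  also have "... = \<theta>^4 * h^8" by (simp add: power_mult_distrib flip: power_mult)
  also have "... <= \<theta>^4 * h\<^sup>2" using pw \<theta> by (intro mult_left_mono) auto
  finally have "X * dt^4 <= X * (\<theta>^4 * h\<^sup>2)" using X by (intro mult_left_mono) auto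
  then show ?thesis using False by (simp add: mult.assoc)
  qed simp
  have "X1 * h^(2 * k) + X2 * h^(2 * l+2) <= X1 * h\<^sup>2 + X2 * h\<^sup>2" using X pw by (intro add_mono mult_left_mono) auto
  then have "T * (X1 * h^(2 * k) + X2 * h^(2 * l+2)) <= T * (X1 * h\<^sup>2 + X2 * h\<^sup>2)" using pos by (intro mult_left_mono) auto
  then show ?thesis using 1 unfolding Bs_def KB_def by (simp add: algebra_simps)
  qed
  then have "exp (8*(\<kappa>+1)+2 * T * \<Lambda>) * Bs <= exp (8*(\<kappa>+1)+2 * T * \<Lambda>)*(KB * h\<^sup>2)" by (intro mult_left_mono) auto
  also have "... <= exp (8*(\<kappa>+1)+2 * T * \<Lambda>0)*(KB * h\<^sup>2)" using \<Lambda> KB pos by (intro mult_right_mono) (auto intro!: mult_left_mono)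
  also have "... = (K * h)\<^sup>2" unfolding power_mult_distrib K(2) by simp
  finally have Kb: "exp (8*(\<kappa>+1)+2 * T * \<Lambda>) * Bs <= (K * h)\<^sup>2" .
  have n': "1 <= n" "n+1 <= N" using n N by auto
  note est = P.projected_error_estimate[OF dt e' Q_sub pos(1,2,4) assms(5) less_imp_le[OF \<epsilon>0] inv' sup' imex[unfolded sh_def] gs S'2 cfl n'
  stab[unfolded sh_def, rule_format] \<Lambda>le[unfolded sh_def] \<Lambda>(1) C(1,2) C(3)[unfolded nk_def mm_def c1_def, folded P.c1_def] C(4)[unfolded nk_def] C(5)[unfolded np_def] K(1)
  Kb[unfolded Bs_def X_def X1_def X2_def] \<epsilon>K \<epsilon> \<epsilon>2]
  have "(L2_norm \<Omega> (%x. sh (n+1) x-uh (n+1) x))\<^sup>2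
  + (\<Sum>j=2..n+1. \<nu> * dt * (L2_norm \<Omega> (grad \<Omega> (%x. sh j x-uh j x)))\<^sup>2)
  + \<mu>*(\<Sum>j=2..n+1. dt * (L2_norm \<Omega> (divergence \<Omega> (%x. sh j x-uh j x)))\<^sup>2) <= exp (8*(\<kappa>+1)+2 * T * \<Lambda>) * Bs" unfolding Bs_def X_def X1_def X2_def sh_def by (rule est)
  \<comment> \<open>Dropping the indicator of a nonzero \<open>E.U\<close> only enlarges the
    bound.\<close>
  also have "... <= exp (8*(\<kappa>+1)+2 * T * \<Lambda>)*(X * dt^4 + T * (X1 * h^(2 * k) + X2 * h^(2 * l+2)))" unfolding Bs_def using X dt by (intro mult_left_mono add_right_mono) auto
  finally show ?thesis unfolding \<Lambda>_def .
  qed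
  show "let h = mesh_size (\<T> i); \<Delta>t = T/real N; sh = (%n. s i (real n * \<Delta>t));
  e = (%n x. sh n x-uh n x)
  in N \<ge> 1 & h < h0 &
  imex_solution \<Omega> (Vh i) (Qh i) \<nu> \<mu> \<Delta>t N f (sh 0) uh ph &
  64 * c_inv\<^sup>2*(bochner_norm T \<infinity> (Lp_norm \<Omega> \<infinity>) u)\<^sup>2*(\<Delta>t/h\<^sup>2) <= \<kappa>/T -->
  (\<forall>n. 1 <= n & n <= N-1 &
  (\<forall>j\<in>{2..n+1}. \<Delta>t * (4*((\<kappa>+1)/T)+stab_const \<Omega> \<mu> sh n j) <= 1/2) -->
  (L2_norm \<Omega> (e (n+1)))\<^sup>2
  + (\<Sum>j=2..n+1. \<nu>*\<Delta>t * (L2_norm \<Omega> (grad \<Omega> (e j)))\<^sup>2)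
  + \<mu>*(\<Sum>j=2..n+1. \<Delta>t * (L2_norm \<Omega> (divergence \<Omega> (e j)))\<^sup>2)
  <= exp (8*(\<kappa>+1)+2 * T * Max (stab_const \<Omega> \<mu> sh n ` {2..n+1}))
  * ((C0_sq C \<Omega> T u ut utt + T * C3_sq C \<Omega> T u utt uttt)*\<Delta>t^4
  + T * (C1_sq C \<Omega> T \<mu> k u ut * h^(2 * k) + C2_sq C \<Omega> T \<mu> l p * h^(2 * l+2))))" unfolding Let_def by (intro impI allI, elim conjE, rule main[unfolded h_def sh_def dt_def X_def X1_def X2_def E.U_def]; assumption)
  qed
 qed
qed

end
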